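(* Let $K$ be an oriented classical link diagram, let $i$ be a crossing of $K$, and let $T$ be the classical oriented $2$-tangle that is the complement of a small disk neighbourhood of $i$ in $K$. The extended bracket expansion of $T$ is a linear combination $$a(T)\,[\text{oriented smoothing}]+b(T)\,[\text{reverse oriented smoothing}],\qquad a(T),b(T)\in\mathbb{Q}[A,A^{-1}].$$ If $b(T)\neq 0$, then the virtual link diagram $K^{v(i)}$ obtained from $K$ by virtualizing the single crossing $i$ is non-trivial and non-classical.
   Context: Virtual links. An (oriented) virtual link diagram is a generic immersion of finitely many oriented circles in the plane in which each double point is either a classical crossing (with over/under information) or a virtual crossing. Virtual isotopy is generated by planar isotopy, the classical Reidemeister moves I, II, III, and detour moves: a segment containing only consecutive virtual crossings may be replaced by any other generic segment with the same endpoints all of whose crossings are virtual. A diagram is classical if it has no virtual crossings; a virtual link is non-classical if it is not virtually isotopic to any classical link diagram, and non-trivial if it is not virtually isotopic to a disjoint union of embedded circles in the plane. Virtualization. The virtualization of a crossing $i$ replaces it by a classical crossing flanked by two virtual crossings, so that the same strand remains the overcrossing strand while the sign of the crossing is changed; smoothing the two flanking virtual crossings gives the original diagram with the crossing $i$ switched. The rest of the diagram is unchanged. Tangle expansion. $T$ is viewed as an oriented $2$-tangle with four boundary ends, in cyclic order in, in, out, out. Smooth every crossing of $T$ by either the oriented smoothing (joining incoming to outgoing ends) or the disoriented smoothing (joining the two outgoing ends by an arc and the two incoming ends by an arc; each arc carries a cusp where the orientation changes, and the two facing cusps are paired as a disoriented site). At a positive crossing the oriented smoothing has weight $A$ and the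 disoriented one $A^{-1}$; at a negative crossing the weights are exchanged. Each closed loop contributes $d=-A^{2}-A^{-2}$. The states are then reduced: each cusp is given an arrow along its strand (a cusp pointing up in the plane gets an arrow from left to right); two consecutive cusps with arrows in the same direction cancel, and if they belong to different sites the two remaining cusps of these sites are paired to form a new site, while if they belong to one site that site disappears; cusp-free closed loops are removed; when several cancellations between different sites are possible, one takes the average of the results. The configuration consisting of four consecutive cusps $\beta,\alpha,\alpha',\beta'$, with $\beta,\beta'$ the cusps of one site having the same arrow direction, and $\alpha,\alpha'$ from two other distinct sites both having the opposite arrow direction, is given precedence: these four cusps are deleted and the remaining cusps of the sites of $\alpha,\alpha'$ are paired. "[oriented smoothing]" denotes the planar tangle of two arcs each joining an in end to an adjacent out end without cusps, and "[reverse oriented smoothing]" denotes the planar tangle consisting of a single disoriented site, i.e. one arc joining the two in ends and one joining the two out ends, each with one cusp, the two cusps facing each other. *)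

theory Defs
  imports "HOL-Analysis.Analysis" "HOL-Library.Poly_Mapping"
begin

section \<open>Virtual link diagrams\<close>

text \<open>
  We work in the piecewise linear category.  A generic immersion of oriented circles in the plane
  is a family of closed polygons: an edge \<^term>\<open>e\<close> is the oriented segment from \<^term>\<open>vpos D e\<close>
  to \<^term>\<open>vpos D (nxt D e)\<close>, the function \<^term>\<open>nxt D\<close> permutes the finite set of edge labels, and
  its cycles are the circles.  The labels carry no information, see \<open>relabel\<close>.

  \<open>(e, f) \<in> over D\<close> says that \<open>e\<close> and \<open>f\<close> meet in a classical crossing at which \<open>e\<close> is the
  overcrossing edge.  A double point of \<open>e\<close> and \<open>f\<close> that is recorded in neither order is virtual.
\<close>

record vdiag =
  edges :: "nat set"
  nxt :: "nat \<Rightarrow> nat"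
  vpos :: "nat \<Rightarrow> complex"
  over :: "(nat \<times> nat) set"

definition src :: "vdiag \<Rightarrow> nat \<Rightarrow> complex" where
  "src D e = vpos D e"

definition tgt :: "vdiag \<Rightarrow> nat \<Rightarrow> complex" where
  "tgt D e = vpos D (nxt D e)"

definition seg :: "vdiag \<Rightarrow> nat \<Rightarrow> complex set" where
  "seg D e = closed_segment (src D e) (tgt D e)"

definition crosses :: "vdiag \<Rightarrow> nat \<Rightarrow> nat \<Rightarrow> bool" where
  "crosses D e f \<longleftrightarrow> e \<in> edges D \<and> f \<in> edges D \<and> e \<noteq> f \<and>
     open_segment (src D e) (tgt D e) \<inter> open_segment (src D f) (tgt D f) \<noteq> {}"

text \<open>
  Genericity.  As no vertex lies on a foreign edge, two edges that meet away from a common vertex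
  are not collinear and cross transversally in one interior point, and a polygon does not fold
  back at a vertex (the exclusion of 2-cycles covers the remaining degenerate case).
\<close>

definition generic :: "vdiag \<Rightarrow> bool" where
  "generic D \<longleftrightarrow>
     finite (edges D) \<and> bij_betw (nxt D) (edges D) (edges D) \<and>
     (\<forall>e\<in>edges D. src D e \<noteq> tgt D e \<and> nxt D (nxt D e) \<noteq> e) \<and>
     (\<forall>e\<in>edges D. \<forall>f\<in>edges D. src D e \<in> seg D f \<longrightarrow> f = e \<or> nxt D f = e) \<and>
     (\<forall>e\<in>edges D. \<forall>f\<in>edges D. \<forall>g\<in>edges D.
        e \<noteq> f \<and> f \<noteq> g \<and> e \<noteq> g \<longrightarrow> seg D e \<inter> seg D f \<inter> seg D g = {})"

definition vdiagram :: "vdiag \<Rightarrow> bool" where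
  "vdiagram D \<longleftrightarrow> generic D \<and>
     (\<forall>(e, f)\<in>over D. crosses D e f \<and> (f, e) \<notin> over D)"

definition classical :: "vdiag \<Rightarrow> bool" where
  "classical D \<longleftrightarrow> (\<forall>e f. crosses D e f \<longrightarrow> (e, f) \<in> over D \<or> (f, e) \<in> over D)"

definition embedded :: "vdiag \<Rightarrow> bool" where
  "embedded D \<longleftrightarrow> (\<forall>e f. \<not> crosses D e f)"


section \<open>Virtual isotopy\<close>

subsection \<open>Planar isotopy\<close>

definition relabel :: "vdiag \<Rightarrow> vdiag \<Rightarrow> bool" where
  "relabel D D' \<longleftrightarrow> (\<exists>g. bij_betw g (edges D) (edges D') \<and>
     (\<forall>e\<in>edges D. nxt D' (g e) = g (nxt D e) \<and> vpos D' (g e) = vpos D e) \<and>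
     over D' = map_prod g g ` over D)"

text \<open>
  Motion of the vertices through generic polygons.  By genericity the pairs of crossing
  edges, and hence the crossing data, cannot change during the motion.
\<close>

definition motion :: "vdiag \<Rightarrow> vdiag \<Rightarrow> bool" where
  "motion D D' \<longleftrightarrow> (\<exists>P :: real \<Rightarrow> nat \<Rightarrow> complex.
     (\<forall>e\<in>edges D. continuous_on {0..1} (\<lambda>t. P t e)) \<and>
     (\<forall>t\<in>{0..1}. vdiagram (D\<lparr>vpos := P t\<rparr>)) \<and>
     (\<forall>e\<in>edges D. P 0 e = vpos D e) \<and> D' = D\<lparr>vpos := P 1\<rparr>)"

text \<open>
  \<open>add_vertex e n z D\<close> replaces the edge \<open>e\<close> from \<open>a\<close> to \<open>b\<close> by \<open>e\<close> from \<open>a\<close> to \<open>z\<close> followed by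
  the edge with the fresh label \<open>n\<close> from \<open>z\<close> to \<open>b\<close>.  It keeps the relation \<^const>\<open>over\<close>, whereas in
  \<open>split\<close> both new edges inherit the classical crossings of \<open>e\<close>.
\<close>

definition add_vertex :: "nat \<Rightarrow> nat \<Rightarrow> complex \<Rightarrow> vdiag \<Rightarrow> vdiag" where
  "add_vertex e n z D = D\<lparr>edges := insert n (edges D),
     nxt := (nxt D)(e := n, n := nxt D e), vpos := (vpos D)(n := z)\<rparr>"

definition split :: "nat \<Rightarrow> nat \<Rightarrow> complex \<Rightarrow> vdiag \<Rightarrow> vdiag" where
  "split e n z D = (let D' = add_vertex e n z D; parent = id(n := e) in
     D'\<lparr>over := {(x, y). crosses D' x y \<and> (parent x, parent y) \<in> over D}\<rparr>)"

definition subdivision :: "vdiag \<Rightarrow> vdiag \<Rightarrow> bool" where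
  "subdivision D D' \<longleftrightarrow> (\<exists>e n z. e \<in> edges D \<and> n \<notin> edges D \<and>
     z \<in> open_segment (src D e) (tgt D e) \<and> D' = split e n z D)"

subsection \<open>Reidemeister moves\<close>

text \<open>\<open>meets_only D F C V\<close>: apart from the edges in \<open>F\<close>, the diagram meets \<open>C\<close> at most in \<open>V\<close>.\<close>

definition meets_only :: "vdiag \<Rightarrow> nat set \<Rightarrow> complex set \<Rightarrow> complex set \<Rightarrow> bool" where
  "meets_only D F C V \<longleftrightarrow> (\<forall>g\<in>edges D - F. seg D g \<inter> C \<subseteq> V)"

text \<open>
  In each move \<open>D'\<close> is obtained from \<open>D\<close> by replacing an edge from \<open>a\<close> to \<open>b\<close> by a polygonal arc.
  The convex hull of the arc is the disk in which the move takes place.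
\<close>

definition reidemeister1 :: "vdiag \<Rightarrow> vdiag \<Rightarrow> bool" where
  "reidemeister1 D D' \<longleftrightarrow> (\<exists>e n m c d R. let a = src D e; b = tgt D e in
     e \<in> edges D \<and> n \<notin> edges D \<and> m \<notin> edges D \<and> n \<noteq> m \<and>
     meets_only D {e} (convex hull {a, c, d, b}) {a, b} \<and>
     R \<in> {{(e, m)}, {(m, e)}} \<and>
     D' = (add_vertex n m d (add_vertex e n c D))\<lparr>over := over D \<union> R\<rparr> \<and>
     crosses D' e m)"

definition reidemeister2 :: "vdiag \<Rightarrow> vdiag \<Rightarrow> bool" where
  "reidemeister2 D D' \<longleftrightarrow> (\<exists>e f n z R. let a = src D e; b = tgt D e in
     e \<in> edges D \<and> f \<in> edges D \<and> e \<noteq> f \<and> n \<notin> edges D \<and>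
     meets_only D {e, f} (convex hull {a, z, b}) {a, b} \<and>
     \<not> crosses D e f \<and>
     R \<in> {{(e, f), (n, f)}, {(f, e), (f, n)}} \<and>
     D' = (add_vertex e n z D)\<lparr>over := over D \<union> R\<rparr> \<and>
     crosses D' e f \<and> crosses D' n f)"

text \<open>
  In a third Reidemeister move one of the three strands is the uppermost one (a choice of
  over and under that is cyclic is not a Reidemeister move).  This strand is moved
  across the classical crossing of the two others.
\<close>

definition reidemeister3 :: "vdiag \<Rightarrow> vdiag \<Rightarrow> bool" where
  "reidemeister3 D D' \<longleftrightarrow> (\<exists>e f g n z. let a = src D e; b = tgt D e; C = convex hull {a, z, b} in
     (e, f) \<in> over D \<and> (e, g) \<in> over D \<and> (f, g) \<in> over D \<and> n \<notin> edges D \<and>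
     meets_only D {e, f, g} C {a, b} \<and>
     seg D f \<inter> seg D g \<inter> C \<noteq> {} \<and>
     D' = split e n z D)"

subsection \<open>Detour moves\<close>

text \<open>
  A segment is a chain of consecutive edges \<open>e, nxt e, \<dots>, nxt\<^sup>m e\<close>.  Its crossings are all virtual
  iff none of its edges occurs in \<^const>\<open>over\<close>.  The chain is replaced by an arbitrary chain with
  the same endpoints; the rest of the diagram is untouched.
\<close>

definition chain :: "vdiag \<Rightarrow> nat \<Rightarrow> nat \<Rightarrow> nat set" where
  "chain D e m = (\<lambda>j. (nxt D ^^ j) e) ` {..m}"

definition detour :: "vdiag \<Rightarrow> vdiag \<Rightarrow> bool" where
  "detour D D' \<longleftrightarrow> (\<exists>e m m'. let C = edges D - chain D e m; q = (nxt D ^^ Suc m) e in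
     e \<in> edges D \<and> e \<in> edges D' \<and> edges D' - chain D' e m' = C \<and>
     q \<in> C \<and> (nxt D' ^^ Suc m') e = q \<and> vpos D' e = vpos D e \<and>
     (\<forall>g\<in>C. nxt D' g = nxt D g \<and> vpos D' g = vpos D g) \<and>
     over D' = over D \<and> over D \<subseteq> C \<times> C)"

definition move :: "vdiag \<Rightarrow> vdiag \<Rightarrow> bool" where
  "move D D' \<longleftrightarrow> vdiagram D \<and> vdiagram D' \<and>
     (relabel D D' \<or> motion D D' \<or> subdivision D D' \<or>
      reidemeister1 D D' \<or> reidemeister2 D D' \<or> reidemeister3 D D' \<or> detour D D')"

definition virtually_isotopic :: "vdiag \<Rightarrow> vdiag \<Rightarrow> bool" where
  "virtually_isotopic = equivclp move"

definition nonclassical :: "vdiag \<Rightarrow> bool" where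
  "nonclassical D \<longleftrightarrow>
     \<not> (\<exists>D'. vdiagram D' \<and> classical D' \<and> virtually_isotopic D D')"

definition nontrivial :: "vdiag \<Rightarrow> bool" where
  "nontrivial D \<longleftrightarrow>
     \<not> (\<exists>D'. vdiagram D' \<and> embedded D' \<and> virtually_isotopic D D')"


section \<open>Virtualization of a crossing\<close>

text \<open>
  Near the crossing, the overcrossing edge \<open>x\<close> is cut at \<open>a\<close> and \<open>b\<close>, and the piece between \<open>a\<close>
  and \<open>b\<close> is replaced by a zigzag \<open>a, p, q, b\<close> whose three edges all cross \<open>y\<close>: the middle one as
  overcrossing edge, the outer ones virtually.  The middle edge crosses \<open>y\<close> from the other side,
  so the sign is changed.
\<close>

definition virtualization :: "vdiag \<Rightarrow> nat \<times> nat \<Rightarrow> vdiag \<Rightarrow> bool" where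
  "virtualization K i K' \<longleftrightarrow> (\<exists>x y n1 n2 n3 n4 a b p q.
     let K1 = split n1 n4 b (split x n1 a K) in
     i = (x, y) \<and> i \<in> over K \<and>
     distinct [n1, n2, n3, n4] \<and> {n1, n2, n3, n4} \<inter> edges K = {} \<and>
     a \<in> open_segment (src K x) (tgt K x) \<and> b \<in> open_segment a (tgt K x) \<and>
     vdiagram K1 \<and> (n1, y) \<in> over K1 \<and>
     meets_only K1 {n1, y} (convex hull {a, p, q, b}) {a, b} \<and>
     K' = (add_vertex n2 n3 q (add_vertex n1 n2 p K1))
            \<lparr>over := over K1 - {(n1, y)} \<union> {(n2, y)}\<rparr> \<and>
     vdiagram K' \<and> crosses K' n1 y \<and> crosses K' n2 y \<and> crosses K' n3 y)"


section \<open>Tangles with cusps and their reduction\<close>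

text \<open>
  A reduced or unreduced state, considered up to the virtual (abstract) equivalence of its curves:
  each cusp is the pair of its two ends, in the direction of its arrow; a site is a set of two
  cusps; and the members of \<^term>\<open>arcs\<close> are the two-element sets of ends (of cusps, or of the tangle)
  that are joined by a cusp-free arc.  Cusp-free closed loops leave no trace.
\<close>

datatype tangle_end = In_L | In_R | Out_R | Out_L

record 'p config =
  cusps :: "('p \<times> 'p) set"
  sites :: "('p \<times> 'p) set set"
  arcs :: "'p set set"
  boundary :: "tangle_end \<Rightarrow> 'p"

definition points :: "'p config \<Rightarrow> 'p set" where
  "points S = fst ` cusps S \<union> snd ` cusps S \<union> \<Union>(arcs S) \<union> range (boundary S)"

definition config_iso :: "'p config \<Rightarrow> 'q config \<Rightarrow> bool" where
  "config_iso S X \<longleftrightarrow> (\<exists>f. inj_on f (points S) \<and>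
     cusps X = map_prod f f ` cusps S \<and>
     sites X = (\<lambda>s. map_prod f f ` s) ` sites S \<and>
     arcs X = (\<lambda>s. f ` s) ` arcs S \<and>
     boundary X = f \<circ> boundary S)"

text \<open>
  \<open>splice L J\<close>: the arcs that arise from the arcs \<open>L\<close> when the pairs of points in \<open>J\<close> are joined
  and then forgotten.
\<close>

definition connected_by :: "'p set set \<Rightarrow> ('p \<times> 'p) set" where
  "connected_by L = {(x, y). {x, y} \<in> L}\<^sup>*"

definition splice :: "'p set set \<Rightarrow> 'p set set \<Rightarrow> 'p set set" where
  "splice L J = {{x, y} | x y. x \<in> \<Union>L - \<Union>J \<and> y \<in> \<Union>L - \<Union>J \<and> x \<noteq> y \<and>
     (x, y) \<in> connected_by (L \<union> J)}"

text \<open>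
  Deletion of a set \<open>Q\<close> of cusps; the cusps outside \<open>Q\<close> that lose their partners form
  a new site.  If \<open>Q\<close> is a site, no cusp is left over and the site disappears.
\<close>

definition delete_cusps :: "('p \<times> 'p) set \<Rightarrow> 'p config \<Rightarrow> 'p config" where
  "delete_cusps Q S = S\<lparr>cusps := cusps S - Q,
     sites := {s \<in> sites S. s \<inter> Q = {}} \<union> ({\<Union>{s \<in> sites S. s \<inter> Q \<noteq> {}} - Q} - {{}}),
     arcs := splice (arcs S) ((\<lambda>(t, h). {t, h}) ` Q)\<rparr>"

text \<open>Two consecutive cusps have arrows in the same direction iff head meets tail.\<close>

definition cancellations :: "'p config \<Rightarrow> ('p \<times> 'p) set set" where
  "cancellations S = {{c, c'} | c c'. c \<in> cusps S \<and> c' \<in> cusps S \<and> c \<noteq> c' \<and>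
     {snd c, fst c'} \<in> arcs S}"

text \<open>
  The consecutive cusps \<open>\<beta>, \<alpha>, \<alpha>', \<beta>'\<close> of the configuration with precedence, the strand being
  traversed in the direction of the arrows at \<open>\<beta>\<close> and \<open>\<beta>'\<close>.
\<close>

definition precedence :: "'p config \<Rightarrow> ('p \<times> 'p) set set" where
  "precedence S = {{\<beta>, \<alpha>, \<alpha>', \<beta>'} | \<beta> \<alpha> \<alpha>' \<beta>'.
     \<beta> \<noteq> \<beta>' \<and> {\<beta>, \<beta>'} \<in> sites S \<and>
     \<alpha> \<in> cusps S - {\<beta>, \<beta>'} \<and> \<alpha>' \<in> cusps S - {\<beta>, \<beta>'} \<and> \<alpha> \<noteq> \<alpha>' \<and> {\<alpha>, \<alpha>'} \<notin> sites S \<and>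
     {snd \<beta>, snd \<alpha>} \<in> arcs S \<and> {fst \<alpha>, snd \<alpha>'} \<in> arcs S \<and> {fst \<alpha>', fst \<beta>'} \<in> arcs S}"

definition reductions :: "'p config \<Rightarrow> ('p \<times> 'p) set set" where
  "reductions S = (if precedence S \<noteq> {} then precedence S else cancellations S)"

text \<open>
  \<open>reduce S X\<close> is the coefficient of (the isomorphism class of) \<open>X\<close> in the average over all ways
  to reduce \<open>S\<close>.  As a reduction step deletes at least two cusps, the number of cusps bounds the
  number of steps.
\<close>

primrec reduce_steps :: "nat \<Rightarrow> 'p config \<Rightarrow> 'q config \<Rightarrow> rat" where
  "reduce_steps 0 S X = (if config_iso S X then 1 else 0)"
| "reduce_steps (Suc n) S X =
     (if reductions S = {} then (if config_iso S X then 1 else 0)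
      else (\<Sum>Q\<in>reductions S. reduce_steps n (delete_cusps Q S) X) / of_nat (card (reductions S)))"

definition reduce :: "'p config \<Rightarrow> 'q config \<Rightarrow> rat" where
  "reduce S X = reduce_steps (card (cusps S)) S X"

text \<open>
  The planar tangles [oriented smoothing] and [reverse oriented smoothing].  The ends occur in the
  cyclic (counterclockwise) order \<open>In_L, In_R, Out_R, Out_L\<close>, the in ends at the bottom.  The cusp
  of the lower arc points up, so its arrow leads from \<open>In_L\<close> to \<open>In_R\<close>; the cusp of the upper arc
  points down, so its arrow leads from \<open>Out_R\<close> to \<open>Out_L\<close>.
\<close>

primrec end_label :: "tangle_end \<Rightarrow> nat" where
  "end_label In_L = 0"
| "end_label In_R = 1"
| "end_label Out_R = 2"
| "end_label Out_L = 3"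

definition oriented_smoothing :: "nat config" where
  "oriented_smoothing = \<lparr>cusps = {}, sites = {}, arcs = {{0, 3}, {1, 2}}, boundary = end_label\<rparr>"

definition reverse_oriented_smoothing :: "nat config" where
  "reverse_oriented_smoothing = \<lparr>cusps = {(4, 5), (6, 7)}, sites = {{(4, 5), (6, 7)}},
     arcs = {{0, 4}, {5, 1}, {2, 6}, {7, 3}}, boundary = end_label\<rparr>"


section \<open>The extended bracket expansion of the complement of a crossing\<close>

text \<open>The group algebra of the integers over the rationals, that is, \<open>\<rat>[A, A\<inverse>]\<close>.\<close>

type_synonym laurent = "int \<Rightarrow>\<^sub>0 rat"

definition A_pow :: "int \<Rightarrow> laurent" where
  "A_pow k = Poly_Mapping.single k 1"

definition scalar :: "rat \<Rightarrow> laurent" where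
  "scalar r = Poly_Mapping.single 0 r"

definition loop_value :: laurent where
  "loop_value = - A_pow 2 - A_pow (-2)"

text \<open>
  Formal linear combinations of isomorphism classes of configurations are given by
  their coefficient functions.
\<close>

definition basis :: "nat config \<Rightarrow> nat config \<Rightarrow> laurent" where
  "basis S = (\<lambda>X. if config_iso S X then 1 else 0)"

definition direction :: "vdiag \<Rightarrow> nat \<Rightarrow> complex" where
  "direction D e = tgt D e - src D e"

definition det2 :: "complex \<Rightarrow> complex \<Rightarrow> real" where
  "det2 u v = Re u * Im v - Im u * Re v"

definition positive :: "vdiag \<Rightarrow> nat \<times> nat \<Rightarrow> bool" where
  "positive D c \<longleftrightarrow> det2 (direction D (fst c)) (direction D (snd c)) > 0"

text \<open>
  A classical crossing of \<open>e\<close> and \<open>f\<close> is passed twice: the passage \<open>(e, f)\<close> along \<open>e\<close> and the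
  passage \<open>(f, e)\<close> along \<open>f\<close>.  Each passage has an incoming and an outgoing strand end.
\<close>

definition passages :: "vdiag \<Rightarrow> (nat \<times> nat) set" where
  "passages D = over D \<union> (over D)\<inverse>"

datatype side = Incoming | Outgoing

type_synonym strand_end = "(nat \<times> nat) \<times> side"

text \<open>The parameter in \<open>(0, 1)\<close>, along the first edge, of its crossing with the second.\<close>

definition param :: "vdiag \<Rightarrow> nat \<times> nat \<Rightarrow> real" where
  "param D P = (THE t. 0 < t \<and> t < 1 \<and>
     src D (fst P) + complex_of_real t * direction D (fst P) \<in> seg D (snd P))"

text \<open>\<open>travel D P Q\<close>: the distances from \<open>P\<close> to \<open>Q\<close> along the strand, each edge having length 1.\<close>

definition travel :: "vdiag \<Rightarrow> nat \<times> nat \<Rightarrow> nat \<times> nat \<Rightarrow> real set" where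
  "travel D P Q =
     {real k + param D Q - param D P | k. fst Q = (nxt D ^^ k) (fst P)} \<inter> {0<..}"

definition next_passage :: "vdiag \<Rightarrow> nat \<times> nat \<Rightarrow> nat \<times> nat \<Rightarrow> bool" where
  "next_passage D P Q \<longleftrightarrow> P \<in> passages D \<and> Q \<in> passages D \<and>
     (\<exists>h\<in>travel D P Q. \<forall>Q'\<in>passages D. \<forall>h'\<in>travel D P Q'. h \<le> h')"

definition strands :: "vdiag \<Rightarrow> strand_end set set" where
  "strands D = {{(P, Outgoing), (Q, Incoming)} | P Q. next_passage D P Q}"

definition oriented_joins :: "nat \<times> nat \<Rightarrow> strand_end set set" where
  "oriented_joins c = (case c of (x, y) \<Rightarrow>
     {{((x, y), Incoming), ((y, x), Outgoing)}, {((y, x), Incoming), ((x, y), Outgoing)}})"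

text \<open>
  Counterclockwise, the strand ends at a crossing are: left in, right in, right out, left out.  At a
  positive crossing \<open>(x, y)\<close> (\<open>x\<close> over \<open>y\<close>) the overcrossing strand runs from left in to right out, at
  a negative one from right in to left out.
\<close>

definition crossing_end :: "vdiag \<Rightarrow> nat \<times> nat \<Rightarrow> tangle_end \<Rightarrow> strand_end" where
  "crossing_end D c t = (case c of (x, y) \<Rightarrow>
     let l = (if positive D c then (x, y) else (y, x)); r = prod.swap l in
     (case t of In_L \<Rightarrow> (l, Incoming) | In_R \<Rightarrow> (r, Incoming)
              | Out_R \<Rightarrow> (l, Outgoing) | Out_L \<Rightarrow> (r, Outgoing)))"

text \<open>The two cusps of a disoriented smoothing point at each other.\<close>

definition in_cusp :: "vdiag \<Rightarrow> nat \<times> nat \<Rightarrow> strand_end \<times> strand_end" where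
  "in_cusp D c = (crossing_end D c In_L, crossing_end D c In_R)"

definition out_cusp :: "vdiag \<Rightarrow> nat \<times> nat \<Rightarrow> strand_end \<times> strand_end" where
  "out_cusp D c = (crossing_end D c Out_R, crossing_end D c Out_L)"

text \<open>
  The boundary of the complement \<open>T\<close> of a small disk about the crossing \<open>i\<close>: the in ends of \<open>T\<close> are
  the out ends of \<open>i\<close> and vice versa, and the cyclic order is reversed.
\<close>

definition complement_boundary :: "vdiag \<Rightarrow> nat \<times> nat \<Rightarrow> tangle_end \<Rightarrow> strand_end" where
  "complement_boundary D i t = crossing_end D i
     (case t of In_L \<Rightarrow> Out_L | In_R \<Rightarrow> Out_R | Out_R \<Rightarrow> In_R | Out_L \<Rightarrow> In_L)"

text \<open>
  A state of \<open>T\<close> is given by the set \<open>\<sigma>\<close> of crossings with disoriented smoothing;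
  all other crossings except \<open>i\<close> receive the oriented smoothing.
\<close>

definition state_config ::
    "vdiag \<Rightarrow> nat \<times> nat \<Rightarrow> (nat \<times> nat) set \<Rightarrow> strand_end config" where
  "state_config D i \<sigma> =
     \<lparr>cusps = in_cusp D ` \<sigma> \<union> out_cusp D ` \<sigma>,
      sites = (\<lambda>c. {in_cusp D c, out_cusp D c}) ` \<sigma>,
      arcs = splice (strands D) (\<Union>(oriented_joins ` (over D - {i} - \<sigma>))),
      boundary = complement_boundary D i\<rparr>"

text \<open>Closed loops that pass crossings, and link components without any classical crossing.\<close>

definition state_curves :: "vdiag \<Rightarrow> nat \<times> nat \<Rightarrow> (nat \<times> nat) set \<Rightarrow> strand_end set set" where
  "state_curves D i \<sigma> = (passages D \<times> UNIV) //
     connected_by (strands D \<union> \<Union>(oriented_joins ` (over D - {i} - \<sigma>)) \<union>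
       (\<lambda>(t, h). {t, h}) ` (in_cusp D ` \<sigma> \<union> out_cusp D ` \<sigma>))"

definition free_circles :: "vdiag \<Rightarrow> nat set set" where
  "free_circles D = {C. \<exists>e\<in>edges D. C = range (\<lambda>k. (nxt D ^^ k) e) \<and> C \<inter> fst ` passages D = {}}"

definition loop_count :: "vdiag \<Rightarrow> nat \<times> nat \<Rightarrow> (nat \<times> nat) set \<Rightarrow> nat" where
  "loop_count D i \<sigma> =
     card {C \<in> state_curves D i \<sigma>. C \<inter> range (complement_boundary D i) = {}} +
     card (free_circles D)"

definition state_weight :: "vdiag \<Rightarrow> nat \<times> nat \<Rightarrow> (nat \<times> nat) set \<Rightarrow> laurent" where
  "state_weight D i \<sigma> = (\<Prod>c\<in>over D - {i}.
     if c \<in> \<sigma> then (if positive D c then A_pow (-1) else A_pow 1)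
     else (if positive D c then A_pow 1 else A_pow (-1)))"

definition extended_bracket :: "vdiag \<Rightarrow> nat \<times> nat \<Rightarrow> nat config \<Rightarrow> laurent" where
  "extended_bracket D i = (\<lambda>X. \<Sum>\<sigma>\<in>Pow (over D - {i}).
     state_weight D i \<sigma> * loop_value ^ loop_count D i \<sigma> *
     scalar (reduce (state_config D i \<sigma>) X))"

definition is_expansion :: "vdiag \<Rightarrow> nat \<times> nat \<Rightarrow> laurent \<Rightarrow> laurent \<Rightarrow> bool" where
  "is_expansion D i a b \<longleftrightarrow> (\<forall>X. extended_bracket D i X =
     a * basis oriented_smoothing X + b * basis reverse_oriented_smoothing X)"

end

theory Submission
  imports Defs "HOL-Computational_Algebra.Polynomial"
begin


text \<open>The proof detects virtualization with a state sum \<open>Z t\<close>, where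
  \<open>t\<close> is an integer parameter. Fix \<open>N > 0\<close> and a complex \<open>A\<close>
  with \<open>A\<^sup>2 + inverse A ^ 2 = - N\<close>, so that the loop value is \<open>N\<close>,
  the number of labels. Strands are labelled by integers modulo \<open>N\<close>. Each crossing has
  the two smoothings of the bracket as its weight: the oriented one transmits labels, and at both
  cusps of the disoriented one the label on the left exceeds the label on the right by
  \<open>t\<close>. At \<open>t = 0\<close> this is the ordinary bracket with \<open>N\<close>
  choices for every loop. For other \<open>t\<close>, a loop whose cusp shifts do not add up to 0
  modulo \<open>N\<close> has no labelling.

  The main device is a change of gauge (\<open>W_rot\<close>). Let an integer function on the
  strands be constant along the oriented smoothing and larger by one on the left of every crossing
  (an Alexander numbering). Rotating each label by \<open>t\<close> times this function turns the
  weights for \<open>t\<close> into those for 0. Inside the disk of a classical Reidemeister move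
  such a numbering always exists, so \<open>R2_local\<close> and \<open>R3_local\<close> follow from
  the bracket identities at \<open>t = 0\<close>; in \<open>R1_local\<close> the shifts cancel
  directly. Virtual crossings do not enter the sum, so detours preserve it. Hence \<open>Z\<close>
  is invariant under virtual isotopy up to a nonzero factor that is independent of \<open>t\<close>
  (\<open>Z_isotopic\<close>). A classical diagram has a global numbering, obtained from winding
  angles (\<open>alexander_numbering\<close>), so there \<open>Z t = Z 0\<close>
  (\<open>Z_classical\<close>). Thus \<open>Z 1 D ~= Z 0 D\<close> proves \<open>D\<close>
  non-classical and non-trivial (\<open>nonclassicalI\<close>).

  Virtualizing \<open>i\<close> only reverses the sign of \<open>i\<close> in the state sum
  (\<open>Z_virtualization\<close>). The numbering of \<open>K\<close> removes \<open>t\<close> from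
  the complement \<open>T\<close>; at \<open>i\<close> itself left and right have been exchanged, so
  the shift is doubled. After the gauge, \<open>T\<close> acts on the four boundary labels as
  \<open>a\<close> times the oriented plus \<open>b\<close> times the reverse oriented pairing, with
  \<open>a\<close> and \<open>b\<close> evaluated at \<open>A\<close>
  (\<open>gsum_expansion\<close>). The first pairing closes up to a value independent of
  \<open>t\<close>. In the second one a term survives at \<open>t = 0\<close> that disappears at
  \<open>t = 1\<close> when \<open>N >= 3\<close>, so \<open>Z 0 K' - Z 1 K'\<close> is
  \<open>b\<close> times a nonzero number (\<open>Z_virtualization_ne\<close>). A nonzero Laurent
  polynomial is nonzero at some admissible \<open>A\<close> (\<open>laurent_nonroot\<close>).

  It remains to identify \<open>a\<close> and \<open>b\<close> with the extended bracket. The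
  numbering assigns levels to the arcs of every state, each cusp changing the level by one, and
  reductions respect the levels (\<open>reductions_coherent\<close>). A reduced state can only be
  one of the two planar tangles, and which one depends only on how the state joins the four ends
  (\<open>reduced_shape\<close>, \<open>joined_delete\<close>). So all terms of every average agree
  (\<open>reduce_steps_coherent\<close>), and \<open>a\<close> and \<open>b\<close> are plain sums
  over states sorted by connectivity (\<open>coefficient\<close>).\<close>

section \<open>Labels modulo \<open>N\<close>, crossing weights and the local identities behind the
  moves\<close>

locale bracket_model =
 fixes N :: int and A :: complex
 assumes N_pos: "N > 0" and A_nz: "A ~= 0" and loop: "A\<^sup>2 + inverse A ^ 2 = - of_int N"
begin

definition S :: "int set" where "S = {0..<N}"

text \<open>Here \<open>xi\<close> and \<open>xo\<close> are the labels of the overcrossing strand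
  before and after the crossing, \<open>yi\<close> and \<open>yo\<close> those of the other strand.
  In the disoriented term both cusps have a left end whose label is larger by \<open>t\<close> than
  that of the right end. The overcrossing strand comes in on the left exactly at positive crossings,
  which gives the two forms.\<close>

definition W :: "int => bool => int => int => int => int => complex" where
 "W t pos xi xo yi yo = (if pos
 then A * of_bool (xi = yo & yi = xo) +
 inverse A * of_bool (xi = (yi + t) mod N & yo = (xo + t) mod N)
 else inverse A * of_bool (xi = yo & yi = xo) +
 A * of_bool (yi = (xi + t) mod N & xo = (yo + t) mod N))"

definition rot :: "int => int => int" where "rot k x = (x + k) mod N"

lemma finite_S [simp]: "finite S" and card_S: "of_nat (card S) = (of_int N :: complex)"
 using N_pos by (auto simp: S_def)

lemma S_mod [simp]: "x \<in> S ==> x mod N = x"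
 by (auto simp: S_def)

lemma rot_in_S [simp]: "rot k x \<in> S"
 using N_pos by (simp add: S_def rot_def)

lemma rot_0 [simp]: "x \<in> S ==> rot 0 x = x"
 by (simp add: rot_def)

lemma rot_rot [simp]: "rot j (rot k x) = rot (j + k) x"
 by (simp add: rot_def mod_simps algebra_simps)

lemma rot_eq_iff:
 assumes "x \<in> S" "y \<in> S"
 shows "rot j x = rot k y \<longleftrightarrow> x = rot (k - j) y"
proof
 assume "rot j x = rot k y"
 then have "rot (-j) (rot j x) = rot (-j) (rot k y)" by simp
 then show "x = rot (k - j) y" using assms by simp
qed (simp add: assms)

lemma sum_rot: "(\<Sum>x\<in>S. f (rot k x)) = (\<Sum>x\<in>S. f x)"
 by (rule sum.reindex_bij_witness[of _ "rot (- k)" "rot k"]) auto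

lemma sum_at:
 assumes "c \<in> S" "\<And>x. x \<in> S ==> x ~= c ==> f x = 0"
 shows "(\<Sum>x\<in>S. f x) = (f c :: complex)"
 using assms by (subst sum.mono_neutral_right[of S "{c}"]) auto

text \<open>The two left ends are rotated by one amount and the two right ends by an amount smaller
  by \<open>t\<close>. The oriented smoothing joins left to left and right to right, and at the
  cusps the difference cancels the shift.\<close>

lemma W_rot:
 assumes "xi \<in> S" "xo \<in> S" "yi \<in> S" "yo \<in> S"
 and "b = (if pos then a - t else a + t)"
 shows "W t pos (rot a xi) (rot b xo) (rot b yi) (rot a yo) = W 0 pos xi xo yi yo"
proof -
 have *: "(u + t) mod N = rot t u" for u by (simp add: rot_def)
 have **: "rot j u = rot j v \<longleftrightarrow> u = v" if "u \<in> S" "v \<in> S" for j u v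
 using that by (simp add: rot_eq_iff)
 show ?thesis using assms(1-4) unfolding W_def * assms(5)
 by (simp add: ** algebra_simps)
qed

lemma W0_True:
 assumes "xo \<in> S" "yi \<in> S"
 shows "W 0 True xi xo yi yo =
 A * of_bool (xi = yo & yi = xo) + inverse A * of_bool (xi = yi & yo = xo)"
 using assms by (simp add: W_def)

text \<open>Without shift, reversing one strand exchanges the two smoothings, exactly as a change of
  sign does. So at \<open>t = 0\<close> orientations can be normalized.\<close>

lemma W0_False:
 assumes "xi \<in> S" "xo \<in> S" "yi \<in> S" "yo \<in> S"
 shows "W 0 False xi xo yi yo = W 0 True xi xo yo yi"
 using assms by (auto simp: W_def)

text \<open>Of the four products of smoothings one is the desired identity. The other three join
  \<open>ei\<close> to \<open>fi\<close> and \<open>gi\<close> to \<open>eo\<close>, one of them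
  with an extra loop worth \<open>N\<close>, and their coefficients add up to
  \<open>A\<^sup>2 + inverse A ^ 2 + N = 0\<close>. Both crossings are written as positive by
  reversing the lower strand at one of them, whence two versions.\<close>

lemma R2_core:
 assumes [simp]: "ei \<in> S" "eo \<in> S" "fi \<in> S" "gi \<in> S"
 shows "(\<Sum>x\<in>S. \<Sum>y\<in>S. W 0 True ei x fi y * W 0 True x eo gi y) = of_bool (ei = eo & fi = gi)"
 (is ?A)
 and "(\<Sum>x\<in>S. \<Sum>y\<in>S. W 0 True ei x y fi * W 0 True x eo y gi) = of_bool (ei = eo & fi = gi)"
 (is ?B)
proof -
 let ?a = "%P. of_bool P :: complex"
 have c: "of_bool P * (A * (A * of_bool Q)) + (of_bool P * (inverse A * (inverse A * of_bool Q))
 + of_int N * of_bool (P & Q)) = (0::complex)" for P Q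
 using loop by (auto simp: power2_eq_square algebra_simps)
 have "(\<Sum>x\<in>S. \<Sum>y\<in>S. W 0 True ei x fi y * W 0 True x eo gi y) =
 A * A * (\<Sum>x\<in>S. \<Sum>y\<in>S. ?a (ei = y & fi = x) * ?a (x = y & gi = eo)) +
 A * inverse A * (\<Sum>x\<in>S. \<Sum>y\<in>S. ?a (ei = y & fi = x) * ?a (x = gi & y = eo)) +
 A * inverse A * (\<Sum>x\<in>S. \<Sum>y\<in>S. ?a (ei = fi & y = x) * ?a (x = y & gi = eo)) +
 inverse A * inverse A * (\<Sum>x\<in>S. \<Sum>y\<in>S. ?a (ei = fi & y = x) * ?a (x = gi & y = eo))"
 unfolding sum_distrib_left sum.distrib[symmetric]
 by (intro sum.cong refl) (simp add: W0_True ring_distribs del: of_bool_conj)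
 moreover have "(\<Sum>x\<in>S. \<Sum>y\<in>S. ?a (ei = y & fi = x) * ?a (x = y & gi = eo)) = ?a (ei = fi & gi = eo)"
 by (subst sum_at[of fi], simp, force, subst sum_at[of ei]) auto
 moreover have "(\<Sum>x\<in>S. \<Sum>y\<in>S. ?a (ei = y & fi = x) * ?a (x = gi & y = eo)) = ?a (ei = eo & fi = gi)"
 by (subst sum_at[of fi], simp, force, subst sum_at[of ei]) auto
 moreover have "(\<Sum>x\<in>S. \<Sum>y\<in>S. ?a (ei = fi & y = x) * ?a (x = y & gi = eo)) = of_int N * ?a (ei = fi & gi = eo)"
 proof -
 have "(\<Sum>y\<in>S. ?a (ei = fi & y = x) * ?a (x = y & gi = eo)) = ?a (ei = fi & gi = eo)" if "x \<in> S" for x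
 using that by (subst sum_at[of x]) auto
 then show ?thesis by (simp add: card_S)
 qed
 moreover have "(\<Sum>x\<in>S. \<Sum>y\<in>S. ?a (ei = fi & y = x) * ?a (x = gi & y = eo)) = ?a (ei = fi & gi = eo)"
 by (subst sum_at[of gi], simp, force, subst sum_at[of eo]) auto
 ultimately have "(\<Sum>x\<in>S. \<Sum>y\<in>S. W 0 True ei x fi y * W 0 True x eo gi y) =
 (A\<^sup>2 + inverse A ^ 2 + of_int N) * ?a (ei = fi & gi = eo) + ?a (ei = eo & fi = gi)"
 using A_nz by (simp add: power2_eq_square ring_distribs del: of_bool_conj)
 then show ?A using loop by simp
 have "(\<Sum>x\<in>S. \<Sum>y\<in>S. W 0 True ei x y fi * W 0 True x eo y gi) =
 A * A * (\<Sum>x\<in>S. \<Sum>y\<in>S. ?a (ei = fi & y = x) * ?a (x = gi & y = eo)) +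
 A * inverse A * (\<Sum>x\<in>S. \<Sum>y\<in>S. ?a (ei = fi & y = x) * ?a (x = y & gi = eo)) +
 A * inverse A * (\<Sum>x\<in>S. \<Sum>y\<in>S. ?a (ei = y & fi = x) * ?a (x = gi & y = eo)) +
 inverse A * inverse A * (\<Sum>x\<in>S. \<Sum>y\<in>S. ?a (ei = y & fi = x) * ?a (x = y & gi = eo))"
 unfolding sum_distrib_left sum.distrib[symmetric]
 by (intro sum.cong refl) (simp add: W0_True ring_distribs del: of_bool_conj)
 moreover have "(\<Sum>x\<in>S. \<Sum>y\<in>S. ?a (ei = y & fi = x) * ?a (x = y & gi = eo)) = ?a (ei = fi & gi = eo)"
 by (subst sum_at[of fi], simp, force, subst sum_at[of ei]) auto
 moreover have "(\<Sum>x\<in>S. \<Sum>y\<in>S. ?a (ei = y & fi = x) * ?a (x = gi & y = eo)) = ?a (ei = eo & fi = gi)"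
 by (subst sum_at[of fi], simp, force, subst sum_at[of ei]) auto
 moreover have "(\<Sum>x\<in>S. \<Sum>y\<in>S. ?a (ei = fi & y = x) * ?a (x = y & gi = eo)) = of_int N * ?a (ei = fi & gi = eo)"
 proof -
 have "(\<Sum>y\<in>S. ?a (ei = fi & y = x) * ?a (x = y & gi = eo)) = ?a (ei = fi & gi = eo)" if "x \<in> S" for x
 using that by (subst sum_at[of x]) auto
 then show ?thesis by (simp add: card_S)
 qed
 moreover have "(\<Sum>x\<in>S. \<Sum>y\<in>S. ?a (ei = fi & y = x) * ?a (x = gi & y = eo)) = ?a (ei = fi & gi = eo)"
 by (subst sum_at[of gi], simp, force, subst sum_at[of eo]) auto
 ultimately have "(\<Sum>x\<in>S. \<Sum>y\<in>S. W 0 True ei x y fi * W 0 True x eo y gi) =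
 (A\<^sup>2 + inverse A ^ 2 + of_int N) * ?a (ei = fi & gi = eo) + ?a (ei = eo & fi = gi)"
 using A_nz by (simp add: power2_eq_square ring_distribs del: of_bool_conj)
 then show ?B using loop by simp
qed

text \<open>An arbitrary combination of the two smoothings. The third Reidemeister identity is
  linear in the crossing of the two lower strands, and this form is stable under reversing strands
  (\<open>skein_sym\<close>).\<close>

definition skein :: "complex => complex => int => int => int => int => complex" where
 "skein c d xi xo yi yo = c * of_bool (xi = yo & yi = xo) + d * of_bool (xi = yi & yo = xo)"

lemma W0_skein:
 assumes "xi \<in> S" "xo \<in> S" "yi \<in> S" "yo \<in> S"
 shows "W 0 pos xi xo yi yo =
 skein (if pos then A else inverse A) (if pos then inverse A else A) xi xo yi yo"
 using assms by (auto simp: W_def skein_def)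

lemma skein_sym: "skein c d yi yo xi xo = skein c d xi xo yi yo" "skein c d xo xi yo yi = skein c d xi xo yi yo"
 "skein c d xi xo yo yi = skein d c xi xo yi yo"
 by (auto simp: skein_def)

text \<open>The crossing of the two lower strands is expanded; in one smoothing the upper strand slides
 over an arc, in the other one it is pulled off by \<open>R2_core\<close>.\<close>

lemma R3_core:
 assumes [simp]: "ei \<in> S" "eo \<in> S" "fi \<in> S" "fo \<in> S" "gi \<in> S" "go \<in> S"
 shows "(\<Sum>x\<in>S. \<Sum>y\<in>S. \<Sum>z\<in>S. W 0 True ei x fi y * W 0 True x eo gi z * skein c d y fo z go) =
 (\<Sum>x\<in>S. \<Sum>y\<in>S. \<Sum>z\<in>S. W 0 True x eo y fo * W 0 True ei x z go * skein c d fi y gi z)"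
proof -
 have "(\<Sum>y\<in>S. \<Sum>z\<in>S. W 0 True ei x fi y * W 0 True x eo gi z * skein c d y fo z go) =
 c * (W 0 True ei x fi go * W 0 True x eo gi fo) +
 d * of_bool (fo = go) * (\<Sum>y\<in>S. W 0 True ei x fi y * W 0 True x eo gi y)"
 if [simp]: "x \<in> S" for x
 proof -
 have "(\<Sum>y\<in>S. \<Sum>z\<in>S. W 0 True ei x fi y * W 0 True x eo gi z * skein c d y fo z go) =
 c * (\<Sum>y\<in>S. \<Sum>z\<in>S. W 0 True ei x fi y * W 0 True x eo gi z * of_bool (y = go & z = fo)) +
 d * (\<Sum>y\<in>S. \<Sum>z\<in>S. W 0 True ei x fi y * W 0 True x eo gi z * of_bool (y = z & go = fo))"
 unfolding sum_distrib_left sum.distrib[symmetric]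
 by (intro sum.cong refl) (simp add: skein_def ring_distribs del: of_bool_conj)
 moreover have "(\<Sum>y\<in>S. \<Sum>z\<in>S. W 0 True ei x fi y * W 0 True x eo gi z * of_bool (y = go & z = fo))
 = W 0 True ei x fi go * W 0 True x eo gi fo"
 by (subst sum_at[of go], simp, force, subst sum_at[of fo]) auto
 moreover have "(\<Sum>y\<in>S. \<Sum>z\<in>S. W 0 True ei x fi y * W 0 True x eo gi z * of_bool (y = z & go = fo))
 = of_bool (fo = go) * (\<Sum>y\<in>S. W 0 True ei x fi y * W 0 True x eo gi y)"
 unfolding sum_distrib_left
 proof (rule sum.cong[OF refl])
 fix y assume "y \<in> S"
 then show "(\<Sum>z\<in>S. W 0 True ei x fi y * W 0 True x eo gi z * of_bool (y = z & go = fo)) =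
 of_bool (fo = go) * (W 0 True ei x fi y * W 0 True x eo gi y)"
 by (subst sum_at[of y]) auto
 qed
 ultimately show ?thesis by simp
 qed
 then have L: "(\<Sum>x\<in>S. \<Sum>y\<in>S. \<Sum>z\<in>S. W 0 True ei x fi y * W 0 True x eo gi z * skein c d y fo z go) =
 c * (\<Sum>x\<in>S. W 0 True ei x fi go * W 0 True x eo gi fo) +
 d * of_bool (fo = go) * of_bool (ei = eo & fi = gi)"
 by (simp add: sum.distrib sum_distrib_left[symmetric] R2_core del: of_bool_conj)
 have "(\<Sum>y\<in>S. \<Sum>z\<in>S. W 0 True x eo y fo * W 0 True ei x z go * skein c d fi y gi z) =
 c * (W 0 True ei x fi go * W 0 True x eo gi fo) +
 d * of_bool (fi = gi) * (\<Sum>y\<in>S. W 0 True ei x y go * W 0 True x eo y fo)"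
 if [simp]: "x \<in> S" for x
 proof -
 have "(\<Sum>y\<in>S. \<Sum>z\<in>S. W 0 True x eo y fo * W 0 True ei x z go * skein c d fi y gi z) =
 c * (\<Sum>y\<in>S. \<Sum>z\<in>S. W 0 True x eo y fo * W 0 True ei x z go * of_bool (fi = z & gi = y)) +
 d * (\<Sum>y\<in>S. \<Sum>z\<in>S. W 0 True x eo y fo * W 0 True ei x z go * of_bool (fi = gi & z = y))"
 unfolding sum_distrib_left sum.distrib[symmetric]
 by (intro sum.cong refl) (simp add: skein_def ring_distribs del: of_bool_conj)
 moreover have "(\<Sum>y\<in>S. \<Sum>z\<in>S. W 0 True x eo y fo * W 0 True ei x z go * of_bool (fi = z & gi = y))
 = W 0 True ei x fi go * W 0 True x eo gi fo"
 by (subst sum_at[of gi], simp, force, subst sum_at[of fi]) auto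
 moreover have "(\<Sum>y\<in>S. \<Sum>z\<in>S. W 0 True x eo y fo * W 0 True ei x z go * of_bool (fi = gi & z = y))
 = of_bool (fi = gi) * (\<Sum>y\<in>S. W 0 True ei x y go * W 0 True x eo y fo)"
 unfolding sum_distrib_left
 proof (rule sum.cong[OF refl])
 fix y assume "y \<in> S"
 then show "(\<Sum>z\<in>S. W 0 True x eo y fo * W 0 True ei x z go * of_bool (fi = gi & z = y)) =
 of_bool (fi = gi) * (W 0 True ei x y go * W 0 True x eo y fo)"
 by (subst sum_at[of y]) auto
 qed
 ultimately show ?thesis by simp
 qed
 then have R: "(\<Sum>x\<in>S. \<Sum>y\<in>S. \<Sum>z\<in>S. W 0 True x eo y fo * W 0 True ei x z go * skein c d fi y gi z) =
 c * (\<Sum>x\<in>S. W 0 True ei x fi go * W 0 True x eo gi fo) +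
 d * of_bool (fi = gi) * of_bool (ei = eo & go = fo)"
 by (simp add: sum.distrib sum_distrib_left[symmetric] R2_core del: of_bool_conj)
 show ?thesis unfolding L R by auto
qed

end

context bracket_model begin

text \<open>The flags record the order of the crossings on each strand: \<open>\<kappa>\<close> that
  \<open>e\<close> meets \<open>f\<close> before \<open>g\<close>, \<open>a\<close> that
  \<open>f\<close> meets \<open>e\<close> before \<open>g\<close>, \<open>b\<close> that
  \<open>g\<close> meets \<open>e\<close> before \<open>f\<close>. The signs are \<open>pf\<close>,
  \<open>pg\<close>, \<open>pfg\<close>, and \<open>x\<close>, \<open>y\<close>, \<open>z\<close>
  are the labels of the three inner pieces. The move negates the three orders and keeps the
  signs.\<close>

definition R3_weight where
 "R3_weight t \<kappa> a b pf pg pfg ei x eo fi y fo gi z go =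
 W t pf (if \<kappa> then ei else x) (if \<kappa> then x else eo) (if a then fi else y) (if a then y else fo) *
 W t pg (if \<kappa> then x else ei) (if \<kappa> then eo else x) (if b then gi else z) (if b then z else go) *
 W t pfg (if a then y else fi) (if a then fo else y) (if b then z else gi) (if b then go else z)"

text \<open>Normalization of the orientations. The strands \<open>f\<close> and \<open>g\<close> are
  read from their crossing with \<open>e\<close> towards their common crossing, and \<open>e\<close>
  is read from \<open>e1\<close> to \<open>e2\<close>, the direction in which its crossings become
  positive; by \<open>pos\<close> one direction serves both. The coefficients \<open>c\<close> and
  \<open>d\<close> absorb the sign of the lower crossing.\<close>

lemma R3_weight_zero:
 assumes [simp]: "ei \<in> S" "eo \<in> S" "fi \<in> S" "fo \<in> S" "gi \<in> S" "go \<in> S" "x \<in> S" "y \<in> S" "z \<in> S"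
 and c: "c = (if pfg = (a = b) then A else inverse A)" "d = (if pfg = (a = b) then inverse A else A)"
 and pos: "(a = pf) = (b = pg)"
 and fg: "fr = (if a then fi else fo)" "fl = (if a then fo else fi)"
 "gr = (if b then gi else go)" "gl = (if b then go else gi)"
 "e1 = (if a = pf then ei else eo)" "e2 = (if a = pf then eo else ei)"
 shows "\<kappa> = (a = pf) ==> R3_weight 0 \<kappa> a b pf pg pfg ei x eo fi y fo gi z go =
 W 0 True e1 x fr y * W 0 True x e2 gr z * skein c d y fl z gl"
 and "\<kappa> ~= (a = pf) ==> R3_weight 0 \<kappa> a b pf pg pfg ei x eo fi y fo gi z go =
 W 0 True e1 x gr z * W 0 True x e2 fr y * skein c d y fl z gl"
 and "\<kappa> = (a = pf) ==> R3_weight 0 (~ \<kappa>) (~ a) (~ b) pf pg pfg ei x eo fi y fo gi z go =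
 W 0 True x e2 y fl * W 0 True e1 x z gl * skein c d fr y gr z"
 and "\<kappa> ~= (a = pf) ==> R3_weight 0 (~ \<kappa>) (~ a) (~ b) pf pg pfg ei x eo fi y fo gi z go =
 W 0 True x e2 z gl * W 0 True e1 x y fl * skein c d fr y gr z"
proof -
 have F: "W 0 pf (if \<kappa> then ei else x) (if \<kappa> then x else eo) (if a then fi else y) (if a then y else fo)
 = (if \<kappa> = (a = pf) then W 0 True e1 x fr y else W 0 True x e2 fr y)"
 by (cases \<kappa>; cases a; cases pf; simp add: fg W0_skein; simp add: skein_def; auto)
 have G: "W 0 pg (if \<kappa> then x else ei) (if \<kappa> then eo else x) (if b then gi else z) (if b then z else go)
 = (if \<kappa> = (a = pf) then W 0 True x e2 gr z else W 0 True e1 x gr z)"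
 unfolding fg(5,6) pos by (cases \<kappa>; cases b; cases pg; simp add: fg W0_skein; simp add: skein_def; auto)
 have FG: "W 0 pfg (if a then y else fi) (if a then fo else y) (if b then z else gi) (if b then go else z)
 = skein c d y fl z gl"
 by (cases a; cases b; cases pfg; simp add: fg c W0_skein; simp add: skein_def; auto)
 have F': "W 0 pf (if ~ \<kappa> then ei else x) (if ~ \<kappa> then x else eo) (if ~ a then fi else y) (if ~ a then y else fo)
 = (if \<kappa> = (a = pf) then W 0 True x e2 y fl else W 0 True e1 x y fl)"
 by (cases \<kappa>; cases a; cases pf; simp add: fg W0_skein; simp add: skein_def; auto)
 have G': "W 0 pg (if ~ \<kappa> then x else ei) (if ~ \<kappa> then eo else x) (if ~ b then gi else z) (if ~ b then z else go)
 = (if \<kappa> = (a = pf) then W 0 True e1 x z gl else W 0 True x e2 z gl)"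
 unfolding fg(5,6) pos by (cases \<kappa>; cases b; cases pg; simp add: fg W0_skein; simp add: skein_def; auto)
 have FG': "W 0 pfg (if ~ a then y else fi) (if ~ a then fo else y) (if ~ b then z else gi) (if ~ b then go else z)
 = skein c d fr y gr z"
 by (cases a; cases b; cases pfg; simp add: fg c W0_skein; simp add: skein_def; auto)
 show "\<kappa> = (a = pf) ==> R3_weight 0 \<kappa> a b pf pg pfg ei x eo fi y fo gi z go =
 W 0 True e1 x fr y * W 0 True x e2 gr z * skein c d y fl z gl"
 unfolding R3_weight_def F G FG by simp
 show "\<kappa> ~= (a = pf) ==> R3_weight 0 \<kappa> a b pf pg pfg ei x eo fi y fo gi z go =
 W 0 True e1 x gr z * W 0 True x e2 fr y * skein c d y fl z gl"
 unfolding R3_weight_def F G FG by (simp only: if_False mult_ac)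
 show "\<kappa> = (a = pf) ==> R3_weight 0 (~ \<kappa>) (~ a) (~ b) pf pg pfg ei x eo fi y fo gi z go =
 W 0 True x e2 y fl * W 0 True e1 x z gl * skein c d fr y gr z"
 unfolding R3_weight_def F' G' FG' by simp
 show "\<kappa> ~= (a = pf) ==> R3_weight 0 (~ \<kappa>) (~ a) (~ b) pf pg pfg ei x eo fi y fo gi z go =
 W 0 True x e2 z gl * W 0 True e1 x y fl * skein c d fr y gr z"
 unfolding R3_weight_def F' G' FG' by (simp only: if_False mult_ac)
qed

lemma R3_zero:
 assumes mem: "ei \<in> S" "eo \<in> S" "fi \<in> S" "fo \<in> S" "gi \<in> S" "go \<in> S"
 and pos: "(a = pf) = (b = pg)"
 shows "(\<Sum>x\<in>S. \<Sum>y\<in>S. \<Sum>z\<in>S. R3_weight 0 \<kappa> a b pf pg pfg ei x eo fi y fo gi z go) =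
 (\<Sum>x\<in>S. \<Sum>y\<in>S. \<Sum>z\<in>S. R3_weight 0 (~ \<kappa>) (~ a) (~ b) pf pg pfg ei x eo fi y fo gi z go)"
 (is "?l = ?r")
proof -
 define c d where c: "c = (if pfg = (a = b) then A else inverse A)" "d = (if pfg = (a = b) then inverse A else A)"
 define fr fl gr gl e1 e2 where fg: "fr = (if a then fi else fo)" "fl = (if a then fo else fi)"
 "gr = (if b then gi else go)" "gl = (if b then go else gi)"
 "e1 = (if a = pf then ei else eo)" "e2 = (if a = pf then eo else ei)"
 have [simp]: "fr \<in> S" "fl \<in> S" "gr \<in> S" "gl \<in> S" "e1 \<in> S" "e2 \<in> S" using mem by (auto simp: fg)
 note eqs = R3_weight_zero[OF mem _ _ _ c pos fg]
 show ?thesis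
 proof (cases "\<kappa> = (a = pf)")
 case True
 have "?l = (\<Sum>x\<in>S. \<Sum>y\<in>S. \<Sum>z\<in>S. W 0 True e1 x fr y * W 0 True x e2 gr z * skein c d y fl z gl)"
 by (intro sum.cong refl, rule eqs(1)[OF _ _ _ True])
 also have "\<dots> = (\<Sum>x\<in>S. \<Sum>y\<in>S. \<Sum>z\<in>S. W 0 True x e2 y fl * W 0 True e1 x z gl * skein c d fr y gr z)"
 by (rule R3_core) auto
 also have "\<dots> = ?r"
 by (intro sum.cong refl, rule eqs(3)[OF _ _ _ True, symmetric])
 finally show ?thesis .
 next
 case False
 have "?l = (\<Sum>x\<in>S. \<Sum>y\<in>S. \<Sum>z\<in>S. W 0 True e1 x gr z * W 0 True x e2 fr y * skein c d y fl z gl)"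
 by (intro sum.cong refl, rule eqs(2)[OF _ _ _ False])
 also have "\<dots> = (\<Sum>x\<in>S. \<Sum>y\<in>S. \<Sum>z\<in>S. W 0 True e1 x gr y * W 0 True x e2 fr z * skein c d y gl z fl)"
 by (rule sum.cong[OF refl], subst sum.swap) (simp add: skein_sym(1))
 also have "\<dots> = (\<Sum>x\<in>S. \<Sum>y\<in>S. \<Sum>z\<in>S. W 0 True x e2 y gl * W 0 True e1 x z fl * skein c d gr y fr z)"
 by (rule R3_core) auto
 also have "\<dots> = (\<Sum>x\<in>S. \<Sum>y\<in>S. \<Sum>z\<in>S. W 0 True x e2 z gl * W 0 True e1 x y fl * skein c d fr y gr z)"
 by (rule sum.cong[OF refl], subst sum.swap) (simp add: skein_sym(1))
 also have "\<dots> = ?r"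
 by (intro sum.cong refl, rule eqs(4)[OF _ _ _ False, symmetric])
 finally show ?thesis .
 qed
qed

lemma W_rot':
 assumes "xi \<in> S" "xo \<in> S" "yi \<in> S" "yo \<in> S"
 and "l4 = l1" "l3 = l2" "l2 = l1 - (if pos then t else - t)"
 shows "W t pos (rot l1 xi) (rot l2 xo) (rot l3 yi) (rot l4 yo) = W 0 pos xi xo yi yo"
 using W_rot[OF assms(1-4), of l2 pos l1 t] assms(5-7) by (auto split: if_splits)

text \<open>The rotations form an Alexander numbering of the local picture, started with 0 on the
  incoming end of \<open>e\<close> and continued through the crossings by the rule of
  \<open>W_rot\<close>. The conditions \<open>pos\<close>, which hold for three lines in the plane,
  make it close up around the triangle.\<close>

lemma R3_weight_rot:
 assumes [simp]: "ei \<in> S" "eo \<in> S" "fi \<in> S" "fo \<in> S" "gi \<in> S" "go \<in> S" "x \<in> S" "y \<in> S" "z \<in> S"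
 and pos: "(a = pf) = (b = pg)" "(b = pfg) = (\<kappa> = pf)"
 and s: "sf = (if pf then t else - t)" "sg = (if pg then t else - t)" "sfg = (if pfg then t else - t)"
 and l: "lf = (if \<kappa> then 0 else - sg)" "lg = (if \<kappa> then - sf else 0)"
 shows "R3_weight t \<kappa> a b pf pg pfg (rot 0 ei) (rot (if \<kappa> then - sf else - sg) x) (rot (- sf - sg) eo)
 (rot (if a then lf - sf else lf - sf + sfg) fi) (rot (if a then lf else lf - sf) y)
 (rot (if a then lf - sfg else lf) fo)
 (rot (if b then lg - sg else lg - sg - sfg) gi) (rot (if b then lg else lg - sg) z)
 (rot (if b then lg + sfg else lg) go) =
 R3_weight 0 \<kappa> a b pf pg pfg ei x eo fi y fo gi z go"
 unfolding R3_weight_def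
 apply (intro arg_cong2[where f="(*)"])
 subgoal by (cases \<kappa>; cases a; simp only: if_True if_False simp_thms; rule W_rot'; simp add: s l)
 subgoal by (cases \<kappa>; cases b; simp only: if_True if_False simp_thms; rule W_rot'; simp add: s l)
 subgoal using pos apply (cases \<kappa>; cases a; cases b; cases pf; simp only: if_True if_False simp_thms) by (rule W_rot'; simp add: s l)+
 done

end

context bracket_model begin

lemma sum_rot3:
 "(\<Sum>x\<in>S. \<Sum>y\<in>S. \<Sum>z\<in>S. F (rot i x) (rot j y) (rot k z)) = (\<Sum>x\<in>S. \<Sum>y\<in>S. \<Sum>z\<in>S. F x y z)"
 using sum_rot[of "%x. \<Sum>y\<in>S. \<Sum>z\<in>S. F x (rot j y) (rot k z)" i]
 sum_rot[of "%y. \<Sum>z\<in>S. F _ y (rot k z)" j] sum_rot[of "%z. F _ _ z" k] by simp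

text \<open>The numberings before and after the move agree on the six outer ends
  (\<open>k'\<close>), so both sides are the sums for 0 with equally rotated end labels. On the
  inner pieces the rotation is absorbed by the summation.\<close>

lemma R3_local:
 assumes mem: "ei \<in> S" "eo \<in> S" "fi \<in> S" "fo \<in> S" "gi \<in> S" "go \<in> S"
 and pos: "(a = pf) = (b = pg)" "(b = pfg) = (\<kappa> = pf)"
 shows "(\<Sum>x\<in>S. \<Sum>y\<in>S. \<Sum>z\<in>S. R3_weight t \<kappa> a b pf pg pfg ei x eo fi y fo gi z go) =
 (\<Sum>x\<in>S. \<Sum>y\<in>S. \<Sum>z\<in>S. R3_weight t (~ \<kappa>) (~ a) (~ b) pf pg pfg ei x eo fi y fo gi z go)"
proof -
 define sf sg sfg where s: "sf = (if pf then t else - t)" "sg = (if pg then t else - t)" "sfg = (if pfg then t else - t)"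
 define lf lg where l: "lf = (if \<kappa> then 0 else - sg)" "lg = (if \<kappa> then - sf else 0)"
 define lf' lg' where l': "lf' = (if ~ \<kappa> then 0 else - sg)" "lg' = (if ~ \<kappa> then - sf else 0)"
 have pos': "((~ a) = pf) = ((~ b) = pg)" "((~ b) = pfg) = ((~ \<kappa>) = pf)" using pos by auto
 define k1 k2 k3 k4 k5 where k: "k1 = - sf - sg" "k2 = (if a then lf - sf else lf - sf + sfg)"
 "k3 = (if a then lf - sfg else lf)" "k4 = (if b then lg - sg else lg - sg - sfg)"
 "k5 = (if b then lg + sfg else lg)"
 have k': "k2 = (if ~ a then lf' - sf else lf' - sf + sfg)"
 "k3 = (if ~ a then lf' - sfg else lf')" "k4 = (if ~ b then lg' - sg else lg' - sg - sfg)"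
 "k5 = (if ~ b then lg' + sfg else lg')"
 unfolding k l l' s using pos by (cases \<kappa>; cases a; cases b; cases pf; simp)+
 define eo' fi' fo' gi' go' where d: "eo' = rot (- k1) eo" "fi' = rot (- k2) fi" "fo' = rot (- k3) fo"
 "gi' = rot (- k4) gi" "go' = rot (- k5) go"
 have u: "ei = rot 0 ei" "eo = rot k1 eo'" "fi = rot k2 fi'" "fo = rot k3 fo'" "gi = rot k4 gi'" "go = rot k5 go'"
 using mem by (simp_all add: d)
 have mem': "eo' \<in> S" "fi' \<in> S" "fo' \<in> S" "gi' \<in> S" "go' \<in> S" by (simp_all add: d)
 let ?T = "\<lambda>t \<kappa> a b ei eo fi fo gi go. \<Sum>x\<in>S. \<Sum>y\<in>S. \<Sum>z\<in>S. R3_weight t \<kappa> a b pf pg pfg ei x eo fi y fo gi z go"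
 have "?T t \<kappa> a b ei eo fi fo gi go = ?T t \<kappa> a b (rot 0 ei) (rot k1 eo') (rot k2 fi') (rot k3 fo') (rot k4 gi') (rot k5 go')"
 using u by metis
 also have "\<dots> = ?T 0 \<kappa> a b ei eo' fi' fo' gi' go'"
 unfolding k by (subst sum_rot3[symmetric], intro sum.cong refl,
 rule R3_weight_rot[OF mem(1) mem' _ _ _ pos s l]) auto
 also have "\<dots> = ?T 0 (~ \<kappa>) (~ a) (~ b) ei eo' fi' fo' gi' go'"
 by (rule R3_zero[OF mem(1) mem' pos(1)])
 also have "\<dots> = ?T t (~ \<kappa>) (~ a) (~ b) (rot 0 ei) (rot k1 eo') (rot k2 fi') (rot k3 fo') (rot k4 gi') (rot k5 go')"
 unfolding k' k(1) by (subst (2) sum_rot3[symmetric], intro sum.cong refl,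
 rule R3_weight_rot[OF mem(1) mem' _ _ _ pos' s l', symmetric]) auto
 also have "\<dots> = ?T t (~ \<kappa>) (~ a) (~ b) ei eo fi fo gi go"
 using u by metis
 finally show ?thesis .
qed

text \<open>The flag \<open>k\<close> says that both strands meet the two crossings in the same
  order. A numbering of the bigon reduces the claim to \<open>R2_core\<close>.\<close>

lemma R2_local:
 assumes mem: "ai \<in> S" "ao \<in> S" "bi \<in> S" "bo \<in> S"
 shows "(\<Sum>x\<in>S. \<Sum>y\<in>S. W t p ai x (if k then bi else y) (if k then y else bo) *
 W t (~ p) x ao (if k then y else bi) (if k then bo else y)) = of_bool (ai = ao & bi = bo)"
proof -
 define s where s: "s = (if p then t else - t)"
 define k2 where k2: "k2 = (if k then - s else 0)"
 define bi' bo' where d: "bi' = rot (- k2) bi" "bo' = rot (- k2) bo"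
 have mem': "bi' \<in> S" "bo' \<in> S" by (simp_all add: d)
 have u: "ai = rot 0 ai" "ao = rot 0 ao" "bi = rot k2 bi'" "bo = rot k2 bo'"
 using mem by (simp_all add: d)
 let ?T = "%t ai ao bi bo x y. W t p ai x (if k then bi else y) (if k then y else bo) *
 W t (~ p) x ao (if k then y else bi) (if k then bo else y)"
 have "(\<Sum>x\<in>S. \<Sum>y\<in>S. ?T t ai ao bi bo x y) =
 (\<Sum>x\<in>S. \<Sum>y\<in>S. ?T t (rot 0 ai) (rot 0 ao) (rot k2 bi') (rot k2 bo') x y)"
 using u by metis
 also have "\<dots> = (\<Sum>x\<in>S. \<Sum>y\<in>S. ?T t (rot 0 ai) (rot 0 ao) (rot k2 bi') (rot k2 bo') (rot (- s) x) (rot (if k then 0 else - s) y))"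
 using sum_rot[of "%x. \<Sum>y\<in>S. ?T t (rot 0 ai) (rot 0 ao) (rot k2 bi') (rot k2 bo') x (rot (if k then 0 else - s) y)" "- s"]
 sum_rot[of "%y. ?T t (rot 0 ai) (rot 0 ao) (rot k2 bi') (rot k2 bo') _ y" "if k then 0 else - s"] by simp
 also have "\<dots> = (\<Sum>x\<in>S. \<Sum>y\<in>S. ?T 0 ai ao bi' bo' x y)"
 by (intro sum.cong refl arg_cong2[where f="(*)"]; cases k; simp only: if_True if_False; rule W_rot')
 (use mem mem' in \<open>auto simp: s k2\<close>)
 also have "\<dots> = of_bool (ai = ao & bi' = bo')"
 proof (cases p)
 case True
 show ?thesis
 proof (cases k)
 case k: True
 show ?thesis using True k mem mem' R2_core(1)[of ai ao bi' bo'] by (simp add: W0_False)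
 next
 case False
 show ?thesis using True False mem mem' R2_core(2)[of ai ao bo' bi'] by (auto simp add: W0_False)
 qed
 next
 case p: False
 show ?thesis
 proof (cases k)
 case k: True
 show ?thesis using p k mem mem' R2_core(2)[of ai ao bi' bo'] by (simp add: W0_False)
 next
 case False
 show ?thesis using p False mem mem' R2_core(1)[of ai ao bo' bi'] by (auto simp add: W0_False)
 qed
 qed
 also have "\<dots> = of_bool (ai = ao & bi = bo)"
 using u mem' by (simp add: rot_eq_iff)
 finally show ?thesis .
qed

text \<open>One smoothing of the curl splits off a loop worth \<open>N\<close>, the other one
  straightens the strand, and \<open>A * N + inverse A = - (A ^ 3)\<close>. In the straightening
  smoothing the strand passes both cusps and the two shifts cancel.\<close>

lemma R1_local:
 assumes "a \<in> S" "b \<in> S"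
 shows "(\<Sum>x\<in>S. W t p a x x b) = (if p then - (A ^ 3) else - (inverse A ^ 3)) * of_bool (a = b)" (is ?A)
 and "(\<Sum>x\<in>S. W t p x b a x) = (if p then - (A ^ 3) else - (inverse A ^ 3)) * of_bool (a = b)" (is ?B)
proof -
 have e: "(u + t) mod N = rot t u" for u by (simp add: rot_def)
 have 1: "(\<Sum>x\<in>S. of_bool (a = rot t x & b = rot t x)) = (of_bool (a = b) :: complex)"
 using assms by (subst sum_at[of "rot (- t) a"]) auto
 have 2: "(\<Sum>x\<in>S. of_bool (x = rot t a & x = rot t b)) = (of_bool (a = b) :: complex)"
 using assms by (subst sum_at[of "rot t a"]) (auto simp: rot_eq_iff)
 have 3: "(\<Sum>x\<in>S. of_bool (a = b)) = (of_int N * of_bool (a = b) :: complex)"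
 by (simp add: card_S)
 have N: "of_int N = - (A\<^sup>2 + inverse A ^ 2)" using loop by simp
 have 4: "A * of_int N + inverse A = - (A ^ 3)" "inverse A * of_int N + A = - (inverse A ^ 3)"
 unfolding N using A_nz by (simp_all add: power2_eq_square power3_eq_cube ring_distribs)
 have 5: "A * (of_int N * of_bool (a = b)) + inverse A * of_bool (a = b) = - (A ^ 3) * of_bool (a = b)"
 "inverse A * (of_int N * of_bool (a = b)) + A * of_bool (a = b) = - (inverse A ^ 3) * of_bool (a = b)"
 using 4 by (auto)
 have c: "(x = y & z = x) = (z = x & y = x)" "(x = y & a = b) = (x = y & a = b)" for x y z :: int by auto
 show ?A
 proof (cases p)
 case True
 have "(\<Sum>x\<in>S. W t p a x x b) = A * (\<Sum>x\<in>S. of_bool (a = b)) + inverse A * (\<Sum>x\<in>S. of_bool (a = rot t x & b = rot t x))"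
 unfolding W_def e sum_distrib_left sum.distrib[symmetric] using True by simp
 then show ?thesis using True 5 by (simp only: 1 3 if_True)
 next
 case False
 have "(\<Sum>x\<in>S. W t p a x x b) = inverse A * (\<Sum>x\<in>S. of_bool (a = b)) + A * (\<Sum>x\<in>S. of_bool (x = rot t a & x = rot t b))"
 unfolding W_def e sum_distrib_left sum.distrib[symmetric] using False by simp
 then show ?thesis using False 5 by (simp only: 2 3 if_False)
 qed
 show ?B
 proof (cases p)
 case True
 have "(\<Sum>x\<in>S. W t p x b a x) = A * (\<Sum>x\<in>S. of_bool (a = b)) + inverse A * (\<Sum>x\<in>S. of_bool (x = rot t a & x = rot t b))"
 unfolding W_def e sum_distrib_left sum.distrib[symmetric] using True by simp
 then show ?thesis using True 5 by (simp only: 2 3 if_True)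
 next
 case False
 have "(\<Sum>x\<in>S. W t p x b a x) = inverse A * (\<Sum>x\<in>S. of_bool (a = b)) + A * (\<Sum>x\<in>S. of_bool (a = rot t x & b = rot t x))"
 unfolding W_def e sum_distrib_left sum.distrib[symmetric] using False by simp
 then show ?thesis using False 5 by (simp only: 1 3 if_False)
 qed
qed

section \<open>State sums over the labellings of a finite set of nodes with a successor map\<close>

definition (in -) ends :: "('v \<times> 'v \<times> bool) set => 'v set" where
 "ends X = (\<Union>(x, y, p)\<in>X. {x, y})"

text \<open>The label \<open>\<phi> v\<close> belongs to the strand arriving at \<open>v\<close>, so
  the strand leaving \<open>v\<close> carries \<open>\<phi> (sc v)\<close>. Nodes in
  \<open>T\<close> transmit labels. A triple \<open>(x, y, p)\<close> is a crossing of sign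
  \<open>p\<close> whose upper strand passes at \<open>x\<close> and whose lower strand passes at
  \<open>y\<close>. The factor \<open>q\<close> allows one crossing to be treated
  separately.\<close>

definition gsum :: "int => 'v set => 'v set => ('v => 'v) => ('v \<times> 'v \<times> bool) set =>
 (('v => int) => complex) => complex" where
 "gsum t V T sc X q = (\<Sum>\<phi>\<in>V \<rightarrow>\<^sub>E S. (\<Prod>v\<in>T. of_bool (\<phi> v = \<phi> (sc v))) *
 (\<Prod>(x, y, p)\<in>X. W t p (\<phi> x) (\<phi> (sc x)) (\<phi> y) (\<phi> (sc y))) * q \<phi>)"

definition state_sum :: "int => 'v set => ('v => 'v) => ('v \<times> 'v \<times> bool) set => complex" where
 "state_sum t V sc X = gsum t V (V - ends X) sc X (%_. 1)"

lemma PiE_upd: "\<phi> \<in> V \<rightarrow>\<^sub>E S ==> m \<in> V ==> x \<in> S ==> \<phi>(m := x) \<in> V \<rightarrow>\<^sub>E S"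
 by (auto simp: PiE_def Pi_def extensional_def)

text \<open>Overwriting the label at \<open>m\<close> by every possible value counts each labelling
  \<open>N\<close> times. Dividing by \<open>N\<close>, the three lemmas
  \<open>sum_PiE_local1\<close> to \<open>sum_PiE_local3\<close> reduce the comparison of two state
  sums to a comparison after summation over the inner labels of a move.\<close>

lemma sum_PiE_average:
 assumes "finite V" "m \<in> V"
 shows "(\<Sum>\<phi>\<in>V \<rightarrow>\<^sub>E S. \<Sum>x\<in>S. F (\<phi>(m := x))) = of_int N * (\<Sum>\<phi>\<in>V \<rightarrow>\<^sub>E S. F \<phi> :: complex)"
proof -
 define V' where "V' = V - {m}"
 have V: "V = insert m V'" "m \<notin> V'" using assms by (auto simp: V'_def)
 have inj: "inj_on (%(y, g). g(m := y)) (S \<times> (V' \<rightarrow>\<^sub>E S))"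
 using V(2) by (rule inj_combinator[of m V' "%_. S"])
 have *: "(\<Sum>\<phi>\<in>V \<rightarrow>\<^sub>E S. G \<phi>) = (\<Sum>y\<in>S. \<Sum>g\<in>V' \<rightarrow>\<^sub>E S. G (g(m := y)))" for G :: "_ => complex"
 unfolding V(1) PiE_insert_eq
 by (subst sum.reindex[OF inj]) (simp add: sum.cartesian_product case_prod_unfold)
 show ?thesis unfolding * by (simp add: card_S sum.swap[of _ S])
qed

lemma finite_PiE_S [simp]: "finite V ==> finite (V \<rightarrow>\<^sub>E S)"
 by (simp add: finite_PiE)

lemma sum_PiE_local1:
 assumes "finite V" "m \<in> V"
 and "\<And>\<phi>. \<phi> \<in> V \<rightarrow>\<^sub>E S ==> (\<Sum>x\<in>S. F (\<phi>(m := x))) = c * (\<Sum>x\<in>S. G (\<phi>(m := x)))"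
 shows "(\<Sum>\<phi>\<in>V \<rightarrow>\<^sub>E S. F \<phi>) = c * (\<Sum>\<phi>\<in>V \<rightarrow>\<^sub>E S. G \<phi> :: complex)"
proof -
 have "(\<Sum>\<phi>\<in>V \<rightarrow>\<^sub>E S. \<Sum>x\<in>S. F (\<phi>(m := x))) = c * (\<Sum>\<phi>\<in>V \<rightarrow>\<^sub>E S. \<Sum>x\<in>S. G (\<phi>(m := x)))"
 unfolding sum_distrib_left[of c "\<lambda>\<phi>. \<Sum>x\<in>S. G (\<phi>(m := x))"] by (rule sum.cong[OF refl]) (rule assms(3))
 then have "of_int N * (\<Sum>\<phi>\<in>V \<rightarrow>\<^sub>E S. F \<phi>) = of_int N * (c * (\<Sum>\<phi>\<in>V \<rightarrow>\<^sub>E S. G \<phi>))"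
 unfolding sum_PiE_average[OF assms(1,2)] by (simp only: mult_ac)
 then show ?thesis using N_pos by (metis less_irrefl mult_left_cancel of_int_eq_0_iff)
qed

lemma sum_PiE_local2:
 assumes "finite V" "m \<in> V" "n \<in> V"
 and "\<And>\<phi>. \<phi> \<in> V \<rightarrow>\<^sub>E S ==>
 (\<Sum>x\<in>S. \<Sum>y\<in>S. F (\<phi>(m := x, n := y))) = c * (\<Sum>x\<in>S. \<Sum>y\<in>S. G (\<phi>(m := x, n := y)))"
 shows "(\<Sum>\<phi>\<in>V \<rightarrow>\<^sub>E S. F \<phi>) = c * (\<Sum>\<phi>\<in>V \<rightarrow>\<^sub>E S. G \<phi> :: complex)"
proof -
 have "(\<Sum>\<phi>\<in>V \<rightarrow>\<^sub>E S. \<Sum>y\<in>S. F (\<phi>(n := y))) = c * (\<Sum>\<phi>\<in>V \<rightarrow>\<^sub>E S. \<Sum>y\<in>S. G (\<phi>(n := y)))"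
 by (rule sum_PiE_local1[OF assms(1,2)]) (rule assms(4))
 then show ?thesis using N_pos by (simp add: sum_PiE_average[OF assms(1,3)])
qed

lemma sum_PiE_local3:
 assumes "finite V" "m \<in> V" "n \<in> V" "k \<in> V"
 and "\<And>\<phi>. \<phi> \<in> V \<rightarrow>\<^sub>E S ==>
 (\<Sum>x\<in>S. \<Sum>y\<in>S. \<Sum>z\<in>S. F (\<phi>(m := x, n := y, k := z))) =
 c * (\<Sum>x\<in>S. \<Sum>y\<in>S. \<Sum>z\<in>S. G (\<phi>(m := x, n := y, k := z)))"
 shows "(\<Sum>\<phi>\<in>V \<rightarrow>\<^sub>E S. F \<phi>) = c * (\<Sum>\<phi>\<in>V \<rightarrow>\<^sub>E S. G \<phi> :: complex)"
proof -
 have "(\<Sum>\<phi>\<in>V \<rightarrow>\<^sub>E S. \<Sum>y\<in>S. F (\<phi>(k := y))) = c * (\<Sum>\<phi>\<in>V \<rightarrow>\<^sub>E S. \<Sum>y\<in>S. G (\<phi>(k := y)))"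
 by (rule sum_PiE_local2[OF assms(1-3)]) (rule assms(5))
 then show ?thesis using N_pos by (simp add: sum_PiE_average[OF assms(1,4)])
qed

end

context bracket_model begin

lemma ends_Un: "ends (X \<union> Y) = ends X \<union> ends Y" and ends_empty [simp]: "ends {} = {}"
 and ends_insert [simp]: "ends (insert (x, y, p) X) = {x, y} \<union> ends X"
 by (auto simp: ends_def)

lemma in_endsI: "(x, y, p) \<in> X ==> x \<in> ends X" "(x, y, p) \<in> X ==> y \<in> ends X"
 by (auto simp: ends_def)

definition local_weight where
 "local_weight t T sc X \<phi> = (\<Prod>v\<in>T. of_bool (\<phi> v = \<phi> (sc v))) *
 (\<Prod>(x, y, p)\<in>X. W t p (\<phi> x) (\<phi> (sc x)) (\<phi> y) (\<phi> (sc y)))"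

text \<open>Separates the factors at the nodes \<open>Q\<close> that take part in a move from all
  others.\<close>

lemma state_sum_split:
 assumes "finite V" "finite X" "finite Y" "X \<inter> Y = {}" "ends X \<subseteq> V - Q" "ends Y \<subseteq> Q" "Q \<subseteq> V"
 shows "state_sum t V sc (X \<union> Y) = (\<Sum>\<phi>\<in>V \<rightarrow>\<^sub>E S.
 local_weight t (V - Q - ends X) sc X \<phi> * local_weight t (Q - ends Y) sc Y \<phi>)"
proof -
 have V: "V - ends (X \<union> Y) = (V - Q - ends X) \<union> (Q - ends Y)"
 using assms by (auto simp: ends_Un)
 have "finite (V - Q - ends X)" "finite (Q - ends Y)" "(V - Q - ends X) \<inter> (Q - ends Y) = {}"
 using assms finite_subset[OF assms(7,1)] by auto
 then show ?thesis unfolding state_sum_def gsum_def local_weight_def V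
 using assms by (intro sum.cong refl) (simp add: prod.union_disjoint mult_ac)
qed

lemma local_weight_cong:
 assumes "\<And>v. v \<in> T \<union> ends X ==> \<phi> v = \<psi> v & \<phi> (sc v) = \<psi> (sc v)"
 shows "local_weight t T sc X \<phi> = local_weight t T sc X \<psi>"
proof -
 have "(\<Prod>(x, y, p)\<in>X. W t p (\<phi> x) (\<phi> (sc x)) (\<phi> y) (\<phi> (sc y))) =
 (\<Prod>(x, y, p)\<in>X. W t p (\<psi> x) (\<psi> (sc x)) (\<psi> y) (\<psi> (sc y)))"
 proof (rule prod.cong[OF refl])
 fix c assume c: "c \<in> X"
 obtain x y p where xyp: "c = (x, y, p)" by (cases c)
 have "x \<in> T \<union> ends X" "y \<in> T \<union> ends X" using in_endsI[OF c[unfolded xyp]] by blast+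
 from this[THEN assms]
 show "(case c of (x, y, p) => W t p (\<phi> x) (\<phi> (sc x)) (\<phi> y) (\<phi> (sc y))) =
 (case c of (x, y, p) => W t p (\<psi> x) (\<psi> (sc x)) (\<psi> y) (\<psi> (sc y)))" by (simp add: xyp)
 qed
 moreover have "(\<Prod>v\<in>T. of_bool (\<phi> v = \<phi> (sc v))) = (\<Prod>v\<in>T. of_bool (\<psi> v = \<psi> (sc v)) :: complex)"
 by (rule prod.cong) (use assms in auto)
 ultimately show ?thesis by (simp add: local_weight_def)
qed

text \<open>The strand runs through \<open>p\<close> and then \<open>sc p\<close>, which form the
  crossing of the curl. By the labelling convention the inner label is the one at
  \<open>sc p\<close>.\<close>

lemma state_sum_R1:
 assumes "finite V" "finite X" "sc ` V \<subseteq> V" "inj_on sc V" "p \<in> V" "sc p ~= p" "sc (sc p) ~= sc p"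
 "ends X \<subseteq> V - {p, sc p}" and Y: "Y \<in> {{(p, sc p, b)}, {(sc p, p, b)}}"
 shows "state_sum t V sc (X \<union> Y) = (if b then - (A ^ 3) else - (inverse A ^ 3)) * state_sum t V sc X"
proof -
 let ?q = "sc p" let ?Q = "{p, sc p}"
 have q: "?q \<in> V" using assms by auto
 have E: "ends Y = ?Q" and fY: "finite Y" and d: "X \<inter> Y = {}"
 using Y assms(8) by (auto simp: ends_def)
 have A: "sc v ~= ?q" if "v \<in> V" "v ~= p" for v
 using that assms(4,5) by (auto dest: inj_onD)
 have s1: "state_sum t V sc (X \<union> Y) = (\<Sum>\<phi>\<in>V \<rightarrow>\<^sub>E S.
 local_weight t (V - ?Q - ends X) sc X \<phi> * local_weight t (?Q - ends (Y)) sc (Y) \<phi>)"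
 by (rule state_sum_split) (use assms E fY d q in auto)
 have s2: "state_sum t V sc (X \<union> {}) = (\<Sum>\<phi>\<in>V \<rightarrow>\<^sub>E S.
 local_weight t (V - ?Q - ends X) sc X \<phi> * local_weight t (?Q - ends ({})) sc ({}) \<phi>)"
 by (rule state_sum_split) (use assms q in auto)
 have "state_sum t V sc (X \<union> Y) = (if b then - (A ^ 3) else - (inverse A ^ 3)) * state_sum t V sc (X \<union> {})"
 proof (unfold s1 s2, rule sum_PiE_local1[OF assms(1) q])
 fix \<phi> assume \<phi>: "\<phi> \<in> V \<rightarrow>\<^sub>E S"
 have \<phi>S: "\<phi> v \<in> S" if "v \<in> V" for v using \<phi> that by auto
 let ?R = "local_weight t (V - ?Q - ends X) sc X"
 have R: "?R (\<phi>(?q := x)) = ?R \<phi>" for x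
 by (rule local_weight_cong) (use assms(8) A in auto)
 have r: "sc ?q \<in> V" using assms(3) q by auto
 have L: "(\<Sum>x\<in>S. local_weight t {} sc Y (\<phi>(?q := x))) =
 (if b then - (A ^ 3) else - (inverse A ^ 3)) * of_bool (\<phi> p = \<phi> (sc ?q))"
 using Y R1_local[OF \<phi>S[OF assms(5)] \<phi>S[OF r], of t b] assms(6,7)
 by (auto simp: local_weight_def)
 have L0: "(\<Sum>x\<in>S. local_weight t ?Q sc {} (\<phi>(?q := x))) = of_bool (\<phi> p = \<phi> (sc ?q))"
 using assms(6,7) \<phi>S[OF assms(5)]
 by (subst sum_at[of "\<phi> p"]) (auto simp: local_weight_def)
 show "(\<Sum>x\<in>S. ?R (\<phi>(?q := x)) * local_weight t (?Q - ends Y) sc Y (\<phi>(?q := x))) =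
 (if b then - (A ^ 3) else - (inverse A ^ 3)) *
 (\<Sum>x\<in>S. ?R (\<phi>(?q := x)) * local_weight t (?Q - ends {}) sc {} (\<phi>(?q := x)))"
 unfolding R E by (simp only: sum_distrib_left[symmetric] Diff_cancel L ends_empty Diff_empty L0) (simp add: mult_ac)
 qed
 then show ?thesis by simp
qed

text \<open>The inner labels sit at \<open>sc p\<close> and \<open>sc q\<close>. Without the
  crossings \<open>Y\<close> the four nodes only transmit labels, which produces the same Kronecker
  deltas as \<open>R2_local\<close>.\<close>

lemma state_sum_R2:
 assumes "finite V" "finite X" "sc ` V \<subseteq> V" "inj_on sc V" "p \<in> V" "q \<in> V"
 and dist: "distinct [p, sc p, q, sc q]" and nl: "sc (sc p) ~= sc p" "sc (sc q) ~= sc q"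
 and X: "ends X \<subseteq> V - {p, sc p, q, sc q}"
 and Y: "Y = {(p, if k then q else sc q, b), (sc p, if k then sc q else q, ~ b)}"
 shows "state_sum t V sc (X \<union> Y) = state_sum t V sc X"
proof -
 let ?Q = "{p, sc p, q, sc q}"
 have q: "sc p \<in> V" "sc q \<in> V" using assms by auto
 have E: "ends Y = ?Q" and fY: "finite Y" and d: "X \<inter> Y = {}"
 using Y X dist by (auto simp: ends_def)
 have A: "sc v ~= sc p & sc v ~= sc q" if "v \<in> V" "v ~= p" "v ~= q" for v
 using that assms(4-6) by (auto dest: inj_onD)
 have n: "sc (sc p) ~= sc q" "sc (sc q) ~= sc p" using A[OF q(1)] A[OF q(2)] dist by auto
 have s1: "state_sum t V sc (X \<union> Y) = (\<Sum>\<phi>\<in>V \<rightarrow>\<^sub>E S.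
 local_weight t (V - ?Q - ends X) sc X \<phi> * local_weight t (?Q - ends (Y)) sc (Y) \<phi>)"
 by (rule state_sum_split) (use assms E fY d q in auto)
 have s2: "state_sum t V sc (X \<union> {}) = (\<Sum>\<phi>\<in>V \<rightarrow>\<^sub>E S.
 local_weight t (V - ?Q - ends X) sc X \<phi> * local_weight t (?Q - ends ({})) sc ({}) \<phi>)"
 by (rule state_sum_split) (use assms q in auto)
 have "state_sum t V sc (X \<union> Y) = 1 * state_sum t V sc (X \<union> {})"
 proof (unfold s1 s2, rule sum_PiE_local2[OF assms(1) q])
 fix \<phi> assume \<phi>: "\<phi> \<in> V \<rightarrow>\<^sub>E S"
 have \<phi>S: "\<phi> v \<in> S" if "v \<in> V" for v using \<phi> that by auto
 have mem: "\<phi> p \<in> S" "\<phi> (sc (sc p)) \<in> S" "\<phi> q \<in> S" "\<phi> (sc (sc q)) \<in> S"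
 using \<phi>S assms(3,5,6) by (simp_all add: image_subset_iff)
 let ?R = "local_weight t (V - ?Q - ends X) sc X"
 have R: "?R (\<phi>(sc p := x, sc q := y)) = ?R \<phi>" for x y
 by (rule local_weight_cong) (use X A in auto)
 have "(\<Sum>x\<in>S. \<Sum>y\<in>S. local_weight t {} sc Y (\<phi>(sc p := x, sc q := y))) =
 (\<Sum>x\<in>S. \<Sum>y\<in>S. W t b (\<phi> p) x (if k then \<phi> q else y) (if k then y else \<phi> (sc (sc q))) *
 W t (~ b) x (\<phi> (sc (sc p))) (if k then y else \<phi> q) (if k then \<phi> (sc (sc q)) else y))"
 using dist nl n by (intro sum.cong refl) (auto simp: Y local_weight_def)
 then have L: "(\<Sum>x\<in>S. \<Sum>y\<in>S. local_weight t {} sc Y (\<phi>(sc p := x, sc q := y))) =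
 of_bool (\<phi> p = \<phi> (sc (sc p)) & \<phi> q = \<phi> (sc (sc q)))"
 using R2_local[OF mem] by simp
 have L0: "(\<Sum>x\<in>S. \<Sum>y\<in>S. local_weight t ?Q sc {} (\<phi>(sc p := x, sc q := y))) =
 of_bool (\<phi> p = \<phi> (sc (sc p)) & \<phi> q = \<phi> (sc (sc q)))"
 using dist nl n mem
 by (subst sum_at[of "\<phi> p"], simp, force simp: local_weight_def, subst sum_at[of "\<phi> q"])
 (auto simp: local_weight_def)
 show "(\<Sum>x\<in>S. \<Sum>y\<in>S. ?R (\<phi>(sc p := x, sc q := y)) * local_weight t (?Q - ends Y) sc Y (\<phi>(sc p := x, sc q := y))) =
 1 * (\<Sum>x\<in>S. \<Sum>y\<in>S. ?R (\<phi>(sc p := x, sc q := y)) * local_weight t (?Q - ends {}) sc {} (\<phi>(sc p := x, sc q := y)))"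
 unfolding R E by (simp only: sum_distrib_left[symmetric] Diff_cancel L ends_empty Diff_empty L0) simp
 qed
 then show ?thesis by simp
qed

definition R3_crossings where
 "R3_crossings \<kappa> a b pf pg pfg e e' f f' g g' =
 {(if \<kappa> then e else e', if a then f else f', pf), (if \<kappa> then e' else e, if b then g else g', pg),
 (if a then f' else f, if b then g' else g, pfg)}"

text \<open>The same six nodes serve before and after the move; only their pairing into crossings
  changes.\<close>

lemma state_sum_R3:
 assumes "finite V" "finite X" "sc ` V \<subseteq> V" "inj_on sc V" "e \<in> V" "f \<in> V" "g \<in> V"
 and dist: "distinct [e, sc e, f, sc f, g, sc g]"
 and nl: "sc (sc e) ~= sc e" "sc (sc f) ~= sc f" "sc (sc g) ~= sc g"
 and X: "ends X \<subseteq> V - {e, sc e, f, sc f, g, sc g}"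
 and pos: "(a = pf) = (b = pg)" "(b = pfg) = (\<kappa> = pf)"
 defines "Y \<equiv> \<lambda>\<kappa> a b. R3_crossings \<kappa> a b pf pg pfg e (sc e) f (sc f) g (sc g)"
 shows "state_sum t V sc (X \<union> Y \<kappa> a b) = state_sum t V sc (X \<union> Y (~ \<kappa>) (~ a) (~ b))"
proof -
 let ?Q = "{e, sc e, f, sc f, g, sc g}"
 have q: "sc e \<in> V" "sc f \<in> V" "sc g \<in> V" using assms by auto
 have E: "ends (Y \<kappa> a b) = ?Q" for \<kappa> a b
 unfolding Y_def R3_crossings_def using X dist by (cases \<kappa>; cases a; cases b; auto simp: ends_def)
 have fY: "finite (Y \<kappa> a b)" for \<kappa> a b
 by (simp add: Y_def R3_crossings_def)
 have d: "X \<inter> Y \<kappa> a b = {}" for \<kappa> a b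
 using X E[of \<kappa> a b] by (auto 0 3 dest: in_endsI)
 have A: "sc v ~= sc e & sc v ~= sc f & sc v ~= sc g" if "v \<in> V" "v ~= e" "v ~= f" "v ~= g" for v
 using that assms(4-7) by (auto dest: inj_onD)
 have n: "sc (sc e) ~= sc f" "sc (sc e) ~= sc g" "sc (sc f) ~= sc e" "sc (sc f) ~= sc g"
 "sc (sc g) ~= sc e" "sc (sc g) ~= sc f"
 using A[OF q(1)] A[OF q(2)] A[OF q(3)] dist by auto
 have ds: "f ~= sc e" "g ~= sc e" "g ~= sc f" "e ~= sc f" "e ~= sc g" "f ~= sc g" "e ~= sc e" "f ~= sc f" "g ~= sc g"
 "sc f ~= sc e" "sc g ~= sc e" "sc g ~= sc f" "sc e ~= sc f" "sc e ~= sc g" "sc f ~= sc g"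
 "f ~= e" "g ~= e" "g ~= f" "e ~= f" "e ~= g" "f ~= g"
 using dist by auto
 have s1: "state_sum t V sc (X \<union> Y \<kappa> a b) = (\<Sum>\<phi>\<in>V \<rightarrow>\<^sub>E S.
 local_weight t (V - ?Q - ends X) sc X \<phi> * local_weight t (?Q - ends (Y \<kappa> a b)) sc (Y \<kappa> a b) \<phi>)" for \<kappa> a b
 by (rule state_sum_split) (use assms(1-7) X E fY d q in auto)
 note s2 = s1[of "~ \<kappa>" "~ a" "~ b"]
 have "state_sum t V sc (X \<union> Y \<kappa> a b) = 1 * state_sum t V sc (X \<union> Y (~ \<kappa>) (~ a) (~ b))"
 proof (subst s1, subst s2, rule sum_PiE_local3[OF assms(1) q])
 fix \<phi> assume \<phi>: "\<phi> \<in> V \<rightarrow>\<^sub>E S"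
 have \<phi>S: "\<phi> v \<in> S" if "v \<in> V" for v using \<phi> that by auto
 have mem: "\<phi> e \<in> S" "\<phi> (sc (sc e)) \<in> S" "\<phi> f \<in> S" "\<phi> (sc (sc f)) \<in> S" "\<phi> g \<in> S" "\<phi> (sc (sc g)) \<in> S"
 using \<phi>S assms(3,5-7) by (simp_all add: image_subset_iff)
 let ?R = "local_weight t (V - ?Q - ends X) sc X"
 let ?u = "%x y z. \<phi>(sc e := x, sc f := y, sc g := z)"
 have R: "?R (?u x y z) = ?R \<phi>" for x y z
 by (rule local_weight_cong) (use X A in auto)
 have L: "local_weight t {} sc (Y \<kappa> a b) (?u x y z) =
 R3_weight t \<kappa> a b pf pg pfg (\<phi> e) x (\<phi> (sc (sc e))) (\<phi> f) y (\<phi> (sc (sc f))) (\<phi> g) z (\<phi> (sc (sc g)))"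
 for \<kappa> a b x y z
 unfolding Y_def R3_crossings_def local_weight_def R3_weight_def
 by (cases \<kappa>; cases a; cases b; simp add: ds ds[THEN not_sym] nl n mult_ac)
 show "(\<Sum>x\<in>S. \<Sum>y\<in>S. \<Sum>z\<in>S. ?R (?u x y z) * local_weight t (?Q - ends (Y \<kappa> a b)) sc (Y \<kappa> a b) (?u x y z)) =
 1 * (\<Sum>x\<in>S. \<Sum>y\<in>S. \<Sum>z\<in>S. ?R (?u x y z) * local_weight t (?Q - ends (Y (~ \<kappa>) (~ a) (~ b))) sc (Y (~ \<kappa>) (~ a) (~ b)) (?u x y z))"
 unfolding R E by (simp only: sum_distrib_left[symmetric] Diff_cancel L) (simp add: R3_local[OF mem pos])
 qed
 then show ?thesis by simp
qed

end

context bracket_model begin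

text \<open>A transmitting node inserted behind \<open>u\<close> is forced to carry the label of the
  node that follows it, so the sum over its label has a single nonzero term.\<close>

lemma state_sum_insert:
 assumes "finite V" "sc ` V \<subseteq> V" "u \<in> V" "v \<notin> V" "ends X \<subseteq> V"
 shows "state_sum t (insert v V) (sc(u := v, v := sc u)) X = state_sum t V sc X"
proof -
 let ?sc = "sc(u := v, v := sc u)"
 have inj: "inj_on (%(y, g). g(v := y)) (S \<times> (V \<rightarrow>\<^sub>E S))"
 using assms(4) by (rule inj_combinator[of v V "%_. S"])
 have T: "insert v V - ends X = insert v (V - ends X)" using assms by auto
 have fT: "finite (V - ends X)" "v \<notin> V - ends X" using assms by auto
 have ne: "sc w ~= v" if "w \<in> V" for w using that assms by auto
 let ?F = "\<lambda>T \<phi> sc. (\<Prod>v\<in>T. of_bool (\<phi> v = \<phi> (sc v)) :: complex) *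
 (\<Prod>(x, y, p)\<in>X. W t p (\<phi> x) (\<phi> (sc x)) (\<phi> y) (\<phi> (sc y)))"
 have *: "(\<Sum>\<phi>\<in>insert v V \<rightarrow>\<^sub>E S. G \<phi>) = (\<Sum>y\<in>S. \<Sum>g\<in>V \<rightarrow>\<^sub>E S. G (g(v := y)))" for G :: "_ => complex"
 unfolding PiE_insert_eq
 by (subst sum.reindex[OF inj]) (simp add: sum.cartesian_product case_prod_unfold)
 have "state_sum t (insert v V) ?sc X = (\<Sum>y\<in>S. \<Sum>g\<in>V \<rightarrow>\<^sub>E S.
 of_bool (y = g (sc u)) * ?F (V - ends X) (g(v := y)) ?sc)"
 unfolding state_sum_def gsum_def T * prod.insert[OF fT] mult_1_right mult.assoc
 by (intro sum.cong arg_cong2[where f="(*)"] refl) (use ne[OF assms(3)] in simp)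
 also have "\<dots> = (\<Sum>g\<in>V \<rightarrow>\<^sub>E S. \<Sum>y\<in>S. of_bool (y = g (sc u)) * ?F (V - ends X) (g(v := y)) ?sc)"
 by (rule sum.swap)
 also have "\<dots> = (\<Sum>g\<in>V \<rightarrow>\<^sub>E S. ?F (V - ends X) g sc)"
 proof (rule sum.cong[OF refl])
 fix g assume g: "g \<in> V \<rightarrow>\<^sub>E S"
 have m: "g (sc u) \<in> S" using g assms by auto
 have "(\<Sum>y\<in>S. of_bool (y = g (sc u)) * ?F (V - ends X) (g(v := y)) ?sc) = ?F (V - ends X) (g(v := g (sc u))) ?sc"
 by (subst sum_at[OF m]) auto
 also have "\<dots> = ?F (V - ends X) g sc"
 proof (intro arg_cong2[where f="(*)"] prod.cong refl)
 fix w assume "w \<in> V - ends X"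
 then show "(of_bool ((g(v := g (sc u))) w = (g(v := g (sc u))) (?sc w)) :: complex) = of_bool (g w = g (sc w))"
 using assms ne by auto
 next
 fix c assume c: "c \<in> X"
 obtain x y p where xyp: "c = (x, y, p)" by (cases c)
 have xy: "x \<in> V" "y \<in> V" using in_endsI[OF c[unfolded xyp]] assms(5) by blast+
 have *: "(g(v := g (sc u))) w = g w & (g(v := g (sc u))) (?sc w) = g (sc w)" if "w \<in> V" for w
 using that assms ne by auto
 show "(case c of (x, y, p) => W t p ((g(v := g (sc u))) x) ((g(v := g (sc u))) (?sc x)) ((g(v := g (sc u))) y) ((g(v := g (sc u))) (?sc y))) =
 (case c of (x, y, p) => W t p (g x) (g (sc x)) (g y) (g (sc y)))"
 unfolding xyp using *[OF xy(1)] *[OF xy(2)] by simp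
 qed
 finally show "(\<Sum>y\<in>S. of_bool (y = g (sc u)) * ?F (V - ends X) (g(v := y)) ?sc) = ?F (V - ends X) g sc" .
 qed
 finally show ?thesis by (simp add: state_sum_def gsum_def)
qed

lemma sum_PiE_reindex:
 assumes "bij_betw h V V'"
 shows "(\<Sum>\<phi>\<in>V' \<rightarrow>\<^sub>E S. G (\<lambda>v\<in>V. \<phi> (h v))) = (\<Sum>\<phi>\<in>V \<rightarrow>\<^sub>E S. G \<phi> :: complex)"
proof (rule sum.reindex_bij_betw)
 have inj: "inj_on h V" and V': "V' = h ` V" using assms by (auto simp: bij_betw_def)
 let ?k = "inv_into V h"
 have k: "?k (h v) = v" if "v \<in> V" for v using inj that by simp
 show "bij_betw (\<lambda>\<phi>. \<lambda>v\<in>V. \<phi> (h v)) (V' \<rightarrow>\<^sub>E S) (V \<rightarrow>\<^sub>E S)"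
 proof (rule bij_betw_byWitness[where f'="\<lambda>\<phi>. \<lambda>v\<in>V'. \<phi> (?k v)"]; (intro ballI)?)
 fix \<phi> assume "\<phi> \<in> V' \<rightarrow>\<^sub>E S"
 then show "(\<lambda>v\<in>V'. (\<lambda>v\<in>V. \<phi> (h v)) (?k v)) = \<phi>"
 unfolding V' by (intro ext) (auto simp: restrict_def PiE_def extensional_def k)
 next
 fix \<phi> assume "\<phi> \<in> V \<rightarrow>\<^sub>E S"
 then show "(\<lambda>v\<in>V. (\<lambda>v\<in>V'. \<phi> (?k v)) (h v)) = \<phi>"
 unfolding V' by (intro ext) (auto simp: restrict_def PiE_def extensional_def k)
 qed (auto simp: V' k)
qed

lemma state_sum_iso:
 assumes h: "bij_betw h V V'" and sc: "sc ` V \<subseteq> V" "\<And>v. v \<in> V ==> sc' (h v) = h (sc v)"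
 and X: "ends X \<subseteq> V" "X' = (%(x, y, p). (h x, h y, p)) ` X"
 shows "state_sum t V sc X = state_sum t V' sc' X'"
proof -
 have inj: "inj_on h V" and V': "V' = h ` V" using h by (auto simp: bij_betw_def)
 have injX: "inj_on (%(x, y, p). (h x, h y, p)) X"
 proof (rule inj_onI)
 fix c d assume cd: "c \<in> X" "d \<in> X" and e: "(%(x, y, p). (h x, h y, p)) c = (%(x, y, p). (h x, h y, p)) d"
 obtain x y p x' y' p' where xyp: "c = (x, y, p)" "d = (x', y', p')" by (cases c; cases d)
 have "x \<in> V" "y \<in> V" "x' \<in> V" "y' \<in> V"
 using in_endsI[OF cd(1)[unfolded xyp]] in_endsI[OF cd(2)[unfolded xyp]] X(1) by blast+
 then show "c = d" using e inj by (auto simp: xyp dest: inj_onD)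
 qed
 have E: "ends X' = h ` ends X" unfolding X(2) by (force simp: ends_def)
 have T: "V' - ends X' = h ` (V - ends X)"
 unfolding V' E using inj X(1) by (simp add: inj_on_image_set_diff)
 have "state_sum t V' sc' X' = (\<Sum>\<phi>\<in>V' \<rightarrow>\<^sub>E S. (\<Prod>v\<in>V - ends X. of_bool (\<phi> (h v) = \<phi> (sc' (h v)))) *
 (\<Prod>(x, y, p)\<in>X. W t p (\<phi> (h x)) (\<phi> (sc' (h x))) (\<phi> (h y)) (\<phi> (sc' (h y)))))"
 unfolding state_sum_def gsum_def T unfolding X(2)
 by (subst prod.reindex[OF inj_on_subset[OF inj]], blast, subst prod.reindex[OF injX])
 (simp add: case_prod_unfold)
 also have "\<dots> = (\<Sum>\<phi>\<in>V' \<rightarrow>\<^sub>E S. local_weight t (V - ends X) sc X (\<lambda>v\<in>V. \<phi> (h v)))"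
 proof (rule sum.cong[OF refl], unfold local_weight_def, intro arg_cong2[where f="(*)"] prod.cong refl)
 fix \<phi> v assume "v \<in> V - ends X"
 then have "v \<in> V" "sc v \<in> V" using sc(1) by auto
 then show "(of_bool (\<phi> (h v) = \<phi> (sc' (h v))) :: complex) = of_bool ((\<lambda>v\<in>V. \<phi> (h v)) v = (\<lambda>v\<in>V. \<phi> (h v)) (sc v))"
 by (simp add: sc(2))
 next
 fix \<phi> c assume c: "c \<in> X"
 obtain x y p where xyp: "c = (x, y, p)" by (cases c)
 have xy: "x \<in> V" "y \<in> V" using in_endsI[OF c[unfolded xyp]] X(1) by blast+
 then have "sc x \<in> V" "sc y \<in> V" using sc(1) by auto
 then show "(case c of (x, y, p) => W t p (\<phi> (h x)) (\<phi> (sc' (h x))) (\<phi> (h y)) (\<phi> (sc' (h y)))) =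
 (case c of (x, y, p) => W t p ((\<lambda>v\<in>V. \<phi> (h v)) x) ((\<lambda>v\<in>V. \<phi> (h v)) (sc x)) ((\<lambda>v\<in>V. \<phi> (h v)) y) ((\<lambda>v\<in>V. \<phi> (h v)) (sc y)))"
 using xy by (simp add: xyp sc(2))
 qed
 also have "\<dots> = state_sum t V sc X"
 unfolding sum_PiE_reindex[OF h] by (simp add: state_sum_def gsum_def local_weight_def)
 finally show ?thesis ..
qed

text \<open>Labels are shifted by a local Alexander numbering; on a classical diagram this removes the
 parameter \<open>t\<close> altogether.\<close>

lemma gsum_gauge:
 fixes lam :: "'v => int"
 assumes "finite V" "sc ` V \<subseteq> V" "T \<subseteq> V" "ends X \<subseteq> V"
 and T: "\<And>v. v \<in> T ==> lam (sc v) = lam v"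
 and X: "\<And>x y p. (x, y, p) \<in> X ==>
 lam (sc y) = lam x & lam (sc x) = lam y & lam y = lam x - (if p then 1 else - 1)"
 shows "gsum t V T sc X q = gsum 0 V T sc X (\<lambda>\<phi>. q (\<lambda>v\<in>V. rot (t * lam v) (\<phi> v)))"
 unfolding gsum_def
proof (rule sum.reindex_bij_witness[where i="\<lambda>\<phi>. \<lambda>v\<in>V. rot (t * lam v) (\<phi> v)" and j="\<lambda>\<phi>. \<lambda>v\<in>V. rot (- (t * lam v)) (\<phi> v)"])
 fix \<phi> assume \<phi>: "\<phi> \<in> V \<rightarrow>\<^sub>E S"
 then have \<phi>S: "\<phi> v \<in> S" if "v \<in> V" for v using that by auto
 let ?d = "\<lambda>v\<in>V. rot (- (t * lam v)) (\<phi> v)"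
 show e: "(\<lambda>v\<in>V. rot (t * lam v) (?d v)) = \<phi>"
 using \<phi> by (intro ext) (auto simp: restrict_def PiE_def extensional_def Pi_def)
 show "?d \<in> V \<rightarrow>\<^sub>E S" by simp
 have d: "\<phi> v = rot (t * lam v) (?d v)" "?d v \<in> S" if "v \<in> V" for v using that \<phi>S by auto
 have "(\<Prod>v\<in>T. of_bool (?d v = ?d (sc v))) = (\<Prod>v\<in>T. of_bool (\<phi> v = \<phi> (sc v)) :: complex)"
 proof (rule prod.cong[OF refl])
 fix v assume v: "v \<in> T"
 then have m: "v \<in> V" "sc v \<in> V" using assms by auto
 show "of_bool (?d v = ?d (sc v)) = (of_bool (\<phi> v = \<phi> (sc v)) :: complex)"
 using m \<phi>S T[OF v] by (simp add: rot_eq_iff)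
 qed
 moreover have "(\<Prod>(x, y, p)\<in>X. W 0 p (?d x) (?d (sc x)) (?d y) (?d (sc y))) =
 (\<Prod>(x, y, p)\<in>X. W t p (\<phi> x) (\<phi> (sc x)) (\<phi> y) (\<phi> (sc y)))"
 proof (rule prod.cong[OF refl])
 fix c assume c: "c \<in> X"
 obtain x y p where xyp: "c = (x, y, p)" by (cases c)
 have xy: "x \<in> V" "y \<in> V" using in_endsI[OF c[unfolded xyp]] assms(4) by blast+
 then have m: "sc x \<in> V" "sc y \<in> V" using assms by auto
 have l: "lam (sc y) = lam x" "lam (sc x) = lam x - (if p then 1 else - 1)" "lam y = lam x - (if p then 1 else - 1)"
 using X[OF c[unfolded xyp]] by auto
 have "W t p (\<phi> x) (\<phi> (sc x)) (\<phi> y) (\<phi> (sc y)) = W t p (rot (t * lam x) (?d x)) (rot (t * lam (sc x)) (?d (sc x)))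
 (rot (t * lam y) (?d y)) (rot (t * lam (sc y)) (?d (sc y)))"
 using d(1)[OF xy(1)] d(1)[OF xy(2)] d(1)[OF m(1)] d(1)[OF m(2)] by simp
 also have "\<dots> = W 0 p (?d x) (?d (sc x)) (?d y) (?d (sc y))"
 by (rule W_rot'[OF d(2)[OF xy(1)] d(2)[OF m(1)] d(2)[OF xy(2)] d(2)[OF m(2)]])
 (simp_all add: l right_diff_distrib)
 finally show "(case c of (x, y, p) => W 0 p (?d x) (?d (sc x)) (?d y) (?d (sc y))) =
 (case c of (x, y, p) => W t p (\<phi> x) (\<phi> (sc x)) (\<phi> y) (\<phi> (sc y)))" by (simp add: xyp)
 qed
 ultimately show "(\<Prod>v\<in>T. of_bool (?d v = ?d (sc v))) * (\<Prod>(x, y, p)\<in>X. W 0 p (?d x) (?d (sc x)) (?d y) (?d (sc y))) *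
 q (\<lambda>v\<in>V. rot (t * lam v) (?d v)) =
 (\<Prod>v\<in>T. of_bool (\<phi> v = \<phi> (sc v))) * (\<Prod>(x, y, p)\<in>X. W t p (\<phi> x) (\<phi> (sc x)) (\<phi> y) (\<phi> (sc y))) * q \<phi>"
 unfolding e by simp
next
 fix \<phi> assume \<phi>: "\<phi> \<in> V \<rightarrow>\<^sub>E S"
 show "(\<lambda>v\<in>V. rot (- (t * lam v)) ((\<lambda>v\<in>V. rot (t * lam v) (\<phi> v)) v)) = \<phi>"
 using \<phi> by (intro ext) (auto simp: restrict_def PiE_def extensional_def Pi_def)
qed auto

lemma state_sum_gauge:
 fixes lam :: "'v => int"
 assumes "finite V" "sc ` V \<subseteq> V" "ends X \<subseteq> V"
 and T: "\<And>v. v \<in> V - ends X ==> lam (sc v) = lam v"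
 and X: "\<And>x y p. (x, y, p) \<in> X ==>
 lam (sc y) = lam x & lam (sc x) = lam y & lam y = lam x - (if p then 1 else - 1)"
 shows "state_sum t V sc X = state_sum 0 V sc X"
 unfolding state_sum_def by (subst gsum_gauge[where lam=lam]) (use assms in auto)

end

section \<open>Nodes as positions on the edges of polygons; the sum depends only on their
  order\<close>

definition positions :: "nat set => (nat => nat) => (nat \<times> real) set => bool" where
 "positions E nx M \<longleftrightarrow> finite M & bij_betw nx E E & (\<forall>e\<in>E. (e, 0) \<in> M) &
 (\<forall>(e, s)\<in>M. e \<in> E & 0 <= s & s < 1)"

text \<open>When no further position lies on the edge, the next node is the start of the following
  edge. For this reason \<open>positions\<close> contains \<open>(e, 0)\<close> for every
  edge.\<close>

definition nsucc :: "(nat => nat) => (nat \<times> real) set => nat \<times> real => nat \<times> real" where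
 "nsucc nx M v = (let R = {s. (fst v, s) \<in> M & snd v < s} in
 if R = {} then (nx (fst v), 0) else (fst v, Min R))"

text \<open>A relational form of \<open>nsucc\<close> without the minimum: a map between two sets of
  positions commutes with the successor as soon as it preserves this relation
  (\<open>psum_iso\<close>).\<close>

definition consecutive :: "(nat => nat) => (nat \<times> real) set => nat \<times> real => nat \<times> real => bool" where
 "consecutive nx M v w \<longleftrightarrow>
 (fst w = fst v & w \<in> M & snd v < snd w & (\<forall>s. (fst v, s) \<in> M --> s <= snd v \<or> snd w <= s)) \<or>
 (w = (nx (fst v), 0) & (\<forall>s. (fst v, s) \<in> M --> s <= snd v))"

lemma finite_fibre: "finite M ==> finite {s. (e, s) \<in> M & P s}"
 by (rule finite_subset[of _ "snd ` M"]) force+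

lemma consecutive_nsucc:
 assumes "finite M"
 shows "consecutive nx M v (nsucc nx M v)"
proof -
 let ?R = "{s. (fst v, s) \<in> M & snd v < s}"
 have f: "finite ?R" using assms by (rule finite_fibre)
 show ?thesis
 proof (cases "?R = {}")
 case True
 then show ?thesis by (force simp: consecutive_def nsucc_def)
 next
 case False
 have "(fst v, Min ?R) \<in> M & snd v < Min ?R" using Min_in[OF f False] by blast
 moreover have "s <= snd v \<or> Min ?R <= s" if "(fst v, s) \<in> M" for s
 using Min_le[OF f, of s] that by (cases "s <= snd v") auto
 moreover have "nsucc nx M v = (fst v, Min ?R)" unfolding nsucc_def Let_def by (rule if_not_P[OF False])
 ultimately show ?thesis by (simp add: consecutive_def)
 qed
qed

lemma nsucc_eqI:
 assumes "finite M" "consecutive nx M v w"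
 shows "nsucc nx M v = w"
proof -
 let ?R = "{s. (fst v, s) \<in> M & snd v < s}"
 have f: "finite ?R" using assms by (auto intro: finite_fibre)
 from assms(2) show ?thesis unfolding consecutive_def
 proof (elim disjE conjE)
 assume a: "fst w = fst v" "w \<in> M" "snd v < snd w" "\<forall>s. (fst v, s) \<in> M --> s <= snd v \<or> snd w <= s"
 have "snd w \<in> ?R" using a by (metis (mono_tags, lifting) mem_Collect_eq prod.collapse)
 moreover have "Min ?R = snd w" using f calculation a by (intro Min_eqI) auto
 ultimately show ?thesis using a by (auto simp: nsucc_def Let_def prod_eq_iff)
 qed (auto simp: nsucc_def Let_def not_less[symmetric])
qed

context
 fixes E nx M assumes pos: "positions E nx M"
begin

lemma positions_finite: "finite M" using pos by (simp add: positions_def)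

lemma positionsD: "(e, s) \<in> M ==> e \<in> E & 0 <= s & s < 1" "e \<in> E ==> (e, 0) \<in> M"
 "e \<in> E ==> nx e \<in> E"
 using pos by (auto simp: positions_def bij_betw_def)

lemma nsucc_in: "v \<in> M ==> nsucc nx M v \<in> M"
 using consecutive_nsucc[OF positions_finite, of nx v] positionsD(1)[of "fst v" "snd v"] positionsD(2,3)
 by (auto simp: consecutive_def)

lemma nsucc_image: "nsucc nx M ` M \<subseteq> M"
 using nsucc_in by auto

lemma inj_nsucc: "inj_on (nsucc nx M) M"
proof (rule inj_onI)
 fix v w assume v: "v \<in> M" and w: "w \<in> M" and e: "nsucc nx M v = nsucc nx M w"
 have E: "fst v \<in> E" "fst w \<in> E" "0 <= snd v" "0 <= snd w"
 using v w positionsD(1)[of "fst v" "snd v"] positionsD(1)[of "fst w" "snd w"] by auto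
 have inj: "nx (fst v) = nx (fst w) ==> fst v = fst w"
 using pos E by (auto simp: positions_def bij_betw_def inj_on_def)
 have mv: "(fst v, snd v) \<in> M" "(fst w, snd w) \<in> M" using v w by auto
 let ?x = "nsucc nx M w"
 have 1: "(fst ?x = fst v & snd v < snd ?x & (\<forall>s. (fst v, s) \<in> M --> s <= snd v \<or> snd ?x <= s)) \<or>
 (fst ?x = nx (fst v) & snd ?x = 0 & (\<forall>s. (fst v, s) \<in> M --> s <= snd v))"
 using consecutive_nsucc[OF positions_finite, of nx v] unfolding e consecutive_def by auto
 have 2: "(fst ?x = fst w & snd w < snd ?x & (\<forall>s. (fst w, s) \<in> M --> s <= snd w \<or> snd ?x <= s)) \<or>
 (fst ?x = nx (fst w) & snd ?x = 0 & (\<forall>s. (fst w, s) \<in> M --> s <= snd w))"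
 using consecutive_nsucc[OF positions_finite, of nx w] unfolding consecutive_def by auto
 have *: "fst v = fst w" using 1 2 E inj by auto
 then have "(fst v, snd w) \<in> M" "(fst w, snd v) \<in> M" using mv by auto
 then have "snd w <= snd v" "snd v <= snd w" using 1 2 E * by (smt (verit))+
 then show "v = w" using * by (simp add: prod_eq_iff)
qed

lemma nsucc_same_edge:
 assumes "(e, s) \<in> M" "(e, s') \<in> M" "s < s'" "\<And>r. (e, r) \<in> M ==> r <= s \<or> s' <= r"
 shows "nsucc nx M (e, s) = (e, s')"
 by (rule nsucc_eqI[OF positions_finite]) (use assms in \<open>auto simp: consecutive_def\<close>)

lemma nsucc_ne:
 assumes "(e, s) \<in> M" "0 < s"
 shows "nsucc nx M (e, s) ~= (e, s)"
 using consecutive_nsucc[OF positions_finite, of nx "(e, s)"] assms by (auto simp: consecutive_def)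

lemma positions_insert: "e \<in> E ==> 0 <= s ==> s < 1 ==> positions E nx (insert (e, s) M)"
 using pos by (auto simp: positions_def)

end

lemma (in bracket_model) state_sum_cong:
 assumes "ends X \<subseteq> V" "\<And>v. v \<in> V ==> sc v = sc' v"
 shows "state_sum t V sc X = state_sum t V sc' X"
 unfolding state_sum_def gsum_def
proof (intro sum.cong arg_cong2[where f="(*)"] prod.cong refl)
 fix \<phi> :: "'a => int" and c assume c: "c \<in> X"
 obtain x y p where xyp: "c = (x, y, p)" by (cases c)
 have "x \<in> V" "y \<in> V" using in_endsI[OF c[unfolded xyp]] assms(1) by blast+
 then show "(case c of (x, y, p) => W t p (\<phi> x) (\<phi> (sc x)) (\<phi> y) (\<phi> (sc y))) =
 (case c of (x, y, p) => W t p (\<phi> x) (\<phi> (sc' x)) (\<phi> y) (\<phi> (sc' y)))"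
 by (simp add: xyp assms(2))
qed (use assms in auto)

context bracket_model
begin

definition psum :: "int => (nat => nat) => (nat \<times> real) set => ((nat \<times> real) \<times> (nat \<times> real) \<times> bool) set => complex" where
 "psum t nx M X = state_sum t M (nsucc nx M) X"

lemma psum_insert:
 assumes pos: "positions E nx M" and x: "(e, s) \<notin> M" "e \<in> E" "0 <= s" "s < 1" and X: "ends X \<subseteq> M"
 shows "psum t nx (insert (e, s) M) X = psum t nx M X"
proof -
 let ?L = "{r. (e, r) \<in> M & r < s}"
 have fM: "finite M" using pos by (simp add: positions_def)
 have f: "finite ?L" using fM by (rule finite_fibre)
 have "0 \<in> ?L" using pos x by (auto simp: positions_def less_le)
 then have ne: "?L ~= {}" by blast
 \<comment> \<open>The last old position before \<open>s\<close> on the edge; the new node is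
   inserted right behind it.\<close>
 define u where "u = Max ?L"
 have u: "(e, u) \<in> M" "u < s" using Max_in[OF f ne] by (auto simp: u_def)
 have u': "r <= u" if "(e, r) \<in> M" "r < s" for r using Max_ge[OF f] that by (auto simp: u_def)
 let ?M = "insert (e, s) M"
 have fM': "finite ?M" using fM by simp
 have *: "nsucc nx ?M v = ((nsucc nx M)((e, u) := (e, s), (e, s) := nsucc nx M (e, u))) v" if v: "v \<in> ?M" for v
 proof (rule nsucc_eqI[OF fM'])
 have c: "consecutive nx M w (nsucc nx M w)" for w by (rule consecutive_nsucc[OF fM])
 have s: "r ~= s" if "(e, r) \<in> M" for r using that x by auto
 consider "v = (e, s)" | "v = (e, u)" | "v ~= (e, s)" "v ~= (e, u)" by blast
 then show "consecutive nx ?M v (((nsucc nx M)((e, u) := (e, s), (e, s) := nsucc nx M (e, u))) v)"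
 proof cases
 case 1
 have "consecutive nx ?M (e, s) (nsucc nx M (e, u))"
 proof (cases "nsucc nx M (e, u) = (nx e, 0) & (\<forall>r. (e, r) \<in> M --> r <= u)")
 case True
 then have "r <= s" if "(e, r) \<in> ?M" for r using that u by force
 then show ?thesis using True by (auto simp: consecutive_def)
 next
 case False
 then obtain b where b: "nsucc nx M (e, u) = (e, b)" "(e, b) \<in> M" "u < b" "\<And>r. (e, r) \<in> M ==> r <= u \<or> b <= r"
 using c[of "(e, u)"] unfolding consecutive_def by (cases "nsucc nx M (e, u)") auto
 have "s < b" using u'[OF b(2)] b(3) s[OF b(2)] by (cases "b < s") auto
 moreover have "r <= s \<or> b <= r" if "(e, r) \<in> ?M" for r using that b(4)[of r] u by auto
 ultimately show ?thesis using b by (auto simp: consecutive_def)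
 qed
 then show ?thesis using 1 by simp
 next
 case 2
 have "r <= u \<or> s <= r" if "(e, r) \<in> ?M" for r using that u'[of r] by auto
 then have "consecutive nx ?M (e, u) (e, s)" using u by (auto simp: consecutive_def)
 then show ?thesis using 2 u by auto
 next
 case 3
 then have vM: "v \<in> M" using v by auto
 have "consecutive nx ?M v (nsucc nx M v)"
 proof (cases "fst v = e")
 case True
 have "snd v ~= u" "snd v ~= s" using 3 True by (auto simp: prod_eq_iff)
 moreover have "(e, snd v) \<in> M" using vM True by auto
 ultimately have r: "s <= snd v \<or> (snd v < u)" using u'[of "snd v"] by force
 show ?thesis
 proof (cases "nsucc nx M v = (nx e, 0) & (\<forall>r. (e, r) \<in> M --> r <= snd v)")
 case T: True
 then have "s <= snd v" using r u(1) by force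
 then have "q <= snd v" if "(e, q) \<in> ?M" for q using that T by auto
 then show ?thesis using T True by (auto simp: consecutive_def)
 next
 case False
 then obtain b where b: "nsucc nx M v = (e, b)" "(e, b) \<in> M" "snd v < b" "\<And>q. (e, q) \<in> M ==> q <= snd v \<or> b <= q"
 using c[of v] True unfolding consecutive_def by (cases "nsucc nx M v") auto
 have "s <= snd v \<or> b <= s" using r b(4)[OF u(1)] u by auto
 then have "q <= snd v \<or> b <= q" if "(e, q) \<in> ?M" for q using that b(4)[of q] by auto
 then show ?thesis using b True by (auto simp: consecutive_def)
 qed
 next
 case False
 then show ?thesis using c[of v] unfolding consecutive_def by auto
 qed
 then show ?thesis using 3 by simp
 qed
 qed
 have "psum t nx ?M X = state_sum t ?M ((nsucc nx M)((e, u) := (e, s), (e, s) := nsucc nx M (e, u))) X"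
 unfolding psum_def by (rule state_sum_cong) (use X * in auto)
 also have "\<dots> = psum t nx M X"
 unfolding psum_def by (rule state_sum_insert) (use fM nsucc_image[OF pos] u x X in auto)
 finally show ?thesis .
qed

lemma psum_mono:
 assumes "positions E nx M" "positions E nx M'" "M \<subseteq> M'" "ends X \<subseteq> M"
 shows "psum t nx M' X = psum t nx M X"
proof -
 have "finite (M' - M)" using assms by (auto simp: positions_def)
 moreover have "positions E nx (M \<union> P) & psum t nx (M \<union> P) X = psum t nx M X" if "finite P" "P \<subseteq> M' - M" for P
 using that
 proof (induction P rule: finite_induct)
 case (insert x P)
 obtain e s where x: "x = (e, s)" by (cases x)
 have es: "e \<in> E" "0 <= s" "s < 1" "(e, s) \<notin> M \<union> P"
 using insert.prems insert.hyps assms(2) by (auto simp: x positions_def)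
 have IH: "positions E nx (M \<union> P)" "psum t nx (M \<union> P) X = psum t nx M X" using insert by auto
 show ?case
 using positions_insert[OF IH(1) es(1-3)] psum_insert[OF IH(1) es(4,1-3), of X t] assms(4) IH(2)
 by (auto simp: x)
 qed (use assms in simp)
 ultimately have "psum t nx (M \<union> (M' - M)) X = psum t nx M X" by blast
 moreover have "M \<union> (M' - M) = M'" using assms(3) by auto
 ultimately show ?thesis by simp
qed

lemma psum_iso:
 assumes pos: "positions E nx M" and fM': "finite M'" and h: "bij_betw h M M'"
 and c: "\<And>v w. v \<in> M ==> w \<in> M ==> consecutive nx M v w ==> consecutive nx' M' (h v) (h w)"
 and X: "ends X \<subseteq> M" "X' = (%(x, y, p). (h x, h y, p)) ` X"
 shows "psum t nx M X = psum t nx' M' X'"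
 unfolding psum_def
proof (rule state_sum_iso[OF h nsucc_image[OF pos] _ X])
 fix v assume "v \<in> M"
 then show "nsucc nx' M' (h v) = h (nsucc nx M v)"
 by (intro nsucc_eqI[OF fM'] c consecutive_nsucc[OF positions_finite[OF pos]] nsucc_in[OF pos])
qed

lemma psum_relabel:
 assumes pos: "positions E nx M" and g: "inj_on g E" "\<And>e. e \<in> E ==> nx' (g e) = g (nx e)"
 and X: "ends X \<subseteq> M" "X' = (%(x, y, p). (map_prod g id x, map_prod g id y, p)) ` X"
 shows "psum t nx M X = psum t nx' (map_prod g id ` M) X'"
proof (rule psum_iso[OF pos _ _ _ X])
 have fE: "fst ` M \<subseteq> E" using positionsD(1)[OF pos] by auto
 have inj: "inj_on (map_prod g id) M"
 proof (rule inj_onI)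
 fix v w assume vw: "v \<in> M" "w \<in> M" "map_prod g id v = map_prod g id w"
 then have "fst v \<in> E" "fst w \<in> E" using fE by auto
 then show "v = w" using vw(3) g(1) by (auto simp: prod_eq_iff map_prod_def case_prod_unfold dest: inj_onD)
 qed
 then show "bij_betw (map_prod g id) M (map_prod g id ` M)" by (rule inj_on_imp_bij_betw)
 have *: "(g (fst v), s) \<in> map_prod g id ` M \<longleftrightarrow> (fst v, s) \<in> M" if "v \<in> M" for v s
 proof
 assume "(g (fst v), s) \<in> map_prod g id ` M"
 then obtain e where "(e, s) \<in> M" "g (fst v) = g e" by auto
 then show "(fst v, s) \<in> M" using g(1) fE that by (metis (no_types, lifting) fst_conv image_eqI inj_onD subsetD)
 qed force
 fix v w assume v: "v \<in> M" "w \<in> M" "consecutive nx M v w"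
 have "fst v \<in> E" using v fE by auto
 then show "consecutive nx' (map_prod g id ` M) (map_prod g id v) (map_prod g id w)"
 using v(3) * [OF v(1)] v(1,2) unfolding consecutive_def by (auto simp: g(2) map_prod_def case_prod_unfold)
qed (use positions_finite[OF pos] in simp)

text \<open>Only the order of the positions along each edge enters, so they may be moved
  monotonically as long as the vertices stay at 0.\<close>

lemma psum_rescale:
 assumes pos: "positions E nx M"
 and f: "\<And>e s s'. (e, s) \<in> M ==> (e, s') \<in> M ==> s < s' ==> f e s < f e s'" "\<And>e. e \<in> E ==> f e 0 = 0"
 and X: "ends X \<subseteq> M" "X' = (%(x, y, p). ((fst x, f (fst x) (snd x)), (fst y, f (fst y) (snd y)), p)) ` X"
 shows "psum t nx M X = psum t nx ((%(e, s). (e, f e s)) ` M) X'"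
proof (rule psum_iso[OF pos, where h="%(e, s). (e, f e s)"])
 let ?h = "%(e, s). (e, f e s)"
 have mono: "f e s <= f e s' \<longleftrightarrow> s <= s'" "f e s < f e s' \<longleftrightarrow> s < s'" if "(e, s) \<in> M" "(e, s') \<in> M" for e s s'
 using f(1)[OF that] f(1)[OF that(2,1)] by (cases s s' rule: linorder_cases; force)+
 have "inj_on ?h M"
 proof (rule inj_onI)
 fix v w assume vw: "v \<in> M" "w \<in> M" "?h v = ?h w"
 obtain a b a' b' where "v = (a, b)" "w = (a', b')" by (cases v; cases w)
 then show "v = w" using vw mono(1)[of a b b'] mono(1)[of a b' b] by auto
 qed
 then show "bij_betw ?h M (?h ` M)" by (rule inj_on_imp_bij_betw)
 fix v w assume v: "v \<in> M" "w \<in> M" "consecutive nx M v w"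
 obtain a r b q where vw: "v = (a, r)" "w = (b, q)" by (cases v; cases w)
 have m: "(a, r) \<in> M" "(b, q) \<in> M" using v vw by auto
 have e: "a \<in> E" using positionsD(1)[OF pos m(1)] by auto
 then have z: "f (nx a) 0 = 0" using f(2) positionsD(3)[OF pos] by auto
 show "consecutive nx (?h ` M) (?h v) (?h w)"
 proof (cases "w = (nx a, 0) & (\<forall>s. (a, s) \<in> M --> s <= r)")
 case True
 then show ?thesis using m z vw mono(1)[of a _ r] by (auto simp: consecutive_def)
 next
 case False
 then have "b = a" "r < q" "\<forall>s. (a, s) \<in> M --> s <= r \<or> q <= s"
 using v(3) vw by (auto simp: consecutive_def)
 then show ?thesis using m vw mono(1)[of a _ r] mono(1)[of a q] mono(2)[of a r q] by (auto simp: consecutive_def)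
 qed
qed (use positions_finite[OF pos] X in \<open>auto simp: case_prod_unfold\<close>)

definition (in -) cut_at :: "nat => nat => real => nat \<times> real => nat \<times> real" where
 "cut_at e n s0 v = (if fst v = e then (if snd v < s0 then (e, snd v / s0) else (n, (snd v - s0) / (1 - s0))) else v)"

text \<open>Cutting \<open>e\<close> at the position \<open>s0\<close> stretches the two pieces to
  unit length, and the cut becomes the starting vertex of \<open>n\<close>; the cyclic order of the
  nodes is unchanged. Moves that replace an edge by a polygonal arc are treated by placing the
  crossings of the arc on the old edge first and cutting it afterwards.\<close>

lemma psum_cut:
 assumes pos: "positions E nx M" and e: "e \<in> E" "n \<notin> E" "0 < s0" "s0 < 1" "(e, s0) \<in> M"
 and X: "ends X \<subseteq> M" "X' = (%(x, y, p). (cut_at e n s0 x, cut_at e n s0 y, p)) ` X"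
 shows "psum t nx M X = psum t (nx(e := n, n := nx e)) (cut_at e n s0 ` M) X'"
proof (rule psum_iso[OF pos _ _ _ X])
 let ?h = "cut_at e n s0"
 have fE: "fst v \<in> E" "0 <= snd v" if "v \<in> M" for v using positionsD(1)[OF pos, of "fst v" "snd v"] that by auto
 have ne: "fst v ~= n" if "v \<in> M" for v using fE(1)[OF that] e by auto
 have "inj_on ?h M"
 proof (rule inj_onI)
 fix v w assume "v \<in> M" "w \<in> M" "?h v = ?h w"
 then show "v = w" using ne[of v] ne[of w] e by (auto simp: cut_at_def prod_eq_iff split: if_splits)
 qed
 then show "bij_betw ?h M (?h ` M)" by (rule inj_on_imp_bij_betw)
 have m1: "(e, s) \<in> ?h ` M \<longleftrightarrow> (e, s * s0) \<in> M & s < 1" for s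
 proof
 assume "(e, s) \<in> ?h ` M"
 then show "(e, s * s0) \<in> M & s < 1" using e ne by (auto simp: cut_at_def field_simps split: if_splits)
 next
 assume "(e, s * s0) \<in> M & s < 1"
 then show "(e, s) \<in> ?h ` M" using e by (intro image_eqI[of _ _ "(e, s * s0)"]) (auto simp: cut_at_def)
 qed
 have m2: "(n, s) \<in> ?h ` M \<longleftrightarrow> (e, s0 + s * (1 - s0)) \<in> M & s >= 0" for s
 proof
 assume "(n, s) \<in> ?h ` M"
 then obtain v where v: "v \<in> M" "?h v = (n, s)" by auto
 then have *: "fst v = e" "~ snd v < s0" "s = (snd v - s0) / (1 - s0)"
 using ne[OF v(1)] e by (auto simp: cut_at_def split: if_splits)
 then have "s0 + s * (1 - s0) = snd v" using e by simp
 then show "(e, s0 + s * (1 - s0)) \<in> M & s >= 0" using v(1) * e by (cases v) auto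
 next
 assume a: "(e, s0 + s * (1 - s0)) \<in> M & s >= 0"
 have "~ s0 + s * (1 - s0) < s0" using mult_nonneg_nonneg[of s "1 - s0"] a e by linarith
 then have "?h (e, s0 + s * (1 - s0)) = (n, s)" unfolding cut_at_def fst_conv snd_conv using e by simp
 then show "(n, s) \<in> ?h ` M" using a by (intro image_eqI[of _ _ "(e, s0 + s * (1 - s0))"]) auto
 qed
 have m3: "(a, s) \<in> ?h ` M \<longleftrightarrow> (a, s) \<in> M" if "a ~= e" "a ~= n" for a s
 using that by (auto simp: cut_at_def image_iff split: if_splits)
 fix v w assume v: "v \<in> M" "w \<in> M" "consecutive nx M v w"
 obtain a r where vv: "v = (a, r)" by (cases v)
 have a: "a \<in> E" "a ~= n" using fE[OF v(1)] ne[OF v(1)] vv by auto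
 have m0: "?h (nx a, 0) = (nx a, 0)" using e by (auto simp: cut_at_def)
 show "consecutive (nx(e := n, n := nx e)) (?h ` M) (?h v) (?h w)"
 proof (cases "a = e")
 case False
 then show ?thesis using v m0 a e m3 unfolding vv consecutive_def by (auto simp: cut_at_def split: if_splits)
 next
 case ae: True
 have nx: "nx e ~= n" using positionsD(3)[OF pos e(1)] e by auto
 show ?thesis
 proof (cases "r < s0")
 case True
 have s0: "~ (\<forall>s. (e, s) \<in> M --> s <= r)" using e(5) True by force
 then obtain b where w: "w = (e, b)" "(e, b) \<in> M" "r < b" "\<And>s. (e, s) \<in> M ==> s <= r \<or> b <= s"
 using v(3) ae unfolding vv consecutive_def by (cases w) auto
 have b: "b <= s0" using w(4)[OF e(5)] True by auto
 show ?thesis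
 proof (cases "b = s0")
 case True
 then have "?h w = (n, 0)" by (simp add: w cut_at_def)
 moreover have "s <= r / s0" if "(e, s) \<in> ?h ` M" for s
 using w(4)[of "s * s0"] that True e unfolding m1 by (auto simp: field_simps)
 ultimately show ?thesis using ae \<open>r < s0\<close> a by (simp add: vv cut_at_def consecutive_def)
 next
 case False
 then have "?h w = (e, b / s0)" using b by (simp add: w cut_at_def)
 moreover have "s <= r / s0 \<or> b / s0 <= s" if "(e, s) \<in> ?h ` M" for s
 using w(4)[of "s * s0"] that e unfolding m1 by (auto simp: field_simps)
 moreover have "(e, b / s0) \<in> ?h ` M" using w(2) b False e unfolding m1 by simp
 ultimately show ?thesis using ae \<open>r < s0\<close> w(3) e by (auto simp: vv cut_at_def consecutive_def divide_strict_right_mono)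
 qed
 next
 case r: False
 show ?thesis
 proof (cases "w = (nx e, 0) & (\<forall>s. (e, s) \<in> M --> s <= r)")
 case True
 have "s <= (r - s0) / (1 - s0)" if "(n, s) \<in> ?h ` M" for s
 using True that e unfolding m2 by (auto simp: field_simps)
 then show ?thesis using True m0 ae r unfolding vv consecutive_def by (simp add: cut_at_def)
 next
 case False
 then obtain b where w: "w = (e, b)" "(e, b) \<in> M" "r < b" "\<And>s. (e, s) \<in> M ==> s <= r \<or> b <= s"
 using v(3) ae unfolding vv consecutive_def by (cases w) auto
 have "?h w = (n, (b - s0) / (1 - s0))" using w r by (simp add: cut_at_def)
 moreover have "s <= (r - s0) / (1 - s0) \<or> (b - s0) / (1 - s0) <= s" if "(n, s) \<in> ?h ` M" for s
 using w(4)[of "s0 + s * (1 - s0)"] that e unfolding m2 by (auto simp: field_simps)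
 moreover have "(n, (b - s0) / (1 - s0)) \<in> ?h ` M" using w(2,3) r e unfolding m2 by simp
 ultimately show ?thesis using ae r w(3) e by (auto simp: vv cut_at_def consecutive_def divide_strict_right_mono)
 qed
 qed
 qed
qed (use positions_finite[OF pos] in simp)

end

section \<open>Plane geometry of generic polygons: parameters, determinants, transversality\<close>

definition pt :: "vdiag => nat => real => complex" where
 "pt D e s = src D e + complex_of_real s * direction D e"

lemma pt_0 [simp]: "pt D e 0 = src D e" and pt_1 [simp]: "pt D e 1 = tgt D e"
 by (simp_all add: pt_def direction_def)

lemma mem_seg: "z \<in> seg D e \<longleftrightarrow> (\<exists>s. 0 <= s & s <= 1 & z = pt D e s)"
 by (auto simp: seg_def in_segment pt_def direction_def algebra_simps scaleR_conv_of_real)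

lemma pt_in_seg: "0 <= s ==> s <= 1 ==> pt D e s \<in> seg D e"
 by (auto simp: mem_seg)

lemma mem_open_seg: "src D e ~= tgt D e ==>
 z \<in> open_segment (src D e) (tgt D e) \<longleftrightarrow> (\<exists>s. 0 < s & s < 1 & z = pt D e s)"
 by (auto simp: in_segment pt_def direction_def algebra_simps scaleR_conv_of_real)

lemma tgt_src: "tgt D e = src D (nxt D e)"
 by (simp add: tgt_def src_def)

lemma det2_simps [simp]: "det2 u u = 0" "det2 0 u = 0" "det2 u 0 = 0"
 by (simp_all add: det2_def)

lemma det2_add: "det2 (u + v) w = det2 u w + det2 v w" "det2 u (v + w) = det2 u v + det2 u w"
 "det2 (u - v) w = det2 u w - det2 v w" "det2 u (v - w) = det2 u v - det2 u w"
 "det2 (- u) w = - det2 u w" "det2 u (- w) = - det2 u w"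
 "det2 (complex_of_real c * u) w = c * det2 u w" "det2 u (complex_of_real c * w) = c * det2 u w"
 by (simp_all add: det2_def algebra_simps)

lemma det2_swap: "det2 v u = - det2 u v"
 by (simp add: det2_def)

lemma det2_eq_0D:
 assumes "det2 u w = 0" "u ~= 0"
 obtains k where "w = complex_of_real k * u"
proof
 have "Re u * Re u + Im u * Im u ~= 0"
 using assms(2) by (simp add: complex_eq_iff sum_squares_eq_zero_iff)
 then show "w = complex_of_real ((Re w * Re u + Im w * Im u) / (Re u * Re u + Im u * Im u)) * u"
 using assms(1) unfolding det2_def complex_eq_iff
 by (simp add: field_simps)
qed

locale generic_diagram =
 fixes D :: vdiag
 assumes gen: "generic D"
begin

lemma finite_edges: "finite (edges D)"
 and bij_nxt: "bij_betw (nxt D) (edges D) (edges D)"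
 using gen by (auto simp: generic_def)

lemma src_ne_tgt: "e \<in> edges D ==> src D e ~= tgt D e"
 and nxt_nxt: "e \<in> edges D ==> nxt D (nxt D e) ~= e"
 using gen[unfolded generic_def, THEN conjunct2, THEN conjunct2, THEN conjunct1] by auto

lemma vertex_on_edge: "e \<in> edges D ==> f \<in> edges D ==> src D e \<in> seg D f ==> f = e \<or> nxt D f = e"
 by (rule gen[unfolded generic_def, THEN conjunct2, THEN conjunct2, THEN conjunct2, THEN conjunct1,
 THEN bspec, THEN bspec, THEN mp])

lemma no_triple:
 assumes "e \<in> edges D" "f \<in> edges D" "g \<in> edges D" "e ~= f" "f ~= g" "e ~= g"
 "z \<in> seg D e" "z \<in> seg D f" "z \<in> seg D g"
 shows False
proof -
 have "seg D e \<inter> seg D f \<inter> seg D g = {}"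
 using gen[unfolded generic_def, THEN conjunct2, THEN conjunct2, THEN conjunct2, THEN conjunct2,
 THEN bspec, THEN bspec, THEN bspec, THEN mp, OF assms(1-3)] assms(4-6) by (simp only: simp_thms)
 then show False using assms(7-9) by blast
qed

lemma nxt_in: "e \<in> edges D ==> nxt D e \<in> edges D"
 using bij_nxt by (auto simp: bij_betw_def)

lemma nxt_inj: "e \<in> edges D ==> f \<in> edges D ==> nxt D e = nxt D f ==> e = f"
 using bij_nxt by (auto simp: bij_betw_def inj_on_def)

lemma direction_nz: "e \<in> edges D ==> direction D e ~= 0"
 using src_ne_tgt by (force simp: direction_def)

lemma nxt_ne: "e \<in> edges D ==> nxt D e ~= e"
 using nxt_nxt by metis

lemma pt_inj: "e \<in> edges D ==> pt D e s = pt D e t \<longleftrightarrow> s = t"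
 using direction_nz by (auto simp: pt_def)

lemma crossesE:
 assumes "crosses D e f"
 obtains s t where "0 < s" "s < 1" "0 < t" "t < 1" "pt D e s = pt D f t"
proof -
 have "e \<in> edges D" "f \<in> edges D" using assms by (auto simp: crosses_def)
 note m = mem_open_seg[OF src_ne_tgt[OF this(1)]] mem_open_seg[OF src_ne_tgt[OF this(2)]]
 obtain z where "z \<in> open_segment (src D e) (tgt D e)" "z \<in> open_segment (src D f) (tgt D f)"
 using assms unfolding crosses_def by blast
 then obtain s t where "0 < s" "s < 1" "z = pt D e s" "0 < t" "t < 1" "z = pt D f t"
 unfolding m by blast
 then show ?thesis using that[of s t] by simp
qed

lemma crossesI:
 assumes "e \<in> edges D" "f \<in> edges D" "e ~= f" "0 < s" "s < 1" "0 < t" "t < 1" "pt D e s = pt D f t"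
 shows "crosses D e f"
proof -
 have "pt D e s \<in> open_segment (src D e) (tgt D e)" "pt D e s \<in> open_segment (src D f) (tgt D f)"
 unfolding mem_open_seg[OF src_ne_tgt[OF assms(1)]] mem_open_seg[OF src_ne_tgt[OF assms(2)]]
 using assms by blast+
 then show ?thesis using assms unfolding crosses_def by blast
qed

lemma crosses_sym: "crosses D e f \<longleftrightarrow> crosses D f e"
 unfolding crosses_def by (metis Int_commute)

lemma tgt_on_edge: "e \<in> edges D ==> f \<in> edges D ==> tgt D e \<in> seg D f ==> f = nxt D e \<or> f = e"
 using vertex_on_edge[of "nxt D e" f] nxt_in[of e] nxt_inj[of f e] by (auto simp: tgt_src)

text \<open>Two overlapping collinear edges would share both end points, which a polygon without
 2-cycles excludes.\<close>

lemma crosses_det: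
 assumes "crosses D e f"
 shows "det2 (direction D e) (direction D f) ~= 0"
proof
 assume "det2 (direction D e) (direction D f) = 0"
 have ef: "e \<in> edges D" "f \<in> edges D" "e ~= f" using assms by (auto simp: crosses_def)
 let ?u = "direction D e"
 have u: "?u ~= 0" using direction_nz ef by auto
 obtain k where k: "direction D f = complex_of_real k * ?u"
 using det2_eq_0D[OF \<open>det2 _ _ = 0\<close> u] .
 have k0: "k ~= 0" using direction_nz[OF ef(2)] k by auto
 obtain s t where st: "0 < s" "s < 1" "0 < t" "t < 1" "pt D e s = pt D f t" using crossesE[OF assms] .
 \<comment> \<open>In the affine parameter of \<open>e\<close> the edge \<open>f\<close> runs from
   \<open>\<alpha>\<close> to \<open>\<alpha> + k\<close>. The rest compares this interval with the
   unit interval.\<close>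
 define \<alpha> where "\<alpha> = s - t * k"
 have "src D f = src D e + complex_of_real \<alpha> * ?u"
 using st(5) unfolding pt_def k \<alpha>_def by (simp add: algebra_simps)
 then have F: "pt D f r = pt D e (\<alpha> + r * k)" for r
 unfolding pt_def k by (simp add: algebra_simps)
 have A: "nxt D f = e" if "0 <= r" "r <= 1" "\<alpha> + r * k = 0" for r
 using vertex_on_edge[OF ef(1,2)] ef(3) F[of r] pt_in_seg[OF that(1,2), of D f] that(3) by auto
 have B: "nxt D e = f" if "0 <= r" "r <= 1" "\<alpha> + r * k = 1" for r
 using tgt_on_edge[OF ef(1,2)] ef(3) F[of r] pt_in_seg[OF that(1,2), of D f] that(3) by auto
 have C: "nxt D e = f" if "0 <= \<alpha>" "\<alpha> <= 1"
 using vertex_on_edge[OF ef(2,1)] ef(3) F[of 0] pt_in_seg[OF that, of D e] by auto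
 have D: "nxt D f = e" if "0 <= \<alpha> + k" "\<alpha> + k <= 1"
 using tgt_on_edge[OF ef(2,1)] ef(3) F[of 1] pt_in_seg[OF that, of D e] by auto
 have A': "\<alpha> + k = 0" if "nxt D f = e"
 using F[of 1] that pt_inj[OF ef(1), of "\<alpha> + k" 0] by (simp add: tgt_src)
 have B': "\<alpha> = 1" if "nxt D e = f"
 using F[of 0] that pt_inj[OF ef(1), of \<alpha> 1] by (simp add: tgt_src)
 have n2: "~ (nxt D f = e & nxt D e = f)" using nxt_nxt ef by auto
 have s: "s = \<alpha> + t * k" by (simp add: \<alpha>_def)
 have A2: "nxt D f = e" if "\<alpha> <= 0 & 0 <= \<alpha> + k \<or> \<alpha> + k <= 0 & 0 <= \<alpha>"
 using A[of "- \<alpha> / k"] that k0 by (cases "k > 0") (auto simp: field_simps)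
 have B2: "nxt D e = f" if "\<alpha> <= 1 & 1 <= \<alpha> + k \<or> \<alpha> + k <= 1 & 1 <= \<alpha>"
 using B[of "(1 - \<alpha>) / k"] that k0 by (cases "k > 0") (auto simp: field_simps)
 have k1: "k > 0 ==> \<alpha> < s & s < \<alpha> + k" "k < 0 ==> s < \<alpha> & \<alpha> + k < s"
 using mult_strict_right_mono[OF st(4), of k] mult_strict_right_mono[OF st(3), of k]
 mult_strict_right_mono_neg[OF st(4), of k] mult_strict_right_mono_neg[OF st(3), of k] s by auto
 show False
 proof (cases "k > 0")
 case True
 then show False using k1(1) A2 B2 C D A' B' n2 st(1,2) by (smt (verit))
 next
 case False
 then show False using k0 k1(2) A2 B2 C D A' B' n2 st(1,2) by (smt (verit))
 qed
qed

lemma intersection_unique: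
 assumes "det2 (direction D e) (direction D f) ~= 0" "pt D e s = pt D f t" "pt D e s' = pt D f t'"
 shows "s = s'" "t = t'"
proof -
 have "complex_of_real (s - s') * direction D e = complex_of_real (t - t') * direction D f"
 proof -
 have "complex_of_real (r - r') * direction D g = pt D g r - pt D g r'" for g r r'
 by (simp add: pt_def algebra_simps)
 then show ?thesis using assms(2,3) by simp
 qed
 from arg_cong[OF this, of "%z. det2 z (direction D f)"] arg_cong[OF this, of "%z. det2 (direction D e) z"]
 show "s = s'" "t = t'" using assms(1) unfolding det2_add det2_simps by simp_all
qed

lemma param_eqI:
 assumes "crosses D e f" "0 < s" "s < 1" "pt D e s \<in> seg D f"
 shows "param D (e, f) = s"
proof -
 note det = crosses_det[OF assms(1)]
 show ?thesis unfolding param_def fst_conv snd_conv pt_def[symmetric]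
 proof (rule the_equality)
 fix r assume "0 < r & r < 1 & pt D e r \<in> seg D f"
 then show "r = s" using assms(4) intersection_unique(1)[OF det] unfolding mem_seg by blast
 qed (use assms in auto)
qed

lemma param:
 assumes "crosses D e f"
 shows "0 < param D (e, f)" "param D (e, f) < 1" "pt D e (param D (e, f)) = pt D f (param D (f, e))"
proof -
 obtain s t where st: "0 < s" "s < 1" "0 < t" "t < 1" "pt D e s = pt D f t" using crossesE[OF assms] .
 have "param D (e, f) = s" using st pt_in_seg[of t D f] by (intro param_eqI assms) simp_all
 moreover have "param D (f, e) = t"
 using st assms crosses_sym[of e f] pt_in_seg[of s D e] by (intro param_eqI) simp_all
 ultimately show "0 < param D (e, f)" "param D (e, f) < 1" "pt D e (param D (e, f)) = pt D f (param D (f, e))"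
 using st by auto
qed

text \<open>An end point of \<open>f\<close> inside \<open>e\<close> would be a vertex on a foreign
  edge. Genericity would then make the edges adjacent and the point an end of
  \<open>e\<close>.\<close>

lemma crosses_interior:
 assumes "e \<in> edges D" "f \<in> edges D" "e ~= f" "0 < s" "s < 1" "pt D e s \<in> seg D f"
 shows "crosses D e f"
proof -
 obtain t where t: "0 <= t" "t <= 1" "pt D e s = pt D f t" using assms(6) by (auto simp: mem_seg)
 have "t ~= 0"
 proof
 assume "t = 0"
 then have "src D f = pt D e s" using t by simp
 moreover from this have "nxt D e = f"
 using vertex_on_edge[OF assms(2,1)] assms(3-5) pt_in_seg[of s D e] by auto
 ultimately have "pt D e 1 = pt D e s" by (simp add: tgt_src)
 then show False using pt_inj[OF assms(1), of 1 s] assms(5) by simp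
 qed
 moreover have "t ~= 1"
 proof
 assume "t = 1"
 then have *: "tgt D f = pt D e s" using t by simp
 then have "e = nxt D f"
 using tgt_on_edge[OF assms(2,1)] assms(3-5) pt_in_seg[of s D e] by auto
 then have "pt D e 0 = pt D e s" using * by (simp add: tgt_src)
 then show False using pt_inj[OF assms(1), of 0 s] assms(4) by simp
 qed
 ultimately show ?thesis using crossesI[OF assms(1-5), of t] t by auto
qed

lemma crosses_not_adjacent:
 assumes "crosses D e f"
 shows "nxt D e ~= f" "nxt D f ~= e"
proof -
 have *: False if "crosses D e f" "nxt D e = f" for e f
 proof -
 have "pt D e 1 = pt D f 0" using that by (simp add: tgt_src)
 then show False using intersection_unique(1)[OF crosses_det[OF that(1)] _ param(3)[OF that(1)], of 1 0] param(2)[OF that(1)] by simp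
 qed
 show "nxt D e ~= f" "nxt D f ~= e" using *[of e f] *[of f e] assms crosses_sym[of e f] by auto
qed

text \<open>Two edges crossing \<open>e\<close> at the same place would produce a triple
  point.\<close>

lemma param_inj:
 assumes "crosses D e f" "crosses D e g" "param D (e, f) = param D (e, g)"
 shows "f = g"
proof (rule ccontr)
 assume "f ~= g"
 have s: "crosses D f e" "crosses D g e" using assms crosses_sym[of e f] crosses_sym[of e g] by auto
 have "pt D e (param D (e, f)) \<in> seg D e"
 using param[OF assms(1)] by (intro pt_in_seg) auto
 moreover have "pt D e (param D (e, f)) \<in> seg D f"
 unfolding param(3)[OF assms(1)] using param[OF s(1)] by (intro pt_in_seg) auto
 moreover have "pt D e (param D (e, f)) \<in> seg D g"
 unfolding assms(3) param(3)[OF assms(2)] using param[OF s(2)] by (intro pt_in_seg) auto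
 ultimately show False using no_triple[of e f g] assms \<open>f ~= g\<close> by (auto simp: crosses_def)
qed

end

section \<open>The nodes, the crossings and the state sum of a diagram\<close>

definition pos :: "vdiag => nat \<times> nat => nat \<times> real" where
 "pos D P = (fst P, param D P)"

text \<open>Only vertices and passages through classical crossings become nodes. Virtual crossings
  are therefore invisible to the state sum, which is the reason for its invariance under
  detours.\<close>

definition nodes :: "vdiag => (nat \<times> real) set" where
 "nodes D = (%e. (e, 0)) ` edges D \<union> pos D ` passages D"

definition xings :: "vdiag => ((nat \<times> real) \<times> (nat \<times> real) \<times> bool) set" where
 "xings D = (%(e, f). (pos D (e, f), pos D (f, e), positive D (e, f))) ` over D"

locale diagram = generic_diagram +
 assumes vd: "vdiagram D"
begin

lemma over_crosses: "(e, f) \<in> over D ==> crosses D e f"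
 and over_asym: "(e, f) \<in> over D ==> (f, e) \<notin> over D"
 using vd by (auto simp: vdiagram_def)

lemma passage_crosses: "(e, f) \<in> passages D ==> crosses D e f"
 using over_crosses[of e f] over_crosses[of f e] crosses_sym[of e f] by (auto simp: passages_def)

lemma passages_sym: "(e, f) \<in> passages D \<longleftrightarrow> (f, e) \<in> passages D"
 by (auto simp: passages_def)

lemma finite_passages: "finite (passages D)"
proof (rule finite_subset)
 show "passages D \<subseteq> edges D \<times> edges D" using passage_crosses by (auto simp: crosses_def)
qed (simp add: finite_edges)

lemma finite_over: "finite (over D)"
 using finite_passages by (rule rev_finite_subset) (auto simp: passages_def)

lemma positions_nodes: "positions (edges D) (nxt D) (nodes D)"
 unfolding positions_def nodes_def
proof (intro conjI ballI bij_nxt)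
 show "finite ((%e. (e, 0)) ` edges D \<union> pos D ` passages D)"
 using finite_edges finite_passages by simp
 have "e \<in> edges D & 0 <= param D (e, f) & param D (e, f) < 1" if "(e, f) \<in> passages D" for e f
 using param(1,2)[OF passage_crosses[OF that]] passage_crosses[OF that] by (simp add: crosses_def)
 then show "case v of (e, s) => e \<in> edges D & 0 <= s & s < 1"
 if "v \<in> (%e. (e, 0)) ` edges D \<union> pos D ` passages D" for v
 using that by (auto simp: pos_def)
qed auto

lemma inj_pos: "inj_on (pos D) (passages D)"
proof (rule inj_onI)
 fix P Q assume "P \<in> passages D" "Q \<in> passages D" "pos D P = pos D Q"
 then show "P = Q" using param_inj[OF passage_crosses passage_crosses, of "fst P" "snd P" "snd Q"]
 by (cases P; cases Q) (simp add: pos_def)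
qed

lemma ends_xings: "ends (xings D) = pos D ` passages D"
 by (auto simp: ends_def xings_def passages_def)

lemma ends_xings_nodes: "ends (xings D) \<subseteq> nodes D"
 by (auto simp: ends_xings nodes_def)

lemma finite_xings: "finite (xings D)"
 using finite_over by (simp add: xings_def)

end

lemma diagramI: "vdiagram D ==> diagram D"
 by unfold_locales (auto simp: vdiagram_def)

definition (in bracket_model) Z :: "int => vdiag => complex" where
 "Z t D = psum t (nxt D) (nodes D) (xings D)"

lemma nsucc_cong:
 assumes "nx (fst v) = nx' (fst v)" "\<And>s. (fst v, s) \<in> M \<longleftrightarrow> (fst v, s) \<in> M'"
 shows "nsucc nx M v = nsucc nx' M' v"
 unfolding nsucc_def assms ..

lemma param_cong:
 assumes "src D' x = src D e" "tgt D' x = tgt D e" "src D' y = src D f" "tgt D' y = tgt D f"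
 shows "param D' (x, y) = param D (e, f)"
 using assms by (simp add: param_def direction_def seg_def)

text \<open>Cramer's rule for the intersection point. It shows that the parameter depends
  continuously on the vertices, as needed for motions.\<close>

lemma (in generic_diagram) param_formula:
 assumes "crosses D e f"
 shows "param D (e, f) = det2 (src D f - src D e) (direction D f) / det2 (direction D e) (direction D f)"
proof -
 have "src D f - src D e = complex_of_real (param D (e, f)) * direction D e - complex_of_real (param D (f, e)) * direction D f"
 using param(3)[OF assms] by (simp add: pt_def algebra_simps)
 then show ?thesis using crosses_det[OF assms] by (simp only: det2_add det2_simps) simp
qed

section \<open>Invariance under relabelling, motions and detours\<close>

context bracket_model
begin

lemma Z_relabel:
 assumes D: "vdiagram D" and r: "relabel D D'"
 shows "Z t D' = Z t D"
proof -
 interpret diagram D by (rule diagramI[OF D])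
 obtain g where g: "bij_betw g (edges D) (edges D')"
 "\<And>e. e \<in> edges D ==> nxt D' (g e) = g (nxt D e)" "\<And>e. e \<in> edges D ==> vpos D' (g e) = vpos D e"
 "over D' = map_prod g g ` over D"
 using r unfolding relabel_def by blast
 have inj: "inj_on g (edges D)" and E: "edges D' = g ` edges D" using g(1) by (auto simp: bij_betw_def)
 have st: "src D' (g e) = src D e" "tgt D' (g e) = tgt D e" if "e \<in> edges D" for e
 using that nxt_in[OF that] g by (simp_all add: src_def tgt_def)
 have in_edges: "e \<in> edges D" "f \<in> edges D" if "(e, f) \<in> over D" for e f
 using over_crosses[OF that] by (auto simp: crosses_def)
 have p: "pos D' (g e, g f) = map_prod g id (pos D (e, f))" if "e \<in> edges D" "f \<in> edges D" for e f
 using that by (simp add: pos_def st param_cong[of D' "g e" D e "g f" f])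
 have P: "passages D' = map_prod g g ` passages D" unfolding passages_def g(4) by force
 have pin: "e \<in> edges D & f \<in> edges D" if "(e, f) \<in> passages D" for e f
 using that in_edges by (auto simp: passages_def)
 have "pos D' ` passages D' = map_prod g id ` pos D ` passages D"
 unfolding P image_image using pin p by (intro image_cong refl) auto
 then have N: "nodes D' = map_prod g id ` nodes D"
 unfolding nodes_def E image_Un by (simp add: image_image)
 have X: "xings D' = (%(x, y, p). (map_prod g id x, map_prod g id y, p)) ` xings D"
 unfolding xings_def g(4) image_image
 by (intro image_cong refl) (use in_edges p in \<open>auto simp: positive_def direction_def st\<close>)
 show ?thesis unfolding Z_def N
 by (rule psum_relabel[OF positions_nodes inj, symmetric]) (use g ends_xings_nodes X in auto)
qed

text \<open>During a motion the parameters of the crossings vary continuously, two passages on one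
  edge never meet, and the determinant of two crossing edges never vanishes. By the intermediate
  value theorem the orders on the edges and the signs persist.\<close>

lemma Z_motion:
 assumes D: "vdiagram D" and r: "motion D D'"
 shows "Z t D' = Z t D"
proof -
 interpret diagram D by (rule diagramI[OF D])
 obtain P :: "real => nat => complex" where
 cont: "\<And>e. e \<in> edges D ==> continuous_on {0..1} (%t. P t e)"
 and vd: "\<And>t. t \<in> {0..1} ==> vdiagram (D\<lparr>vpos := P t\<rparr>)"
 and P0: "\<And>e. e \<in> edges D ==> P 0 e = vpos D e" and D': "D' = D\<lparr>vpos := P 1\<rparr>"
 using r unfolding motion_def by blast
 define F where "F t = D\<lparr>vpos := P t\<rparr>" for t
 have F: "edges (F t) = edges D" "nxt (F t) = nxt D" "over (F t) = over D" "passages (F t) = passages D" for t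
 by (simp_all add: F_def passages_def)
 have g: "diagram (F t)" if "t \<in> {0..1}" for t using vd[OF that] by (auto simp: F_def intro: diagramI)
 have in_edges: "e \<in> edges D" "f \<in> edges D" if "(e, f) \<in> passages D" for e f
 using passage_crosses[OF that] by (auto simp: crosses_def)
 have cs: "continuous_on {0..1} (%t. src (F t) e)" if "e \<in> edges D" for e
 using cont[OF that] by (simp add: src_def F_def)
 have cd: "continuous_on {0..1} (%t. direction (F t) e)" if "e \<in> edges D" for e
 using cont[OF that] cont[OF nxt_in[OF that]]
 by (simp add: src_def tgt_def direction_def F_def continuous_on_diff)
 have cdet: "continuous_on {0..1} (%t. det2 (u t) (v t))"
 if "continuous_on {0..1} u" "continuous_on {0..1} v" for u v :: "real => complex"
 unfolding det2_def by (intro continuous_intros that)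
 have cr: "crosses (F t) e f" if "t \<in> {0..1}" "(e, f) \<in> passages D" for t e f
 using diagram.passage_crosses[OF g[OF that(1)]] that(2) F by auto
 have nz: "det2 (direction (F t) e) (direction (F t) f) ~= 0" if "t \<in> {0..1}" "(e, f) \<in> passages D" for t e f
 using generic_diagram.crosses_det[OF diagram.axioms(1)[OF g[OF that(1)]] cr[OF that]] .
 have cp: "continuous_on {0..1} (%t. param (F t) (e, f))" if p: "(e, f) \<in> passages D" for e f
 proof -
 have "continuous_on {0..1} (%t. det2 (src (F t) f - src (F t) e) (direction (F t) f) / det2 (direction (F t) e) (direction (F t) f))"
 using in_edges[OF p] by (intro continuous_on_divide cdet continuous_on_diff cs cd ballI nz p) auto
 then show ?thesis
 by (rule continuous_on_eq)
 (use generic_diagram.param_formula[OF diagram.axioms(1)[OF g] cr] p in auto)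
 qed
 have sign: "0 < h 0 \<longleftrightarrow> 0 < h 1" if "continuous_on {0..1} h" "\<And>t. t \<in> {0..1} ==> h t ~= 0" for h :: "real => real"
 proof (rule ccontr)
 assume "~ ?thesis"
 then have "h 0 <= 0 & 0 <= h 1 \<or> h 1 <= 0 & 0 <= h 0" by auto
 then have "\<exists>x. 0 <= x & x <= 1 & h x = 0"
 proof (elim disjE conjE)
 assume "h 0 <= 0" "0 <= h 1"
 then show ?thesis using IVT'[of h 0 0 1] that(1) by auto
 next
 assume "h 1 <= 0" "0 <= h 0"
 then show ?thesis using IVT2'[of h 1 0 0] that(1) by auto
 qed
 then show False using that(2) by auto
 qed
 have st0: "src (F 0) e = src D e" "tgt (F 0) e = tgt D e" if "e \<in> edges D" for e
 using P0 that nxt_in[OF that] by (simp_all add: src_def tgt_def F_def)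
 have p0: "param (F 0) (e, f) = param D (e, f)" if "(e, f) \<in> passages D" for e f
 using in_edges[OF that] by (intro param_cong) (simp_all add: st0)
 have F1: "F 1 = D'" by (simp add: D' F_def)
 have ord: "param D' (e, f) < param D' (e, g)" if "(e, f) \<in> passages D" "(e, g) \<in> passages D"
 "param D (e, f) < param D (e, g)" for e f g
 proof -
 have ne: "f ~= g" using that by auto
 have "param (F t) (e, g) - param (F t) (e, f) ~= 0" if t: "t \<in> {0..1}" for t
 using generic_diagram.param_inj[OF diagram.axioms(1)[OF g[OF t]] cr[OF t] cr[OF t]] \<open>(e, f) \<in> _\<close> \<open>(e, g) \<in> _\<close> ne by force
 moreover have "continuous_on {0..1} (%t. param (F t) (e, g) - param (F t) (e, f))"
 by (intro continuous_on_diff cp that)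
 ultimately show ?thesis
 using sign[of "%t. param (F t) (e, g) - param (F t) (e, f)"] that p0[OF that(1)] p0[OF that(2)] F1
 by simp
 qed
 have sgn: "positive D' (e, f) = positive D (e, f)" if "(e, f) \<in> over D" for e f
 proof -
 have p: "(e, f) \<in> passages D" using that by (auto simp: passages_def)
 show ?thesis
 using sign[of "%t. det2 (direction (F t) e) (direction (F t) f)"] nz[OF _ p] in_edges[OF p] cd cdet F1 st0
 by (auto simp: positive_def direction_def)
 qed
 \<comment> \<open>Maps the parameter of a passage at the start of the motion to its parameter at
   the end. It is well defined because different passages on one edge have different
   parameters.\<close>
 define \<theta> where "\<theta> e s = (if s = 0 then 0 else param D' (e, SOME f. (e, f) \<in> passages D & param D (e, f) = s))" for e s
 have \<theta>: "\<theta> e (param D (e, f)) = param D' (e, f)" if "(e, f) \<in> passages D" for e f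
 proof -
 have "(SOME f'. (e, f') \<in> passages D & param D (e, f') = param D (e, f)) = f"
 by (rule some_equality) (use that param_inj[OF passage_crosses passage_crosses] in blast)+
 then show ?thesis using param(1)[OF passage_crosses[OF that]] by (simp add: \<theta>_def)
 qed
 have pp: "pos D' P = (%(e, s). (e, \<theta> e s)) (pos D P)" if "P \<in> passages D" for P
 using that by (cases P) (simp add: pos_def \<theta>)
 have E: "edges D' = edges D" "nxt D' = nxt D" "over D' = over D" "passages D' = passages D" using F F1 by metis+
 have N: "nodes D' = (%(e, s). (e, \<theta> e s)) ` nodes D"
 unfolding nodes_def E image_Un image_image using pp by (intro arg_cong2[where f="(\<union>)"] image_cong refl) (auto simp: \<theta>_def)
 have pos': "0 < param D' (e, f)" if "(e, f) \<in> passages D" for e f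
 using generic_diagram.param(1)[OF diagram.axioms(1)[OF g] cr[OF _ that], of 1] F1 by auto
 show ?thesis unfolding Z_def N E
 proof (rule psum_rescale[OF positions_nodes, symmetric, OF _ _ ends_xings_nodes])
 fix e s s' assume s: "(e, s) \<in> nodes D" "(e, s') \<in> nodes D" "s < s'"
 then have "0 <= s" using positionsD(1)[OF positions_nodes] by auto
 then obtain f' where f': "(e, f') \<in> passages D" "s' = param D (e, f')"
 using s unfolding nodes_def pos_def by auto
 show "\<theta> e s < \<theta> e s'"
 proof (cases "s = 0")
 case True
 then show ?thesis using f' \<theta> pos' by (simp add: \<theta>_def[of e 0])
 next
 case False
 then obtain f where "(e, f) \<in> passages D" "s = param D (e, f)"
 using s unfolding nodes_def pos_def by auto
 then show ?thesis using f' s \<theta> ord by simp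
 qed
 next
 show "xings D' = (%(x, y, p). ((fst x, \<theta> (fst x) (snd x)), (fst y, \<theta> (fst y) (snd y)), p)) ` xings D"
 unfolding xings_def E image_image
 by (intro image_cong refl) (auto simp: pos_def sgn passages_def intro!: \<theta>[symmetric])
 qed (simp add: \<theta>_def)
qed

text \<open>The vertices of a path without classical crossings are inserted one after the other
  behind \<open>c 0\<close>, each by \<open>state_sum_insert\<close>.\<close>

lemma state_sum_chain:
 assumes V: "finite V" "sc ` V \<subseteq> V" "ends X \<subseteq> V" "c 0 \<in> V"
 and c: "inj_on c {..m}" "\<And>j. 0 < j ==> j <= m ==> c j \<notin> V"
 and sc': "\<And>j. j < m ==> sc' (c j) = c (Suc j)" "sc' (c m) = sc (c 0)"
 "\<And>v. v \<in> V ==> v ~= c 0 ==> sc' v = sc v"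
 shows "state_sum t (V \<union> c ` {1..m}) sc' X = state_sum t V sc X"
 using c sc'
proof (induction m arbitrary: sc')
 case 0
 then have "state_sum t V sc' X = state_sum t V sc X"
 using V(3) by (intro state_sum_cong) metis+
 then show ?case by simp
next
 case (Suc m)
 let ?V = "V \<union> c ` {1..m}"
 let ?sc = "sc'(c m := sc (c 0))"
 have ne: "c j ~= c k" if "j ~= k" "j <= Suc m" "k <= Suc m" for j k
 using that inj_onD[OF Suc.prems(1), of j k] by auto
 have inj: "inj_on c {..m}" using Suc.prems(1) by (rule inj_on_subset) auto
 have cm: "c m \<in> ?V" using V(4) by (cases m) auto
 have new: "c (Suc m) \<notin> ?V" using Suc.prems(2)[of "Suc m"] ne by fastforce
 have V': "?sc v = sc v" if "v \<in> V" "v ~= c 0" for v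
 using Suc.prems(5)[OF that] Suc.prems(2)[of m] that by (cases m) auto
 have C: "?sc (c j) = c (Suc j)" if "j < m" for j using Suc.prems(3)[of j] ne[of j m] that by simp
 have IH: "state_sum t ?V ?sc X = state_sum t V sc X"
 by (rule Suc.IH[OF inj]) (use Suc.prems(2) V' C in auto)
 have "?sc v \<in> ?V" if "v \<in> ?V" for v
 proof -
 consider "v \<in> V" "v ~= c 0" | "v = c m" | j where "j < m" "v = c j"
 proof (cases "v \<in> V & v ~= c 0")
 case False
 then obtain j where "j <= m" "v = c j" using \<open>v \<in> ?V\<close> by auto
 then show ?thesis using that(2) that(3)[of j] by (cases "j = m") auto
 qed (use that in blast)
 then show ?thesis
 proof cases
 case 1
 then show ?thesis using V' V(2) by auto
 next
 case 2
 then show ?thesis using V(2,4) by auto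
 next
 case 3
 then show ?thesis using C by auto
 qed
 qed
 then have img: "?sc ` ?V \<subseteq> ?V" by blast
 have "state_sum t (insert (c (Suc m)) ?V) sc' X =
 state_sum t (insert (c (Suc m)) ?V) (?sc(c m := c (Suc m), c (Suc m) := ?sc (c m))) X"
 by (rule state_sum_cong) (use V(3) Suc.prems(3)[of m] Suc.prems(4) ne[of m "Suc m"] in auto)
 also have "\<dots> = state_sum t ?V ?sc X"
 by (rule state_sum_insert) (use V(1,3) img cm new in auto)
 moreover have "V \<union> c ` {1..Suc m} = insert (c (Suc m)) ?V" by (auto simp: atLeastAtMostSuc_conv)
 ultimately show ?case using IH by simp
qed

text \<open>Both diagrams are compared with one common state sum, in which the whole chain is
  contracted to the transmitting node \<open>(e, 0)\<close> followed by \<open>(q, 0)\<close>. All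
  classical crossings lie on edges of \<open>C\<close>, where the two diagrams coincide.\<close>

lemma Z_detour:
 assumes D: "vdiagram D" and D': "vdiagram D'" and r: "detour D D'"
 shows "Z t D' = Z t D"
proof -
 obtain e m m' C q where C: "C = edges D - chain D e m" "C = edges D' - chain D' e m'" and
 q: "q = (nxt D ^^ Suc m) e" "(nxt D' ^^ Suc m') e = q" "q \<in> C" and
 e: "e \<in> edges D" "e \<in> edges D'" and vp: "vpos D' e = vpos D e" and
 same: "\<And>g. g \<in> C ==> nxt D' g = nxt D g & vpos D' g = vpos D g" and
 ov: "over D' = over D" "over D \<subseteq> C \<times> C"
 using r unfolding detour_def Let_def by metis
 define V where "V = (%g. (g, 0 :: real)) ` insert e C \<union> pos D ` passages D"
 define sc where "sc v = (if v = (e, 0) then (q, 0) else nsucc (nxt D) V v)" for v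
 have key: "Z t G = state_sum t V sc (xings D)"
 if G: "vdiagram G" "C = edges G - chain G e k" "(nxt G ^^ Suc k) e = q" "e \<in> edges G"
 "\<And>g. g \<in> C ==> nxt G g = nxt D g & vpos G g = vpos D g" "vpos G e = vpos D e" "over G = over D"
 for G k
 proof -
 interpret diagram G by (rule diagramI[OF G(1)])
 define c where "c j = (nxt G ^^ j) e" for j
 have c_in: "c j \<in> edges G" for j unfolding c_def using G(4) nxt_in by (induction j) auto
 have c_Suc: "c (Suc j) = nxt G (c j)" for j by (simp add: c_def)
 have cq: "c (Suc k) = q" using G(3) by (simp only: c_def)
 have ch: "chain G e k = c ` {..k}" by (auto simp: chain_def c_def)
 have cC: "c j \<notin> C" if "j <= k" for j using G(2) that ch by auto
 have cancel: "c i = c (i + d) ==> c 0 = c d" for i d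
 by (induction i) (use c_in nxt_inj c_Suc in \<open>auto simp: c_Suc\<close>)
 \<comment> \<open>If the chain repeated an edge, it would be periodic, and \<open>q\<close> would
   occur in the chain although it belongs to \<open>C\<close>.\<close>
 have ne: False if "c i = c j" "i < j" "j <= k" for i j
 proof -
 have "c 0 = c (j - i)" using cancel[of i "j - i"] that by simp
 then have "c n = c (n + (j - i))" for n by (induction n) (auto simp: c_Suc)
 from this[of "Suc k - (j - i)"] have "c (Suc k - (j - i)) = q" using that cq by auto
 moreover have "Suc k - (j - i) <= k" using that by auto
 ultimately show False using cC q(3) by metis
 qed
 have c_inj: "inj_on c {..k}"
 by (rule inj_onI) (metis atMost_iff linorder_neqE_nat ne)
 have E: "edges G = C \<union> c ` {..k}" using G(2) ch c_in by auto
 \<comment> \<open>A later edge of the chain has its only predecessor in the chain, so from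
   \<open>C\<close> the chain can be entered at \<open>e\<close> only.\<close>
 have into: "nxt G g \<in> insert e C" if "g \<in> C" for g
 proof (rule ccontr)
 assume n: "nxt G g \<notin> insert e C"
 have "g \<in> edges G" using that G(2) by auto
 then have "nxt G g \<in> c ` {..k}" using n nxt_in E by auto
 then obtain j where j: "nxt G g = c j" "j <= k" by auto
 have "j ~= 0"
 proof
 assume "j = 0"
 then show False using n j by (simp add: c_def)
 qed
 then obtain i where "j = Suc i" by (cases j) auto
 then have "g = c i" using j c_Suc nxt_inj c_in \<open>g \<in> edges G\<close> by metis
 then show False using cC[of i] that j \<open>j = Suc i\<close> by auto
 qed
 have st: "src G g = src D g" "tgt G g = tgt D g" if "g \<in> C" for g
 using into[OF that] G(5)[OF that] G(5,6) by (auto simp: src_def tgt_def)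
 have P: "passages G = passages D" "passages D \<subseteq> C \<times> C" using G(7) ov by (auto simp: passages_def)
 have p: "pos G Q = pos D Q" if "Q \<in> passages D" for Q
 using that P(2) by (cases Q) (auto simp: pos_def intro!: param_cong st)
 have X: "xings G = xings D"
 unfolding xings_def G(7)
 proof (intro image_cong refl)
 fix c assume "c \<in> over D"
 moreover obtain x y where xy: "c = (x, y)" by (cases c)
 ultimately have "x \<in> C" "y \<in> C" "(x, y) \<in> passages D" "(y, x) \<in> passages D" using ov by (auto simp: passages_def)
 then show "(case c of (e, f) => (pos G (e, f), pos G (f, e), positive G (e, f))) =
 (case c of (e, f) => (pos D (e, f), pos D (f, e), positive D (e, f)))"
 using p by (simp add: xy positive_def direction_def st)
 qed
 have c0: "c 0 = e" by (simp add: c_def)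
 have N: "nodes G = V \<union> (%j. (c j, 0)) ` {1..k}"
 proof -
 have "edges G = insert e C \<union> c ` {1..k}" unfolding E c0[symmetric] by (force simp: image_iff le_Suc_eq Suc_le_eq)
 moreover have "pos G ` passages G = pos D ` passages D" using P p by auto
 ultimately show ?thesis unfolding nodes_def V_def by auto
 qed
 have fC: "fst v \<in> C \<or> v = (e, 0)" if "v \<in> V" for v
 using that P(2) by (auto simp: V_def pos_def)
 have fib: "(a, s) \<in> nodes G \<longleftrightarrow> (a, s) \<in> V" if "a \<in> C" for a s
 using that cC unfolding N by auto
 have scV: "nsucc (nxt G) (nodes G) v = sc v" if v: "v \<in> V" "v ~= (e, 0)" for v
 proof -
 have "fst v \<in> C" using fC[OF v(1)] v(2) by auto
 then show ?thesis using v(2) G(5) fib unfolding sc_def by (auto intro: nsucc_cong)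
 qed
 have cs: "nsucc (nxt G) (nodes G) (c j, 0) = (c (Suc j), 0)" if "j <= k" for j
 proof (rule nsucc_eqI[OF positions_finite[OF positions_nodes]])
 have "s = 0" if "(c j, s) \<in> nodes G" for s
 using that cC[OF \<open>j <= k\<close>] P unfolding nodes_def pos_def by auto
 then show "consecutive (nxt G) (nodes G) (c j, 0) (c (Suc j), 0)"
 unfolding consecutive_def c_Suc by auto
 qed
 have e0: "(e, 0) \<in> V" "(q, 0) \<in> V" using q(3) by (auto simp: V_def)
 have "Z t G = state_sum t (V \<union> (%j. (c j, 0)) ` {1..k}) (nsucc (nxt G) (nodes G)) (xings D)"
 by (simp add: Z_def psum_def N X)
 also have "\<dots> = state_sum t V sc (xings D)"
 proof (rule state_sum_chain)
 show "finite V" using positions_finite[OF positions_nodes] N by auto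
 show "sc ` V \<subseteq> V"
 proof
 fix y assume "y \<in> sc ` V"
 then obtain v where v: "v \<in> V" "y = sc v" by auto
 show "y \<in> V"
 proof (cases "v = (e, 0)")
 case True
 then show ?thesis using v e0 by (simp add: sc_def)
 next
 case False
 then have "y = nsucc (nxt G) (nodes G) v" using v scV by simp
 then have y: "consecutive (nxt G) (nodes G) v y"
 using consecutive_nsucc[OF positions_finite[OF positions_nodes], of "nxt G" v] by simp
 have "fst v \<in> C" using fC[OF v(1)] False by auto
 then have "(fst v, snd y) \<in> nodes G ==> (fst v, snd y) \<in> V" "nxt G (fst v) \<in> insert e C"
 using fib into by auto
 then show ?thesis using y unfolding consecutive_def by (cases y) (auto simp: V_def)
 qed
 qed
 show "ends (xings D) \<subseteq> V" using ends_xings P p unfolding X by (auto simp: V_def)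
 show "inj_on (%j. (c j, 0)) {..k}" using c_inj by (auto simp: inj_on_def)
 show "nsucc (nxt G) (nodes G) (c j, 0) = (c (Suc j), 0)" if "j < k" for j using cs that by auto
 show "nsucc (nxt G) (nodes G) (c k, 0) = sc (c 0, 0)" using cs[of k] cq c0 by (simp add: sc_def)
 show "(c j, 0) \<notin> V" if "0 < j" "j <= k" for j
 using fC[of "(c j, 0)"] cC[OF that(2)] ne[of 0 j] that c0 by auto
 qed (use e0 c0 scV in auto)
 finally show ?thesis .
 qed
 show ?thesis using key[OF D' C(2) q(2) e(2) same vp ov(1)] key[OF D C(1) q(1)[symmetric] e(1)] by simp
qed

end

section \<open>Added vertices and subdivision\<close>

locale vertex_added = generic_diagram D + D': generic_diagram D' for D D' +
 fixes e n :: nat and z :: complex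
 assumes e: "e \<in> edges D" and n: "n \<notin> edges D"
 and D': "edges D' = insert n (edges D)" "nxt D' = (nxt D)(e := n, n := nxt D e)" "vpos D' = (vpos D)(n := z)"
begin

lemma ne: "e ~= n" "n ~= e" using e n by auto

lemma src_tgt:
 "src D' e = src D e" "tgt D' e = z" "src D' n = z" "tgt D' n = tgt D e"
 "x \<in> edges D ==> src D' x = src D x" "x \<in> edges D ==> x ~= e ==> tgt D' x = tgt D x"
proof -
 have *: "nxt D x ~= n" if "x \<in> edges D" for x using nxt_in[OF that] n by auto
 show "src D' e = src D e" "tgt D' e = z" "src D' n = z" "tgt D' n = tgt D e"
 using ne *[OF e] by (simp_all add: src_def tgt_def D')
 show "x \<in> edges D ==> src D' x = src D x" "x \<in> edges D ==> x ~= e ==> tgt D' x = tgt D x"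
 using n *[of x] by (auto simp: src_def tgt_def D')
qed

lemma other:
 assumes "x \<in> edges D" "x ~= e"
 shows "pt D' x = pt D x" "seg D' x = seg D x" "direction D' x = direction D x"
 using src_tgt(5,6) assms by (auto simp: pt_def seg_def direction_def fun_eq_iff)

lemma crosses_other:
 "x \<in> edges D ==> y \<in> edges D ==> x ~= e ==> y ~= e ==> crosses D' x y \<longleftrightarrow> crosses D x y"
 by (simp add: crosses_def D' src_tgt)

lemma param_other:
 "x \<in> edges D ==> y \<in> edges D ==> x ~= e ==> y ~= e ==> param D' (x, y) = param D (x, y)"
 by (rule param_cong) (simp_all add: src_tgt)

end

locale split_edge = vertex_added +
 fixes s0 :: real
 assumes s0: "0 < s0" "s0 < 1" and z: "z = pt D e s0"
begin

definition half :: "nat => nat => nat" where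
 "half x y = (if x = e & param D (e, y) > s0 then n else x)"

lemma directions: "direction D' e = complex_of_real s0 * direction D e"
 "direction D' n = complex_of_real (1 - s0) * direction D e"
 by (simp_all add: direction_def src_tgt z pt_def algebra_simps)

lemma pts: "pt D' e s = pt D e (s * s0)" "pt D' n s = pt D e (s0 + s * (1 - s0))"
 by (simp_all add: pt_def src_tgt directions z algebra_simps)

text \<open>A crossing exactly at the cut would place the new vertex on a foreign edge, which the
  genericity of \<open>D'\<close> forbids. So every crossing belongs to exactly one half.\<close>

lemma param_ne: assumes "crosses D e y" shows "param D (e, y) ~= s0"
proof
 assume a: "param D (e, y) = s0"
 have y: "y \<in> edges D" "y ~= e" using assms by (auto simp: crosses_def)
 have "z = pt D y (param D (y, e))" using param(3)[OF assms] a z by simp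
 then have "src D' n \<in> seg D' y"
 using param(1,2)[of y e] assms crosses_sym[of e y] y by (simp add: src_tgt other pt_in_seg)
 then have "y = n \<or> nxt D' y = n" using D'.vertex_on_edge[of n y] y D' by auto
 then show False using y n nxt_in[of y] by (auto simp: D' split: if_splits)
qed

lemma half_crosses:
 assumes c: "crosses D e y"
 shows "crosses D' (half e y) y" "(half e y, param D' (half e y, y)) = cut_at e n s0 (e, param D (e, y))"
 "param D' (y, half e y) = param D (y, e)" "half y e = y"
 "det2 (direction D' (half e y)) w > 0 \<longleftrightarrow> det2 (direction D e) w > 0"
 "det2 w (direction D' (half e y)) > 0 \<longleftrightarrow> det2 w (direction D e) > 0"
 "crosses D' x y ==> x = e \<or> x = n ==> x = half e y"
proof -
 have y: "y \<in> edges D" "y ~= e" "y ~= n" "crosses D y e" using c n crosses_sym[of e y] by (auto simp: crosses_def)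
 let ?r = "param D (e, y)"
 note p = param[OF c] param(1,2)[OF y(4)]
 define r where "r = (if ?r < s0 then ?r / s0 else (?r - s0) / (1 - s0))"
 have r: "0 < r" "r < 1" using p s0 param_ne[OF c] by (auto simp: r_def field_simps)
 have pr: "pt D' (half e y) r = pt D e ?r"
 using param_ne[OF c] s0 by (auto simp: half_def r_def pts)
 have h: "half e y \<in> edges D'" "half e y ~= y" using y e by (auto simp: half_def D')
 have q: "pt D' (half e y) r = pt D' y (param D (y, e))" using pr p other[OF y(1,2)] by simp
 show c': "crosses D' (half e y) y"
 by (rule D'.crossesI[OF h(1) _ h(2) r p(4,5) q]) (use y D' in auto)
 have "param D' (half e y, y) = r"
 by (rule D'.param_eqI[OF c' r]) (use q p in \<open>auto intro: pt_in_seg\<close>)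
 then show "(half e y, param D' (half e y, y)) = cut_at e n s0 (e, ?r)"
 using param_ne[OF c] by (auto simp: half_def cut_at_def r_def)
 show "param D' (y, half e y) = param D (y, e)"
 proof (rule D'.param_eqI[OF _ p(4,5)])
 show "crosses D' y (half e y)" using c' D'.crosses_sym by blast
 show "pt D' y (param D (y, e)) \<in> seg D' (half e y)" unfolding q[symmetric] using r by (auto intro: pt_in_seg)
 qed
 show "half y e = y" using y by (simp add: half_def)
 define k where "k = (if ?r > s0 then 1 - s0 else s0)"
 have k: "k > 0" using s0 by (simp add: k_def)
 have d: "direction D' (half e y) = complex_of_real k * direction D e"
 by (cases "?r > s0") (simp_all only: half_def k_def directions if_True if_False simp_thms)
 show "det2 (direction D' (half e y)) w > 0 \<longleftrightarrow> det2 (direction D e) w > 0"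
 unfolding d det2_add using k by (simp add: zero_less_mult_iff)
 show "det2 w (direction D' (half e y)) > 0 \<longleftrightarrow> det2 w (direction D e) > 0"
 unfolding d det2_add using k by (simp add: zero_less_mult_iff)
 show "x = half e y" if x: "crosses D' x y" "x = e \<or> x = n"
 proof -
 note q = D'.param(1,2,3)[OF x(1)]
 define r' where "r' = (if x = e then param D' (x, y) * s0 else s0 + param D' (x, y) * (1 - s0))"
 have "pt D e r' = pt D y (param D' (y, x))"
 using q(3) x(2) other[OF y(1,2)] ne by (auto simp: r'_def pts)
 then have "r' = ?r" using intersection_unique(1)[OF crosses_det[OF c] _ p(3)] by auto
 moreover have "r' < s0 \<longleftrightarrow> x = e"
 using q(1,2) s0 by (auto simp: r'_def mult_less_cancel_right2 mult_less_0_iff)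
 moreover have "?r ~= s0" using param_ne[OF c] .
 ultimately show ?thesis using x(2) by (auto simp: half_def)
 qed
qed

end

context bracket_model
begin

text \<open>The sign function \<open>q\<close> is arbitrary, so that the lemma covers subdivisions
  as well as a diagram in which the sign of one crossing has been changed by hand.\<close>

lemma psum_split:
 assumes D: "vdiagram D" and D': "vdiagram D'" and e: "e \<in> edges D" "n \<notin> edges D"
 and s0: "0 < s0" "s0 < 1" and sp: "D' = split e n (pt D e s0) D"
 defines "par \<equiv> id(n := e)"
 shows "psum t (nxt D') (nodes D') ((%(u, v). (pos D' (u, v), pos D' (v, u), q (par u, par v))) ` over D') =
 psum t (nxt D) (nodes D) ((%(u, v). (pos D (u, v), pos D (v, u), q (u, v))) ` over D)"
 and "inj_on (map_prod par par) (over D')"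
 and "\<And>c. c \<in> over D' ==> map_prod par par c \<in> over D & positive D' c = positive D (map_prod par par c)"
proof -
 let ?z = "pt D e s0"
 note par_def [simp]
 interpret diagram D by (rule diagramI[OF D])
 interpret D': diagram D' by (rule diagramI[OF D'])
 interpret split_edge D D' e n ?z s0
 by unfold_locales (use e s0 sp in \<open>auto simp: split_def add_vertex_def Let_def\<close>)
 have ov: "over D' = {(x, y). crosses D' x y & (par x, par y) \<in> over D}"
 by (simp add: sp split_def Let_def crosses_def src_def tgt_def)
 have ov_edges: "x \<in> edges D" "y \<in> edges D" "x ~= y" if "crosses D x y" for x y
 using that by (auto simp: crosses_def)
 define \<sigma> where "\<sigma> = (%(x, y). (half x y, half y x))"
 have half_other: "half x y = x" if "x ~= e" for x y using that by (simp add: half_def)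
 have \<sigma>: "crosses D' (half x y) (half y x) & pos D' (\<sigma> (x, y)) = cut_at e n s0 (pos D (x, y)) &
 (det2 (direction D' (half x y)) (direction D' (half y x)) > 0 \<longleftrightarrow> det2 (direction D x) (direction D y) > 0) &
 par (half x y) = x & par (half y x) = y"
 if c: "crosses D x y" for x y
 proof -
 have x: "x \<in> edges D" "y \<in> edges D" "x ~= y" "x ~= n" "y ~= n" using ov_edges[OF c] n by auto
 have par: "par (half x y) = x" "par (half y x) = y" using x by (auto simp: half_def)
 consider (a) "x = e" | (b) "y = e" | (c) "x ~= e" "y ~= e" by blast
 then show ?thesis
 proof cases
 case a
 then have c: "crosses D e y" "y ~= e" using that x by auto
 note h = half_crosses(1-6)[OF c(1)]
 show ?thesis unfolding a
 using h(1,2,5) par x a c other(3)[OF x(2) c(2)] unfolding \<sigma>_def pos_def h(4) by (simp add: h(4))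
 next
 case b
 then have c: "crosses D e x" "x ~= e" using that x crosses_sym by auto
 note h = half_crosses(1-6)[OF c(1)]
 have "crosses D' x (half e x)" using h(1) D'.crosses_sym by blast
 moreover have "cut_at e n s0 (x, param D (x, e)) = (x, param D (x, e))" using c by (simp add: cut_at_def)
 ultimately show ?thesis unfolding b
 using h(3,6) par x b c other(3)[OF x(1) c(2)] unfolding \<sigma>_def pos_def h(4) by (simp add: h(4))
 next
 case c
 have "crosses D' x y" using that crosses_other x c by simp
 moreover have "param D' (x, y) = param D (x, y)" using param_other x c by simp
 ultimately show ?thesis
 using par other(3)[OF x(1) c(1)] other(3)[OF x(2) c(2)] c
 unfolding \<sigma>_def pos_def half_other[OF c(1)] half_other[OF c(2)]
 by (simp add: half_other[OF c(1)] half_other[OF c(2)] cut_at_def)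
 qed
 qed
 have \<sigma>_surj: "(x, y) = \<sigma> (par x, par y)" if c: "crosses D' x y" "crosses D (par x) (par y)" for x y
 proof -
 have p: "par x ~= par y" using ov_edges[OF c(2)] by simp
 consider "par x = e" | "par y = e" | "par x ~= e" "par y ~= e" by blast
 then show ?thesis
 proof cases
 case 1
 then have y: "y ~= e" "y ~= n" using p by (auto split: if_splits)
 then have "x = half e y" using half_crosses(7)[of y x] c 1 by (auto split: if_splits)
 then show ?thesis using 1 y half_other unfolding \<sigma>_def by simp
 next
 case 2
 then have x: "x ~= e" "x ~= n" using p by (auto split: if_splits)
 have "crosses D e x" "crosses D' y x" using c 2 x crosses_sym D'.crosses_sym by auto
 then have "y = half e x" using half_crosses(7)[of x y] 2 by (auto split: if_splits)
 then show ?thesis using 2 x half_other unfolding \<sigma>_def by simp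
 next
 case 3
 then have "x ~= e" "x ~= n" "y ~= e" "y ~= n" by (auto split: if_splits)
 then show ?thesis using half_other unfolding \<sigma>_def by simp
 qed
 qed
 have O: "over D' = \<sigma> ` over D"
 proof
 show "over D' \<subseteq> \<sigma> ` over D"
 proof
 fix c assume "c \<in> over D'"
 then obtain x y where xy: "c = (x, y)" "crosses D' x y" "(par x, par y) \<in> over D" unfolding ov by auto
 then show "c \<in> \<sigma> ` over D" using \<sigma>_surj[OF xy(2) over_crosses[OF xy(3)]] by blast
 qed
 show "\<sigma> ` over D \<subseteq> over D'"
 proof
 fix c assume "c \<in> \<sigma> ` over D"
 then obtain x y where xy: "(x, y) \<in> over D" "c = \<sigma> (x, y)" by auto
 then show "c \<in> over D'" using \<sigma>[OF over_crosses[OF xy(1)]] unfolding ov by (simp add: \<sigma>_def)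
 qed
 qed
 have swap: "prod.swap (\<sigma> c) = \<sigma> (prod.swap c)" for c by (cases c) (simp add: \<sigma>_def)
 have P: "passages D' = \<sigma> ` passages D"
 proof -
 have c: "R\<inverse> = prod.swap ` R" for R :: "(nat \<times> nat) set" by force
 show ?thesis unfolding passages_def c O image_Un image_image swap ..
 qed
 have pp: "pos D' (\<sigma> Q) = cut_at e n s0 (pos D Q)" if "Q \<in> passages D" for Q
 using \<sigma>[OF passage_crosses, of "fst Q" "snd Q"] that by simp
 let ?X = "(%(u, v). (pos D (u, v), pos D (v, u), q (u, v))) ` over D"
 have sx: "(%(u, v). (pos D' (u, v), pos D' (v, u), q (par u, par v))) ` over D' =
 (%(x, y, p). (cut_at e n s0 x, cut_at e n s0 y, p)) ` ?X"
 unfolding O image_image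
 proof (intro image_cong refl)
 fix c assume c: "c \<in> over D"
 obtain x y where xy: "c = (x, y)" by (cases c)
 have "crosses D x y" "crosses D y x" using over_crosses c crosses_sym xy by blast+
 from \<sigma>[OF this(1)] \<sigma>[OF this(2)]
 show "(case \<sigma> c of (u, v) => (pos D' (u, v), pos D' (v, u), q (par u, par v))) =
 (case (case c of (u, v) => (pos D (u, v), pos D (v, u), q (u, v))) of
 (x, y, p) => (cut_at e n s0 x, cut_at e n s0 y, p))"
 by (simp add: xy \<sigma>_def)
 qed
 have eX: "ends ?X \<subseteq> nodes D" using ends_xings_nodes unfolding xings_def by (auto simp: ends_def)
 let ?M = "insert (e, s0) (nodes D)"
 have N: "nodes D' = cut_at e n s0 ` ?M"
 proof -
 have "cut_at e n s0 (x, 0) = (x, 0)" for x using s0 by (auto simp: cut_at_def)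
 moreover have "cut_at e n s0 (e, s0) = (n, 0)" by (simp add: cut_at_def)
 moreover have "pos D' ` passages D' = cut_at e n s0 ` pos D ` passages D"
 unfolding P image_image using pp by (intro image_cong refl) auto
 ultimately show ?thesis unfolding nodes_def image_insert image_Un image_image vertex_added_axioms D'(1) by auto
 qed
 have pos': "positions (edges D) (nxt D) ?M" by (rule positions_insert[OF positions_nodes]) (use e s0 in auto)
 have "psum t (nxt D') (nodes D') ((%(u, v). (pos D' (u, v), pos D' (v, u), q (par u, par v))) ` over D') = psum t (nxt D) ?M ?X"
 unfolding N D'(2)
 by (rule psum_cut[OF pos', symmetric]) (use e n s0 eX sx in auto)
 also have "\<dots> = psum t (nxt D) (nodes D) ?X"
 by (rule psum_mono[OF positions_nodes pos' _ eX]) auto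
 finally show "psum t (nxt D') (nodes D') ((%(u, v). (pos D' (u, v), pos D' (v, u), q (par u, par v))) ` over D') =
 psum t (nxt D) (nodes D) ?X" .
 have inv: "map_prod par par (\<sigma> c) = c & positive D' (\<sigma> c) = positive D c" if "c \<in> over D" for c
 using \<sigma>[OF over_crosses, of "fst c" "snd c"] that by (cases c) (simp add: \<sigma>_def positive_def)
 show "inj_on (map_prod par par) (over D')"
 unfolding O by (rule inj_on_inverseI[of _ \<sigma>]) (use inv in auto)
 show "map_prod par par c \<in> over D & positive D' c = positive D (map_prod par par c)" if "c \<in> over D'" for c
 using inv that unfolding O by auto
qed

lemma Z_subdivision:
 assumes D: "vdiagram D" and D': "vdiagram D'" and r: "subdivision D D'"
 shows "Z t D' = Z t D"
proof -
 interpret diagram D by (rule diagramI[OF D])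
 obtain e n z where e: "e \<in> edges D" "n \<notin> edges D" "z \<in> open_segment (src D e) (tgt D e)" and
 sp: "D' = split e n z D"
 using r unfolding subdivision_def by blast
 obtain s0 where s0: "0 < s0" "s0 < 1" "z = pt D e s0"
 using e mem_open_seg[OF src_ne_tgt[OF e(1)]] by auto
 note s = psum_split[OF D D' e(1,2) s0(1,2) sp[unfolded s0(3)]]
 have "xings D' = (%(u, v). (pos D' (u, v), pos D' (v, u), positive D ((id(n := e)) u, (id(n := e)) v))) ` over D'"
 unfolding xings_def using s(3) by (intro image_cong refl) auto
 then show ?thesis using s(1)[of t "positive D"] unfolding Z_def xings_def[of D] by simp
qed

end

section \<open>The first Reidemeister move\<close>

lemma positions_Un:
 assumes "positions E nx M" "finite P" "\<And>e s. (e, s) \<in> P ==> e \<in> E & 0 <= s & s < 1"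
 shows "positions E nx (M \<union> P)"
 using assms unfolding positions_def by auto

lemma positions_cut:
 assumes p: "positions E nx M" and e: "e \<in> E" "n \<notin> E" "0 < s0" "s0 < 1" "(e, s0) \<in> M"
 shows "positions (insert n E) (nx(e := n, n := nx e)) (cut_at e n s0 ` M)"
 unfolding positions_def
proof (intro conjI)
 have b: "inj_on nx E" "nx ` E = E" using p by (auto simp: positions_def bij_betw_def)
 have ne: "nx x ~= n" if "x \<in> E" for x using b(2) that e(2) by auto
 let ?nx = "nx(e := n, n := nx e)"
 have "inj_on ?nx (insert n E)"
 proof (rule inj_onI)
 fix x y assume "x \<in> insert n E" "y \<in> insert n E" "?nx x = ?nx y"
 then show "x = y" using ne[of x] ne[of y] ne[OF e(1)] e(1,2) inj_onD[OF b(1), of x y]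
 inj_onD[OF b(1), of e y] inj_onD[OF b(1), of x e] by (auto split: if_splits)
 qed
 moreover have "?nx ` insert n E = insert n E"
 proof
 show "?nx ` insert n E \<subseteq> insert n E" using b(2) e by auto
 show "insert n E \<subseteq> ?nx ` insert n E"
 proof
 fix y assume "y \<in> insert n E"
 then consider "y = n" | "y = nx e" | x where "x \<in> E" "x ~= e" "y = nx x" using b(2) by blast
 then show "y \<in> ?nx ` insert n E"
 proof cases
 case 1
 then show ?thesis using e by (intro image_eqI[of _ _ e]) auto
 next
 case 2
 then show ?thesis by (intro image_eqI[of _ _ n]) auto
 next
 case 3
 then show ?thesis using e by (intro image_eqI[of _ _ x]) auto
 qed
 qed
 qed
 ultimately show "bij_betw ?nx (insert n E) (insert n E)" by (simp add: bij_betw_def)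
 show "finite (cut_at e n s0 ` M)" using p by (simp add: positions_def)
 show "\<forall>x\<in>insert n E. (x, 0) \<in> cut_at e n s0 ` M"
 proof
 fix x assume "x \<in> insert n E"
 then show "(x, 0) \<in> cut_at e n s0 ` M"
 proof
 assume "x = n"
 then show ?thesis using e by (intro image_eqI[of _ _ "(e, s0)"]) (auto simp: cut_at_def)
 next
 assume "x \<in> E"
 then show ?thesis using e p by (intro image_eqI[of _ _ "(x, 0)"]) (auto simp: cut_at_def positions_def)
 qed
 qed
 show "\<forall>v\<in>cut_at e n s0 ` M. case v of (a, s) => a \<in> insert n E & 0 <= s & s < 1"
 proof
 fix v assume "v \<in> cut_at e n s0 ` M"
 then obtain a s where as: "(a, s) \<in> M" "v = cut_at e n s0 (a, s)" by auto
 then show "case v of (a, s) => a \<in> insert n E & 0 <= s & s < 1"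
 using positionsD(1)[OF p as(1)] e by (auto simp: cut_at_def field_simps)
 qed
qed

text \<open>The crossing would lie in the convex set \<open>C\<close>, hence at an end of
  \<open>e\<close> by the assumption on the disk, while crossings are interior points of their
  edges.\<close>

lemma (in generic_diagram) meets_only_no_crossing:
 assumes m: "meets_only D F C {src D e, tgt D e}" and C: "convex C" "src D e \<in> C" "tgt D e \<in> C"
 and y: "crosses D e y" "y \<notin> F"
 shows False
proof -
 let ?z = "pt D e (param D (e, y))"
 have y': "y \<in> edges D" "e \<in> edges D" "crosses D y e" using y(1) crosses_sym by (auto simp: crosses_def)
 have "?z \<in> seg D e" using param(1,2)[OF y(1)] by (intro pt_in_seg) auto
 then have "?z \<in> C" using closed_segment_subset[OF C(2,3,1)] by (auto simp: seg_def)
 moreover have "?z \<in> seg D y" unfolding param(3)[OF y(1)] using param(1,2)[OF y'(3)] by (intro pt_in_seg) auto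
 ultimately have "?z \<in> {src D e, tgt D e}" using m y(2) y'(1) unfolding meets_only_def by blast
 then have "?z = pt D e 0 \<or> ?z = pt D e 1" by simp
 then have "param D (e, y) = 0 \<or> param D (e, y) = 1" unfolding pt_inj[OF y'(2)] .
 then show False using param(1,2)[OF y(1)] by auto
qed

context bracket_model
begin

text \<open>The curl is first realized on the straight edge by two consecutive nodes of
  \<open>e\<close> that are declared to be a crossing. Cutting \<open>e\<close> twice then produces
  the three edges of the loop.\<close>

lemma Z_R1:
 assumes D: "vdiagram D" and D': "vdiagram D'" and r: "reidemeister1 D D'"
 shows "\<exists>c. c ~= 0 & (\<forall>t. Z t D' = c * Z t D)"
proof -
 obtain e n m c d R where e: "e \<in> edges D" "n \<notin> edges D" "m \<notin> edges D" "n ~= m" and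
 mo: "meets_only D {e} (convex hull {src D e, c, d, tgt D e}) {src D e, tgt D e}" and
 R: "R \<in> {{(e, m)}, {(m, e)}}" and
 eq: "D' = (add_vertex n m d (add_vertex e n c D))\<lparr>over := over D \<union> R\<rparr>" and cr: "crosses D' e m"
 using r unfolding reidemeister1_def Let_def by metis
 interpret diagram D by (rule diagramI[OF D])
 interpret D': diagram D' by (rule diagramI[OF D'])
 have E: "edges D' = insert m (insert n (edges D))" "over D' = over D \<union> R" "vpos D' = (vpos D)(n := c, m := d)"
 "nxt D' = ((nxt D)(e := n, n := nxt D e))(n := m, m := ((nxt D)(e := n, n := nxt D e)) n)"
 by (simp_all add: eq add_vertex_def)
 have nxt_new: "nxt D x ~= n" "nxt D x ~= m" if "x \<in> edges D" for x using nxt_in[OF that] e by auto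
 have st: "src D' x = src D x" "tgt D' x = tgt D x" if "x \<in> edges D" "x ~= e" for x
 using that e nxt_new[OF that(1)] by (auto simp: src_def tgt_def E)
 have ne: "~ crosses D e y" for y
 by (rule notI, rule meets_only_no_crossing[OF mo, of y]) (auto simp: hull_inc crosses_def)
 have inP: "x \<in> edges D & y \<in> edges D & x ~= e & y ~= e" if "(x, y) \<in> passages D" for x y
 using passage_crosses[OF that] ne[of x] ne[of y] crosses_sym[of x y] by (auto simp: crosses_def)
 have pp: "pos D' Q = pos D Q" if "Q \<in> passages D" for Q
 using inP[of "fst Q" "snd Q"] that st by (cases Q) (auto simp: pos_def intro!: param_cong)
 define \<alpha> \<beta> where ab: "\<alpha> = param D' (e, m)" "\<beta> = param D' (m, e)"
 have cr': "crosses D' m e" using cr D'.crosses_sym by blast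
 have ab_pos: "0 < \<alpha>" "\<alpha> < 1" "0 < \<beta>" "\<beta> < 1"
 using D'.param(1,2)[OF cr] D'.param(1,2)[OF cr'] by (simp_all add: ab)
 have P: "passages D' = passages D \<union> {(e, m), (m, e)}" using R by (auto simp: passages_def E)
 have N: "nodes D' = nodes D \<union> {(n, 0), (m, 0), (e, \<alpha>), (m, \<beta>)}"
 unfolding nodes_def P E(1) image_Un using pp by (auto simp: ab pos_def)
 have Ne: "(e, s) \<in> nodes D \<longleftrightarrow> s = 0" for s
 using e by (auto simp: nodes_def pos_def dest!: inP)
 have nm: "(n, s) \<notin> nodes D" "(m, s) \<notin> nodes D" for s
 using positionsD(1)[OF positions_nodes] e by blast+
 \<comment> \<open>The two cuts at one half send \<open>(e, \<alpha> / 2)\<close> to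
   \<open>(e, \<alpha>)\<close>, and \<open>(e, 3 / 4 + \<beta> / 4)\<close> first to
   \<open>(n, 1 / 2 + \<beta> / 2)\<close> and then to \<open>(m, \<beta>)\<close>.\<close>
 define p q where pq: "p = (e, \<alpha> / 2)" "q = (e, 3 / 4 + \<beta> / 4)"
 define b where "b = positive D' (if R = {(e, m)} then (e, m) else (m, e))"
 define Y where "Y = (if R = {(e, m)} then {(p, q, b)} else {(q, p, b)})"
 define M1 where "M1 = nodes D \<union> {p, q}"
 define M2 where "M2 = M1 \<union> {(e, 1/2), (e, 3/4)}"
 have pos1: "positions (edges D) (nxt D) M1"
 unfolding M1_def by (rule positions_Un[OF positions_nodes]) (use ab_pos e in \<open>auto simp: pq\<close>)
 have pos2: "positions (edges D) (nxt D) M2"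
 unfolding M2_def by (rule positions_Un[OF pos1]) (use e in auto)
 note f1 = positions_finite[OF pos1]
 have scp: "nsucc (nxt D) M1 p = q" unfolding pq
 by (rule nsucc_same_edge[OF pos1]) (use ab_pos in \<open>auto simp: M1_def pq Ne\<close>)
 have nn: "p \<notin> nodes D" "q \<notin> nodes D" using ab_pos by (simp_all add: pq Ne)
 have sub: "nodes D \<subseteq> M1" by (auto simp: M1_def)
 have "state_sum t M1 (nsucc (nxt D) M1) (xings D \<union> Y) =
 (if b then - (A ^ 3) else - (inverse A ^ 3)) * state_sum t M1 (nsucc (nxt D) M1) (xings D)" for t
 proof (rule state_sum_R1[of _ _ _ p])
 show "nsucc (nxt D) M1 p ~= p" using scp ab_pos by (simp add: pq)
 show "nsucc (nxt D) M1 (nsucc (nxt D) M1 p) ~= nsucc (nxt D) M1 p"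
 unfolding scp unfolding pq by (rule nsucc_ne[OF pos1]) (use ab_pos in \<open>auto simp: M1_def pq\<close>)
 show "ends (xings D) \<subseteq> M1 - {p, nsucc (nxt D) M1 p}"
 unfolding scp using ends_xings_nodes nn by (auto simp: M1_def)
 qed (use scp f1 nsucc_image[OF pos1] inj_nsucc[OF pos1] finite_xings in \<open>auto simp: Y_def M1_def\<close>)
 then have s1: "psum t (nxt D) M1 (xings D \<union> Y) = (if b then - (A ^ 3) else - (inverse A ^ 3)) * Z t D" for t
 using psum_mono[OF positions_nodes pos1 sub ends_xings_nodes, of t] unfolding psum_def Z_def by simp
 have eY: "ends (xings D \<union> Y) \<subseteq> M1" using ends_xings_nodes by (auto simp: ends_Un Y_def M1_def)
 have s2: "psum t (nxt D) M2 (xings D \<union> Y) = psum t (nxt D) M1 (xings D \<union> Y)" for t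
 by (rule psum_mono[OF pos1 pos2 _ eY]) (auto simp: M2_def)
 let ?h1 = "cut_at e n (1/2)" and ?h2 = "cut_at n m (1/2)"
 let ?nx = "(nxt D)(e := n, n := nxt D e)"
 let ?X1 = "(%(x, y, p). (?h1 x, ?h1 y, p)) ` (xings D \<union> Y)"
 have m2: "(e, 1/2) \<in> M2" by (simp add: M2_def)
 have eY2: "ends (xings D \<union> Y) \<subseteq> M2" using eY by (auto simp: M2_def)
 have s3: "psum t (nxt D) M2 (xings D \<union> Y) = psum t ?nx (?h1 ` M2) ?X1" for t
 by (rule psum_cut[OF pos2 e(1,2) _ _ m2 eY2 refl]) auto
 have pos3: "positions (insert n (edges D)) ?nx (?h1 ` M2)"
 by (rule positions_cut[OF pos2 e(1,2) _ _ m2]) auto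
 have ends_map: "ends ((%(x, y, p). (h x, h y, p)) ` X) = h ` ends X" for h :: "nat \<times> real => nat \<times> real" and X
 by (force simp: ends_def)
 have m3: "(n, 1/2) \<in> ?h1 ` M2"
 by (rule image_eqI[of _ _ "(e, 3/4)"]) (auto simp: M2_def cut_at_def)
 have s4: "psum t ?nx (?h1 ` M2) ?X1 = psum t (nxt D') (?h2 ` ?h1 ` M2) ((%(x, y, p). (?h2 x, ?h2 y, p)) ` ?X1)" for t
 unfolding E(4) by (rule psum_cut[OF pos3 _ _ _ _ m3 _ refl]) (use e eY2 in \<open>auto simp: ends_map\<close>)
 have ne': "e ~= n" "e ~= m" using e by auto
 have h: "?h2 (?h1 p) = (e, \<alpha>)" "?h2 (?h1 q) = (m, \<beta>)" "?h2 (?h1 (e, 1/2)) = (n, 0)" "?h2 (?h1 (e, 3/4)) = (m, 0)"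
 using ab_pos ne' by (simp_all add: pq cut_at_def field_simps)
 have hid: "?h2 (?h1 v) = v" if "v \<in> nodes D" for v
 proof -
 have "fst v ~= n" using nm(1)[of "snd v"] that by (metis prod.collapse)
 moreover have "fst v = e --> snd v = 0" using Ne[of "snd v"] that by (metis prod.collapse)
 ultimately show ?thesis by (auto simp: cut_at_def prod_eq_iff ne')
 qed
 have N': "?h2 ` ?h1 ` M2 = nodes D'"
 proof -
 have "?h2 ` ?h1 ` nodes D = nodes D" using hid by (force simp: image_iff)
 then show ?thesis unfolding N M2_def M1_def image_Un by (auto simp: h)
 qed
 have X': "(%(x, y, p). (?h2 x, ?h2 y, p)) ` ?X1 = xings D'"
 proof -
 have "(%(x, y, p). (?h2 x, ?h2 y, p)) ` (%(x, y, p). (?h1 x, ?h1 y, p)) ` xings D =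
 (%(e, f). (pos D' (e, f), pos D' (f, e), positive D' (e, f))) ` over D"
 unfolding xings_def image_image
 proof (intro image_cong refl)
 fix c assume c: "c \<in> over D"
 obtain x y where xy: "c = (x, y)" by (cases c)
 have P: "(x, y) \<in> passages D" "(y, x) \<in> passages D" using c xy by (auto simp: passages_def)
 then have "pos D (x, y) \<in> nodes D" "pos D (y, x) \<in> nodes D" by (auto simp: nodes_def)
 from this[THEN hid] show "(case (case (case c of (e, f) => (pos D (e, f), pos D (f, e), positive D (e, f))) of
 (x, y, p) => (?h1 x, ?h1 y, p)) of (x, y, p) => (?h2 x, ?h2 y, p)) =
 (case c of (e, f) => (pos D' (e, f), pos D' (f, e), positive D' (e, f)))"
 using inP[OF P(1)] st by (simp add: xy pp P positive_def direction_def)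
 qed
 moreover have "(%(x, y, p). (?h2 x, ?h2 y, p)) ` (%(x, y, p). (?h1 x, ?h1 y, p)) ` Y =
 (%(e, f). (pos D' (e, f), pos D' (f, e), positive D' (e, f))) ` R"
 using R ne' by (auto simp: Y_def h b_def pos_def ab)
 ultimately show ?thesis unfolding xings_def E(2) image_Un by simp
 qed
 have "Z t D' = (if b then - (A ^ 3) else - (inverse A ^ 3)) * Z t D" for t
 using s1[of t] s2[of t] s3[of t] s4[of t] unfolding N' X' by (simp add: Z_def)
 moreover have "(if b then - (A ^ 3) else - (inverse A ^ 3)) ~= 0" using A_nz by simp
 ultimately show ?thesis by blast
qed

end

section \<open>The second Reidemeister move\<close>

lemma pt_between:
 assumes "lo <= s" "s <= hi" "lo < hi"
 shows "pt D f s \<in> closed_segment (pt D f lo) (pt D f hi)"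
proof -
 define u where "u = (s - lo) / (hi - lo)"
 have "u * (hi - lo) = s - lo" using assms by (simp add: u_def)
 moreover have "(1 - u) * lo + u * hi = lo + u * (hi - lo)" by (simp add: algebra_simps)
 ultimately have s: "s = (1 - u) * lo + u * hi" by simp
 have u: "0 <= u" "u <= 1" using assms by (auto simp: u_def field_simps)
 have "pt D f s = (1 - u) *\<^sub>R pt D f lo + u *\<^sub>R pt D f hi"
 unfolding s by (simp add: pt_def scaleR_conv_of_real algebra_simps)
 then show ?thesis using u by (auto simp: in_segment)
qed

text \<open>The left-hand sides are signed distances from the line through \<open>y\<close>, up to
  scale: affine along \<open>x\<close> and zero at the crossing. Evaluating them at a vertex shared
  by two edges relates the signs of the crossings of these edges with \<open>y\<close>.\<close>

lemma (in generic_diagram) side_src_tgt: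
 assumes "crosses D x y"
 shows "det2 (src D x - src D y) (direction D y) = - param D (x, y) * det2 (direction D x) (direction D y)"
 "det2 (tgt D x - src D y) (direction D y) = (1 - param D (x, y)) * det2 (direction D x) (direction D y)"
proof -
 have e: "src D x - src D y = complex_of_real (param D (y, x)) * direction D y - complex_of_real (param D (x, y)) * direction D x"
 using param(3)[OF assms] by (simp add: pt_def algebra_simps)
 then show 1: "det2 (src D x - src D y) (direction D y) = - param D (x, y) * det2 (direction D x) (direction D y)"
 by (simp only: e det2_add det2_simps)
 have "tgt D x - src D y = (src D x - src D y) + direction D x" by (simp add: direction_def)
 then show "det2 (tgt D x - src D y) (direction D y) = (1 - param D (x, y)) * det2 (direction D x) (direction D y)"
 unfolding \<open>tgt D x - src D y = _\<close> det2_add(1) 1 by (simp add: algebra_simps)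
qed

text \<open>A node of \<open>f\<close> in the disk would lie on an edge that meets the disk at most
  in the ends of \<open>e\<close>, and by genericity these are not interior points of
  \<open>f\<close>.\<close>

lemma (in diagram) foreign_node:
 assumes s: "(f, s) \<in> nodes D" "s ~= 0" and e: "e \<in> edges D" "e ~= f"
 and mo: "meets_only D F C {src D e, tgt D e}"
 and F: "\<And>g. g \<in> F ==> (f, g) \<in> passages D ==> param D (f, g) ~= s"
 shows "pt D f s \<notin> C"
proof
 assume C: "pt D f s \<in> C"
 obtain g where g: "(f, g) \<in> passages D" "s = param D (f, g)" using s by (auto simp: nodes_def pos_def)
 have c: "crosses D f g" "crosses D g f" using passage_crosses[OF g(1)] crosses_sym by auto
 have fg: "f \<in> edges D" "g \<in> edges D" "0 < s" "s < 1"
 using c param(1,2)[OF c(1)] g(2) by (auto simp: crosses_def)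
 have "pt D f s \<in> seg D g"
 unfolding g(2) param(3)[OF c(1)] using param(1,2)[OF c(2)] by (intro pt_in_seg) auto
 then have "pt D f s \<in> {src D e, tgt D e}" using mo C fg F g unfolding meets_only_def by blast
 moreover have "pt D f s \<in> seg D f" using fg by (intro pt_in_seg) auto
 ultimately show False
 proof (elim insertE emptyE)
 assume a: "pt D f s = src D e" "pt D f s \<in> seg D f"
 then have "nxt D f = e" using vertex_on_edge[OF e(1) fg(1)] e by auto
 then have "pt D f s = pt D f 1" using a by (simp add: tgt_src)
 then have "s = 1" unfolding pt_inj[OF fg(1)] .
 then show False using fg by simp
 next
 assume a: "pt D f s = tgt D e" "pt D f s \<in> seg D f"
 then have "f = nxt D e" using tgt_on_edge[OF e(1) fg(1)] e by auto
 then have "pt D f s = pt D f 0" using a by (simp add: tgt_src)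
 then have "s = 0" unfolding pt_inj[OF fg(1)] .
 then show False using fg by simp
 qed
qed

lemma ends_map: "ends ((%(x, y, p). (h x, h y, p)) ` X) = h ` ends X"
 by (force simp: ends_def)

context bracket_model
begin

text \<open>As for the first move, the new crossings are placed on the unchanged edges
  \<open>e\<close> and \<open>f\<close>, where \<open>state_sum_R2\<close> applies, and then
  \<open>e\<close> is cut at the corner \<open>z\<close>.\<close>

lemma Z_R2:
 assumes D: "vdiagram D" and D': "vdiagram D'" and r: "reidemeister2 D D'"
 shows "Z t D' = Z t D"
proof -
 obtain e f n z R where ef: "e \<in> edges D" "f \<in> edges D" "e ~= f" "n \<notin> edges D" and
 mo: "meets_only D {e, f} (convex hull {src D e, z, tgt D e}) {src D e, tgt D e}" and
 nc: "~ crosses D e f" and R: "R \<in> {{(e, f), (n, f)}, {(f, e), (f, n)}}" and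
 eq: "D' = (add_vertex e n z D)\<lparr>over := over D \<union> R\<rparr>" and cr: "crosses D' e f" "crosses D' n f"
 using r unfolding reidemeister2_def Let_def by metis
 interpret diagram D by (rule diagramI[OF D])
 interpret D': diagram D' by (rule diagramI[OF D'])
 have E: "over D' = over D \<union> R" by (simp add: eq)
 interpret vertex_added D D' e n z
 by unfold_locales (use ef in \<open>auto simp: eq add_vertex_def\<close>)
 let ?C = "convex hull {src D e, z, tgt D e}"
 have nf: "n ~= f" "f ~= n" using ef by auto
 have no: "~ crosses D e y" for y
 proof
 assume y: "crosses D e y"
 then have "y \<notin> {e, f}" using nc by (auto simp: crosses_def)
 then show False by (intro meets_only_no_crossing[OF mo _ _ _ y]) (auto simp: hull_inc)
 qed
 have inP: "x \<in> edges D & y \<in> edges D & x ~= e & y ~= e" if "(x, y) \<in> passages D" for x y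
 using passage_crosses[OF that] no[of x] no[of y] crosses_sym[of x y] by (auto simp: crosses_def)
 have pp: "pos D' Q = pos D Q" if "Q \<in> passages D" for Q
 using inP[of "fst Q" "snd Q"] that param_other by (cases Q) (auto simp: pos_def)
 have cr': "crosses D' f e" "crosses D' f n" using cr D'.crosses_sym by auto
 define \<alpha> \<beta> \<phi>1 \<phi>2 where ab: "\<alpha> = param D' (e, f)" "\<beta> = param D' (n, f)" "\<phi>1 = param D' (f, e)" "\<phi>2 = param D' (f, n)"
 have ab_pos: "0 < \<alpha>" "\<alpha> < 1" "0 < \<beta>" "\<beta> < 1" "0 < \<phi>1" "\<phi>1 < 1" "0 < \<phi>2" "\<phi>2 < 1"
 using D'.param(1,2)[OF cr(1)] D'.param(1,2)[OF cr(2)] D'.param(1,2)[OF cr'(1)] D'.param(1,2)[OF cr'(2)] by (simp_all add: ab)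
 have \<phi>12: "\<phi>1 ~= \<phi>2" using D'.param_inj[OF cr'] ne by (auto simp: ab)
 have P: "passages D' = passages D \<union> {(e, f), (f, e), (n, f), (f, n)}" using R by (auto simp: passages_def E)
 have N: "nodes D' = nodes D \<union> {(n, 0), (e, \<alpha>), (n, \<beta>), (f, \<phi>1), (f, \<phi>2)}"
 unfolding nodes_def P D'(1) image_Un using pp by (auto simp: ab pos_def)
 have Ne: "(e, s) \<in> nodes D \<longleftrightarrow> s = 0" for s
 using ef by (auto simp: nodes_def pos_def dest!: inP)
 have nm: "(n, s) \<notin> nodes D" for s
 using positionsD(1)[OF positions_nodes] ef by blast
 define lo hi where lh: "lo = min \<phi>1 \<phi>2" "hi = max \<phi>1 \<phi>2"
 have lh': "0 < lo" "lo < hi" "hi < 1" using ab_pos \<phi>12 by (auto simp: lh)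
 have f_other: "pt D' f = pt D f" using other(1) ef by auto
 have sub1: "seg D' e \<subseteq> ?C" "seg D' n \<subseteq> ?C"
 unfolding seg_def src_tgt by (rule closed_segment_subset; simp add: hull_inc)+
 have "pt D f \<phi>1 \<in> ?C" "pt D f \<phi>2 \<in> ?C"
 using subsetD[OF sub1(1), OF pt_in_seg[of \<alpha> D' e]] subsetD[OF sub1(2), OF pt_in_seg[of \<beta> D' n]] ab_pos
 D'.param(3)[OF cr(1)] D'.param(3)[OF cr(2)]
 unfolding ab f_other by simp_all
 then have "pt D f lo \<in> ?C" "pt D f hi \<in> ?C" by (auto simp: lh min_def max_def)
 then have sub2: "closed_segment (pt D f lo) (pt D f hi) \<subseteq> ?C" by (intro closed_segment_subset) auto
 \<comment> \<open>By convexity the part of \<open>f\<close> between the two new crossings lies in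
   the disk, where \<open>f\<close> has no other node. So the two new nodes will be consecutive on
   \<open>f\<close>.\<close>
 have out: "s < lo \<or> hi < s" if s: "(f, s) \<in> nodes D" for s
 proof (rule ccontr)
 assume "~ ?thesis"
 then have b: "lo <= s" "s <= hi" by auto
 have "pt D f s \<notin> ?C"
 by (rule foreign_node[OF s _ ef(1,3) mo]) (use b lh' inP[of f] in \<open>auto simp: crosses_def dest!: passage_crosses\<close>)
 then show False using pt_between[OF b lh'(2)] sub2 by auto
 qed
 \<comment> \<open>The edge \<open>e\<close> of \<open>D'\<close> ends and \<open>n\<close> starts
   at \<open>z\<close>. Expressing the signed distance of \<open>z\<close> from \<open>f\<close> in
   both ways shows that the path crosses \<open>f\<close> forth and back.\<close>
 have sign: "positive D' (n, f) \<longleftrightarrow> ~ positive D' (e, f)" "positive D' (f, n) \<longleftrightarrow> ~ positive D' (f, e)"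
 proof -
 let ?de = "det2 (direction D' e) (direction D' f)" and ?dn = "det2 (direction D' n) (direction D' f)"
 have "(1 - \<alpha>) * ?de = - \<beta> * ?dn"
 using D'.side_src_tgt(2)[OF cr(1)] D'.side_src_tgt(1)[OF cr(2)] by (simp add: src_tgt ab)
 moreover have "?de ~= 0" "?dn ~= 0" using D'.crosses_det[OF cr(1)] D'.crosses_det[OF cr(2)] by auto
 ultimately have "?de > 0 \<longleftrightarrow> ~ ?dn > 0"
 using ab_pos by (smt (verit) mult_pos_pos mult_pos_neg mult_minus_left)
 then show "positive D' (n, f) \<longleftrightarrow> ~ positive D' (e, f)" "positive D' (f, n) \<longleftrightarrow> ~ positive D' (f, e)"
 using \<open>?de ~= 0\<close> \<open>?dn ~= 0\<close> det2_swap[of "direction D' f"] by (auto simp: positive_def)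
 qed
 define p1 p2 where pq: "p1 = (e, \<alpha> / 2)" "p2 = (e, 1 / 2 + \<beta> / 2)"
 define M1 where "M1 = nodes D \<union> {p1, p2, (f, lo), (f, hi)}"
 define M2 where "M2 = M1 \<union> {(e, 1/2)}"
 have pos1: "positions (edges D) (nxt D) M1"
 unfolding M1_def by (rule positions_Un[OF positions_nodes]) (use ab_pos lh' ef in \<open>auto simp: pq\<close>)
 have pos2: "positions (edges D) (nxt D) M2"
 unfolding M2_def by (rule positions_Un[OF pos1]) (use ef in auto)
 have sc1: "nsucc (nxt D) M1 p1 = p2" unfolding pq
 by (rule nsucc_same_edge[OF pos1]) (use ab_pos ef in \<open>auto simp: M1_def pq Ne\<close>)
 have sc2: "nsucc (nxt D) M1 (f, lo) = (f, hi)"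
 by (rule nsucc_same_edge[OF pos1]) (use lh' ef in \<open>auto simp: M1_def pq dest!: out\<close>)
 have new: "p1 \<notin> nodes D" "p2 \<notin> nodes D" "(f, lo) \<notin> nodes D" "(f, hi) \<notin> nodes D"
 using ab_pos out[of lo] out[of hi] lh' by (auto simp: pq Ne)
 define k where "k = (\<phi>1 < \<phi>2)"
 have kf: "(f, \<phi>1) = (if k then (f, lo) else (f, hi))" "(f, \<phi>2) = (if k then (f, hi) else (f, lo))"
 using \<phi>12 by (auto simp: k_def lh)
 \<comment> \<open>If \<open>f\<close> is the upper strand, it takes the role of the first strand of
   \<open>state_sum_R2\<close>. Its first crossing then is the one with \<open>e\<close> if
   \<open>k\<close> holds and otherwise the one with \<open>n\<close>, of opposite sign.\<close>
 define Y where "Y = (if R = {(e, f), (n, f)}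
 then {(p1, if k then (f, lo) else (f, hi), positive D' (e, f)), (p2, if k then (f, hi) else (f, lo), ~ positive D' (e, f))}
 else {((f, lo), if k then p1 else p2, positive D' (f, e) = k), ((f, hi), if k then p2 else p1, ~ (positive D' (f, e) = k))})"
 have nl: "nsucc (nxt D) M1 p2 ~= p2" "nsucc (nxt D) M1 (f, hi) ~= (f, hi)"
 unfolding pq by (rule nsucc_ne[OF pos1]; use ab_pos lh' in \<open>auto simp: M1_def pq\<close>)+
 have e1: "ends (xings D) \<subseteq> M1 - {p1, p2, (f, lo), (f, hi)}" using ends_xings_nodes new by (auto simp: M1_def)
 have dist: "distinct [p1, p2, (f, lo), (f, hi)]" using lh' ab_pos ef by (auto simp: pq)
 have mem: "p1 \<in> M1" "(f, lo) \<in> M1" by (simp_all add: M1_def)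
 note facts = positions_finite[OF pos1] finite_xings nsucc_image[OF pos1] inj_nsucc[OF pos1]
 have "state_sum t M1 (nsucc (nxt D) M1) (xings D \<union> Y) = state_sum t M1 (nsucc (nxt D) M1) (xings D)"
 proof (cases "R = {(e, f), (n, f)}")
 case True
 show ?thesis
 by (rule state_sum_R2[OF facts mem, where k=k and b="positive D' (e, f)"])
 (use dist nl e1 True in \<open>simp_all add: sc1 sc2 Y_def insert_commute\<close>)
 next
 case False
 show ?thesis
 by (rule state_sum_R2[OF facts mem(2,1), where k=k and b="positive D' (f, e) = k"])
 (use dist nl e1 False in \<open>auto simp add: sc1 sc2 Y_def\<close>)
 qed
 moreover have sub: "nodes D \<subseteq> M1" by (auto simp: M1_def)
 ultimately have s1: "psum t (nxt D) M1 (xings D \<union> Y) = Z t D"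
 using psum_mono[OF positions_nodes pos1 sub ends_xings_nodes, of t] unfolding psum_def Z_def by simp
 have eY: "ends (xings D \<union> Y) \<subseteq> M1" using ends_xings_nodes by (auto simp: ends_Un Y_def M1_def)
 have s2: "psum t (nxt D) M2 (xings D \<union> Y) = psum t (nxt D) M1 (xings D \<union> Y)"
 by (rule psum_mono[OF pos1 pos2 _ eY]) (auto simp: M2_def)
 let ?h = "cut_at e n (1/2)"
 let ?X = "(%(x, y, p). (?h x, ?h y, p)) ` (xings D \<union> Y)"
 have m2: "(e, 1/2) \<in> M2" by (simp add: M2_def)
 have eY2: "ends (xings D \<union> Y) \<subseteq> M2" using eY by (auto simp: M2_def)
 have s3: "psum t (nxt D) M2 (xings D \<union> Y) = psum t (nxt D') (?h ` M2) ?X"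
 unfolding D'(2) by (rule psum_cut[OF pos2 ef(1,4) _ _ m2 eY2 refl]) auto
 have h: "?h p1 = (e, \<alpha>)" "?h p2 = (n, \<beta>)" "?h (e, 1/2) = (n, 0)" "?h (f, s) = (f, s)" for s
 using ab_pos ef by (simp_all add: pq cut_at_def field_simps)
 have hid: "?h v = v" if "v \<in> nodes D" for v
 proof -
 have "fst v = e --> snd v = 0" using Ne[of "snd v"] that by (metis prod.collapse)
 then show ?thesis by (auto simp: cut_at_def prod_eq_iff)
 qed
 have lohi: "{(f, lo), (f, hi)} = {(f, \<phi>1), (f, \<phi>2)}" unfolding kf by auto
 have N': "?h ` M2 = nodes D'"
 proof -
 have "?h ` nodes D = nodes D" using hid by (force simp: image_iff)
 moreover have "M2 = nodes D \<union> {p1, p2, (e, 1/2)} \<union> {(f, lo), (f, hi)}" by (auto simp: M1_def M2_def)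
 ultimately show ?thesis unfolding N lohi image_Un by (auto simp: h)
 qed
 have X': "?X = xings D'"
 proof -
 have "(%(x, y, p). (?h x, ?h y, p)) ` xings D =
 (%(e, f). (pos D' (e, f), pos D' (f, e), positive D' (e, f))) ` over D"
 unfolding xings_def image_image
 proof (intro image_cong refl)
 fix c assume c: "c \<in> over D"
 obtain x y where xy: "c = (x, y)" by (cases c)
 have P: "(x, y) \<in> passages D" "(y, x) \<in> passages D" using c xy by (auto simp: passages_def)
 then have "pos D (x, y) \<in> nodes D" "pos D (y, x) \<in> nodes D" by (auto simp: nodes_def)
 from this[THEN hid] show "(case (case c of (e, f) => (pos D (e, f), pos D (f, e), positive D (e, f))) of
 (x, y, p) => (?h x, ?h y, p)) =
 (case c of (e, f) => (pos D' (e, f), pos D' (f, e), positive D' (e, f)))"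
 using inP[OF P(1)] other(3) by (simp add: xy pp P positive_def)
 qed
 moreover have "(%(x, y, p). (?h x, ?h y, p)) ` Y =
 (%(e, f). (pos D' (e, f), pos D' (f, e), positive D' (e, f))) ` R"
 proof (cases "R = {(e, f), (n, f)}")
 case True
 then show ?thesis using kf by (simp add: Y_def h pos_def sign flip: ab)
 next
 case False
 then have R': "R = {(f, e), (f, n)}" using R by auto
 show ?thesis using kf False by (cases k) (simp_all add: Y_def R' h pos_def sign insert_commute flip: ab)
 qed
 ultimately show ?thesis unfolding xings_def E image_Un by simp
 qed
 show ?thesis using s1 s2 s3 unfolding N' X' by (simp add: Z_def)
qed

end

section \<open>The third Reidemeister move: geometry of the triangle and exchange of the
  orders\<close>

lemma affine_pos_between:
 fixes c0 c1 :: real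
 assumes "0 < c0 + p * c1" "0 < c0 + r * c1" "p <= q & q <= r \<or> r <= q & q <= p"
 shows "0 < c0 + q * c1"
 using assms mult_right_mono[of p q c1] mult_right_mono[of q r c1] mult_right_mono[of r q c1] mult_right_mono[of q p c1]
 mult_right_mono_neg[of p q c1] mult_right_mono_neg[of q r c1] mult_right_mono_neg[of r q c1] mult_right_mono_neg[of q p c1]
 by (cases "c1 >= 0") linarith+

locale triangle = vertex_added +
 assumes nondeg: "det2 (direction D e) (z - src D e) ~= 0"
begin

text \<open>\<open>B\<close> and \<open>G\<close> are the barycentric coordinates belonging to the
  corners \<open>tgt D e\<close> and \<open>z\<close>, by Cramer's rule. The old edge lies on
  \<open>G p = 0\<close>, the two new edges on \<open>B p = 0\<close> and
  \<open>B p + G p = 1\<close>.\<close>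

definition B :: "complex => real" where
 "B p = det2 (p - src D e) (z - src D e) / det2 (direction D e) (z - src D e)"

definition G :: "complex => real" where
 "G p = det2 (direction D e) (p - src D e) / det2 (direction D e) (z - src D e)"

lemma barycentric: "p = src D e + complex_of_real (B p) * direction D e + complex_of_real (G p) * (z - src D e)"
proof -
 define u w q where d: "u = direction D e" "w = z - src D e" "q = p - src D e"
 have nz: "det2 u w ~= 0" using nondeg by (simp add: d)
 have "det2 q w * Re u + det2 u q * Re w = Re q * det2 u w" "det2 q w * Im u + det2 u q * Im w = Im q * det2 u w"
 by (simp_all add: det2_def algebra_simps)
 then have "Re q = det2 q w / det2 u w * Re u + det2 u q / det2 u w * Re w"
 "Im q = det2 q w / det2 u w * Im u + det2 u q / det2 u w * Im w"
 using nz by (simp_all add: field_simps)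
 then have "q = complex_of_real (det2 q w / det2 u w) * u + complex_of_real (det2 u q / det2 u w) * w"
 unfolding complex_eq_iff by simp
 then show ?thesis unfolding B_def G_def d by (simp add: algebra_simps)
qed

lemma BG: "B (src D e + complex_of_real \<beta> * direction D e + complex_of_real \<gamma> * (z - src D e)) = \<beta>"
 "G (src D e + complex_of_real \<beta> * direction D e + complex_of_real \<gamma> * (z - src D e)) = \<gamma>"
proof -
 have s: "src D e + x + y - src D e = x + y" for x y :: complex by simp
 show "B (src D e + complex_of_real \<beta> * direction D e + complex_of_real \<gamma> * (z - src D e)) = \<beta>"
 "G (src D e + complex_of_real \<beta> * direction D e + complex_of_real \<gamma> * (z - src D e)) = \<gamma>"
 unfolding B_def G_def s det2_add(1,2,7,8) det2_simps using nondeg by simp_all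
qed

lemma BG_edges:
 "B (pt D e s) = s" "G (pt D e s) = 0" "B (pt D' e s) = 0" "G (pt D' e s) = s"
 "B (pt D' n s) = s" "G (pt D' n s) = 1 - s"
proof -
 show "B (pt D e s) = s" "G (pt D e s) = 0" using BG[of s 0] by (simp_all add: pt_def)
 have "pt D' e s = src D e + complex_of_real 0 * direction D e + complex_of_real s * (z - src D e)"
 by (simp add: pt_def direction_def src_tgt)
 then show "B (pt D' e s) = 0" "G (pt D' e s) = s" by (simp_all only: BG)
 have "pt D' n s = src D e + complex_of_real s * direction D e + complex_of_real (1 - s) * (z - src D e)"
 by (simp add: pt_def direction_def src_tgt algebra_simps)
 then show "B (pt D' n s) = s" "G (pt D' n s) = 1 - s" by (simp_all only: BG)
qed

lemma affine: obtains b0 b1 g0 g1 where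
 "\<And>t. B (pt D h t) = b0 + t * b1" "\<And>t. G (pt D h t) = g0 + t * g1"
proof
 have s: "pt D h t - src D e = (src D h - src D e) + complex_of_real t * direction D h" for t
 by (simp add: pt_def)
 show "B (pt D h t) = B (src D h) + t * (det2 (direction D h) (z - src D e) / det2 (direction D e) (z - src D e))" for t
 unfolding B_def s det2_add(1,7) by (simp add: add_divide_distrib)
 show "G (pt D h t) = G (src D h) + t * (det2 (direction D e) (direction D h) / det2 (direction D e) (z - src D e))" for t
 unfolding G_def s det2_add(2,8) by (simp add: add_divide_distrib)
qed

abbreviation "C \<equiv> convex hull {src D e, z, tgt D e}"

lemma mem_C: "p \<in> C \<longleftrightarrow> 0 <= B p & 0 <= G p & B p + G p <= 1"
proof
 assume "p \<in> C"
 then obtain u v w where uvw: "0 <= u" "0 <= v" "0 <= w" "u + v + w = 1"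
 "p = u *\<^sub>R src D e + v *\<^sub>R z + w *\<^sub>R tgt D e"
 unfolding convex_hull_3 by blast
 have u: "u = 1 - v - w" using uvw(4) by simp
 have "p = src D e + complex_of_real w * direction D e + complex_of_real v * (z - src D e)"
 using uvw(5) unfolding u by (simp add: scaleR_conv_of_real direction_def algebra_simps)
 then have "B p = w" "G p = v" by (simp_all only: BG)
 then show "0 <= B p & 0 <= G p & B p + G p <= 1" using uvw by auto
next
 assume a: "0 <= B p & 0 <= G p & B p + G p <= 1"
 have "p = (1 - B p - G p) *\<^sub>R src D e + G p *\<^sub>R z + B p *\<^sub>R tgt D e"
 by (subst barycentric) (simp add: scaleR_conv_of_real direction_def algebra_simps)
 then show "p \<in> C" unfolding convex_hull_3 using a
 by (intro CollectI exI[of _ "1 - B p - G p"] exI[of _ "G p"] exI[of _ "B p"]) auto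
qed

text \<open>A strand that crosses the base of the triangle and passes through an inner point leaves the
 triangle through exactly one of the two other sides.\<close>

lemma strand_exit:
 assumes h: "crosses D h e" and h': "crosses D h h'" "h' ~= e"
 and inside: "pt D h (param D (h, h')) \<in> C" "G (pt D h (param D (h, h'))) ~= 0"
 and ends: "pt D h 0 \<notin> C" "pt D h 1 \<notin> C"
 obtains x where "x = e \<or> x = n" "crosses D' h x" "\<And>y. crosses D' h y ==> y = e \<or> y = n ==> y = x"
 "param D (h, e) < param D (h, h') & param D (h, h') < param D' (h, x) \<or>
 param D' (h, x) < param D (h, h') & param D (h, h') < param D (h, e)"
 "pt D h (param D (h, e)) \<in> C" "pt D h (param D' (h, x)) \<in> C"
proof -
 obtain b0 b1 g0 g1 where aff: "\<And>t. B (pt D h t) = b0 + t * b1" "\<And>t. G (pt D h t) = g0 + t * g1"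
 using affine[where h=h] by blast
 let ?te = "param D (h, e)" and ?tc = "param D (h, h')"
 have he: "h \<in> edges D" "h ~= e" "h' \<in> edges D" "h' ~= h" "crosses D e h" using h h' crosses_sym[of h e] by (auto simp: crosses_def)
 have hn: "h ~= n" "h' ~= n" using he n by auto
 have te: "0 < ?te" "?te < 1" "pt D h ?te = pt D e (param D (e, h))" using param[OF h] by auto
 have s: "0 < param D (e, h)" "param D (e, h) < 1" using param(1,2)[OF he(5)] by auto
 have bte: "b0 + ?te * b1 = param D (e, h)" "g0 + ?te * g1 = 0"
 using te(3) aff[of ?te] by (simp_all add: BG_edges)
 have tc: "0 < ?tc" "?tc < 1" using param[OF h'(1)] by auto
 have btc: "0 <= b0 + ?tc * b1" "0 < g0 + ?tc * g1" "b0 + ?tc * b1 + (g0 + ?tc * g1) <= 1"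
 using inside unfolding mem_C aff by auto
 have ne_ec: "?te ~= ?tc" using btc bte by auto
 \<comment> \<open>The parameter of the end of \<open>h\<close> that lies beyond the crossing with
   \<open>h'\<close>, as seen from the crossing with \<open>e\<close>. This end is outside the
   triangle.\<close>
 define T where "T = (if ?te < ?tc then 1 else 0 :: real)"
 have Tout: "pt D h T \<notin> C" using ends by (simp add: T_def)
 have gT: "0 < g0 + t * g1" if "?te < ?tc & ?tc <= t \<or> t <= ?tc & ?tc < ?te" for t
 proof -
 have "g0 + t * g1 = (t - ?te) * g1" "0 < (?tc - ?te) * g1"
 using bte(2) btc(2) by (simp_all add: algebra_simps)
 then show ?thesis using that by (auto simp: zero_less_mult_iff)
 qed
 have T: "?te < ?tc & ?tc <= T \<or> T <= ?tc & ?tc < ?te" using ne_ec tc by (auto simp: T_def)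
 \<comment> \<open>The smaller of the two coordinates that vanish on the new sides. It is
   nonnegative at the crossing with \<open>h'\<close> and negative at the end \<open>T\<close>, and
   a zero in between is the exit.\<close>
 define m where "m t = min (b0 + t * b1) (1 - (b0 + t * b1) - (g0 + t * g1))" for t
 have mT: "m T < 0" using Tout gT[OF T] unfolding mem_C aff m_def by auto
 have mc: "0 <= m ?tc" using btc by (auto simp: m_def)
 have cm: "continuous_on U m" for U unfolding m_def by (intro continuous_intros)
 have "\<exists>t. m t = 0 & (?te < ?tc & ?tc <= t & t <= T \<or> T <= t & t <= ?tc & ?tc < ?te)"
 proof (cases "?te < ?tc")
 case True
 then obtain x where "?tc <= x" "x <= T" "m x = 0"
 using IVT2'[of m T 0 ?tc] mT mc cm T by force
 then show ?thesis using True by blast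
 next
 case False
 then obtain x where "T <= x" "x <= ?tc" "m x = 0"
 using IVT'[of m T 0 ?tc] mT mc cm T by force
 then show ?thesis using False ne_ec by force
 qed
 then obtain t where t: "m t = 0" "?te < ?tc & ?tc <= t & t <= T \<or> T <= t & t <= ?tc & ?tc < ?te" by blast
 have "t ~= T" using t(1) mT by auto
 then have t01: "0 < t" "t < 1" using t(2) tc by (auto simp: T_def split: if_splits)
 have gt: "0 < g0 + t * g1" using gT t(2) by auto
 have pth: "pt D' h = pt D h" using other(1) he by auto
 define x where "x = (if b0 + t * b1 = 0 then e else n)"
 have on: "pt D h t \<in> seg D' x"
 proof (cases "b0 + t * b1 = 0")
 case True
 then have B0: "B (pt D h t) = 0" by (simp add: aff)
 have "pt D h t = src D e + complex_of_real (B (pt D h t)) * direction D e + complex_of_real (G (pt D h t)) * (z - src D e)"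
 by (rule barycentric)
 also have "\<dots> = pt D' e (G (pt D h t))"
 unfolding B0 by (simp add: pt_def[of D'] direction_def src_tgt)
 finally show ?thesis using True gt t(1) aff(2)[of t] by (auto simp: x_def m_def mem_seg intro!: exI[of _ "g0 + t * g1"])
 next
 case False
 then have 1: "g0 + t * g1 = 1 - (b0 + t * b1)" "0 <= b0 + t * b1" using t(1) False min.cobounded1[of "b0 + t * b1" "1 - (b0 + t * b1) - (g0 + t * g1)"]
 by (auto simp: m_def min_def split: if_splits)
 then have G1: "G (pt D h t) = 1 - B (pt D h t)" by (simp add: aff)
 have "pt D h t = src D e + complex_of_real (B (pt D h t)) * direction D e + complex_of_real (G (pt D h t)) * (z - src D e)"
 by (rule barycentric)
 also have "\<dots> = pt D' n (B (pt D h t))"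
 unfolding G1 by (simp add: pt_def[of D'] direction_def src_tgt algebra_simps)
 finally show ?thesis using False gt 1 aff(1)[of t] by (auto simp: x_def mem_seg intro!: exI[of _ "b0 + t * b1"])
 qed
 have xe: "x \<in> edges D'" "h \<in> edges D'" "h ~= x" using he e hn by (auto simp: x_def D')
 have cx: "crosses D' h x"
 by (rule D'.crosses_interior[OF xe(2,1,3) t01]) (simp add: pth on)
 have px: "param D' (h, x) = t"
 by (rule D'.param_eqI[OF cx t01]) (simp add: pth on)
 have "t ~= ?tc"
 proof
 assume "t = ?tc"
 moreover have "crosses D' h h'" using crosses_other he h' by blast
 moreover have "param D' (h, h') = ?tc" using param_other he h'(2) by blast
 ultimately have "x = h'" using D'.param_inj[OF cx] px by simp
 then show False using h'(2) hn by (auto simp: x_def split: if_splits)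
 qed
 then have order: "?te < ?tc & ?tc < t \<or> t < ?tc & ?tc < ?te" using t(2) by auto
 \<comment> \<open>A strand crossing all three sides is impossible: at the middle one of the three
   points a barycentric coordinate vanishes that is positive at the other two, against
   \<open>affine_pos_between\<close>.\<close>
 have uniq: False if c: "crosses D' h e" "crosses D' h n"
 proof -
 define t1 t2 where d: "t1 = param D' (h, e)" "t2 = param D' (h, n)"
 have c': "crosses D' e h" "crosses D' n h" using c D'.crosses_sym by auto
 have 1: "b0 + t1 * b1 = 0" "0 < g0 + t1 * g1" "g0 + t1 * g1 < 1"
 using D'.param(3)[OF c(1)] D'.param(1,2)[OF c'(1)] aff[of t1] by (simp_all add: pth d BG_edges)
 have 2: "0 < b0 + t2 * b1" "g0 + t2 * g1 = 1 - (b0 + t2 * b1)" "0 < g0 + t2 * g1"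
 using D'.param(3)[OF c(2)] D'.param(1,2)[OF c'(2)] aff[of t2] by (simp_all add: pth d BG_edges)
 have 3: "0 < (1 - b0 - g0) + t1 * (- b1 - g1)" "0 < (1 - b0 - g0) + ?te * (- b1 - g1)"
 "(1 - b0 - g0) + t2 * (- b1 - g1) = 0"
 using 1 2 bte s by (simp_all add: algebra_simps)
 have "~ (?te <= t1 & t1 <= t2 \<or> t2 <= t1 & t1 <= ?te)"
 using affine_pos_between[of b0 ?te b1 t2 t1] 1 2 bte s by auto
 moreover have "~ (t1 <= t2 & t2 <= ?te \<or> ?te <= t2 & t2 <= t1)"
 using affine_pos_between[OF 3(1,2), of t2] 3 by auto
 moreover have "~ (t1 <= ?te & ?te <= t2 \<or> t2 <= ?te & ?te <= t1)"
 using affine_pos_between[of g0 t1 g1 t2 ?te] 1 2 bte by auto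
 ultimately show False by linarith
 qed
 show ?thesis
 proof
 show "x = e \<or> x = n" by (simp add: x_def)
 show "crosses D' h x" by (rule cx)
 show "y = x" if "crosses D' h y" "y = e \<or> y = n" for y
 using that cx uniq by (auto simp: x_def split: if_splits)
 show "pt D h ?te \<in> C" using s bte unfolding mem_C aff by auto
 show "pt D h (param D' (h, x)) \<in> C"
 using gt t(1) min.cobounded1[of "b0 + t * b1" "1 - (b0 + t * b1) - (g0 + t * g1)"]
 min.cobounded2[of "b0 + t * b1" "1 - (b0 + t * b1) - (g0 + t * g1)"]
 unfolding px mem_C aff m_def by linarith
 qed (use order px in auto)
qed

end

context vertex_added
begin

text \<open>The position of the crossing with \<open>h\<close> on the bent path from
  \<open>e\<close> to \<open>n\<close>, scaled to one edge with the corner at one half. Cutting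
  there returns the parameters of \<open>D'\<close>.\<close>

definition rank :: "nat => nat => real" where
 "rank x h = (if x = e then param D' (e, h) / 2 else 1 / 2 + param D' (n, h) / 2)"

text \<open>The new side shares an end with the old edge: its start if it is \<open>e\<close>, its
  target if it is \<open>n\<close>. The signed distance of this common point from \<open>h\<close>
  determines the sign of both crossings.\<close>

lemma exit_sign:
 assumes h: "crosses D e h" and x: "x = e \<or> x = n" "crosses D' x h"
 shows "det2 (direction D' x) (direction D' h) > 0 \<longleftrightarrow> det2 (direction D e) (direction D h) > 0"
proof -
 have he: "h \<in> edges D" "h ~= e" using h by (auto simp: crosses_def)
 note p = param(1,2)[OF h] D'.param(1,2)[OF x(2)]
 let ?d = "det2 (direction D e) (direction D h)" and ?d' = "det2 (direction D' x) (direction D h)"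
 have "param D' (x, h) * ?d' = param D (e, h) * ?d \<or> (1 - param D' (x, h)) * ?d' = (1 - param D (e, h)) * ?d"
 using x(1) side_src_tgt[OF h] D'.side_src_tgt[OF x(2)] other(3)[OF he] src_tgt he by auto
 then show ?thesis unfolding other(3)[OF he] using p
 by (smt (verit) mult_pos_pos mult_nonneg_nonpos)
qed

text \<open>Let \<open>\<psi>\<close> be the signed distance from the line of \<open>h\<close>,
  scaled so that it increases along the old edge. The strand \<open>k\<close> meets that edge where
  \<open>\<psi>\<close> is positive, then crosses \<open>h\<close>, and hence exits where
  \<open>\<psi>\<close> is negative. The bent path leads from negative to positive values and has
  its zero at the exit of \<open>h\<close>, so \<open>k\<close> comes first there: the order has
  been exchanged.\<close>

lemma exit_order:
 assumes h: "crosses D e h" and k: "crosses D e k" "crosses D h k"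
 and x: "x = e \<or> x = n" "crosses D' x h" and y: "y = e \<or> y = n" "crosses D' y k"
 and ord: "param D (k, e) < param D (k, h) & param D (k, h) < param D' (k, y) \<or>
 param D' (k, y) < param D (k, h) & param D (k, h) < param D (k, e)"
 and less: "param D (e, h) < param D (e, k)"
 shows "rank y k < rank x h"
proof -
 let ?s = "param D (e, h)"
 define \<delta> where "\<delta> = det2 (direction D e) (direction D h)"
 have \<delta>: "\<delta> ~= 0" using crosses_det[OF h] by (simp add: \<delta>_def)
 define \<psi> where "\<psi> p = det2 (p - src D h) (direction D h) / \<delta>" for p
 have he: "h \<in> edges D" "h ~= e" "k \<in> edges D" "k ~= e" using h k by (auto simp: crosses_def)
 have \<psi>D: "\<psi> (pt G f t) = \<psi> (src G f) + t * (det2 (direction G f) (direction D h) / \<delta>)" for G f t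
 proof -
 have "pt G f t - src D h = (src G f - src D h) + complex_of_real t * direction G f" by (simp add: pt_def)
 then show ?thesis by (simp only: \<psi>_def det2_add(1,7) add_divide_distrib) simp
 qed
 have \<psi>h: "\<psi> (pt D h t) = 0" for t
 by (subst \<psi>D) (simp add: \<psi>_def)
 have \<psi>e: "\<psi> (pt D e s) = s - ?s" for s
 using side_src_tgt(1)[OF h] \<delta> by (subst \<psi>D) (simp add: \<psi>_def \<delta>_def)
 have s: "0 < ?s" "?s < 1" using param[OF h] by auto
 define \<zeta> where "\<zeta> = \<psi> z"
 have ends: "\<psi> (src D e) = - ?s" "\<psi> (tgt D e) = 1 - ?s" using \<psi>e[of 0] \<psi>e[of 1] by simp_all
 have \<psi>1: "\<psi> (pt G f t) = (1 - t) * \<psi> (src G f) + t * \<psi> (tgt G f)" for G f t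
 using \<psi>D[of G f 1] by (subst \<psi>D) (simp add: algebra_simps)
 have \<psi>'e: "\<psi> (pt D' e r) = - ?s + r * (\<zeta> + ?s)" for r
 by (subst \<psi>1) (simp add: src_tgt ends \<zeta>_def algebra_simps)
 have \<psi>'n: "\<psi> (pt D' n r) = \<zeta> + r * (1 - ?s - \<zeta>)" for r
 by (subst \<psi>1) (simp add: src_tgt ends \<zeta>_def algebra_simps)
 have k': "crosses D k e" "crosses D k h" using k crosses_sym by blast+
 have x': "crosses D' h x" "crosses D' k y" using x y D'.crosses_sym by blast+
 have kk: "\<psi> (pt D k (param D (k, e))) > 0" "\<psi> (pt D k (param D (k, h))) = 0"
 using param(3)[OF k'(1)] param(3)[OF k'(2)] less by (simp_all add: \<psi>e \<psi>h)
 have yneg: "\<psi> (pt D' y (param D' (y, k))) < 0"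
 proof -
 define c0 c1 where c: "c0 = \<psi> (src D k)" "c1 = det2 (direction D k) (direction D h) / \<delta>"
 let ?t = "param D' (k, y)"
 have "\<psi> (pt D k ?t) < 0"
 using kk ord unfolding \<psi>D[of D k] c[symmetric]
 by (smt (verit) mult_less_cancel_right mult_le_cancel_right)
 then show ?thesis using D'.param(3)[OF y(2)] other(1)[OF he(3,4)] by simp
 qed
 have xzero: "\<psi> (pt D' x (param D' (x, h))) = 0"
 using D'.param(3)[OF x(2)] other(1)[OF he(1,2)] \<psi>h by simp
 note px = D'.param(1,2)[OF x(2)] and py = D'.param(1,2)[OF y(2)]
 show ?thesis
 proof (cases "x = e")
 case True
 let ?a = "param D' (e, h)"
 have a: "?a * (\<zeta> + ?s) = ?s" using xzero unfolding True \<psi>'e by simp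
 then have pos: "0 < \<zeta> + ?s" using px s True by (smt (verit) mult_nonneg_nonpos)
 have "?a * (\<zeta> + ?s) < 1 * (\<zeta> + ?s)" using px True pos by (intro mult_strict_right_mono) auto
 then have \<zeta>: "0 < \<zeta>" using a by simp
 show ?thesis
 proof (cases "y = e")
 case ye: True
 have "param D' (e, k) * (\<zeta> + ?s) < ?a * (\<zeta> + ?s)" using yneg a unfolding ye \<psi>'e by simp
 then show ?thesis using pos True ye by (simp add: rank_def)
 next
 case False
 then have "y = n" using y(1) by simp
 let ?b = "param D' (n, k)"
 have "0 < (1 - ?b) * \<zeta>" "0 < ?b * (1 - ?s)" using py \<zeta> s \<open>y = n\<close> by simp_all
 moreover have "\<zeta> + ?b * (1 - ?s - \<zeta>) = (1 - ?b) * \<zeta> + ?b * (1 - ?s)" by (simp add: algebra_simps)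
 ultimately show ?thesis using yneg unfolding \<open>y = n\<close> \<psi>'n by simp
 qed
 next
 case False
 then have xn: "x = n" using x(1) by simp
 let ?b = "param D' (n, h)"
 have b: "\<zeta> + ?b * (1 - ?s - \<zeta>) = 0" using xzero unfolding xn \<psi>'n .
 have e: "\<zeta> + ?b * (1 - ?s - \<zeta>) = (1 - ?b) * \<zeta> + ?b * (1 - ?s)" by (simp add: algebra_simps)
 have "0 < ?b * (1 - ?s)" using px s xn by simp
 then have "(1 - ?b) * \<zeta> < 0" using b e by simp
 then have \<zeta>: "\<zeta> < 0" using px xn by (simp add: mult_less_0_iff)
 show ?thesis
 proof (cases "y = e")
 case True
 then show ?thesis using py px xn ne by (simp add: rank_def)
 next
 case False
 then have yn: "y = n" using y(1) by simp
 have "param D' (n, k) * (1 - ?s - \<zeta>) < ?b * (1 - ?s - \<zeta>)" using yneg b unfolding yn \<psi>'n by simp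
 then show ?thesis using \<zeta> s xn yn ne by (simp add: rank_def)
 qed
 qed
qed

end

text \<open>If an end of \<open>h\<close> were in the disk, so would be a point of the edge adjacent
  to \<open>h\<close> there. Crossing edges are not adjacent, so that edge is outside
  \<open>F\<close> and the point must be an end of \<open>e\<close>, which would make
  \<open>h\<close> adjacent to \<open>e\<close>.\<close>

lemma (in diagram) vertex_not_in_disk:
 assumes mo: "meets_only D F C {src D e, tgt D e}" and h: "h \<in> F" and e: "e \<in> F"
 and cr: "\<And>x. x \<in> F ==> x ~= h ==> crosses D x h" "e ~= h"
 shows "pt D h 0 \<notin> C" "pt D h 1 \<notin> C"
proof -
 have he: "crosses D e h" "e \<in> edges D" "h \<in> edges D" using cr(1)[OF e cr(2)] by (auto simp: crosses_def)
 note adj = crosses_not_adjacent[OF he(1)]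
 have *: False if v: "v \<in> C" "v \<in> seg D x" "x \<in> edges D" "x \<notin> F" "v \<in> seg D h" for v x
 proof -
 have "v \<in> {src D e, tgt D e}" using mo v unfolding meets_only_def by blast
 then show False
 using vertex_on_edge[OF he(2,3)] tgt_on_edge[OF he(2,3)] v(5) adj cr(2) by auto
 qed
 have nadj: "nxt D x ~= h" "nxt D h ~= x" if "x \<in> F" for x
 using crosses_not_adjacent[OF cr(1)[OF that]] nxt_ne[OF he(3)] by (cases "x = h"; auto)+
 have "h \<in> nxt D ` edges D" using bij_betw_imp_surj_on[OF bij_nxt] he(3) by simp
 then obtain p where p: "p \<in> edges D" "nxt D p = h" by blast
 have "pt D h 0 = pt D p 1" using p by (simp add: tgt_src)
 then show "pt D h 0 \<notin> C"
 using *[of "pt D h 0" p] nadj p pt_in_seg[of 1 D p] pt_in_seg[of 0 D h] by auto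
 have "pt D h 1 = pt D (nxt D h) 0" by (simp add: tgt_src)
 then show "pt D h 1 \<notin> C"
 using *[of "pt D h 1" "nxt D h"] nadj nxt_in[OF he(3)] pt_in_seg[of 0 D "nxt D h"] pt_in_seg[of 1 D h] by auto
qed

context bracket_model
begin

text \<open>The six nodes of the move are first shifted to the places they occupy in
  \<open>D'\<close>, without changing any order. On this fixed set of nodes the move is
  \<open>state_sum_R3\<close>; finally \<open>e\<close> is cut at the corner.\<close>

lemma Z_R3:
 assumes D: "vdiagram D" and D': "vdiagram D'" and r: "reidemeister3 D D'"
 shows "Z t D' = Z t D"
proof -
 obtain e f g n z where ov: "(e, f) \<in> over D" "(e, g) \<in> over D" "(f, g) \<in> over D" "n \<notin> edges D" and
 mo: "meets_only D {e, f, g} (convex hull {src D e, z, tgt D e}) {src D e, tgt D e}" and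
 inter: "seg D f \<inter> seg D g \<inter> convex hull {src D e, z, tgt D e} ~= {}" and sp: "D' = split e n z D"
 using r unfolding reidemeister3_def Let_def by metis
 interpret diagram D by (rule diagramI[OF D])
 interpret D': diagram D' by (rule diagramI[OF D'])
 have cr: "crosses D e f" "crosses D e g" "crosses D f g" using ov over_crosses by auto
 have cr': "crosses D f e" "crosses D g e" "crosses D g f" using cr crosses_sym by auto
 have efg: "e \<in> edges D" "f \<in> edges D" "g \<in> edges D" "e ~= f" "e ~= g" "f ~= g"
 using cr by (auto simp: crosses_def)
 interpret vertex_added D D' e n z
 by unfold_locales (use efg ov sp in \<open>auto simp: split_def add_vertex_def Let_def\<close>)
 let ?C = "convex hull {src D e, z, tgt D e}"
 let ?par = "id(n := e)"
 have over': "over D' = {(x, y). crosses D' x y & (?par x, ?par y) \<in> over D}"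
 by (simp add: sp split_def Let_def crosses_def src_def tgt_def)
 have no: "y = f \<or> y = g" if y: "crosses D e y" for y
 proof (rule ccontr)
 assume "~ ?thesis"
 then have "y \<notin> {e, f, g}" using y by (auto simp: crosses_def)
 then show False by (intro meets_only_no_crossing[OF mo _ _ _ y]) (auto simp: hull_inc)
 qed
 obtain c where c: "c \<in> seg D f" "c \<in> seg D g" "c \<in> ?C" using inter by blast
 have cfg: "pt D f (param D (f, g)) = pt D g (param D (g, f))" using param(3)[OF cr(3)] .
 have cf: "c = pt D f (param D (f, g))"
 using c(1,2) intersection_unique(1)[OF crosses_det[OF cr(3)] _ cfg] unfolding mem_seg by metis
 then have cg: "c = pt D g (param D (g, f))" using cfg by simp
 have c_off: "det2 (direction D e) (c - src D e) ~= 0"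
 proof
 assume "det2 (direction D e) (c - src D e) = 0"
 then obtain k where "c - src D e = complex_of_real k * direction D e"
 using det2_eq_0D direction_nz[OF efg(1)] by blast
 then have k: "pt D e k = c" by (simp add: pt_def algebra_simps)
 have "k = param D (e, f)" "k = param D (e, g)"
 using intersection_unique(1)[OF crosses_det[OF cr(1)] _ param(3)[OF cr(1)], of k "param D (f, g)"]
 intersection_unique(1)[OF crosses_det[OF cr(2)] _ param(3)[OF cr(2)], of k "param D (g, f)"] k cf cg by auto
 then show False using param_inj[OF cr(1,2)] efg by simp
 qed
 have "det2 (direction D e) (z - src D e) ~= 0"
 proof
 assume 0: "det2 (direction D e) (z - src D e) = 0"
 obtain u v w where uvw: "u + v + w = 1" "c = u *\<^sub>R src D e + v *\<^sub>R z + w *\<^sub>R tgt D e"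
 using c(3) unfolding convex_hull_3 by blast
 then have u: "u = 1 - v - w" by simp
 have "c - src D e = complex_of_real v * (z - src D e) + complex_of_real w * direction D e"
 using uvw(2) unfolding u by (simp add: scaleR_conv_of_real direction_def algebra_simps)
 then show False using c_off 0 by (simp add: det2_add)
 qed
 then interpret triangle D D' e n z by unfold_locales
 have Gc: "G c ~= 0" using c_off nondeg by (simp add: G_def)
 have outf: "pt D f 0 \<notin> ?C" "pt D f 1 \<notin> ?C"
 by (rule vertex_not_in_disk[OF mo]; use cr cr' efg in auto)+
 have outg: "pt D g 0 \<notin> ?C" "pt D g 1 \<notin> ?C"
 by (rule vertex_not_in_disk[OF mo]; use cr cr' efg in auto)+
 obtain x where x: "x = e \<or> x = n" "crosses D' f x" "\<And>y. crosses D' f y ==> y = e \<or> y = n ==> y = x"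
 "param D (f, e) < param D (f, g) & param D (f, g) < param D' (f, x) \<or>
 param D' (f, x) < param D (f, g) & param D (f, g) < param D (f, e)"
 "pt D f (param D (f, e)) \<in> ?C" "pt D f (param D' (f, x)) \<in> ?C"
 by (rule strand_exit[OF cr'(1) cr(3) efg(5)[symmetric] c(3)[unfolded cf] Gc[unfolded cf] outf]) (rule that)
 obtain y where y: "y = e \<or> y = n" "crosses D' g y" "\<And>y'. crosses D' g y' ==> y' = e \<or> y' = n ==> y' = y"
 "param D (g, e) < param D (g, f) & param D (g, f) < param D' (g, y) \<or>
 param D' (g, y) < param D (g, f) & param D (g, f) < param D (g, e)"
 "pt D g (param D (g, e)) \<in> ?C" "pt D g (param D' (g, y)) \<in> ?C"
 by (rule strand_exit[OF cr'(2) cr'(3) efg(4)[symmetric] c(3)[unfolded cg] Gc[unfolded cg] outg]) (rule that)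
 have x': "crosses D' x f" and y': "crosses D' y g" using x(2) y(2) D'.crosses_sym by blast+
 define ef eg fe ff ge gg where abbr: "ef = rank x f" "eg = rank y g"
 "fe = param D' (f, x)" "ff = param D (f, g)" "ge = param D' (g, y)" "gg = param D (g, f)"
 have rk: "0 < ef" "ef < 1" "ef ~= 1/2" "0 < eg" "eg < 1" "eg ~= 1/2"
 using D'.param(1,2)[OF x'] D'.param(1,2)[OF y'] x(1) y(1) ne by (auto simp: abbr rank_def)
 have ineq: "param D (e, f) ~= param D (e, g)" using param_inj[OF cr(1,2)] efg by auto
 have ord1: "param D (e, f) < param D (e, g) ==> eg < ef"
 unfolding abbr by (rule exit_order[OF cr(1,2,3) x(1) x' y(1) y' y(4)])
 have ord2: "param D (e, g) < param D (e, f) ==> ef < eg"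
 unfolding abbr by (rule exit_order[OF cr(2,1) cr'(3) y(1) y' x(1) x' x(4)])
 have ner: "eg ~= ef"
 using ord1 ord2 ineq by (cases "param D (e, f) < param D (e, g)") auto
 have fl1: "param D (e, f) < param D (e, g) \<longleftrightarrow> eg < ef"
 using ord1 ord2 ineq by linarith
 define \<kappa> a b where flags: "\<kappa> = (param D (e, f) < param D (e, g))" "a = (param D (f, e) < param D (f, g))"
 "b = (param D (g, e) < param D (g, f))"
 define pf pg pfg where signs: "pf = positive D (e, f)" "pg = positive D (e, g)" "pfg = positive D (f, g)"
 \<comment> \<open>The crossing \<open>c\<close> of \<open>f\<close> and \<open>g\<close> is reached
   from \<open>src D e\<close> along \<open>e\<close> and then along \<open>f\<close> or along
   \<open>g\<close>. Equating the two expressions and taking determinants relates the orders to the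
   signs.\<close>
 have flag_rel: "(a = pf) = (b = pg)" "(b = pfg) = (\<kappa> = pf)"
 proof -
 define \<alpha> \<beta> \<sigma> where d: "\<alpha> = param D (f, g) - param D (f, e)" "\<beta> = param D (g, f) - param D (g, e)"
 "\<sigma> = param D (e, g) - param D (e, f)"
 define de df dg where dd: "de = direction D e" "df = direction D f" "dg = direction D g"
 have 1: "c - src D e = complex_of_real (param D (e, f)) * de + complex_of_real \<alpha> * df"
 using param(3)[OF cr(1)] cf by (simp add: pt_def d dd algebra_simps)
 have 2: "c - src D e = complex_of_real (param D (e, g)) * de + complex_of_real \<beta> * dg"
 using param(3)[OF cr(2)] cg by (simp add: pt_def d dd algebra_simps)
 have h1: "det2 de (c - src D e) = \<alpha> * det2 de df" unfolding 1 det2_add det2_simps by simp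
 have h2: "det2 de (c - src D e) = \<beta> * det2 de dg" unfolding 2 det2_add det2_simps by simp
 have "complex_of_real \<beta> * dg = complex_of_real \<alpha> * df - complex_of_real \<sigma> * de"
 using 1 2 by (simp add: d algebra_simps)
 then have "det2 df (complex_of_real \<beta> * dg) = det2 df (complex_of_real \<alpha> * df - complex_of_real \<sigma> * de)" by simp
 then have h3: "\<beta> * det2 df dg = \<sigma> * det2 de df"
 by (simp only: det2_add det2_simps) (simp add: det2_swap[of df de])
 have nz: "det2 de df ~= 0" "det2 de dg ~= 0" "det2 df dg ~= 0" using crosses_det cr by (auto simp: dd)
 have fl: "\<kappa> = (\<sigma> > 0)" "a = (\<alpha> > 0)" "b = (\<beta> > 0)" "\<sigma> ~= 0" "\<alpha> ~= 0" "\<beta> ~= 0"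
 using ineq x(4) y(4) by (auto simp: flags d)
 have sg: "pf = (det2 de df > 0)" "pg = (det2 de dg > 0)" "pfg = (det2 df dg > 0)"
 by (simp_all add: signs positive_def dd)
 have m: "(u > 0) = (v > 0) \<longleftrightarrow> u * v > 0" if "u ~= 0" "v ~= 0" for u v :: real
 using that by (auto simp: zero_less_mult_iff)
 show "(a = pf) = (b = pg)" using h1 h2 unfolding fl sg m[OF fl(5) nz(1)] m[OF fl(6) nz(2)] by simp
 show "(b = pfg) = (\<kappa> = pf)" using h3 unfolding fl sg m[OF fl(6) nz(3)] m[OF fl(4) nz(1)] by simp
 qed
 define P0 where "P0 = passages D - {(e, f), (f, e), (e, g), (g, e), (f, g), (g, f)}"
 have P0: "u \<in> edges D & v \<in> edges D & u ~= e & v ~= e & u ~= n & v ~= n" if "(u, v) \<in> P0" for u v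
 proof -
 have c: "crosses D u v" "crosses D v u" using that passage_crosses[of u v] crosses_sym[of u v] unfolding P0_def by blast+
 have "u ~= e" using no[of v] c(1) that unfolding P0_def by blast
 moreover have "v ~= e" using no[of u] c(2) that unfolding P0_def by blast
 ultimately show ?thesis using c(1) n unfolding crosses_def by blast
 qed
 have P: "passages D = P0 \<union> {(e, f), (f, e), (e, g), (g, e), (f, g), (g, f)}"
 using ov unfolding P0_def passages_def by auto
 have O: "over D = (over D \<inter> P0) \<union> {(e, f), (e, g), (f, g)}"
 proof -
 have "(f, e) \<notin> over D" "(g, e) \<notin> over D" "(g, f) \<notin> over D" using ov over_asym by auto
 then show ?thesis using ov unfolding P0_def passages_def by auto
 qed
 have O': "over D' = (over D \<inter> P0) \<union> {(x, f), (y, g), (f, g)}"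
 proof
 show "over D' \<subseteq> (over D \<inter> P0) \<union> {(x, f), (y, g), (f, g)}"
 proof
 fix q assume "q \<in> over D'"
 then obtain u v where q: "q = (u, v)" "crosses D' u v" "(?par u, ?par v) \<in> over D" unfolding over' by auto
 have "(?par u, ?par v) \<in> P0 \<or> (?par u, ?par v) \<in> {(e, f), (e, g), (f, g)}" using q(3) O by blast
 then show "q \<in> (over D \<inter> P0) \<union> {(x, f), (y, g), (f, g)}"
 proof
 assume p: "(?par u, ?par v) \<in> P0"
 have "?par u ~= e" "?par v ~= e" using P0[OF p] by auto
 then have "?par u = u" "?par v = v" by (auto split: if_splits)
 then show ?thesis using p q by auto
 next
 assume p: "(?par u, ?par v) \<in> {(e, f), (e, g), (f, g)}"
 have nn: "n ~= f" "n ~= g" using efg n by auto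
 have "u = x" if "?par u = e" "v = f"
 proof -
 have "crosses D' f u" using q(2) that(2) D'.crosses_sym[of u f] by simp
 moreover have "u = e \<or> u = n" using that(1) by (auto split: if_splits)
 ultimately show ?thesis by (rule x(3))
 qed
 moreover have "u = y" if "?par u = e" "v = g"
 proof -
 have "crosses D' g u" using q(2) that(2) D'.crosses_sym[of u g] by simp
 moreover have "u = e \<or> u = n" using that(1) by (auto split: if_splits)
 ultimately show ?thesis by (rule y(3))
 qed
 moreover have "?par v = v"
 proof -
 have "?par v ~= e" using p efg by auto
 then show ?thesis by (auto split: if_splits)
 qed
 moreover have "?par u = u" if "(?par u, ?par v) = (f, g)"
 proof -
 have "?par u ~= e" using that efg by auto
 then show ?thesis by (auto split: if_splits)
 qed
 ultimately show ?thesis using p q(1) efg by auto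
 qed
 qed
 have "(u, v) \<in> over D'" if uv: "(u, v) \<in> over D" "(u, v) \<in> P0" for u v
 proof -
 have "crosses D' u v" using P0[OF uv(2)] crosses_other[of u v] over_crosses[OF uv(1)] by simp
 then show ?thesis using P0[OF uv(2)] uv(1) unfolding over' by simp
 qed
 moreover have "crosses D' f g" using crosses_other efg cr by simp
 moreover have "?par x = e" "?par y = e" "?par f = f" "?par g = g" using x(1) y(1) efg n by auto
 ultimately show "(over D \<inter> P0) \<union> {(x, f), (y, g), (f, g)} \<subseteq> over D'"
 using ov x' y' unfolding over' by (simp add: subset_iff split_paired_all)
 qed
 have P': "passages D' = P0 \<union> {(x, f), (f, x), (y, g), (g, y), (f, g), (g, f)}"
 proof -
 have "P0 = (over D \<inter> P0) \<union> (over D \<inter> P0)\<inverse>" unfolding P0_def passages_def by auto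
 then show ?thesis unfolding passages_def O' by auto
 qed
 \<comment> \<open>Moves the nodes to their final places and keeps their order on each strand. Since
   the move exchanges the orders, the old crossing of \<open>e\<close> with \<open>f\<close> goes to
   the place of the new crossing of \<open>e\<close> with \<open>g\<close> and conversely, and
   similarly on \<open>f\<close> and \<open>g\<close>.\<close>
 define \<theta> where "\<theta> h s = (if h = e & s = param D (e, f) then eg else if h = e & s = param D (e, g) then ef
 else if h = f & s = param D (f, e) then ff else if h = f & s = ff then fe
 else if h = g & s = param D (g, e) then gg else if h = g & s = gg then ge else s)" for h s
 let ?\<theta> = "%(h, s). (h, \<theta> h s)"
 have \<theta>_spec: "\<theta> e (param D (e, f)) = eg" "\<theta> e (param D (e, g)) = ef" "\<theta> f (param D (f, e)) = ff" "\<theta> f ff = fe"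
 "\<theta> g (param D (g, e)) = gg" "\<theta> g gg = ge"
 using efg ineq x(4) y(4) by (auto simp: \<theta>_def abbr)
 have \<theta>P0: "\<theta> u (param D (u, v)) = param D (u, v)" if "(u, v) \<in> P0" for u v
 proof -
 have "(u, v) \<in> passages D" using that by (auto simp: P0_def)
 then have "param D (f, v) ~= param D (f, e) & param D (f, v) ~= ff" if "u = f"
 using param_inj[OF passage_crosses[of f v] cr'(1)] param_inj[OF passage_crosses[of f v] cr(3)] \<open>(u, v) \<in> P0\<close> that
 by (auto simp: abbr P0_def)
 moreover have "param D (g, v) ~= param D (g, e) & param D (g, v) ~= gg" if "u = g"
 using param_inj[OF passage_crosses[of g v] cr'(2)] param_inj[OF passage_crosses[of g v] cr'(3)] \<open>(u, v) \<in> P0\<close> that \<open>(u, v) \<in> passages D\<close>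
 by (auto simp: abbr P0_def)
 ultimately show ?thesis using P0[OF that] by (auto simp: \<theta>_def)
 qed
 have pos0: "0 < param D (e, f)" "0 < param D (e, g)" "0 < param D (f, e)" "0 < ff" "0 < param D (g, e)" "0 < gg"
 "0 < fe" "0 < ge" "fe < 1" "ge < 1" "ff < 1" "gg < 1"
 using param(1,2) cr cr' D'.param(1,2)[OF x(2)] D'.param(1,2)[OF y(2)] by (auto simp: abbr)
 have \<theta>0: "\<theta> h 0 = 0" for h using pos0 by (auto simp: \<theta>_def)
 \<comment> \<open>Between the old and the new crossing with \<open>e\<close> the strand stays in
   the disk, so no node foreign to the move lies there and \<open>\<theta>\<close> is
   monotone.\<close>
 have outside: "s < min (param D (h, e)) (param D' (h, w)) \<or> max (param D (h, e)) (param D' (h, w)) < s"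
 if s: "(h, s) \<in> nodes D" "s ~= param D (h, e)" "s ~= param D (h, k)" and
 hk: "(h = f & k = g & w = x) \<or> (h = g & k = f & w = y)" for h k s w
 proof (cases "s = 0")
 case True
 then show ?thesis using hk pos0 by (auto simp: abbr)
 next
 case False
 show ?thesis
 proof (rule ccontr)
 assume n: "~ ?thesis"
 let ?lo = "min (param D (h, e)) (param D' (h, w))" and ?hi = "max (param D (h, e)) (param D' (h, w))"
 have in_C: "pt D h ?lo \<in> ?C" "pt D h ?hi \<in> ?C"
 using x(5,6) y(5,6) hk by (auto simp: min_def max_def)
 have "?lo < ?hi" using x(4) y(4) hk by auto
 then have "pt D h s \<in> closed_segment (pt D h ?lo) (pt D h ?hi)" using n by (intro pt_between) auto
 moreover have "closed_segment (pt D h ?lo) (pt D h ?hi) \<subseteq> ?C" using in_C by (intro closed_segment_subset) auto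
 moreover have "pt D h s \<notin> ?C"
 proof (rule foreign_node[OF s(1) False efg(1) _ mo])
 show "e ~= h" using hk efg by auto
 fix q assume "q \<in> {e, f, g}" "(h, q) \<in> passages D"
 moreover have "q ~= h" using passage_crosses[OF calculation(2)] by (auto simp: crosses_def)
 ultimately show "param D (h, q) ~= s" using s(2,3) hk by auto
 qed
 ultimately show False by blast
 qed
 qed
 have Ne: "(e, s) \<in> nodes D \<longleftrightarrow> s = 0 \<or> s = param D (e, f) \<or> s = param D (e, g)" for s
 proof -
 have "(e, v) \<notin> P0" for v using P0[of e v] by auto
 then show ?thesis using efg unfolding nodes_def P pos_def by (auto simp: image_iff)
 qed
 have mono: "\<theta> h s < \<theta> h s'" if m: "(h, s) \<in> nodes D" "(h, s') \<in> nodes D" "s < s'" for h s s'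
 proof -
 have nn: "0 <= s" using positionsD(1)[OF positions_nodes m(1)] by auto
 consider "h = e" | "h = f" | "h = g" | "h ~= e" "h ~= f" "h ~= g" by blast
 then show ?thesis
 proof cases
 case 1
 then show ?thesis using m Ne \<theta>_spec \<theta>0[of e] rk pos0 ord1 ord2 by auto
 next
 case 2
 have id: "\<theta> f r = r" if "r ~= param D (f, e)" "r ~= ff" for r using that efg by (auto simp: \<theta>_def)
 show ?thesis
 using outside[of f s g x] outside[of f s' g x] m x(4) \<theta>_spec(3,4) id[of s] id[of s'] unfolding 2 abbr[symmetric]
 by (cases "s = param D (f, e)"; cases "s = ff"; cases "s' = param D (f, e)"; cases "s' = ff") auto
 next
 case 3
 have id: "\<theta> g r = r" if "r ~= param D (g, e)" "r ~= gg" for r using that efg by (auto simp: \<theta>_def)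
 show ?thesis
 using outside[of g s f y] outside[of g s' f y] m y(4) \<theta>_spec(5,6) id[of s] id[of s'] unfolding 3 abbr[symmetric]
 by (cases "s = param D (g, e)"; cases "s = gg"; cases "s' = param D (g, e)"; cases "s' = gg") auto
 qed (use m in \<open>auto simp: \<theta>_def\<close>)
 qed
 define M1 where "M1 = ?\<theta> ` nodes D"
 define X0 where "X0 = (%(u, v). (pos D (u, v), pos D (v, u), positive D (u, v))) ` (over D \<inter> P0)"
 define e1 e2 f1 f2 g1 g2 where en: "e1 = (e, min ef eg)" "e2 = (e, max ef eg)" "f1 = (f, min ff fe)" "f2 = (f, max ff fe)"
 "g1 = (g, min gg ge)" "g2 = (g, max gg ge)"
 let ?Y = "\<lambda>\<kappa> a b. R3_crossings \<kappa> a b pf pg pfg e1 e2 f1 f2 g1 g2"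
 have nodes: "nodes D = (%h. (h, 0)) ` edges D \<union> pos D ` P0 \<union>
 {(e, param D (e, f)), (f, param D (f, e)), (e, param D (e, g)), (g, param D (g, e)), (f, ff), (g, gg)}"
 unfolding nodes_def P image_Un by (auto simp: pos_def abbr)
 have nodes': "nodes D' = insert (n, 0) ((%h. (h, 0)) ` edges D) \<union> pos D ` P0 \<union>
 {(x, param D' (x, f)), (f, fe), (y, param D' (y, g)), (g, ge), (f, ff), (g, gg)}"
 proof -
 have "pos D' Q = pos D Q" if "Q \<in> P0" for Q
 using P0[of "fst Q" "snd Q"] that param_other by (cases Q) (auto simp: pos_def)
 then have "pos D' ` P0 = pos D ` P0" by auto
 moreover have "param D' (f, g) = ff" "param D' (g, f) = gg" using param_other efg by (auto simp: abbr)
 ultimately show ?thesis unfolding nodes_def P' D'(1) image_Un by (auto simp: pos_def abbr)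
 qed
 have M1: "M1 = (%h. (h, 0)) ` edges D \<union> pos D ` P0 \<union> {(e, ef), (e, eg), (f, ff), (f, fe), (g, gg), (g, ge)}"
 proof -
 have "?\<theta> ` (%h. (h, 0)) ` edges D = (%h. (h, 0)) ` edges D" by (auto simp: \<theta>0 image_image)
 moreover have "?\<theta> ` pos D ` P0 = pos D ` P0"
 unfolding image_image using \<theta>P0 by (intro image_cong refl) (auto simp: pos_def)
 ultimately show ?thesis unfolding M1_def nodes image_Un by (auto simp: \<theta>_spec)
 qed
 have M1': "M1 = (%h. (h, 0)) ` edges D \<union> pos D ` P0 \<union> {e1, e2, f1, f2, g1, g2}"
 unfolding M1 en by (auto simp: min_def max_def)
 have pos1: "positions (edges D) (nxt D) M1"
 unfolding M1_def positions_def
 proof (intro conjI)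
 show "\<forall>v\<in>?\<theta> ` nodes D. case v of (u, s) => u \<in> edges D & 0 <= s & s < 1"
 proof -
 have "u \<in> edges D & 0 <= s & s < 1" if "(u, s) \<in> M1" for u s
 using that positionsD(1)[OF positions_nodes, of u s] efg rk pos0 unfolding M1 nodes by auto
 then show ?thesis unfolding M1_def by blast
 qed
 show "\<forall>h\<in>edges D. (h, 0) \<in> ?\<theta> ` nodes D"
 using M1 unfolding M1_def by auto
 qed (use positions_finite[OF positions_nodes] bij_nxt in auto)
 have X1: "(%(u, v, p). ((fst u, \<theta> (fst u) (snd u)), (fst v, \<theta> (fst v) (snd v)), p)) ` xings D = X0 \<union> ?Y \<kappa> a b"
 proof -
 have fl: "\<kappa> = (eg < ef)" "a = (ff < fe)" "b = (gg < ge)"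
 using fl1 x(4) y(4) unfolding flags abbr by auto
 have ne': "eg ~= ef" "ff ~= fe" "gg ~= ge" using ner x(4) y(4) unfolding abbr by auto
 have "(%(u, v, p). ((fst u, \<theta> (fst u) (snd u)), (fst v, \<theta> (fst v) (snd v)), p)) `
 (%(e, f). (pos D (e, f), pos D (f, e), positive D (e, f))) ` (over D \<inter> P0) = X0"
 unfolding X0_def image_image
 proof (intro image_cong refl)
 fix q assume q: "q \<in> over D \<inter> P0"
 obtain u v where uv: "q = (u, v)" by (cases q)
 have "(u, v) \<in> P0" "(v, u) \<in> P0" using q uv unfolding P0_def passages_def by auto
 then show "(case (case q of (e, f) => (pos D (e, f), pos D (f, e), positive D (e, f))) of
 (u, v, p) => ((fst u, \<theta> (fst u) (snd u)), (fst v, \<theta> (fst v) (snd v)), p)) =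
 (case q of (e, f) => (pos D (e, f), pos D (f, e), positive D (e, f)))"
 by (simp add: uv pos_def \<theta>P0)
 qed
 moreover have "(%(u, v, p). ((fst u, \<theta> (fst u) (snd u)), (fst v, \<theta> (fst v) (snd v)), p)) `
 (%(e, f). (pos D (e, f), pos D (f, e), positive D (e, f))) ` {(e, f), (e, g), (f, g)} =
 {((e, eg), (f, ff), pf), ((e, ef), (g, gg), pg), ((f, fe), (g, ge), pfg)}"
 by (simp add: pos_def \<theta>_spec signs abbr(4,6)[symmetric])
 moreover have "{((e, eg), (f, ff), pf), ((e, ef), (g, gg), pg), ((f, fe), (g, ge), pfg)} = ?Y \<kappa> a b"
 using ne' unfolding R3_crossings_def en fl by (cases "eg < ef"; cases "ff < fe"; cases "gg < ge") (auto simp: min_def max_def)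
 ultimately show ?thesis unfolding xings_def by (subst O) (simp only: image_Un)
 qed
 have s1: "psum t (nxt D) M1 (X0 \<union> ?Y \<kappa> a b) = Z t D"
 unfolding Z_def M1_def X1[symmetric]
 by (rule psum_rescale[where f=\<theta> and X="xings D", OF positions_nodes mono _ ends_xings_nodes refl, symmetric])
 (simp_all add: \<theta>0)
 have lt: "min ef eg < max ef eg" "min ff fe < max ff fe" "min gg ge < max gg ge"
 using ner x(4) y(4) unfolding abbr by (auto simp: min_def max_def)
 have foutP0: "s < min ff fe \<or> max ff fe < s" if fs: "(f, s) \<in> pos D ` P0" for s
 proof -
 obtain v where v: "(f, v) \<in> P0" "s = param D (f, v)" using fs by (auto simp: pos_def)
 have "(f, s) \<in> nodes D" using fs by (auto simp: nodes)
 moreover have "s ~= param D (f, e)" "s ~= param D (f, g)"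
 using v param_inj[OF passage_crosses[of f v] cr'(1)] param_inj[OF passage_crosses[of f v] cr(3)] by (auto simp: P0_def)
 ultimately show ?thesis using outside[of f s g x] x(4) unfolding abbr by auto
 qed
 have goutP0: "s < min gg ge \<or> max gg ge < s" if gs: "(g, s) \<in> pos D ` P0" for s
 proof -
 obtain v where v: "(g, v) \<in> P0" "s = param D (g, v)" using gs by (auto simp: pos_def)
 have "(g, s) \<in> nodes D" using gs by (auto simp: nodes)
 moreover have "s ~= param D (g, e)" "s ~= param D (g, f)"
 using v param_inj[OF passage_crosses[of g v] cr'(2)] param_inj[OF passage_crosses[of g v] cr'(3)] by (auto simp: P0_def)
 ultimately show ?thesis using outside[of g s f y] y(4) unfolding abbr by auto
 qed
 have eP0: "(e, s) \<notin> pos D ` P0" for s by (auto simp: pos_def dest: P0)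
 have sc: "nsucc (nxt D) M1 e1 = e2" "nsucc (nxt D) M1 f1 = f2" "nsucc (nxt D) M1 g1 = g2"
 proof -
 have m: "(e, min ef eg) \<in> M1" "(e, max ef eg) \<in> M1" "(f, min ff fe) \<in> M1" "(f, max ff fe) \<in> M1"
 "(g, min gg ge) \<in> M1" "(g, max gg ge) \<in> M1" unfolding M1' en by auto
 show "nsucc (nxt D) M1 e1 = e2" unfolding en
 proof (rule nsucc_same_edge[OF pos1 m(1,2) lt(1)])
 fix r assume "(e, r) \<in> M1"
 then show "r <= min ef eg \<or> max ef eg <= r" using eP0 efg rk unfolding M1 by auto
 qed
 show "nsucc (nxt D) M1 f1 = f2" unfolding en
 proof (rule nsucc_same_edge[OF pos1 m(3,4) lt(2)])
 fix r assume "(f, r) \<in> M1"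
 then show "r <= min ff fe \<or> max ff fe <= r" using foutP0[of r] efg pos0 unfolding M1 by auto
 qed
 show "nsucc (nxt D) M1 g1 = g2" unfolding en
 proof (rule nsucc_same_edge[OF pos1 m(5,6) lt(3)])
 fix r assume "(g, r) \<in> M1"
 then show "r <= min gg ge \<or> max gg ge <= r" using goutP0[of r] efg pos0 unfolding M1 by auto
 qed
 qed
 have mem: "e1 \<in> M1" "f1 \<in> M1" "g1 \<in> M1" "e2 \<in> M1" "f2 \<in> M1" "g2 \<in> M1" unfolding M1' by auto
 have dist: "distinct [e1, e2, f1, f2, g1, g2]" using lt efg by (auto simp: en)
 have nl: "nsucc (nxt D) M1 e2 ~= e2" "nsucc (nxt D) M1 f2 ~= f2" "nsucc (nxt D) M1 g2 ~= g2"
 using mem rk pos0 unfolding en by (intro nsucc_ne[OF pos1]; auto)+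
 have new: "e1 \<notin> pos D ` P0" "e2 \<notin> pos D ` P0" "f1 \<notin> pos D ` P0" "f2 \<notin> pos D ` P0" "g1 \<notin> pos D ` P0" "g2 \<notin> pos D ` P0"
 using eP0 foutP0 goutP0 lt unfolding en by fastforce+
 have eX0: "ends X0 \<subseteq> pos D ` P0"
 unfolding X0_def ends_def P0_def passages_def by auto
 have fX0: "finite X0" unfolding X0_def using finite_over by auto
 have s2: "psum t (nxt D) M1 (X0 \<union> ?Y \<kappa> a b) = psum t (nxt D) M1 (X0 \<union> ?Y (~ \<kappa>) (~ a) (~ b))"
 unfolding psum_def
 using state_sum_R3[OF positions_finite[OF pos1] fX0 nsucc_image[OF pos1] inj_nsucc[OF pos1] mem(1-3), unfolded sc, OF dist nl _ flag_rel]
 eX0 new M1' by auto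
 have eY: "ends (X0 \<union> ?Y (~ \<kappa>) (~ a) (~ b)) \<subseteq> M1"
 using eX0 mem M1' by (auto simp: ends_Un R3_crossings_def)
 define M2 where "M2 = insert (e, 1/2) M1"
 have pos2: "positions (edges D) (nxt D) M2" unfolding M2_def by (rule positions_insert[OF pos1]) (use efg in auto)
 have s3: "psum t (nxt D) M2 (X0 \<union> ?Y (~ \<kappa>) (~ a) (~ b)) = psum t (nxt D) M1 (X0 \<union> ?Y (~ \<kappa>) (~ a) (~ b))"
 by (rule psum_mono[OF pos1 pos2 _ eY]) (auto simp: M2_def)
 let ?h = "cut_at e n (1/2)"
 let ?X = "(%(u, v, p). (?h u, ?h v, p)) ` (X0 \<union> ?Y (~ \<kappa>) (~ a) (~ b))"
 have s4: "psum t (nxt D) M2 (X0 \<union> ?Y (~ \<kappa>) (~ a) (~ b)) = psum t (nxt D') (?h ` M2) ?X"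
 unfolding D'(2) by (rule psum_cut[OF pos2 efg(1) ov(4) _ _ _ _ refl]) (use eY in \<open>auto simp: M2_def\<close>)
 have hr: "?h (e, rank w q) = (w, param D' (w, q))" if "w = e \<or> w = n" "crosses D' w q" for w q
 using that D'.param(1,2)[OF that(2)] ne by (auto simp: cut_at_def rank_def)
 have h: "?h (e, ef) = (x, param D' (x, f))" "?h (e, eg) = (y, param D' (y, g))" "?h (f, s) = (f, s)" "?h (g, s) = (g, s)"
 "?h (e, 1/2) = (n, 0)" "?h (u, 0) = (u, 0)" for s u
 using hr[OF x(1) x'] hr[OF y(1) y'] efg by (auto simp: abbr cut_at_def)
 have hP0: "?h (pos D (u, v)) = pos D (u, v)" if "(u, v) \<in> P0" for u v
 using P0[OF that] by (auto simp: cut_at_def pos_def)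
 have N': "?h ` M2 = nodes D'"
 proof -
 have "?h ` (%h. (h, 0)) ` edges D = (%h. (h, 0)) ` edges D" unfolding image_image h ..
 moreover have "?h ` pos D ` P0 = pos D ` P0" unfolding image_image using hP0 by (intro image_cong refl) auto
 ultimately show ?thesis unfolding M2_def M1 nodes' image_insert image_Un h by (auto simp: h)
 qed
 have X': "?X = xings D'"
 proof -
 have fl: "\<kappa> = (eg < ef)" "a = (ff < fe)" "b = (gg < ge)"
 using fl1 x(4) y(4) unfolding flags abbr by auto
 have ne': "eg ~= ef" "ff ~= fe" "gg ~= ge" using ner x(4) y(4) unfolding abbr by auto
 have Y': "?Y (~ \<kappa>) (~ a) (~ b) = {((e, ef), (f, fe), pf), ((e, eg), (g, ge), pg), ((f, ff), (g, gg), pfg)}"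
 using ne' unfolding R3_crossings_def en fl by (cases "eg < ef"; cases "ff < fe"; cases "gg < ge") (auto simp: min_def max_def)
 have sgn: "pf = positive D' (x, f)" "pg = positive D' (y, g)" "pfg = positive D' (f, g)"
 using exit_sign[OF cr(1) x(1) x'] exit_sign[OF cr(2) y(1) y'] other(3) efg by (auto simp: signs positive_def)
 have "param D' (f, g) = ff" "param D' (g, f) = gg" using param_other efg by (auto simp: abbr)
 then have "(%(u, v, p). (?h u, ?h v, p)) ` ?Y (~ \<kappa>) (~ a) (~ b) =
 (%(e, f). (pos D' (e, f), pos D' (f, e), positive D' (e, f))) ` {(x, f), (y, g), (f, g)}"
 unfolding Y' by (simp add: h sgn pos_def abbr(3,5))
 moreover have "(%(u, v, p). (?h u, ?h v, p)) ` X0 =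
 (%(e, f). (pos D' (e, f), pos D' (f, e), positive D' (e, f))) ` (over D \<inter> P0)"
 unfolding X0_def image_image
 proof (intro image_cong refl)
 fix q assume q: "q \<in> over D \<inter> P0"
 obtain u v where uv: "q = (u, v)" by (cases q)
 have u: "(u, v) \<in> P0" "(v, u) \<in> P0" using q uv unfolding P0_def passages_def by auto
 then show "(case (case q of (u, v) => (pos D (u, v), pos D (v, u), positive D (u, v))) of (u, v, p) => (?h u, ?h v, p)) =
 (case q of (e, f) => (pos D' (e, f), pos D' (f, e), positive D' (e, f)))"
 using P0[OF u(1)] param_other[of u v] param_other[of v u] other(3)[of u] other(3)[of v]
 by (simp add: uv hP0) (simp add: pos_def positive_def)
 qed
 ultimately show ?thesis unfolding xings_def by (subst O') (simp only: image_Un)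
 qed
 show ?thesis using s1 s2 s3 s4 unfolding N' X' by (simp add: Z_def)
qed

end

section \<open>Virtualization reverses one sign in the state sum\<close>

text \<open>The new edges are parts of old ones (\<open>sub\<close>) and meet each other only in the
  new vertex (\<open>both\<close>), so genericity is inherited. This is applied to the intermediate
  diagram in which the virtualized edge has been cut only once.\<close>

lemma vdiagram_split:
 assumes D: "vdiagram D" and e: "e \<in> edges D" "n \<notin> edges D" and s0: "0 < s0" "s0 < 1"
 and off: "\<And>f. f \<in> edges D ==> f ~= e ==> pt D e s0 \<notin> seg D f"
 shows "vdiagram (split e n (pt D e s0) D)"
proof -
 interpret diagram D by (rule diagramI[OF D])
 let ?z = "pt D e s0"
 define D' where "D' = split e n ?z D"
 let ?par = "id(n := e)"
 have F: "edges D' = insert n (edges D)" "nxt D' = (nxt D)(e := n, n := nxt D e)" "vpos D' = (vpos D)(n := ?z)"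
 by (simp_all add: D'_def split_def add_vertex_def Let_def)
 have ov: "over D' = {(x, y). crosses D' x y & (?par x, ?par y) \<in> over D}"
 by (simp add: D'_def split_def Let_def crosses_def src_def tgt_def)
 have ne: "e ~= n" using e by auto
 have nn: "nxt D x ~= n" if "x \<in> edges D" for x using nxt_in[OF that] e by auto
 have st: "src D' e = src D e" "tgt D' e = ?z" "src D' n = ?z" "tgt D' n = tgt D e"
 "x \<in> edges D ==> src D' x = src D x" "x \<in> edges D ==> x ~= e ==> tgt D' x = tgt D x" for x
 using ne nn[OF e(1)] e nn[of x] by (auto simp: src_def tgt_def F)
 have pts: "pt D' e s = pt D e (s * s0)" "pt D' n s = pt D e (s0 + s * (1 - s0))" for s
 by (simp_all add: pt_def direction_def st algebra_simps)
 have sege: "z \<in> seg D' e \<longleftrightarrow> (\<exists>s. 0 <= s & s <= s0 & z = pt D e s)" for z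
 proof
 assume "z \<in> seg D' e"
 then obtain s where "0 <= s" "s <= 1" "z = pt D e (s * s0)" unfolding mem_seg pts by blast
 then show "\<exists>s. 0 <= s & s <= s0 & z = pt D e s" using s0
 by (intro exI[of _ "s * s0"]) (auto simp: mult_left_le_one_le)
 next
 assume "\<exists>s. 0 <= s & s <= s0 & z = pt D e s"
 then obtain s where "0 <= s" "s <= s0" "z = pt D e s" by blast
 then show "z \<in> seg D' e" using s0 unfolding mem_seg pts by (intro exI[of _ "s / s0"]) auto
 qed
 have segn: "z \<in> seg D' n \<longleftrightarrow> (\<exists>s. s0 <= s & s <= 1 & z = pt D e s)" for z
 proof
 assume "z \<in> seg D' n"
 then obtain s where s: "0 <= s" "s <= 1" "z = pt D e (s0 + s * (1 - s0))" unfolding mem_seg pts by blast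
 have "(1 - s) * (1 - s0) >= 0" "0 <= s * (1 - s0)" using s s0 by simp_all
 then have "s0 <= s0 + s * (1 - s0)" "s0 + s * (1 - s0) <= 1" by (simp_all add: algebra_simps)
 then show "\<exists>s. s0 <= s & s <= 1 & z = pt D e s" using s(3) by blast
 next
 assume "\<exists>s. s0 <= s & s <= 1 & z = pt D e s"
 then obtain s where "s0 <= s" "s <= 1" "z = pt D e s" by blast
 then show "z \<in> seg D' n" using s0 unfolding mem_seg pts by (intro exI[of _ "(s - s0) / (1 - s0)"]) auto
 qed
 have sego: "seg D' x = seg D x" if "x \<in> edges D" "x ~= e" for x using that by (simp add: seg_def st)
 have sub: "seg D' x \<subseteq> seg D (?par x)" if "x \<in> insert n (edges D)" for x
 proof (cases "x = e \<or> x = n")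
 case True
 have "z \<in> seg D e" if z: "z \<in> seg D' e \<or> z \<in> seg D' n" for z
 proof -
 have "\<exists>s. 0 <= s & s <= 1 & z = pt D e s"
 proof -
 consider s where "0 <= s" "s <= s0" "z = pt D e s" | s where "s0 <= s" "s <= 1" "z = pt D e s"
 using z unfolding sege segn by blast
 then show ?thesis
 proof cases
 case (1 s)
 then show ?thesis using s0 by (intro exI[of _ s]) simp
 next
 case (2 s)
 then show ?thesis using s0 by (intro exI[of _ s]) simp
 qed
 qed
 then show ?thesis unfolding mem_seg .
 qed
 then show ?thesis using True by auto
 next
 case False
 then show ?thesis using that sego by auto
 qed
 have both: "z = ?z" if "z \<in> seg D' e" "z \<in> seg D' n" for z
 using that pt_inj[OF e(1)] unfolding sege segn by (metis order_antisym)
 have "vdiagram D'"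
 unfolding vdiagram_def generic_def F(1)
 proof (intro conjI ballI impI)
 show "finite (insert n (edges D))" using finite_edges by simp
 have 1: "bij_betw (nxt D) (edges D) (edges D)" by (rule bij_nxt)
 show "bij_betw (nxt D') (insert n (edges D)) (insert n (edges D))"
 using positions_cut[of "edges D" "nxt D" "insert (e, s0) (nodes D)" e n s0]
 positions_insert[OF positions_nodes, of e s0] e s0
 unfolding F by (auto simp: positions_def)
 fix x assume x: "x \<in> insert n (edges D)"
 show "src D' x ~= tgt D' x"
 proof (cases "x = e \<or> x = n")
 case True
 have "src D e ~= pt D e s0" "pt D e s0 ~= tgt D e"
 using pt_inj[OF e(1), of 0 s0] pt_inj[OF e(1), of s0 1] s0 by auto
 then show ?thesis using True st by auto
 next
 case False
 then show ?thesis using x st(5,6)[of x] src_ne_tgt[of x] by auto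
 qed
 show "nxt D' (nxt D' x) ~= x"
 proof (cases "x = e \<or> x = n")
 case True
 then show ?thesis using ne nn[OF e(1)] nn[OF nxt_in[OF e(1)]] nxt_ne[OF e(1)] nxt_nxt[OF e(1)] by (auto simp: F)
 next
 case False
 then have "x \<in> edges D" using x by auto
 then show ?thesis using False nn[of x] nxt_nxt[of x] by (auto simp: F)
 qed
 fix f assume f: "f \<in> insert n (edges D)"
 show "f = x \<or> nxt D' f = x" if a: "src D' x \<in> seg D' f"
 proof (cases "x = n")
 case True
 have "f = e \<or> f = n"
 using off[of f] f a sego[of f] True st by auto
 then show ?thesis using True ne by (auto simp: F)
 next
 case False
 then have xe: "x \<in> edges D" using x by auto
 have v: "src D x \<in> seg D (?par f)" using sub[OF f] a st(5)[OF xe] by auto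
 have pf: "?par f \<in> edges D" using f e by auto
 from vertex_on_edge[OF xe pf v] consider "f = x" | "f = n" "x = e" | "nxt D (?par f) = x" "f ~= e" "f ~= n" | "nxt D e = x" "f = e" | "nxt D e = x" "f = n"
 by (auto split: if_splits)
 then show ?thesis
 proof cases
 case 2
 then have "src D e = pt D e 0" "\<exists>s. s0 <= s & s <= 1 & src D e = pt D e s" using a st segn by auto
 then show ?thesis using pt_inj[OF e(1)] s0 by (metis not_less)
 next
 case 3
 then show ?thesis by (simp add: F)
 next
 case 4
 then have "src D x = pt D e 1" by (simp add: tgt_src)
 moreover have "\<exists>s. 0 <= s & s <= s0 & src D x = pt D e s" using a st(5)[OF xe] sege 4 by auto
 ultimately show ?thesis using pt_inj[OF e(1)] s0 by (metis not_less)
 next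
 case 5
 then show ?thesis using ne by (simp add: F)
 qed simp
 qed
 fix g assume g: "g \<in> insert n (edges D)"
 assume d: "x ~= f & f ~= g & x ~= g"
 show "seg D' x \<inter> seg D' f \<inter> seg D' g = {}"
 proof (rule ccontr)
 assume "~ ?thesis"
 then obtain w where w: "w \<in> seg D' x" "w \<in> seg D' f" "w \<in> seg D' g" by blast
 have offn: "h = e \<or> h = n" if "h \<in> insert n (edges D)" "?z \<in> seg D' h" for h
 using off[of h] sego[of h] that by auto
 show False
 proof (cases "?par x = ?par f \<or> ?par f = ?par g \<or> ?par x = ?par g")
 case True
 then have "w \<in> seg D' e" "w \<in> seg D' n" using d w by (auto split: if_splits)
 then have "w = ?z" by (rule both)
 then have "{x, f, g} \<subseteq> {e, n}" using offn x f g w by auto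
 then show False using d by auto
 next
 case False
 have "?par x \<in> edges D" "?par f \<in> edges D" "?par g \<in> edges D" using x f g e by auto
 then show False using no_triple[of "?par x" "?par f" "?par g" w] False sub[OF x] sub[OF f] sub[OF g] w by blast
 qed
 qed
 next
 fix c assume "c \<in> over D'"
 then obtain u v where c: "c = (u, v)" "crosses D' u v" "(?par u, ?par v) \<in> over D" unfolding ov by blast
 have "(?par v, ?par u) \<notin> over D" by (rule over_asym[OF c(3)])
 then show "case c of (e, f) => crosses D' e f & (f, e) \<notin> over D'" using c(1,2) unfolding ov by simp
 qed
 then show ?thesis by (simp add: D'_def)
qed

context bracket_model
begin

text \<open>The outer legs of the zigzag cross \<open>y\<close> virtually and leave no trace. The
  middle leg yields a crossing at the same place in the order along both strands, with the same
  overcrossing strand and the opposite sign.\<close>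

lemma Z_virtualization:
 assumes D: "vdiagram K" and v: "virtualization K i K'"
 shows "Z t K' = psum t (nxt K) (nodes K)
 ((%(u, v). (pos K (u, v), pos K (v, u), positive K (u, v) ~= ((u, v) = i))) ` over K)"
proof -
 obtain x y n1 n2 n3 n4 a b p q K1 where K1: "K1 = split n1 n4 b (split x n1 a K)" and
 i: "i = (x, y)" "i \<in> over K" and dist: "distinct [n1, n2, n3, n4]" "{n1, n2, n3, n4} \<inter> edges K = {}" and
 ab: "a \<in> open_segment (src K x) (tgt K x)" "b \<in> open_segment a (tgt K x)" and
 vK1: "vdiagram K1" and n1y: "(n1, y) \<in> over K1" and
 mo: "meets_only K1 {n1, y} (convex hull {a, p, q, b}) {a, b}" and
 K': "K' = (add_vertex n2 n3 q (add_vertex n1 n2 p K1))\<lparr>over := over K1 - {(n1, y)} \<union> {(n2, y)}\<rparr>" and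
 vK': "vdiagram K'" and cr: "crosses K' n1 y" "crosses K' n2 y" "crosses K' n3 y"
 using v unfolding virtualization_def Let_def by metis
 interpret K: diagram K by (rule diagramI[OF D])
 interpret K1: diagram K1 by (rule diagramI[OF vK1])
 interpret K': diagram K' by (rule diagramI[OF vK'])
 have xy: "crosses K x y" "x \<in> edges K" "y \<in> edges K" "x ~= y"
 using K.over_crosses i by (auto simp: crosses_def)
 define K0 where "K0 = split x n1 a K"
 have K1': "K1 = split n1 n4 b K0" by (simp add: K1 K0_def)
 obtain s0 where s0: "0 < s0" "s0 < 1" "a = pt K x s0" using ab(1) mem_open_seg[OF K.src_ne_tgt[OF xy(2)]] by auto
 have F0: "edges K0 = insert n1 (edges K)" "nxt K0 = (nxt K)(x := n1, n1 := nxt K x)" "vpos K0 = (vpos K)(n1 := a)"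
 by (simp_all add: K0_def split_def add_vertex_def Let_def)
 have F1: "edges K1 = insert n4 (edges K0)" "nxt K1 = (nxt K0)(n1 := n4, n4 := nxt K0 n1)" "vpos K1 = (vpos K0)(n4 := b)"
 by (simp_all add: K1' split_def add_vertex_def Let_def)
 have new: "n1 \<notin> edges K" "n4 \<notin> edges K0" "n2 \<notin> edges K1" "n3 \<notin> edges K1" "n2 ~= n3" "n1 ~= n4"
 using dist by (auto simp: F0 F1)
 have nx: "nxt K u ~= n1" "nxt K u ~= n4" if "u \<in> edges K" for u using K.nxt_in[OF that] dist by auto
 \<comment> \<open>Genericity is known for the diagram with both cuts. It keeps \<open>a\<close> off
   the foreign edges of \<open>K\<close>, which is what the diagram with a single cut
   requires.\<close>
 have off: "a \<notin> seg K f" if f: "f \<in> edges K" "f ~= x" for f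
 proof
 assume a: "a \<in> seg K f"
 have ff: "f ~= n1" "f ~= n4" "nxt K f ~= n1" "nxt K f ~= n4" using f dist nx by auto
 have "src K1 f = src K f" "tgt K1 f = tgt K f" using ff f by (simp_all add: src_def tgt_def F0 F1)
 then have "seg K1 f = seg K f" by (simp add: seg_def)
 moreover have "src K1 n1 = a" using new by (simp add: src_def F0 F1)
 ultimately have "f = n1 \<or> nxt K1 f = n1" using K1.vertex_on_edge[of n1 f] a f by (simp add: F0 F1)
 then show False using ff f by (simp add: F0 F1)
 qed
 have vK0: "vdiagram K0"
 unfolding K0_def s0(3) by (rule vdiagram_split[OF D xy(2) new(1) s0(1,2)]) (use off s0(3) in auto)
 interpret K0: diagram K0 by (rule diagramI[OF vK0])
 have n1: "n1 \<in> edges K0" "src K0 n1 = a" "tgt K0 n1 = tgt K x"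
 using nx[OF xy(2)] new xy by (auto simp: F0 src_def tgt_def)
 obtain s1 where s1: "0 < s1" "s1 < 1" "b = pt K0 n1 s1"
 using ab(2) mem_open_seg[OF K0.src_ne_tgt[OF n1(1)]] n1 by auto
 let ?par0 = "id(n1 := x)" and ?par1 = "id(n4 := n1)"
 note sp0 = psum_split[OF D vK0 xy(2) new(1) s0(1,2) K0_def[unfolded s0(3)]]
 note sp1 = psum_split[OF vK0 vK1 n1(1) new(2) s1(1,2) K1'[unfolded s1(3)]]
 define par where "par = ?par0 \<circ> ?par1"
 have par_over: "map_prod par par c \<in> over K & positive K1 c = positive K (map_prod par par c)" if "c \<in> over K1" for c
 using sp1(3)[OF that] sp0(3)[of "map_prod ?par1 ?par1 c"] by (simp add: par_def prod.map_comp)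
 have par_inj: "inj_on (map_prod par par) (over K1)"
 proof -
 have "map_prod par par = map_prod ?par0 ?par0 \<circ> map_prod ?par1 ?par1" by (simp add: par_def fun_eq_iff)
 moreover have "map_prod ?par1 ?par1 ` over K1 \<subseteq> over K0"
 by (rule image_subsetI) (rule sp1(3)[THEN conjunct1])
 ultimately show ?thesis using comp_inj_on[OF sp1(2) inj_on_subset[OF sp0(2)]] by simp
 qed
 have yn: "y ~= n1" "y ~= n4" using xy dist by auto
 have par_n1y: "map_prod par par (n1, y) = (x, y)" using yn new by (simp add: par_def)
 define qs where "qs = (%(u, v). positive K (u, v) ~= ((u, v) = i))"
 define qs1 where "qs1 = (%c. positive K1 c ~= (c = (n1, y)))"
 have q1: "qs (map_prod par par c) = qs1 c" if c: "c \<in> over K1" for c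
 proof -
 have "(map_prod par par c = (x, y)) = (c = (n1, y))"
 using inj_onD[OF par_inj, of c "(n1, y)"] c n1y par_n1y by auto
 moreover obtain u v where uv: "map_prod par par c = (u, v)" by (cases "map_prod par par c")
 ultimately show ?thesis using par_over[OF c] unfolding uv qs_def qs1_def i(1) by auto
 qed
 define X1 where "X1 = (%(u, v). (pos K1 (u, v), pos K1 (v, u), qs1 (u, v))) ` over K1"
 have X1': "X1 = (%(u, v). (pos K1 (u, v), pos K1 (v, u), qs (?par0 (?par1 u), ?par0 (?par1 v)))) ` over K1"
 unfolding X1_def using q1 by (intro image_cong refl) (auto simp: par_def)
 have S1: "psum t (nxt K1) (nodes K1) X1 = psum t (nxt K) (nodes K) ((%(u, v). (pos K (u, v), pos K (v, u), qs (u, v))) ` over K)"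
 unfolding X1' using sp1(1)[of t "%(u, v). qs (?par0 u, ?par0 v)"] sp0(1)[of t qs] by simp
 txt \<open>From now on only the zigzag is considered.\<close>
 have FK': "edges K' = insert n3 (insert n2 (edges K1))" "over K' = over K1 - {(n1, y)} \<union> {(n2, y)}"
 "nxt K' = ((nxt K1)(n1 := n2, n2 := nxt K1 n1))(n2 := n3, n3 := ((nxt K1)(n1 := n2, n2 := nxt K1 n1)) n2)"
 "vpos K' = (vpos K1)(n2 := p, n3 := q)"
 by (simp_all add: K' add_vertex_def)
 have e1: "n1 \<in> edges K1" "y \<in> edges K1" using xy by (auto simp: F0 F1)
 have nx1: "nxt K1 u ~= n2" "nxt K1 u ~= n3" if "u \<in> edges K1" for u using K1.nxt_in[OF that] new by auto
 have ne: "n1 ~= n2" "n1 ~= n3" "n2 ~= n3" "y ~= n2" "y ~= n3" "y ~= n1" using dist e1 new xy yn by auto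
 have st: "src K' u = src K1 u" "u ~= n1 ==> tgt K' u = tgt K1 u" if "u \<in> edges K1" for u
 proof -
 have "u ~= n2" "u ~= n3" using that new by auto
 then show "src K' u = src K1 u" "u ~= n1 ==> tgt K' u = tgt K1 u"
 using nx1[OF that] by (auto simp: src_def tgt_def FK')
 qed
 have st': "tgt K' n1 = p" "src K' n2 = p" "tgt K' n2 = q" "src K1 n1 = a" "tgt K1 n1 = b"
 using ne new by (auto simp: src_def tgt_def FK' F0 F1)
 let ?C = "convex hull {a, p, q, b}"
 have mo': "meets_only K1 {n1, y} ?C {src K1 n1, tgt K1 n1}" using mo by (simp add: st')
 have c1: "crosses K1 n1 y" "crosses K1 y n1" using K1.over_crosses[OF n1y] K1.crosses_sym by auto
 have no: "u = y" if u: "crosses K1 n1 u" for u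
 proof (rule ccontr)
 assume "u ~= y"
 then have "u \<notin> {n1, y}" using u by (auto simp: crosses_def)
 then show False by (intro K1.meets_only_no_crossing[OF mo' _ _ _ u]) (auto simp: hull_inc st')
 qed
 define P0 where "P0 = passages K1 - {(n1, y), (y, n1)}"
 have P0: "u \<in> edges K1 & v \<in> edges K1 & u ~= n1 & v ~= n1" if "(u, v) \<in> P0" for u v
 proof -
 have c: "crosses K1 u v" "crosses K1 v u"
 using that K1.passage_crosses[of u v] K1.crosses_sym[of u v] unfolding P0_def by blast+
 have "u ~= n1" using no[of v] c(1) that unfolding P0_def by blast
 moreover have "v ~= n1" using no[of u] c(2) that unfolding P0_def by blast
 ultimately show ?thesis using c(1) unfolding crosses_def by blast
 qed
 have P: "passages K1 = P0 \<union> {(n1, y), (y, n1)}" using n1y unfolding P0_def passages_def by auto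
 have O: "over K1 = (over K1 \<inter> P0) \<union> {(n1, y)}"
 using n1y K1.over_asym[OF n1y] unfolding P0_def passages_def by auto
 have O': "over K' = (over K1 \<inter> P0) \<union> {(n2, y)}"
 using K1.over_asym[OF n1y] unfolding FK' P0_def passages_def by auto
 have P': "passages K' = P0 \<union> {(n2, y), (y, n2)}"
 proof -
 have "P0 = (over K1 \<inter> P0) \<union> (over K1 \<inter> P0)\<inverse>" unfolding P0_def passages_def by auto
 then show ?thesis unfolding passages_def O' by auto
 qed
 have cr2: "crosses K' y n2" using cr(2) K'.crosses_sym by blast
 define \<phi> \<phi>' \<beta> s where d: "\<phi> = param K1 (y, n1)" "\<phi>' = param K' (y, n2)" "\<beta> = param K' (n2, y)" "s = param K1 (n1, y)"
 have rng: "0 < \<phi>" "\<phi> < 1" "0 < \<phi>'" "\<phi>' < 1" "0 < \<beta>" "\<beta> < 1" "0 < s" "s < 1"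
 unfolding d using K1.param(1,2)[OF c1(1)] K1.param(1,2)[OF c1(2)] K'.param(1,2)[OF cr(2)] K'.param(1,2)[OF cr2] by auto
 have pty: "pt K' y = pt K1 y" "direction K' y = direction K1 y"
 using st[OF e1(2)] ne by (auto simp: pt_def direction_def fun_eq_iff)
 have in_C: "pt K1 y \<phi> \<in> ?C" "pt K1 y \<phi>' \<in> ?C"
 proof -
 have "seg K1 n1 \<subseteq> ?C" "seg K' n2 \<subseteq> ?C"
 unfolding seg_def st' by (rule closed_segment_subset; simp add: hull_inc)+
 moreover have "pt K1 y \<phi> \<in> seg K1 n1" unfolding d K1.param(3)[OF c1(2)]
 using rng d by (intro pt_in_seg) auto
 moreover have "pt K1 y \<phi>' \<in> seg K' n2" unfolding d pty(1)[symmetric] K'.param(3)[OF cr2]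
 using rng d by (intro pt_in_seg) auto
 ultimately show "pt K1 y \<phi> \<in> ?C" "pt K1 y \<phi>' \<in> ?C" by auto
 qed
 have outside: "r < min \<phi> \<phi>' \<or> max \<phi> \<phi>' < r" if r: "(y, r) \<in> nodes K1" "r ~= \<phi>" for r
 proof (cases "r = 0")
 case True
 then show ?thesis using rng by auto
 next
 case False
 have nC: "pt K1 y r \<notin> ?C"
 proof (rule K1.foreign_node[OF r(1) False e1(1) _ mo'])
 fix g assume "g \<in> {n1, y}" "(y, g) \<in> passages K1"
 then show "param K1 (y, g) ~= r" using K1.passage_crosses[of y g] r(2) by (auto simp: d crosses_def)
 qed (use ne in auto)
 show ?thesis
 proof (rule ccontr)
 assume n: "~ ?thesis"
 have io: "pt K1 y (min \<phi> \<phi>') \<in> ?C" "pt K1 y (max \<phi> \<phi>') \<in> ?C" using in_C by (auto simp: min_def max_def)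
 show False
 proof (cases "\<phi> = \<phi>'")
 case True
 then show False using n r(2) by auto
 next
 case False
 then have "pt K1 y r \<in> closed_segment (pt K1 y (min \<phi> \<phi>')) (pt K1 y (max \<phi> \<phi>'))"
 using n by (intro pt_between) auto
 moreover have "closed_segment (pt K1 y (min \<phi> \<phi>')) (pt K1 y (max \<phi> \<phi>')) \<subseteq> ?C"
 using io by (intro closed_segment_subset) auto
 ultimately show False using nC by blast
 qed
 qed
 qed
 \<comment> \<open>The old edge and the first leg both start at \<open>a\<close>, so they cross
   \<open>y\<close> in the same sense. The middle leg starts where the first leg ends, on the far
   side of \<open>y\<close>, and crosses back.\<close>
 have sign: "positive K' (n2, y) = (~ positive K1 (n1, y))"
 proof -
 let ?d0 = "det2 (direction K1 n1) (direction K1 y)" and ?d1 = "det2 (direction K' n1) (direction K1 y)"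
 and ?d2 = "det2 (direction K' n2) (direction K1 y)"
 let ?\<alpha> = "param K' (n1, y)"
 have "s * ?d0 = ?\<alpha> * ?d1" "(1 - ?\<alpha>) * ?d1 = - \<beta> * ?d2"
 using K1.side_src_tgt(1)[OF c1(1)] K'.side_src_tgt[OF cr(1)] K'.side_src_tgt(1)[OF cr(2)] st[OF e1(1)] st[OF e1(2)]
 by (simp_all add: st' d pty)
 moreover have "?d0 ~= 0" "?d2 ~= 0" using K1.crosses_det[OF c1(1)] K'.crosses_det[OF cr(2)] pty by auto
 moreover note K'.param(1,2)[OF cr(1)] rng
 ultimately have "?d2 > 0 \<longleftrightarrow> ~ ?d0 > 0"
 by (smt (verit) mult_pos_pos mult_pos_neg mult_minus_left mult_nonneg_nonpos)
 then show ?thesis by (simp add: positive_def pty)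
 qed
 \<comment> \<open>Under the two cuts at one half \<open>(n1, 1/2 + \<beta>/4)\<close> becomes
   \<open>(n2, \<beta>/2)\<close> and then \<open>(n2, \<beta>)\<close>, so the passage ends up on
   the middle leg.\<close>
 define \<theta> where "\<theta> h r = (if h = n1 & r = s then 1/2 + \<beta>/4 else if h = y & r = \<phi> then \<phi>' else r)" for h r
 have \<theta>0: "\<theta> h 0 = 0" for h using rng by (auto simp: \<theta>_def)
 have N1: "(n1, r) \<in> nodes K1 \<longleftrightarrow> r = 0 \<or> r = s" for r
 proof -
 have "(n1, v) \<notin> P0" for v using P0[of n1 v] by auto
 then show ?thesis using e1 ne unfolding nodes_def P pos_def by (auto simp: image_iff d)
 qed
 have mono: "\<theta> h r < \<theta> h r'" if m: "(h, r) \<in> nodes K1" "(h, r') \<in> nodes K1" "r < r'" for h r r'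
 proof -
 consider "h = n1" | "h = y" | "h ~= n1" "h ~= y" by blast
 then show ?thesis
 proof cases
 case 1
 then show ?thesis using m N1 rng by (auto simp: \<theta>_def)
 next
 case 2
 then show ?thesis using m outside[of r] outside[of r'] ne by (cases "r = \<phi>"; cases "r' = \<phi>") (auto simp: \<theta>_def)
 qed (use m in \<open>auto simp: \<theta>_def\<close>)
 qed
 have \<theta>P0: "\<theta> u (param K1 (u, v)) = param K1 (u, v)" if "(u, v) \<in> P0" for u v
 proof -
 have "u = y ==> param K1 (y, v) ~= \<phi>"
 using K1.param_inj[OF K1.passage_crosses[of y v] c1(2)] that unfolding d P0_def by auto
 then show ?thesis using P0[OF that] by (auto simp: \<theta>_def)
 qed
 let ?\<theta> = "%(h, r). (h, \<theta> h r)"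
 define M1 where "M1 = ?\<theta> ` nodes K1"
 define X0 where "X0 = (%(u, v). (pos K1 (u, v), pos K1 (v, u), positive K1 (u, v))) ` (over K1 \<inter> P0)"
 define Y where "Y = {((n1, 1/2 + \<beta>/4), (y, \<phi>'), positive K' (n2, y))}"
 have nodes1: "nodes K1 = (%h. (h, 0)) ` edges K1 \<union> pos K1 ` P0 \<union> {(n1, s), (y, \<phi>)}"
 unfolding nodes_def P image_Un by (auto simp: pos_def d)
 have pp: "pos K' Q = pos K1 Q" if "Q \<in> P0" for Q
 using P0[of "fst Q" "snd Q"] that st by (cases Q) (auto simp: pos_def intro!: param_cong)
 have nodes': "nodes K' = insert (n3, 0) (insert (n2, 0) ((%h. (h, 0)) ` edges K1)) \<union> pos K1 ` P0 \<union> {(n2, \<beta>), (y, \<phi>')}"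
 proof -
 have "pos K' ` P0 = pos K1 ` P0" using pp by auto
 then show ?thesis unfolding nodes_def P' FK'(1) image_Un by (auto simp: pos_def d)
 qed
 have M1: "M1 = (%h. (h, 0)) ` edges K1 \<union> pos K1 ` P0 \<union> {(n1, 1/2 + \<beta>/4), (y, \<phi>')}"
 proof -
 have "?\<theta> ` (%h. (h, 0)) ` edges K1 = (%h. (h, 0)) ` edges K1" by (auto simp: \<theta>0 image_image)
 moreover have "?\<theta> ` pos K1 ` P0 = pos K1 ` P0"
 unfolding image_image using \<theta>P0 by (intro image_cong refl) (auto simp: pos_def)
 moreover have "\<theta> n1 s = 1/2 + \<beta>/4" "\<theta> y \<phi> = \<phi>'" using ne by (auto simp: \<theta>_def)
 ultimately show ?thesis unfolding M1_def nodes1 image_Un by auto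
 qed
 have pos1: "positions (edges K1) (nxt K1) M1"
 unfolding positions_def
 proof (intro conjI)
 have "u \<in> edges K1 & 0 <= r & r < 1" if "(u, r) \<in> M1" for u r
 using that positionsD(1)[OF K1.positions_nodes, of u r] e1 rng unfolding M1 nodes1 by auto
 then show "\<forall>v\<in>M1. case v of (u, r) => u \<in> edges K1 & 0 <= r & r < 1" by blast
 show "\<forall>h\<in>edges K1. (h, 0) \<in> M1" using M1 by auto
 show "finite M1" unfolding M1_def using positions_finite[OF K1.positions_nodes] by simp
 qed (rule K1.bij_nxt)
 have eX1: "ends X1 \<subseteq> nodes K1" using K1.ends_xings_nodes unfolding X1_def xings_def by (auto simp: ends_def)
 have X1'': "(%(u, v, p). ((fst u, \<theta> (fst u) (snd u)), (fst v, \<theta> (fst v) (snd v)), p)) ` X1 = X0 \<union> Y"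
 proof -
 have "(%(u, v, p). ((fst u, \<theta> (fst u) (snd u)), (fst v, \<theta> (fst v) (snd v)), p)) `
 (%(u, v). (pos K1 (u, v), pos K1 (v, u), qs1 (u, v))) ` (over K1 \<inter> P0) = X0"
 unfolding X0_def image_image
 proof (intro image_cong refl)
 fix c assume c: "c \<in> over K1 \<inter> P0"
 obtain u v where uv: "c = (u, v)" by (cases c)
 have "(u, v) \<in> P0" "(v, u) \<in> P0" "(u, v) ~= (n1, y)" using c uv unfolding P0_def passages_def by auto
 then show "(case (case c of (u, v) => (pos K1 (u, v), pos K1 (v, u), qs1 (u, v))) of
 (u, v, p) => ((fst u, \<theta> (fst u) (snd u)), (fst v, \<theta> (fst v) (snd v)), p)) =
 (case c of (u, v) => (pos K1 (u, v), pos K1 (v, u), positive K1 (u, v)))"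
 by (simp add: uv pos_def \<theta>P0 qs1_def)
 qed
 moreover have "(%(u, v, p). ((fst u, \<theta> (fst u) (snd u)), (fst v, \<theta> (fst v) (snd v)), p)) `
 (%(u, v). (pos K1 (u, v), pos K1 (v, u), qs1 (u, v))) ` {(n1, y)} = Y"
 using ne by (auto simp: pos_def Y_def \<theta>_def d qs1_def sign)
 ultimately show ?thesis unfolding X1_def by (subst O) (simp only: image_Un)
 qed
 have s1': "psum t (nxt K1) M1 (X0 \<union> Y) = psum t (nxt K1) (nodes K1) X1"
 unfolding M1_def X1''[symmetric]
 by (rule psum_rescale[where f=\<theta> and X=X1, OF K1.positions_nodes mono _ eX1 refl, symmetric]) (simp_all add: \<theta>0)
 have eX0: "ends X0 \<subseteq> pos K1 ` P0"
 unfolding X0_def ends_def P0_def passages_def by auto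
 have eY: "ends (X0 \<union> Y) \<subseteq> M1" using eX0 unfolding M1 by (auto simp: ends_Un Y_def)
 define M2 where "M2 = M1 \<union> {(n1, 1/2), (n1, 3/4)}"
 have pos2: "positions (edges K1) (nxt K1) M2"
 unfolding M2_def by (rule positions_Un[OF pos1]) (use e1 in auto)
 have s2: "psum t (nxt K1) M2 (X0 \<union> Y) = psum t (nxt K1) M1 (X0 \<union> Y)"
 by (rule psum_mono[OF pos1 pos2 _ eY]) (auto simp: M2_def)
 let ?h1 = "cut_at n1 n2 (1/2)" and ?h2 = "cut_at n2 n3 (1/2)"
 let ?nx = "(nxt K1)(n1 := n2, n2 := nxt K1 n1)"
 let ?X1 = "(%(x, y, p). (?h1 x, ?h1 y, p)) ` (X0 \<union> Y)"
 have m2: "(n1, 1/2) \<in> M2" by (simp add: M2_def)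
 have eY2: "ends (X0 \<union> Y) \<subseteq> M2" using eY by (auto simp: M2_def)
 have s3: "psum t (nxt K1) M2 (X0 \<union> Y) = psum t ?nx (?h1 ` M2) ?X1"
 by (rule psum_cut[OF pos2 e1(1) new(3) _ _ m2 eY2 refl]) auto
 have pos3: "positions (insert n2 (edges K1)) ?nx (?h1 ` M2)"
 by (rule positions_cut[OF pos2 e1(1) new(3) _ _ m2]) auto
 have m3: "(n2, 1/2) \<in> ?h1 ` M2"
 by (rule image_eqI[of _ _ "(n1, 3/4)"]) (auto simp: M2_def cut_at_def)
 have s4: "psum t ?nx (?h1 ` M2) ?X1 = psum t (nxt K') (?h2 ` ?h1 ` M2) ((%(x, y, p). (?h2 x, ?h2 y, p)) ` ?X1)"
 unfolding FK'(3) by (rule psum_cut[OF pos3 _ _ _ _ m3 _ refl]) (use new ne eY2 in \<open>auto simp: ends_map\<close>)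
 have "?h1 (n1, 1/2 + \<beta>/4) = (n2, \<beta>/2)" "?h2 (n2, \<beta>/2) = (n2, \<beta>)"
 using rng(5,6) ne new by (simp_all add: cut_at_def)
 then have h1: "?h2 (?h1 (n1, 1/2 + \<beta>/4)) = (n2, \<beta>)" by simp
 have h: "?h2 (?h1 (n1, 1/2)) = (n2, 0)" "?h2 (?h1 (n1, 3/4)) = (n3, 0)"
 "?h2 (?h1 (y, r)) = (y, r)" "u \<in> edges K1 ==> ?h2 (?h1 (u, 0)) = (u, 0)" for r u
 using rng ne new by (auto simp: cut_at_def field_simps)
 have hP0: "?h2 (?h1 (pos K1 (u, v))) = pos K1 (u, v)" if "(u, v) \<in> P0" for u v
 proof -
 have "u ~= n1" "u ~= n2" using P0[OF that] new by auto
 then show ?thesis by (simp add: cut_at_def pos_def)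
 qed
 have N': "?h2 ` ?h1 ` M2 = nodes K'"
 proof -
 have "?h2 ` ?h1 ` (%h. (h, 0)) ` edges K1 = (%h. (h, 0)) ` edges K1"
 unfolding image_image by (intro image_cong refl h(4))
 moreover have "?h2 ` ?h1 ` pos K1 ` P0 = pos K1 ` P0" unfolding image_image using hP0 by (intro image_cong refl) auto
 ultimately show ?thesis unfolding M2_def M1 nodes' image_Un by (auto simp: h h1)
 qed
 have X': "(%(x, y, p). (?h2 x, ?h2 y, p)) ` ?X1 = xings K'"
 proof -
 have "(%(x, y, p). (?h2 x, ?h2 y, p)) ` (%(x, y, p). (?h1 x, ?h1 y, p)) ` X0 =
 (%(e, f). (pos K' (e, f), pos K' (f, e), positive K' (e, f))) ` (over K1 \<inter> P0)"
 unfolding X0_def image_image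
 proof (intro image_cong refl)
 fix c assume c: "c \<in> over K1 \<inter> P0"
 obtain u v where uv: "c = (u, v)" by (cases c)
 have P: "(u, v) \<in> P0" "(v, u) \<in> P0" using c uv unfolding P0_def passages_def by auto
 then have "direction K' u = direction K1 u" "direction K' v = direction K1 v"
 using P0[OF P(1)] st by (simp_all add: direction_def)
 then show "(case (case (case c of (u, v) => (pos K1 (u, v), pos K1 (v, u), positive K1 (u, v))) of
 (x, y, p) => (?h1 x, ?h1 y, p)) of (x, y, p) => (?h2 x, ?h2 y, p)) =
 (case c of (e, f) => (pos K' (e, f), pos K' (f, e), positive K' (e, f)))"
 using P by (simp add: uv pp hP0 positive_def)
 qed
 moreover have "(%(x, y, p). (?h2 x, ?h2 y, p)) ` (%(x, y, p). (?h1 x, ?h1 y, p)) ` Y =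
 (%(e, f). (pos K' (e, f), pos K' (f, e), positive K' (e, f))) ` {(n2, y)}"
 using h1 h(3) by (simp add: Y_def pos_def d)
 ultimately show ?thesis unfolding xings_def O' image_Un by simp
 qed
 show ?thesis using S1 s1' s2 s3 s4 unfolding N' X' by (simp add: Z_def qs_def)
qed

end

section \<open>Connectivity, splicing, and arcs as involutions\<close>

lemma connected_by_refl [simp]: "(x, x) \<in> connected_by L"
 and connected_by_trans: "(x, y) \<in> connected_by L ==> (y, z) \<in> connected_by L ==> (x, z) \<in> connected_by L"
 and connected_by_edge: "{x, y} \<in> L ==> (x, y) \<in> connected_by L"
 by (auto simp: connected_by_def)

lemma sym_connected_by: "sym (connected_by L)"
 unfolding connected_by_def by (rule sym_rtrancl) (auto simp: sym_def insert_commute)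

lemma connected_by_sym: "(x, y) \<in> connected_by L ==> (y, x) \<in> connected_by L"
 using sym_connected_by by (rule symD)

lemma connected_by_induct [consumes 1, case_names refl step]:
 assumes "(x, y) \<in> connected_by L" "P x"
 and "\<And>y z. (x, y) \<in> connected_by L ==> {y, z} \<in> L ==> P y ==> P z"
 shows "P y"
 using assms(1) unfolding connected_by_def
 by (induction rule: rtrancl_induct) (use assms(2,3) in \<open>auto simp: connected_by_def\<close>)

lemma connected_by_map:
 assumes "(x, y) \<in> connected_by L" "\<And>a b. {a, b} \<in> L ==> (f a, f b) \<in> connected_by M"
 shows "(f x, f y) \<in> connected_by M"
 using assms(1) by (induction rule: connected_by_induct) (auto intro: connected_by_trans assms(2))

lemma connected_by_mono: "(x, y) \<in> connected_by L ==> L \<subseteq> M ==> (x, y) \<in> connected_by M"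
 by (rule connected_by_map[where f="%x. x"]) (auto intro: connected_by_edge)

lemma splice_edge: "{x, y} \<in> splice L J \<longleftrightarrow> x \<in> \<Union>L - \<Union>J & y \<in> \<Union>L - \<Union>J & x ~= y &
 (x, y) \<in> connected_by (L \<union> J)"
proof
 assume "{x, y} \<in> splice L J"
 then obtain a b where ab: "{x, y} = {a, b}" "a \<in> \<Union>L - \<Union>J" "b \<in> \<Union>L - \<Union>J" "a ~= b"
 "(a, b) \<in> connected_by (L \<union> J)" unfolding splice_def by blast
 then have "x = a & y = b \<or> x = b & y = a" by (auto simp: doubleton_eq_iff)
 then show "x \<in> \<Union>L - \<Union>J & y \<in> \<Union>L - \<Union>J & x ~= y & (x, y) \<in> connected_by (L \<union> J)"
 using ab connected_by_sym[OF ab(5)] by (elim disjE) simp_all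
qed (unfold splice_def, blast)

lemma splice_elem: "s \<in> splice L J ==> \<exists>x y. s = {x, y}"
 unfolding splice_def by blast

text \<open>A path is cut at its uses of \<open>J2\<close>. The stretches in between connect
  surviving points through \<open>L\<close> and \<open>J\<close>, so each is an arc of the splice or
  trivial (\<open>close\<close>).\<close>

lemma connected_by_splice:
 assumes J2: "\<Union>J2 \<subseteq> \<Union>L - \<Union>J" and a: "a \<in> \<Union>L - \<Union>J" and b: "b \<in> \<Union>L - \<Union>J"
 shows "(a, b) \<in> connected_by (splice L J \<union> J2) \<longleftrightarrow> (a, b) \<in> connected_by (L \<union> J \<union> J2)"
proof
 assume "(a, b) \<in> connected_by (splice L J \<union> J2)"
 then show "(a, b) \<in> connected_by (L \<union> J \<union> J2)"
 proof (rule connected_by_map[where f="%x. x"])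
 fix x y assume "{x, y} \<in> splice L J \<union> J2"
 then show "(x, y) \<in> connected_by (L \<union> J \<union> J2)"
 using connected_by_mono[of x y "L \<union> J" "L \<union> J \<union> J2"] connected_by_edge[of x y "L \<union> J \<union> J2"]
 by (auto simp: splice_edge)
 qed
next
 let ?M = "splice L J \<union> J2"
 have close: "(w, z) \<in> connected_by ?M" if "w \<in> \<Union>L - \<Union>J" "z \<in> \<Union>L - \<Union>J" "(w, z) \<in> connected_by (L \<union> J)" for w z
 proof (cases "w = z")
 case False
 then have "{w, z} \<in> ?M" using that by (simp add: splice_edge)
 then show ?thesis by (rule connected_by_edge)
 qed simp
 assume "(a, b) \<in> connected_by (L \<union> J \<union> J2)"
 then have "\<exists>w\<in>\<Union>L - \<Union>J. (a, w) \<in> connected_by ?M & (w, b) \<in> connected_by (L \<union> J)"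
 proof (induction rule: connected_by_induct)
 case refl
 then show ?case using a by (intro bexI[of _ a]) auto
 next
 case (step y z)
 then obtain w where w: "w \<in> \<Union>L - \<Union>J" "(a, w) \<in> connected_by ?M" "(w, y) \<in> connected_by (L \<union> J)" by blast
 show ?case
 proof (cases "{y, z} \<in> L \<union> J")
 case True
 then show ?thesis using w(1,2) connected_by_trans[OF w(3) connected_by_edge[OF True]] by blast
 next
 case False
 then have J: "{y, z} \<in> J2" using step(2) by simp
 then have yz: "y \<in> \<Union>L - \<Union>J" "z \<in> \<Union>L - \<Union>J" using subsetD[OF J2 UnionI[OF J]] by simp_all
 have "(w, y) \<in> connected_by ?M" by (rule close[OF w(1) yz(1) w(3)])
 moreover have "(y, z) \<in> connected_by ?M" by (rule connected_by_edge) (simp add: J)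
 ultimately have "(a, z) \<in> connected_by ?M" using connected_by_trans[OF connected_by_trans[OF w(2)]] by simp
 then show ?thesis using yz(2) connected_by_refl[of z "L \<union> J"] by blast
 qed
 qed
 then obtain w where w: "w \<in> \<Union>L - \<Union>J" "(a, w) \<in> connected_by ?M" "(w, b) \<in> connected_by (L \<union> J)" by blast
 show "(a, b) \<in> connected_by ?M" using w(2) close[OF w(1) b w(3)] by (rule connected_by_trans)
qed

lemma doubletons_eqI:
 assumes "\<And>s. s \<in> L ==> \<exists>x y. s = {x, y}" "\<And>s. s \<in> M ==> \<exists>x y. s = {x, y}"
 and "\<And>x y. {x, y} \<in> L \<longleftrightarrow> {x, y} \<in> M"
 shows "L = M"
proof (rule set_eqI)
 show "s \<in> L \<longleftrightarrow> s \<in> M" for s using assms(1)[of s] assms(2)[of s] assms(3) by auto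
qed

lemma splice_splice:
 assumes U: "\<Union>(splice L J) = \<Union>L - \<Union>J" and J2: "\<Union>J2 \<subseteq> \<Union>L - \<Union>J"
 shows "splice (splice L J) J2 = splice L (J \<union> J2)"
proof (rule doubletons_eqI)
 show "{x, y} \<in> splice (splice L J) J2 \<longleftrightarrow> {x, y} \<in> splice L (J \<union> J2)" for x y
 using connected_by_splice[OF J2, of x y] unfolding splice_edge U Union_Un_distrib Un_assoc Diff_iff Un_iff
 by blast
qed (auto dest: splice_elem)

text \<open>The cusp-free arcs match the points of a state in pairs. They are encoded by an
  involution \<open>m\<close> without fixed points on the set \<open>P\<close> of points
  (\<open>paired\<close>), so that splicing becomes a modification of \<open>m\<close>.\<close>

definition pairs :: "('p => 'p) => 'p set => 'p set set" where
 "pairs m P = (%x. {x, m x}) ` P"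

definition paired :: "('p => 'p) => 'p set => bool" where
 "paired m P \<longleftrightarrow> (\<forall>x\<in>P. m x \<in> P & m x ~= x & m (m x) = x)"

lemma pairedD: "paired m P ==> x \<in> P ==> m x \<in> P & m x ~= x & m (m x) = x"
 by (simp add: paired_def)

lemma Union_pairs: "paired m P ==> \<Union>(pairs m P) = P"
 by (auto simp: pairs_def paired_def)

lemma mem_pairs: "paired m P ==> {x, y} \<in> pairs m P \<longleftrightarrow> x \<in> P & y = m x"
 by (auto simp: pairs_def paired_def doubleton_eq_iff)

lemma connected_by_pairs:
 assumes "paired m P" "(x, y) \<in> connected_by (pairs m P)"
 shows "y = x \<or> x \<in> P & y = m x"
 using assms(2) by (induction rule: connected_by_induct) (use mem_pairs[OF assms(1)] pairedD[OF assms(1)] in auto)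

lemma eq_pairsI:
 assumes "paired m P" "\<And>s. s \<in> L ==> \<exists>x y. s = {x, y}" "\<And>x y. {x, y} \<in> L \<longleftrightarrow> x \<in> P & y = m x"
 shows "L = pairs m P"
 by (rule doubletons_eqI) (use assms(2,3) mem_pairs[OF assms(1)] in \<open>auto simp: pairs_def\<close>)

lemma splice_empty: "paired m P ==> splice (pairs m P) {} = pairs m P"
proof (rule eq_pairsI)
 assume p: "paired m P"
 show "{x, y} \<in> splice (pairs m P) {} \<longleftrightarrow> x \<in> P & y = m x" for x y
 using connected_by_pairs[OF p, of x y] connected_by_edge[of x "m x" "pairs m P"] pairedD[OF p, of x]
 by (auto simp: splice_edge Union_pairs[OF p] mem_pairs[OF p])
qed (auto dest: splice_elem)

text \<open>If \<open>x\<close> and \<open>y\<close> are partners, the modification of \<open>m\<close> is vacuous and the closed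
 curve through them disappears.\<close>

lemma splice_single:
 assumes p: "paired m P" and xy: "x \<in> P" "y \<in> P" "x ~= y"
 shows "paired (m(m x := m y, m y := m x)) (P - {x, y})"
 and "splice (pairs m P) {{x, y}} = pairs (m(m x := m y, m y := m x)) (P - {x, y})"
proof -
 let ?m = "m(m x := m y, m y := m x)"
 have inj: "m a = m b \<longleftrightarrow> a = b" if "a \<in> P" "b \<in> P" for a b using pairedD[OF p] that by metis
 note pd = pairedD[OF p]
 have other: "m a \<in> P & m a ~= x & m a ~= y" if "a \<in> P" "a ~= m x" "a ~= m y" for a
 using pd[OF that(1)] that pd[OF xy(1)] pd[OF xy(2)] by metis
 show p': "paired ?m (P - {x, y})"
 unfolding paired_def
 proof
 fix a assume a: "a \<in> P - {x, y}"
 show "?m a \<in> P - {x, y} & ?m a ~= a & ?m (?m a) = a"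
 proof (cases "a = m x \<or> a = m y")
 case True
 then have "m x ~= y" "m y ~= x" "m x ~= x" "m y ~= y" "m x \<in> P" "m y \<in> P" "m x ~= m y"
 using a pd[OF xy(1)] pd[OF xy(2)] xy(3) inj[OF xy(1,2)] by auto
 then show ?thesis using True by auto
 next
 case False
 then have "m a ~= m x" "m a ~= m y" using a xy inj by auto
 then show ?thesis using False a other[of a] pd[of a] by auto
 qed
 qed
 show "splice (pairs m P) {{x, y}} = pairs ?m (P - {x, y})"
 proof (rule eq_pairsI[OF p'])
 fix a b
 have "b = ?m a" if ab: "a \<in> P - {x, y}" "b \<in> P - {x, y}" "a ~= b" and c: "(a, b) \<in> connected_by (pairs m P \<union> {{x, y}})"
 proof (cases "a = m x \<or> a = m y")
 case True
 have "b \<in> {m x, m y, x, y}" using c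
 proof (induction rule: connected_by_induct)
 case (step u v)
 then show ?case using mem_pairs[OF p, of u v] pd xy by (auto simp: doubleton_eq_iff)
 qed (use True in auto)
 then show ?thesis using ab True by auto
 next
 case False
 have "b \<in> {a, m a}" using c
 proof (induction rule: connected_by_induct)
 case (step u v)
 then show ?case using mem_pairs[OF p, of u v] pd[of a] other[of a] False ab by (auto simp: doubleton_eq_iff)
 qed auto
 then show ?thesis using ab False by auto
 qed
 moreover have "(a, ?m a) \<in> connected_by (pairs m P \<union> {{x, y}})" if "a \<in> P - {x, y}"
 proof -
 let ?C = "connected_by (pairs m P \<union> {{x, y}})"
 have e: "(u, m u) \<in> ?C" "(m u, u) \<in> ?C" if "u \<in> P" for u
 using connected_by_edge[of u "m u"] connected_by_edge[of "m u" u] mem_pairs[OF p] pd that by auto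
 have "(x, y) \<in> ?C" "(y, x) \<in> ?C" by (auto intro!: connected_by_edge)
 then show ?thesis using e xy that connected_by_trans[of "m x" x _ y] connected_by_trans[of "m y" y _ x]
 connected_by_trans[of "m x" y _ "m y"] connected_by_trans[of "m y" x _ "m x"] by auto
 qed
 ultimately show "{a, b} \<in> splice (pairs m P) {{x, y}} \<longleftrightarrow> a \<in> P - {x, y} & b = ?m a"
 using pairedD[OF p', of a] unfolding splice_edge Union_pairs[OF p] by auto
 qed (auto dest: splice_elem)
qed

text \<open>The pairs in \<open>J\<close> are joined one at a time by \<open>splice_single\<close>.
  If joined points have opposite colours, the two ends of every remaining arc still have opposite
  colours.\<close>

lemma splice_pairs:
 assumes "finite J" and p: "paired m P" and flip: "\<And>c. flip (flip c) = c"
 and col: "\<And>x. x \<in> P ==> col (m x) = flip (col x)"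
 and J: "\<And>s. s \<in> J ==> \<exists>x y. s = {x, y} & x ~= y & col y = flip (col x)"
 and "\<Union>J \<subseteq> P" "pairwise disjnt J"
 shows "\<exists>m'. paired m' (P - \<Union>J) & splice (pairs m P) J = pairs m' (P - \<Union>J) &
 (\<forall>x\<in>P - \<Union>J. col (m' x) = flip (col x))"
 using assms(1,5-)
proof (induction J rule: finite_induct)
 case empty
 then show ?case using p splice_empty[OF p] col by auto
next
 case (insert s J)
 have "pairwise disjnt J" using insert.prems by (simp add: pairwise_insert)
 moreover have "\<Union>J \<subseteq> P" using insert.prems by auto
 ultimately obtain m' where m': "paired m' (P - \<Union>J)" "splice (pairs m P) J = pairs m' (P - \<Union>J)"
 "\<forall>x\<in>P - \<Union>J. col (m' x) = flip (col x)" using insert by auto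
 obtain x y where s: "s = {x, y}" "x ~= y" "col y = flip (col x)" using insert.prems(1)[of s] by auto
 have "disjnt s u" if "u \<in> J" for u using insert that by (auto simp: pairwise_insert)
 then have xy: "x \<in> P - \<Union>J" "y \<in> P - \<Union>J" using s insert.prems(2) by (auto simp: disjnt_def)
 let ?m = "m'(m' x := m' y, m' y := m' x)"
 have Q: "P - \<Union>(insert s J) = P - \<Union>J - {x, y}" using s by auto
 have "splice (pairs m P) (insert s J) = splice (splice (pairs m P) J) {s}"
 by (subst splice_splice) (use s xy Union_pairs[OF m'(1)] Union_pairs[OF p] in \<open>auto simp: m'(2)\<close>)
 also have "\<dots> = pairs ?m (P - \<Union>J - {x, y})"
 unfolding m'(2) s by (rule splice_single(2)[OF m'(1) xy s(2)])
 finally have "splice (pairs m P) (insert s J) = pairs ?m (P - \<Union>(insert s J))" unfolding Q .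
 moreover have "paired ?m (P - \<Union>(insert s J))" unfolding Q by (rule splice_single(1)[OF m'(1) xy s(2)])
 moreover have "\<forall>z\<in>P - \<Union>(insert s J). col (?m z) = flip (col z)"
 using m'(3) xy s(3) flip by auto
 ultimately show ?case by blast
qed

section \<open>Levels, and their preservation by the reduction of states\<close>

definition cusp_pairs :: "('p \<times> 'p) set => 'p set set" where
 "cusp_pairs C = (%(t, h). {t, h}) ` C"

text \<open>The colour of the other end of a cusp-free arc: the same level, with the roles of
  beginning and end exchanged.\<close>

definition flip :: "bool \<times> int => bool \<times> int" where
 "flip c = (~ fst c, snd c)"

lemma flip_flip [simp]: "flip (flip c) = c" and flip_ne [simp]: "flip c ~= c" "c ~= flip c"
 and flip_Pair [simp]: "flip (b, l) = (~ b, l)"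
 by (simp_all add: flip_def prod_eq_iff)

text \<open>A cusp-free arc stays at one level of the Alexander numbering; the colour of a point is its
 level together with the information whether the strand is about to end (\<^const>\<open>True\<close>) or has just
 begun.  At a cusp the level changes by one.\<close>

definition coherent :: "('p => bool \<times> int) => ('p => 'p) => 'p set => 'p config => bool" where
 "coherent col m P S \<longleftrightarrow> finite (cusps S) & paired m P & arcs S = pairs m P &
 P = \<Union>(cusp_pairs (cusps S)) \<union> range (boundary S) & (\<forall>x\<in>P. col (m x) = flip (col x)) &
 inj_on fst (cusps S) & inj_on snd (cusps S) & fst ` cusps S \<inter> snd ` cusps S = {} &
 inj (boundary S) & range (boundary S) \<inter> \<Union>(cusp_pairs (cusps S)) = {} &
 (\<forall>(t, h)\<in>cusps S. fst (col t) = fst (col h) &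
 snd (col t) = snd (col h) + (if fst (col t) then 1 else - 1)) &
 (\<exists>k. col (boundary S In_L) = (False, k + 1) & col (boundary S In_R) = (False, k) &
 col (boundary S Out_R) = (True, k) & col (boundary S Out_L) = (True, k + 1)) &
 partition_on (cusps S) (sites S) & (\<forall>s\<in>sites S. even (card s))"

lemma Union_cusp_pairs: "\<Union>(cusp_pairs C) = fst ` C \<union> snd ` C"
 by (force simp: cusp_pairs_def)

lemma cusp_pairs_Un: "cusp_pairs (C \<union> D) = cusp_pairs C \<union> cusp_pairs D"
 by (auto simp: cusp_pairs_def)

lemma coherentD:
 assumes "coherent col m P S"
 shows "finite (cusps S)" "paired m P" "arcs S = pairs m P"
 "P = fst ` cusps S \<union> snd ` cusps S \<union> range (boundary S)"
 "x \<in> P ==> col (m x) = flip (col x)"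
 "inj_on fst (cusps S)" "inj_on snd (cusps S)" "c \<in> cusps S ==> c' \<in> cusps S ==> fst c ~= snd c'"
 "inj (boundary S)" "c \<in> cusps S ==> fst c ~= boundary S a & snd c ~= boundary S a"
 "c \<in> cusps S ==> fst (col (fst c)) = fst (col (snd c)) &
 snd (col (fst c)) = snd (col (snd c)) + (if fst (col (fst c)) then 1 else - 1)"
 "partition_on (cusps S) (sites S)" "s \<in> sites S ==> even (card s)"
proof -
 show "c \<in> cusps S ==> fst c ~= boundary S a & snd c ~= boundary S a"
 using assms unfolding coherent_def Union_cusp_pairs by blast
qed (use assms in \<open>auto simp: coherent_def Union_cusp_pairs split_beta\<close>)

lemma coherent_levels:
 assumes "coherent col m P S"
 obtains k where "col (boundary S In_L) = (False, k + 1)" "col (boundary S In_R) = (False, k)"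
 "col (boundary S Out_R) = (True, k)" "col (boundary S Out_L) = (True, k + 1)"
 using assms unfolding coherent_def by auto

lemma even_card_partition:
 assumes "finite \<A>" "\<And>s. s \<in> \<A> ==> finite s & even (card s)" "disjoint \<A>"
 shows "even (card (\<Union>\<A>))"
 by (subst card_Union_disjoint) (use assms in \<open>auto intro: dvd_sum\<close>)

lemma coherent_even_cusps: "coherent col m P S ==> even (card (cusps S))"
proof -
 assume c: "coherent col m P S"
 have f: "finite (\<Union>(sites S))" and U: "\<Union>(sites S) = cusps S" and d: "disjoint (sites S)"
 using coherentD(1,12)[OF c] by (auto simp: partition_on_def)
 show ?thesis unfolding U[symmetric]
 using finite_UnionD[OF f] d coherentD(13)[OF c] finite_subset[OF Union_upper f] by (intro even_card_partition) auto
qed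

text \<open>The colouring \<open>col'\<close> differs from \<open>col\<close> only at the ends of
  deleted cusps and makes each of these cusps look like a plain join, so that
  \<open>splice_pairs\<close> applies. An even number of cusps is removed from the union of the
  sites concerned, hence the site formed by the rest is again even.\<close>

lemma delete_coherent:
 assumes c: "coherent col m P S" and Q: "Q \<subseteq> cusps S" "even (card Q)"
 and P': "P' = P - \<Union>(cusp_pairs Q)"
 and col': "\<And>x. x \<in> P' ==> col' x = col x" "\<And>x. x \<in> P ==> col' (m x) = flip (col' x)"
 "\<And>t h. (t, h) \<in> Q ==> col' h = flip (col' t)"
 shows "\<exists>m'. coherent col m' P' (delete_cusps Q S)"
proof -
 note C = coherentD[OF c]
 let ?J = "cusp_pairs Q"
 have fQ: "finite Q" using Q C(1) finite_subset by blast
 have JP: "\<Union>?J \<subseteq> P" using Q C(4) by (auto simp: Union_cusp_pairs)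
 have dist: "fst a ~= fst b" "snd a ~= snd b" if "a \<in> cusps S" "b \<in> cusps S" "a ~= b" for a b
 using that C(6,7) by (auto simp: inj_on_def)
 have "pairwise disjnt ?J"
 proof (rule pairwiseI)
 fix s s' assume "s \<in> ?J" "s' \<in> ?J" "s ~= s'"
 then obtain a b where ab0: "a \<in> Q" "b \<in> Q" "s = {fst a, snd a}" "s' = {fst b, snd b}"
 unfolding cusp_pairs_def image_iff split_beta by blast
 then have ab: "a \<in> cusps S" "b \<in> cusps S" "s = {fst a, snd a}" "s' = {fst b, snd b}" "a ~= b"
 using Q \<open>s ~= s'\<close> by auto
 then show "disjnt s s'" using dist[OF ab(1,2,5)] C(8)[OF ab(1,2)] C(8)[OF ab(2,1)] by (auto simp: disjnt_def)
 qed
 moreover have "\<exists>x y. s = {x, y} & x ~= y & col' y = flip (col' x)" if s: "s \<in> ?J" for s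
 proof -
 obtain t h where th: "(t, h) \<in> Q" "s = {t, h}" using s by (auto simp: cusp_pairs_def)
 have "t ~= h" using C(8)[of "(t, h)" "(t, h)"] th(1) Q by auto
 then show ?thesis using col'(3)[OF th(1)] th(2) by blast
 qed
 ultimately obtain m' where m': "paired m' P'" "splice (pairs m P) ?J = pairs m' P'"
 "\<forall>x\<in>P'. col' (m' x) = flip (col' x)"
 using splice_pairs[of ?J m P flip col'] fQ C(2) col'(2) JP unfolding P' by (auto simp: cusp_pairs_def)
 have S': "cusps (delete_cusps Q S) = cusps S - Q" "arcs (delete_cusps Q S) = pairs m' P'"
 "boundary (delete_cusps Q S) = boundary S"
 "sites (delete_cusps Q S) = {s \<in> sites S. s \<inter> Q = {}} \<union> ({\<Union>{s \<in> sites S. s \<inter> Q ~= {}} - Q} - {{}})"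
 using m'(2) C(3) by (simp_all add: delete_cusps_def cusp_pairs_def)
 have colm: "\<forall>x\<in>P'. col (m' x) = flip (col x)"
 using m'(3) col'(1) pairedD[OF m'(1)] by auto
 have eqP: "P' = \<Union>(cusp_pairs (cusps S - Q)) \<union> range (boundary S)"
 proof -
 have "x \<notin> \<Union>?J" if "x \<in> \<Union>(cusp_pairs (cusps S - Q)) \<union> range (boundary S)" for x
 proof
 assume "x \<in> \<Union>?J"
 then obtain a where a: "a \<in> Q" "x = fst a \<or> x = snd a" by (auto simp: Union_cusp_pairs)
 have aS: "a \<in> cusps S" using a Q by auto
 from that show False
 proof
 assume "x \<in> \<Union>(cusp_pairs (cusps S - Q))"
 then obtain b where b: "b \<in> cusps S" "b \<notin> Q" "x = fst b \<or> x = snd b" by (auto simp: Union_cusp_pairs)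
 then have "a ~= b" using a by auto
 then show False using a b(3) dist[OF aS b(1)] C(8)[OF aS b(1)] C(8)[OF b(1) aS] by auto
 next
 assume "x \<in> range (boundary S)"
 then obtain e where "x = boundary S e" by blast
 then show False using a(2) C(10)[OF aS, of e] by metis
 qed
 qed
 then show ?thesis unfolding P' C(4) by (auto simp: Union_cusp_pairs)
 qed
 let ?M = "{s \<in> sites S. s \<inter> Q ~= {}}"
 note part = C(12)[unfolded partition_on_def]
 have QM: "Q \<subseteq> \<Union>?M" using part Q by blast
 have fin: "finite (\<Union>(sites S))" using part C(1) by simp
 have fM: "finite ?M" "finite (\<Union>?M)" using finite_UnionD[OF fin] finite_subset[OF _ fin, of "\<Union>?M"] by auto
 have "even (card (\<Union>?M - Q))"
 proof -
 have "even (card (\<Union>?M))"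
 using fM C(13) finite_subset[OF Union_upper fin] part
 by (intro even_card_partition) (auto simp: disjoint_def)
 then show ?thesis using Q(2) QM fM fQ card_mono[OF fM(2) QM] by (simp add: card_Diff_subset)
 qed
 moreover have "partition_on (cusps S - Q) (sites (delete_cusps Q S))"
 unfolding S'(4)
 proof (rule partition_onI)
 show "\<Union>({s \<in> sites S. s \<inter> Q = {}} \<union> ({\<Union>?M - Q} - {{}})) = cusps S - Q"
 proof -
 have 1: "\<Union>({X} - {{}}) = X" for X :: "('a \<times> 'a) set" by auto
 have 2: "\<Union>(sites S) = cusps S" using part by simp
 show ?thesis unfolding Union_Un_distrib 1 2[symmetric] using QM by blast
 qed
 have dj: "u = v \<or> disjnt u v" if "u \<in> sites S" "v \<in> sites S" for u v
 using part that unfolding disjoint_def disjnt_def by blast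
 have old: "disjnt u (\<Union>?M - Q)" if u: "u \<in> sites S" "u \<inter> Q = {}" for u
 unfolding disjnt_def
 proof (rule equals0I)
 fix z assume "z \<in> u \<inter> (\<Union>?M - Q)"
 then obtain v where v: "v \<in> sites S" "v \<inter> Q ~= {}" "z \<in> v" "z \<in> u" by blast
 then show False using dj[OF u(1) v(1)] u(2) unfolding disjnt_def by blast
 qed
 fix p q assume "p \<in> {s \<in> sites S. s \<inter> Q = {}} \<union> ({\<Union>?M - Q} - {{}})" "q \<in> {s \<in> sites S. s \<inter> Q = {}} \<union> ({\<Union>?M - Q} - {{}})" and ne: "p ~= q"
 then consider "p \<in> sites S" "q \<in> sites S" | "p \<in> sites S" "p \<inter> Q = {}" "q = \<Union>?M - Q" |
 "q \<in> sites S" "q \<inter> Q = {}" "p = \<Union>?M - Q" by blast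
 then show "disjnt p q"
 by cases (use dj[of p q] ne old[of p] old[of q] in \<open>simp_all add: disjnt_sym\<close>)
 qed (use part in auto)
 moreover note coherent_levels[OF c]
 ultimately have "coherent col m' P' (delete_cusps Q S)"
 using c m'(1) colm eqP unfolding coherent_def S'
 by (auto simp: inj_on_def Union_cusp_pairs)
 then show ?thesis by blast
qed

text \<open>Two consecutive cusps with the same arrow direction change the level in opposite senses.
  After both of them the strand is back at its level, to which the arc between them is
  recoloured.\<close>

lemma cancellation_coherent:
 assumes c: "coherent col m P S" and Q: "Q \<in> cancellations S"
 shows "\<exists>m'. coherent col m' (P - \<Union>(cusp_pairs Q)) (delete_cusps Q S)"
proof -
 note C = coherentD[OF c]
 obtain a b where ab: "Q = {a, b}" "a \<in> cusps S" "b \<in> cusps S" "a ~= b" "{snd a, fst b} \<in> arcs S"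
 using Q unfolding cancellations_def by blast
 obtain t h t' h' where th: "a = (t, h)" "b = (t', h')" by (cases a; cases b)
 have ht: "m h = t'" "h \<in> P" using ab(5) unfolding C(3) mem_pairs[OF C(2)] th by auto
 have th': "m t' = h" using pairedD[OF C(2) ht(2)] ht(1) by auto
 have ne: "t ~= t'" "h ~= h'" "t ~= h" "t' ~= h'" "t ~= h'" "t' ~= h"
 using inj_on_eq_iff[OF C(6) ab(2,3)] inj_on_eq_iff[OF C(7) ab(2,3)] ab(4)
 C(8)[OF ab(2,2)] C(8)[OF ab(2,3)] C(8)[OF ab(3,2)] C(8)[OF ab(3,3)] unfolding th by auto
 have "col t' = flip (col h)" using C(5)[OF ht(2)] ht(1) by simp
 then have lev: "col h' = flip (col t)"
 using C(11)[OF ab(2)] C(11)[OF ab(3)] unfolding th by (auto simp: flip_def prod_eq_iff split: if_splits)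
 let ?col = "col(h := flip (col t), t' := col t)"
 have inj: "m x = m y \<longleftrightarrow> x = y" if "x \<in> P" "y \<in> P" for x y using pairedD[OF C(2)] that by metis
 show ?thesis
 proof (rule delete_coherent[OF c _ _ refl, where col'="?col"])
 show "Q \<subseteq> cusps S" "even (card Q)" using ab by auto
 show "?col x = col x" if "x \<in> P - \<Union>(cusp_pairs Q)" for x
 using that by (auto simp: ab th Union_cusp_pairs)
 have t': "t' \<in> P" using ht pairedD[OF C(2) ht(2)] by auto
 fix x assume x: "x \<in> P"
 show "?col (m x) = flip (?col x)"
 proof (cases "x = h \<or> x = t'")
 case True
 then show ?thesis using ht th' ne by auto
 next
 case False
 then have "m x ~= t'" "m x ~= h" using inj[OF x ht(2)] inj[OF x t'] ht th' by auto
 then show ?thesis using False C(5)[OF x] by simp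
 qed
 qed (use lev ne in \<open>auto simp: ab th\<close>)
qed

text \<open>The level changes along the four cusps cancel as well (\<open>lev\<close>), so the six
  inner points can be recoloured to the level of the two outer ones.\<close>

lemma precedence_coherent:
 assumes c: "coherent col m P S" and Q: "Q \<in> precedence S"
 shows "\<exists>m'. coherent col m' (P - \<Union>(cusp_pairs Q)) (delete_cusps Q S)"
 and "Q \<subseteq> cusps S" "Q ~= {}"
proof -
 note C = coherentD[OF c]
 obtain b1 b2 b3 b4 where b: "Q = {b1, b2, b3, b4}" "b1 ~= b4" "{b1, b4} \<in> sites S"
 "b2 \<in> cusps S - {b1, b4}" "b3 \<in> cusps S - {b1, b4}" "b2 ~= b3" 
 and ar: "{snd b1, snd b2} \<in> arcs S" "{fst b2, snd b3} \<in> arcs S" "{fst b3, fst b4} \<in> arcs S"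
 using Q unfolding precedence_def by blast
 have "\<Union>(sites S) = cusps S" using C(12) by (simp add: partition_on_def)
 then have S: "b1 \<in> cusps S" "b2 \<in> cusps S" "b3 \<in> cusps S" "b4 \<in> cusps S" using b by auto
 show Q': "Q \<subseteq> cusps S" "Q ~= {}" using b S by auto
 have dist: "fst x ~= fst y" "snd x ~= snd y" if "x \<in> cusps S" "y \<in> cusps S" "x ~= y" for x y
 using that C(6,7) by (auto simp: inj_on_def)
 have d: "b1 ~= b2" "b1 ~= b3" "b1 ~= b4" "b2 ~= b3" "b2 ~= b4" "b3 ~= b4" using b by auto
 note D = dist[OF S(1,2) d(1)] dist[OF S(1,3) d(2)] dist[OF S(1,4) d(3)] dist[OF S(2,3) d(4)]
 dist[OF S(2,4) d(5)] dist[OF S(3,4) d(6)]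
 have fs: "fst x ~= snd y" "snd y ~= fst x" if "x \<in> Q" "y \<in> Q" for x y using C(8)[OF subsetD[OF Q'(1) that(1)] subsetD[OF Q'(1) that(2)]] by auto
 have F: "fst x ~= snd y" "snd y ~= fst x" if "x \<in> {b1, b2, b3, b4}" "y \<in> {b1, b2, b3, b4}" for x y
 using fs that unfolding b(1) by blast+
 have dis: "distinct [fst b1, snd b1, fst b2, snd b2, fst b3, snd b3, fst b4, snd b4]"
 using D F[of b1 b1] F[of b1 b2] F[of b1 b3] F[of b1 b4] F[of b2 b1] F[of b2 b2] F[of b2 b3] F[of b2 b4]
 F[of b3 b1] F[of b3 b2] F[of b3 b3] F[of b3 b4] F[of b4 b1] F[of b4 b2] F[of b4 b3] F[of b4 b4] by simp
 have dis': "distinct [snd b4, fst b4, snd b3, fst b3, snd b2, fst b2, snd b1, fst b1]" using dis by auto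
 note ar' = ar[unfolded C(3) mem_pairs[OF C(2)]]
 have mm: "m (snd b1) = snd b2" "m (snd b2) = snd b1" "m (fst b2) = snd b3" "m (snd b3) = fst b2"
 "m (fst b3) = fst b4" "m (fst b4) = fst b3"
 using ar' pairedD[OF C(2)] by metis+
 have inP: "snd b1 \<in> P" "snd b2 \<in> P" "fst b2 \<in> P" "snd b3 \<in> P" "fst b3 \<in> P" "fst b4 \<in> P"
 using S unfolding C(4) by auto
 define c1 where "c1 = col (fst b1)"
 have colm: "col (snd b2) = flip (col (snd b1))" "col (snd b3) = flip (col (fst b2))" "col (fst b4) = flip (col (fst b3))"
 using C(5)[OF inP(1)] C(5)[OF inP(3)] C(5)[OF inP(5)] mm by auto
 have lev: "col (snd b4) = flip c1"
 using C(11)[OF S(1)] C(11)[OF S(2)] C(11)[OF S(3)] C(11)[OF S(4)] colm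
 unfolding c1_def by (auto simp: flip_def prod_eq_iff split: if_splits)
 let ?X = "{snd b1, snd b2, fst b2, snd b3, fst b3, fst b4}"
 let ?col = "%x. if x \<in> {snd b1, fst b2, fst b3} then flip c1 else if x \<in> {snd b2, snd b3, fst b4} then c1 else col x"
 have inj: "m x = m y \<longleftrightarrow> x = y" if "x \<in> P" "y \<in> P" for x y using pairedD[OF C(2)] that by metis
 show "\<exists>m'. coherent col m' (P - \<Union>(cusp_pairs Q)) (delete_cusps Q S)"
 proof (rule delete_coherent[OF c Q'(1) _ refl, where col'="?col"])
 show "even (card Q)" using d unfolding b(1) by simp
 show "?col x = col x" if "x \<in> P - \<Union>(cusp_pairs Q)" for x
 proof -
 have "x \<notin> ?X" using that unfolding Union_cusp_pairs b(1) by auto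
 then show ?thesis by auto
 qed
 have s: "m ` ?X \<subseteq> ?X" unfolding image_insert mm by blast
 fix x assume x: "x \<in> P"
 show "?col (m x) = flip (?col x)"
 proof (cases "x \<in> ?X")
 case True
 then show ?thesis using mm dis dis' by (elim insertE emptyE) simp_all
 next
 case False
 moreover have "m x \<notin> ?X"
 proof
 assume "m x \<in> ?X"
 then have "m (m x) \<in> ?X" using s by blast
 then show False using pairedD[OF C(2) x] False by simp
 qed
 ultimately have "?col x = col x" "?col (m x) = col (m x)" by auto
 then show ?thesis using C(5)[OF x] by simp
 qed
 next
 fix t h assume "(t, h) \<in> Q"
 then have "t = fst b1 & h = snd b1 \<or> t = fst b2 & h = snd b2 \<or> t = fst b3 & h = snd b3 \<or> t = fst b4 & h = snd b4"
 unfolding b(1) by (metis fst_conv snd_conv insertE emptyE)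
 then show "?col h = flip (?col t)"
 using lev dis dis' by (elim disjE conjE) (simp_all add: c1_def)
 qed
qed

lemma reductions_coherent:
 assumes "coherent col m P S" "Q \<in> reductions S"
 shows "\<exists>m'. coherent col m' (P - \<Union>(cusp_pairs Q)) (delete_cusps Q S)" "Q \<subseteq> cusps S" "Q ~= {}"
proof -
 have "Q \<in> precedence S \<or> Q \<in> cancellations S" using assms(2) by (auto simp: reductions_def split: if_splits)
 moreover have "Q \<subseteq> cusps S" "Q ~= {}" if "Q \<in> cancellations S" using that by (auto simp: cancellations_def)
 ultimately show "\<exists>m'. coherent col m' (P - \<Union>(cusp_pairs Q)) (delete_cusps Q S)" "Q \<subseteq> cusps S" "Q ~= {}"
 using precedence_coherent[OF assms(1)] cancellation_coherent[OF assms(1)] by blast+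
qed

text \<open>An arc at the lower end of a cusp leads to the upper end of a cusp one level below, or to the
 boundary; otherwise there is a cancellation.  Hence all cusps lie between the two levels of the
 boundary.\<close>

definition low :: "('p => bool \<times> int) => 'p \<times> 'p => 'p" where
 "low col c = (if fst (col (fst c)) then snd c else fst c)"

definition high :: "('p => bool \<times> int) => 'p \<times> 'p => 'p" where
 "high col c = (if fst (col (fst c)) then fst c else snd c)"

lemma reduced_neighbours:
 assumes c: "coherent col m P S" and no: "cancellations S = {}" and a: "a \<in> cusps S"
 shows "m (low col a) \<in> range (boundary S) \<or> (\<exists>b\<in>cusps S. m (low col a) = high col b)"
 and "m (high col a) \<in> range (boundary S) \<or> (\<exists>b\<in>cusps S. m (high col a) = low col b)"
proof -
 note C = coherentD[OF c]
 \<comment> \<open>A head joined to a tail would be a cancellation. A cusp is not joined to itself,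
   since its two ends agree in the first component of the colour while the ends of an arc
   differ.\<close>
 have nc: "m (snd x) ~= fst y" "m (fst y) ~= snd x" if xy: "x \<in> cusps S" "y \<in> cusps S" for x y
 proof -
 have P: "snd x \<in> P" "fst y \<in> P" using xy C(4) by auto
 show *: "m (snd x) ~= fst y"
 proof
 assume e: "m (snd x) = fst y"
 then have "x ~= y" using C(5)[OF P(1)] C(11)[OF xy(1)] by (auto simp: flip_def prod_eq_iff)
 moreover have "{snd x, fst y} \<in> arcs S" using e P unfolding C(3) mem_pairs[OF C(2)] by simp
 ultimately show False using no xy unfolding cancellations_def by blast
 qed
 show "m (fst y) ~= snd x" using * pairedD[OF C(2) P(2)] by metis
 qed
 have key: "m x \<in> range (boundary S) \<or> (\<exists>b\<in>cusps S. m x = fst b \<or> m x = snd b)" if "x \<in> P" for x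
 using pairedD[OF C(2) that] unfolding C(4) by auto
 have P: "fst b \<in> P" "snd b \<in> P" if "b \<in> cusps S" for b using that C(4) by auto
 have col: "fst (col (m x)) \<longleftrightarrow> ~ fst (col x)" if "x \<in> P" for x using C(5)[OF that] by (simp add: flip_def)
 have same: "fst (col (snd b)) = fst (col (fst b))" if "b \<in> cusps S" for b using C(11)[OF that] by simp
 have fs: "m (fst a) \<in> range (boundary S) \<or> (\<exists>b\<in>cusps S. m (fst a) = fst b & fst (col (fst b)) = (~ fst (col (fst a))))"
 proof (cases "m (fst a) \<in> range (boundary S)")
 case False
 then obtain b where b: "b \<in> cusps S" "m (fst a) = fst b \<or> m (fst a) = snd b" using key P(1)[OF a] by blast
 then have "m (fst a) = fst b" using nc(2)[OF b(1) a] by blast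
 then show ?thesis using b(1) col[OF P(1)[OF a]] by metis
 qed simp
 have sn: "m (snd a) \<in> range (boundary S) \<or> (\<exists>b\<in>cusps S. m (snd a) = snd b & fst (col (fst b)) = (~ fst (col (fst a))))"
 proof (cases "m (snd a) \<in> range (boundary S)")
 case False
 then obtain b where b: "b \<in> cusps S" "m (snd a) = fst b \<or> m (snd a) = snd b" using key P(2)[OF a] by blast
 then have "m (snd a) = snd b" using nc(1)[OF a b(1)] by blast
 then show ?thesis using b(1) col[OF P(2)[OF a]] same[OF b(1)] same[OF a] by metis
 qed simp
 show "m (low col a) \<in> range (boundary S) \<or> (\<exists>b\<in>cusps S. m (low col a) = high col b)"
 "m (high col a) \<in> range (boundary S) \<or> (\<exists>b\<in>cusps S. m (high col a) = low col b)"
 using fs sn unfolding low_def high_def by (cases "fst (col (fst a))"; simp; metis)+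
qed

lemma range_tangle_end: "range f = {f In_L, f In_R, f Out_R, f Out_L}"
proof -
 have U: "UNIV = {In_L, In_R, Out_R, Out_L}" using tangle_end.exhaust by blast
 show ?thesis by (subst U) simp
qed

lemma all_tangle_end: "(\<forall>x. P x) \<longleftrightarrow> P In_L & P In_R & P Out_R & P Out_L"
 by (metis tangle_end.exhaust)

lemma doubleton_eqI:
 assumes "X \<subseteq> {a, b}" "card X ~= 1" "X ~= {}"
 shows "X = {a, b}"
proof -
 have "X ~= {a}" "X ~= {b}" using assms(2) by auto
 then show ?thesis using assms(1,3) by blast
qed

text \<open>A lowest cusp is joined to the boundary at its lower end, a highest cusp at its upper
  end. The boundary has only the levels \<open>k\<close> and \<open>k + 1\<close>, so all cusps lie
  between these and are joined to the boundary on both sides. The colour decides at which two ends,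
  so there are at most two cusps; their number is even, which excludes a single one.\<close>

lemma reduced_cusps:
 assumes c: "coherent col m P S" and no: "cancellations S = {}" and ne: "cusps S ~= {}"
 shows "cusps S = {(m (boundary S In_L), m (boundary S In_R)), (m (boundary S Out_R), m (boundary S Out_L))}"
 "m (boundary S In_L) \<notin> range (boundary S)"
proof -
 note C = coherentD[OF c]
 let ?b = "boundary S"
 obtain k where k: "col (?b In_L) = (False, k + 1)" "col (?b In_R) = (False, k)"
 "col (?b Out_R) = (True, k)" "col (?b Out_L) = (True, k + 1)" using coherent_levels[OF c] .
 let ?l = "%c. snd (col (low col c))"
 have hl: "snd (col (high col a)) = ?l a + 1" "fst (col (high col a)) = fst (col (fst a))" "fst (col (low col a)) = fst (col (fst a))"
 "low col a \<in> P" "high col a \<in> P" if "a \<in> cusps S" for a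
 using C(11)[OF that] that by (auto simp: low_def high_def C(4))
 have flv: "snd (col (m x)) = snd (col x)" "fst (col (m x)) = (~ fst (col x))" if "x \<in> P" for x
 using C(5)[OF that] by (auto simp: flip_def)
 have mb: "x = m y" if "m x = y" "x \<in> P" for x y using pairedD[OF C(2) that(2)] that(1) by auto
 have lv: "snd (col x) = k \<or> snd (col x) = k + 1" if "x \<in> range ?b" for x
 using that k unfolding range_tangle_end by auto
 have lowb: "m (low col x) \<in> range ?b" if x: "x \<in> cusps S" and n: "\<And>y. y \<in> cusps S ==> ?l x ~= ?l y + 1" for x
 proof (rule ccontr)
 assume "m (low col x) \<notin> range ?b"
 then obtain y where y: "y \<in> cusps S" "m (low col x) = high col y" using reduced_neighbours(1)[OF c no x] by blast
 then show False using flv(1)[OF hl(4)[OF x]] hl(1)[OF y(1)] n[OF y(1)] by simp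
 qed
 have highb: "m (high col x) \<in> range ?b" if x: "x \<in> cusps S" and n: "\<And>y. y \<in> cusps S ==> ?l x + 1 ~= ?l y" for x
 proof (rule ccontr)
 assume "m (high col x) \<notin> range ?b"
 then obtain y where y: "y \<in> cusps S" "m (high col x) = low col y" using reduced_neighbours(2)[OF c no x] by blast
 then show False using flv(1)[OF hl(5)[OF x]] hl(1)[OF x] n[OF y(1)] by simp
 qed
 have fin: "finite (?l ` cusps S)" "?l ` cusps S ~= {}" using C(1) ne by auto
 obtain a where a: "a \<in> cusps S" "Min (?l ` cusps S) = ?l a" using Min_in[OF fin] by (rule imageE)
 obtain a' where a': "a' \<in> cusps S" "Max (?l ` cusps S) = ?l a'" using Max_in[OF fin] by (rule imageE)
 have min: "?l a <= ?l x" "?l x <= ?l a'" if "x \<in> cusps S" for x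
 using Min_le[OF fin(1) imageI[OF that]] Max_ge[OF fin(1) imageI[OF that]] unfolding a(2) a'(2) by simp_all
 have "m (low col a) \<in> range ?b" by (rule lowb[OF a(1)]) (use min(1) in fastforce)
 from lv[OF this] have 1: "k <= ?l a" using flv(1)[OF hl(4)[OF a(1)]] by auto
 have "m (high col a') \<in> range ?b" by (rule highb[OF a'(1)]) (use min(2) in fastforce)
 from lv[OF this] have 2: "?l a' + 1 <= k + 1" using flv(1)[OF hl(5)[OF a'(1)]] hl(1)[OF a'(1)] by auto
 have lev: "?l x = k" if "x \<in> cusps S" for x using 1 2 min[OF that] by linarith
 have L: "m (low col x) = (if fst (col (fst x)) then ?b In_R else ?b Out_R)" if x: "x \<in> cusps S" for x
 proof -
 have "m (low col x) \<in> range ?b" by (rule lowb[OF x]) (simp add: lev x)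
 then have r: "m (low col x) \<in> {?b In_L, ?b In_R, ?b Out_R, ?b Out_L}" unfolding range_tangle_end .
 have "snd (col (m (low col x))) = k" "fst (col (m (low col x))) = (~ fst (col (fst x)))"
 using flv[OF hl(4)[OF x]] hl(1,2,3)[OF x] lev[OF x] by simp_all
 then show ?thesis using k r by (elim insertE emptyE) simp_all
 qed
 have H: "m (high col x) = (if fst (col (fst x)) then ?b In_L else ?b Out_L)" if x: "x \<in> cusps S" for x
 proof -
 have "m (high col x) \<in> range ?b" by (rule highb[OF x]) (simp add: lev x)
 then have r: "m (high col x) \<in> {?b In_L, ?b In_R, ?b Out_R, ?b Out_L}" unfolding range_tangle_end .
 have "snd (col (m (high col x))) = k + 1" "fst (col (m (high col x))) = (~ fst (col (fst x)))"
 using flv[OF hl(5)[OF x]] hl(1,2,3)[OF x] lev[OF x] by simp_all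
 then show ?thesis using k r by (elim insertE emptyE) simp_all
 qed
 let ?cI = "(m (?b In_L), m (?b In_R))" and ?cO = "(m (?b Out_R), m (?b Out_L))"
 have sub: "x = (if fst (col (fst x)) then ?cI else ?cO)" if x: "x \<in> cusps S" for x
 using mb[OF L[OF x] hl(4)[OF x]] mb[OF H[OF x] hl(5)[OF x]]
 by (cases "fst (col (fst x))") (simp_all add: low_def high_def prod_eq_iff)
 have "x \<in> {?cI, ?cO}" if x: "x \<in> cusps S" for x
 using sub[OF x] by (cases "fst (col (fst x))") simp_all
 then have "cusps S \<subseteq> {?cI, ?cO}" by blast
 moreover have "card (cusps S) ~= 1" using coherent_even_cusps[OF c] by auto
 ultimately show *: "cusps S = {?cI, ?cO}" using ne by (rule doubleton_eqI)
 show "m (?b In_L) \<notin> range ?b" using C(10)[of ?cI] unfolding * by (auto simp: image_iff)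
qed

section \<open>Isomorphism of configurations, and uniqueness of the reduced form\<close>

lemma points_iso:
 assumes "cusps X = map_prod f f ` cusps S" "arcs X = (%s. f ` s) ` arcs S" "boundary X = f \<circ> boundary S"
 shows "points X = f ` points S"
 unfolding points_def assms by (simp add: image_Un image_Union image_image)

lemma config_iso_trans:
 assumes "config_iso S X" "config_iso X Y"
 shows "config_iso S Y"
proof -
 obtain f where f0: "inj_on f (points S) & cusps X = map_prod f f ` cusps S & sites X = (%s. map_prod f f ` s) ` sites S &
 arcs X = (%s. f ` s) ` arcs S & boundary X = f \<circ> boundary S" using assms(1) unfolding config_iso_def by (rule exE)
 note f = f0[THEN conjunct1] f0[THEN conjunct2, THEN conjunct1] f0[THEN conjunct2, THEN conjunct2, THEN conjunct1]
 f0[THEN conjunct2, THEN conjunct2, THEN conjunct2, THEN conjunct1] f0[THEN conjunct2, THEN conjunct2, THEN conjunct2, THEN conjunct2]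
 obtain g where g0: "inj_on g (points X) & cusps Y = map_prod g g ` cusps X & sites Y = (%s. map_prod g g ` s) ` sites X &
 arcs Y = (%s. g ` s) ` arcs X & boundary Y = g \<circ> boundary X" using assms(2) unfolding config_iso_def by (rule exE)
 note g = g0[THEN conjunct1] g0[THEN conjunct2, THEN conjunct1] g0[THEN conjunct2, THEN conjunct2, THEN conjunct1]
 g0[THEN conjunct2, THEN conjunct2, THEN conjunct2, THEN conjunct1] g0[THEN conjunct2, THEN conjunct2, THEN conjunct2, THEN conjunct2]
 have "inj_on (g \<circ> f) (points S)" using comp_inj_on[OF f(1), of g] g(1) unfolding points_iso[OF f(2,4,5)] .
 moreover have "cusps Y = map_prod (g \<circ> f) (g \<circ> f) ` cusps S" by (simp only: g(2) f(2) map_prod_compose image_comp)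
 moreover have "sites Y = (%s. map_prod (g \<circ> f) (g \<circ> f) ` s) ` sites S" unfolding g(3) f(3)
 by (subst image_image) (simp only: image_comp map_prod_compose)
 moreover have "arcs Y = (%s. (g \<circ> f) ` s) ` arcs S" unfolding g(4) f(4) image_image o_def ..
 moreover have "boundary Y = (g \<circ> f) \<circ> boundary S" unfolding g(5) f(5) o_assoc ..
 ultimately show ?thesis unfolding config_iso_def by (intro exI[of _ "g \<circ> f"] conjI)
qed

lemma config_iso_sym:
 assumes "config_iso S X" "\<Union>(sites S) \<subseteq> cusps S"
 shows "config_iso X S"
proof -
 obtain f where f0: "inj_on f (points S) & cusps X = map_prod f f ` cusps S & sites X = (%s. map_prod f f ` s) ` sites S &
 arcs X = (%s. f ` s) ` arcs S & boundary X = f \<circ> boundary S" using assms(1) unfolding config_iso_def by (rule exE)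
 note f = f0[THEN conjunct1] f0[THEN conjunct2, THEN conjunct1] f0[THEN conjunct2, THEN conjunct2, THEN conjunct1]
 f0[THEN conjunct2, THEN conjunct2, THEN conjunct2, THEN conjunct1] f0[THEN conjunct2, THEN conjunct2, THEN conjunct2, THEN conjunct2]
 define g where "g = inv_into (points S) f"
 have g: "g (f x) = x" if "x \<in> points S" for x using f(1) that by (simp add: g_def)
 have 1: "map_prod g g (map_prod f f c) = c" if "c \<in> cusps S" for c
 proof -
 have "fst c \<in> points S" "snd c \<in> points S" using that by (auto simp: points_def)
 then show ?thesis using g by (cases c) auto
 qed
 have 2: "g ` f ` s = s" if "s \<in> arcs S" for s
 proof -
 have "s \<subseteq> points S" using that by (auto simp: points_def)
 then show ?thesis using g by (force simp: image_image)
 qed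
 have 3: "map_prod g g ` map_prod f f ` s = s" if "s \<in> sites S" for s
 proof -
 have "c \<in> cusps S" if "c \<in> s" for c using that \<open>s \<in> sites S\<close> assms(2) by blast
 then show ?thesis using 1 unfolding image_image by simp
 qed
 have "inj_on g (points X)" unfolding points_iso[OF f(2,4,5)] g_def by (rule inj_on_inv_into) simp
 moreover have "boundary S = g \<circ> boundary X" using g by (auto simp: f(5) points_def)
 moreover have "cusps S = map_prod g g ` cusps X" unfolding f(2) image_image using 1 by simp
 moreover have "sites S = (%s. map_prod g g ` s) ` sites X" unfolding f(3) image_image using 3 by (simp add: image_image)
 moreover have "arcs S = (%s. g ` s) ` arcs X" unfolding f(4) image_image using 2 by (simp add: image_image)
 ultimately show ?thesis unfolding config_iso_def by (intro exI[of _ g] conjI)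
qed

definition smoothing :: "bool => nat config" where
 "smoothing d = (if d then reverse_oriented_smoothing else oriented_smoothing)"

lemma config_iso_smoothing:
 assumes "config_iso (smoothing d) S"
 shows "config_iso S X \<longleftrightarrow> config_iso (smoothing d) X"
proof -
 have "\<Union>(sites (smoothing d)) \<subseteq> cusps (smoothing d)"
 by (simp add: smoothing_def oriented_smoothing_def reverse_oriented_smoothing_def)
 then have "config_iso S (smoothing d)" by (rule config_iso_sym[OF assms])
 from config_iso_trans[OF this] config_iso_trans[OF assms] show ?thesis by (intro iffI)
qed

definition joined :: "'p config => ('p \<times> 'p) set" where
 "joined S = connected_by (arcs S \<union> cusp_pairs (cusps S))"

text \<open>With \<open>d\<close> the end \<open>In_L\<close> is joined to \<open>In_R\<close>,
  without \<open>d\<close> to \<open>Out_L\<close>. Two ends lie on the same strand iff their values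
  agree.\<close>

definition left_strand :: "bool => tangle_end => bool" where
 "left_strand d a \<longleftrightarrow> a = In_L \<or> a = (if d then In_R else Out_L)"

text \<open>Without cusps, levels and directions force \<open>In_L\<close> to be joined to
  \<open>Out_L\<close> and \<open>In_R\<close> to \<open>Out_R\<close>. Otherwise
  \<open>reduced_cusps\<close> describes the two cusps, and they form a single site because sites
  have even size.\<close>

lemma reduced_shape:
 assumes c: "coherent col m P S" and no: "cancellations S = {}"
 shows "\<exists>d. (\<forall>a c. (boundary S a, boundary S c) \<in> joined S \<longleftrightarrow> left_strand d a = left_strand d c) &
 config_iso (smoothing d) S"
proof -
 note C = coherentD[OF c]
 let ?b = "boundary S"
 obtain k where k: "col (?b In_L) = (False, k + 1)" "col (?b In_R) = (False, k)"
 "col (?b Out_R) = (True, k)" "col (?b Out_L) = (True, k + 1)" using coherent_levels[OF c] .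
 have bne: "?b a = ?b e \<longleftrightarrow> a = e" for a e by (rule inj_eq[OF C(9)])
 have bP: "?b a \<in> P" for a unfolding C(4) by auto
 have mm: "m (m (?b a)) = ?b a" for a using pairedD[OF C(2) bP[of a]] by simp
 have mbe: "m (?b a) = m (?b e) \<longleftrightarrow> a = e" for a e
 proof
 assume h: "m (?b a) = m (?b e)"
 have "?b a = ?b e" using arg_cong[OF h, of m] unfolding mm .
 then show "a = e" unfolding bne .
 qed simp
 show ?thesis
 proof (cases "cusps S = {}")
 case True
 have P: "P = {?b In_L, ?b In_R, ?b Out_R, ?b Out_L}" using C(4) True by (simp add: range_tangle_end)
 have m1: "m (?b In_L) = ?b Out_L" "m (?b In_R) = ?b Out_R"
 using pairedD[OF C(2) bP[of In_L]] pairedD[OF C(2) bP[of In_R]] C(5)[OF bP[of In_L]] C(5)[OF bP[of In_R]] k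
 unfolding P by auto
 then have m2: "m (?b Out_L) = ?b In_L" "m (?b Out_R) = ?b In_R" using mm by metis+
 have ar: "arcs S = {{?b In_L, ?b Out_L}, {?b In_R, ?b Out_R}}"
 unfolding C(3) pairs_def P using m1 m2 by (auto simp: insert_commute)
 have "sites S = {}" using C(12) True unfolding partition_on_def by auto
 then have "config_iso oriented_smoothing S"
 unfolding config_iso_def points_def using ar True
 by (intro exI[of _ "%n. if n = 0 then ?b In_L else if n = 1 then ?b In_R else if n = 2 then ?b Out_R else ?b Out_L"])
 (auto simp: oriented_smoothing_def range_tangle_end inj_on_def bne fun_eq_iff all_tangle_end)
 moreover have "(?b a, ?b e) \<in> joined S \<longleftrightarrow> left_strand False a = left_strand False e" for a e
 proof
 assume j: "(?b a, ?b e) \<in> joined S"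
 have "?b e = ?b a \<or> ?b e = m (?b a)" using connected_by_pairs[OF C(2), of "?b a" "?b e"] j
 unfolding joined_def True C(3) by (auto simp: cusp_pairs_def)
 then show "left_strand False a = left_strand False e"
 using m1 m2 by (cases a) (auto simp: left_strand_def bne)
 next
 assume l: "left_strand False a = left_strand False e"
 have "a = e \<or> {?b a, ?b e} \<in> arcs S"
 using l unfolding ar by (cases a; cases e) (auto simp: left_strand_def insert_commute)
 then show "(?b a, ?b e) \<in> joined S" unfolding joined_def by (auto intro: connected_by_edge)
 qed
 ultimately show ?thesis by (intro exI[of _ False]) (simp add: smoothing_def)
 next
 case False
 let ?cI = "(m (?b In_L), m (?b In_R))" and ?cO = "(m (?b Out_R), m (?b Out_L))"
 note cu = reduced_cusps(1)[OF c no False]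
 have bm: "m (?b a) ~= ?b e" "?b e ~= m (?b a)" for a e
 using C(10)[of ?cI e] C(10)[of ?cO e] unfolding cu by (cases a; auto)+
 have P: "P = {?b In_L, ?b In_R, ?b Out_R, ?b Out_L, m (?b In_L), m (?b In_R), m (?b Out_R), m (?b Out_L)}"
 unfolding C(4) cu range_tangle_end by auto
 have ar: "arcs S = {{?b In_L, m (?b In_L)}, {m (?b In_R), ?b In_R}, {?b Out_R, m (?b Out_R)}, {m (?b Out_L), ?b Out_L}}"
 unfolding C(3) pairs_def P by (auto simp: insert_commute mm)
 have si: "sites S = {{?cI, ?cO}}"
 proof -
 have "s = {?cI, ?cO}" if s: "s \<in> sites S" for s
 proof -
 have "s \<subseteq> {?cI, ?cO}" "s ~= {}" using s C(12) unfolding partition_on_def cu by auto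
 moreover have "card s ~= 1" using C(13)[OF s] by auto
 ultimately show ?thesis using \<open>s ~= {}\<close> by (intro doubleton_eqI)
 qed
 moreover have "sites S ~= {}" using C(12) False unfolding partition_on_def by auto
 ultimately show ?thesis by blast
 qed
 have "config_iso reverse_oriented_smoothing S"
 unfolding config_iso_def points_def
 by (intro exI[of _ "%n. if n = 0 then ?b In_L else if n = 1 then ?b In_R else if n = 2 then ?b Out_R else
 if n = 3 then ?b Out_L else if n = 4 then m (?b In_L) else if n = 5 then m (?b In_R) else
 if n = 6 then m (?b Out_R) else m (?b Out_L)"])
 (auto simp: reverse_oriented_smoothing_def range_tangle_end inj_on_def bne mbe bm fun_eq_iff cu ar si all_tangle_end)
 moreover have "(?b a, ?b e) \<in> joined S \<longleftrightarrow> left_strand True a = left_strand True e" for a e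
 proof
 let ?U = "{?b In_L, m (?b In_L), m (?b In_R), ?b In_R}"
 assume j: "(?b a, ?b e) \<in> joined S"
 have "?b e \<in> ?U \<longleftrightarrow> ?b a \<in> ?U" using j unfolding joined_def
 proof (induction rule: connected_by_induct)
 case (step y z)
 have "z \<in> ?U \<longleftrightarrow> y \<in> ?U"
 using step(2) unfolding ar cu cusp_pairs_def by (auto simp: doubleton_eq_iff bne mbe bm)
 then show ?case using step(3) by blast
 qed simp
 then show "left_strand True a = left_strand True e" by (auto simp: left_strand_def bne bm)
 next
 let ?C = "joined S"
 have e: "(?b In_L, m (?b In_L)) \<in> ?C" "(m (?b In_L), m (?b In_R)) \<in> ?C" "(m (?b In_R), ?b In_R) \<in> ?C"
 "(?b Out_R, m (?b Out_R)) \<in> ?C" "(m (?b Out_R), m (?b Out_L)) \<in> ?C" "(m (?b Out_L), ?b Out_L) \<in> ?C"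
 unfolding joined_def ar cu cusp_pairs_def by (auto intro!: connected_by_edge)
 have j: "(?b In_L, ?b In_R) \<in> ?C" "(?b Out_R, ?b Out_L) \<in> ?C"
 using e unfolding joined_def by (blast intro: connected_by_trans)+
 assume l: "left_strand True a = left_strand True e"
 show "(?b a, ?b e) \<in> ?C"
 using l j j[unfolded joined_def, THEN connected_by_sym, folded joined_def]
 by (cases a; cases e) (auto simp: left_strand_def joined_def)
 qed
 ultimately show ?thesis by (intro exI[of _ True]) (simp add: smoothing_def)
 qed
qed

text \<open>Deleting a cusp keeps the curve that runs through it. The way in which the ends of the
  tangle are joined is thus an invariant of all reductions.\<close>

lemma joined_delete:
 assumes c: "coherent col m P S" and c': "coherent col m' (P - \<Union>(cusp_pairs Q)) (delete_cusps Q S)" and Q: "Q \<subseteq> cusps S"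
 shows "(boundary S a, boundary S e) \<in> joined (delete_cusps Q S) \<longleftrightarrow> (boundary S a, boundary S e) \<in> joined S"
proof -
 note C = coherentD[OF c]
 have U: "\<Union>(arcs S) = P" using Union_pairs[OF C(2)] C(3) by simp
 have "\<Union>(cusp_pairs (cusps S - Q)) \<subseteq> P - \<Union>(cusp_pairs Q)" and b: "boundary S x \<in> P - \<Union>(cusp_pairs Q)" for x
 using coherentD(4)[OF c'] by (auto simp: delete_cusps_def Union_cusp_pairs)
 then have "(boundary S a, boundary S e) \<in> connected_by (splice (arcs S) (cusp_pairs Q) \<union> cusp_pairs (cusps S - Q)) \<longleftrightarrow>
 (boundary S a, boundary S e) \<in> connected_by (arcs S \<union> cusp_pairs Q \<union> cusp_pairs (cusps S - Q))"
 by (intro connected_by_splice) (simp_all add: U)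
 moreover have "cusp_pairs (cusps S) = cusp_pairs Q \<union> cusp_pairs (cusps S - Q)"
 unfolding cusp_pairs_Un[symmetric] using Q by (simp add: Un_absorb1)
 ultimately show ?thesis by (simp add: joined_def delete_cusps_def cusp_pairs_def Un_assoc)
qed

text \<open>Every way of reducing ends in the tangle determined by the connectivity of the original
  state, so the average is taken over equal values.\<close>

lemma reduce_steps_coherent:
 assumes "coherent col m P S" "card (cusps S) <= n"
 shows "\<exists>d. (\<forall>a c. (boundary S a, boundary S c) \<in> joined S \<longleftrightarrow> left_strand d a = left_strand d c) &
 (\<forall>X::nat config. reduce_steps n S X = (if config_iso (smoothing d) X then 1 else 0))"
 using assms
proof (induction n arbitrary: m P S)
 case 0
 then have "cancellations S = {}" using coherentD(1)[OF 0(1)] by (auto simp: cancellations_def)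
 then show ?case using reduced_shape[OF 0(1)] config_iso_smoothing by fastforce
next
 case (Suc n)
 note C = coherentD[OF Suc.prems(1)]
 show ?case
 proof (cases "reductions S = {}")
 case True
 then have "cancellations S = {}" by (auto simp: reductions_def split: if_splits)
 then show ?thesis using reduced_shape[OF Suc.prems(1)] config_iso_smoothing True by fastforce
 next
 case False
 have *: "\<exists>d. (\<forall>a c. (boundary S a, boundary S c) \<in> joined S \<longleftrightarrow> left_strand d a = left_strand d c) &
 (\<forall>X::nat config. reduce_steps n (delete_cusps Q S) X = (if config_iso (smoothing d) X then 1 else 0))" if Q: "Q \<in> reductions S" for Q
 proof -
 note R = reductions_coherent[OF Suc.prems(1) Q]
 obtain m' where m': "coherent col m' (P - \<Union>(cusp_pairs Q)) (delete_cusps Q S)" using R(1) by blast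
 have "card (cusps S - Q) < card (cusps S)" using R(2,3) C(1) by (intro psubset_card_mono) auto
 then have cn: "card (cusps (delete_cusps Q S)) <= n" using Suc.prems(2) by (simp add: delete_cusps_def)
 have bd: "boundary (delete_cusps Q S) = boundary S" by (simp add: delete_cusps_def)
 show ?thesis using Suc.IH[OF m' cn] unfolding bd joined_delete[OF Suc.prems(1) m' R(2)] .
 qed
 obtain Q0 where Q0: "Q0 \<in> reductions S" using False by blast
 obtain d where d: "\<And>a c. (boundary S a, boundary S c) \<in> joined S \<longleftrightarrow> left_strand d a = left_strand d c" using *[OF Q0] by blast
 have "reduce_steps n (delete_cusps Q S) X = (if config_iso (smoothing d) X then 1 else 0)" if Q: "Q \<in> reductions S" for Q and X :: "nat config"
 proof -
 obtain d' where d': "(\<forall>a c. (boundary S a, boundary S c) \<in> joined S \<longleftrightarrow> left_strand d' a = left_strand d' c)"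
 "(\<forall>X::nat config. reduce_steps n (delete_cusps Q S) X = (if config_iso (smoothing d') X then 1 else 0))" using *[OF Q] by blast
 have "left_strand d In_L = left_strand d In_R \<longleftrightarrow> left_strand d' In_L = left_strand d' In_R"
 using d d'(1) by blast
 then have "d' = d" by (auto simp: left_strand_def split: if_splits)
 then show ?thesis using d'(2) by simp
 qed
 moreover have "finite (reductions S)"
 by (rule finite_subset[of _ "Pow (cusps S)"]) (use C(1) reductions_coherent(2)[OF Suc.prems(1)] in auto)
 ultimately have "\<forall>X::nat config. reduce_steps (Suc n) S X = (if config_iso (smoothing d) X then 1 else 0)"
 using False by simp
 then show ?thesis using d by blast
 qed
qed

section \<open>The Alexander numbering of a classical diagram, from winding angles\<close>

text \<open>The argument of the ratio is the angle under which the edge is seen from \<open>p\<close>.  On a point of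
 an edge \<open>e\<close>, the angles of the other edges add up to an odd multiple of \<open>\<pi>\<close>: the own edge
 contributes a negative ratio, and the product of all ratios is 1.\<close>

definition angle :: "vdiag => nat => complex => real" where
 "angle D g p = Arg ((tgt D g - p) / (src D g - p))"

definition turning :: "vdiag => nat => real => real" where
 "turning D e s = (\<Sum>g\<in>edges D - {e}. angle D g (pt D e s))"

text \<open>Off the segment the ratio avoids the branch cut of \<open>Arg\<close>, so the angle is
  continuous there.\<close>

lemma ratio_off_segment:
 assumes "p \<notin> seg D g"
 shows "src D g - p ~= 0" "(tgt D g - p) / (src D g - p) \<notin> \<real>\<^sub>\<le>\<^sub>0"
proof -
 show n: "src D g - p ~= 0" using assms pt_in_seg[of 0 D g] by auto
 show "(tgt D g - p) / (src D g - p) \<notin> \<real>\<^sub>\<le>\<^sub>0"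
 proof
 assume "(tgt D g - p) / (src D g - p) \<in> \<real>\<^sub>\<le>\<^sub>0"
 then obtain r where r: "r <= 0" "(tgt D g - p) / (src D g - p) = of_real r" by (elim nonpos_Reals_cases)
 then have "tgt D g - p = of_real r * (src D g - p)" using n by (simp add: divide_eq_eq)
 then have "of_real (1 - r) * p = tgt D g - of_real r * src D g" by (simp add: algebra_simps)
 moreover have "of_real (1 - r) ~= (0::complex)" using r(1) by (simp del: of_real_diff)
 ultimately have "p = (tgt D g - of_real r * src D g) / of_real (1 - r)" by (simp add: field_simps)
 also have "\<dots> = pt D g (1 / (1 - r))"
 using r(1) \<open>of_real (1 - r) ~= (0::complex)\<close> by (simp add: pt_def direction_def field_simps)
 finally show False using assms pt_in_seg[of "1 / (1 - r)" D g] r(1) by simp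
 qed
qed

lemma tendsto_Arg: "(f \<longlongrightarrow> l) F ==> l \<notin> \<real>\<^sub>\<le>\<^sub>0 ==> ((%x. Arg (f x)) \<longlongrightarrow> Arg l) F"
 by (rule isCont_tendsto_compose[OF continuous_at_Arg])

lemma tendsto_angle:
 assumes "(f \<longlongrightarrow> p) F" "p \<notin> seg D g"
 shows "((%x. angle D g (f x)) \<longlongrightarrow> angle D g p) F"
 unfolding angle_def
 by (intro tendsto_Arg tendsto_intros assms ratio_off_segment[OF assms(2)])

lemma tendsto_pt: "((%s. pt D e s) \<longlongrightarrow> pt D e a) (at a within X)"
 unfolding pt_def by (intro tendsto_intros)

lemma Im_ratio: "a ~= 0 ==> Im (b / a) = det2 a b / (cmod a)\<^sup>2"
 by (simp add: Im_divide det2_def cmod_power2 algebra_simps)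

context diagram
begin

lemma turning_split:
 assumes "e \<in> edges D" "f \<in> edges D" "e ~= f"
 shows "turning D e s = angle D f (pt D e s) + (\<Sum>g\<in>edges D - {e, f}. angle D g (pt D e s))"
proof -
 have "edges D - {e} = insert f (edges D - {e, f})" using assms by auto
 then show ?thesis unfolding turning_def using finite_edges by simp
qed

lemma turning_integer:
 assumes e: "e \<in> edges D" and s: "0 < s" "s < 1"
 and off: "\<And>g. g \<in> edges D ==> g ~= e ==> pt D e s \<notin> seg D g"
 shows "\<exists>k::int. turning D e s = pi + 2 * pi * k"
proof -
 let ?p = "pt D e s"
 let ?z = "%g. (tgt D g - ?p) / (src D g - ?p)"
 have d: "direction D e ~= 0" by (rule direction_nz[OF e])
 have own: "tgt D e - ?p = of_real (1 - s) * direction D e" "src D e - ?p = of_real (- s) * direction D e"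
 by (simp_all add: pt_def direction_def algebra_simps)
 have nz: "src D g - ?p ~= 0" if "g \<in> edges D" for g
 using that ratio_off_segment(1)[OF off[of g]] own d s by (cases "g = e") auto
 \<comment> \<open>The edges form closed polygons, so both products run over all vertices.\<close>
 have "(\<Prod>g\<in>edges D. tgt D g - ?p) = (\<Prod>g\<in>edges D. src D g - ?p)"
 using prod.reindex_bij_betw[OF bij_nxt, of "%g. src D g - ?p"] by (simp add: tgt_src)
 then have "(\<Prod>g\<in>edges D. ?z g) = 1" using nz finite_edges by (simp add: prod_dividef prod_zero_iff)
 then have 1: "?z e * (\<Prod>g\<in>edges D - {e}. ?z g) = 1" using e finite_edges by (simp add: prod.remove)
 have ze: "?z e = of_real (- (1 - s) / s)" unfolding own using d s by (simp add: field_simps)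
 have nz': "?z g ~= 0" if "g \<in> edges D - {e}" for g
 using that ratio_off_segment(2)[OF off[of g]] by auto
 define R where "R = (\<Prod>g\<in>edges D - {e}. cmod (?z g))"
 have "(\<Prod>g\<in>edges D - {e}. ?z g) = (\<Prod>g\<in>edges D - {e}. of_real (cmod (?z g)) * cis (angle D g ?p))"
 unfolding angle_def by (intro prod.cong refl) (simp only: rcis_def[symmetric] rcis_cmod_Arg)
 also have "\<dots> = of_real R * cis (turning D e s)"
 unfolding R_def turning_def prod.distrib of_real_prod
 using finite_edges by (simp add: cis_conv_exp exp_sum sum_distrib_left)
 finally have P: "(\<Prod>g\<in>edges D - {e}. ?z g) = of_real R * cis (turning D e s)" .
 have "of_real (- (1 - s) / s) * (of_real R * cis (turning D e s)) = 1" using 1 unfolding ze P .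
 then have 2: "complex_of_real ((1 - s) / s * R) * cis (turning D e s) = - 1" by (simp add: algebra_simps)
 have R: "R >= 0" unfolding R_def by (intro prod_nonneg) simp
 have "cmod (complex_of_real ((1 - s) / s * R) * cis (turning D e s)) = 1" unfolding 2 by simp
 then have "(1 - s) / s * R = 1" unfolding norm_mult norm_of_real norm_cis using R s by simp
 then have "cis (turning D e s) = - 1" using 2 by simp
 then have "cos (turning D e s) = - 1" by (metis cis.sel(1) one_complex.sel(1) uminus_complex.sel(1))
 then have "cos (turning D e s - pi) = 1" by simp
 then have "\<exists>k::int. turning D e s - pi = k * 2 * pi" unfolding cos_one_2pi_int .
 then obtain k :: int where "turning D e s - pi = real_of_int k * 2 * pi" by blast
 then show ?thesis by (intro exI[of _ k]) (simp add: algebra_simps)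
qed

text \<open>The turning is continuous on the gap, and its values are odd multiples of
  \<open>pi\<close>, a discrete set.\<close>

lemma turning_constant:
 assumes e: "e \<in> edges D" and ab: "0 <= a" "a < b" "b <= 1"
 and off: "\<And>s g. a < s ==> s < b ==> g \<in> edges D ==> g ~= e ==> pt D e s \<notin> seg D g"
 shows "\<exists>k::int. \<forall>s\<in>{a<..<b}. turning D e s = pi + 2 * pi * k"
proof -
 have int: "\<exists>k::int. turning D e s = pi + 2 * pi * k" if "s \<in> {a<..<b}" for s
 using that ab by (intro turning_integer[OF e] off) auto
 have "turning D e constant_on {a<..<b}"
 proof (rule continuous_discrete_range_constant)
 have off': "pt D e s \<notin> seg D g" if "s \<in> {a<..<b}" "g \<in> edges D - {e}" for s g
 using that off[of s g] by auto
 show "continuous_on {a<..<b} (turning D e)"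
 unfolding continuous_on_def turning_def by (intro ballI tendsto_sum tendsto_angle tendsto_pt off')
 fix s assume s: "s \<in> {a<..<b}"
 have "2 * pi <= norm (turning D e s' - turning D e s)" if s': "s' \<in> {a<..<b}" "turning D e s' ~= turning D e s" for s'
 proof -
 obtain k k' :: int where k: "turning D e s = pi + 2 * pi * k" "turning D e s' = pi + 2 * pi * k'"
 using int[OF s] int[OF s'(1)] by blast
 then have "k ~= k'" using s' by auto
 then have "1 <= \<bar>k' - k\<bar>" by linarith
 then have "1 <= \<bar>real_of_int k' - real_of_int k\<bar>" by linarith
 moreover have "turning D e s' - turning D e s = 2 * pi * (real_of_int k' - real_of_int k)" unfolding k by (simp add: algebra_simps)
 ultimately show ?thesis by (simp add: abs_mult)
 qed
 then show "\<exists>\<epsilon>>0. \<forall>y. y \<in> {a<..<b} & turning D e y ~= turning D e s --> \<epsilon> <= norm (turning D e y - turning D e s)"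
 by (intro exI[of _ "2 * pi"]) auto
 qed simp
 then obtain c where c: "\<And>s. s \<in> {a<..<b} ==> turning D e s = c" by (auto simp: constant_on_def)
 have "(a + b) / 2 \<in> {a<..<b}" using ab by auto
 then show ?thesis using int[of "(a + b) / 2"] c by metis
qed

text \<open>If an edge folded back onto its predecessor, the free end of the shorter of the two
  would lie on the other one, and genericity would produce a 2-cycle.\<close>

lemma not_folded:
 assumes "e \<in> edges D"
 shows "direction D (nxt D e) / direction D e \<notin> \<real>\<^sub>\<le>\<^sub>0"
proof
 let ?f = "nxt D e"
 have f: "?f \<in> edges D" "?f ~= e" using nxt_in nxt_ne assms by auto
 assume "direction D ?f / direction D e \<in> \<real>\<^sub>\<le>\<^sub>0"
 then obtain r where r: "r <= 0" "direction D ?f / direction D e = of_real r" by (elim nonpos_Reals_cases)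
 then have d: "direction D ?f = of_real r * direction D e" using direction_nz[OF assms] by (simp add: divide_eq_eq)
 then have r0: "r < 0" using direction_nz[OF f(1)] r(1) by (cases "r = 0") auto
 have pf: "pt D ?f s = pt D e (1 + s * r)" for s
 unfolding pt_def[of _ ?f] d tgt_src[symmetric] by (simp add: pt_def direction_def algebra_simps)
 show False
 proof (cases "- 1 <= r")
 case True
 then have "pt D ?f 1 \<in> seg D e" unfolding pf using r0 by (intro pt_in_seg) auto
 then have "e = nxt D ?f \<or> e = ?f" using tgt_on_edge[OF f(1) assms] by simp
 then show False using nxt_nxt[OF assms] f(2) by metis
 next
 case False
 have "pt D e 0 = pt D ?f (- 1 / r)" unfolding pf using r0 by simp
 also have "\<dots> \<in> seg D ?f" using False r0 by (intro pt_in_seg) (auto simp: field_simps)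
 finally have "?f = e \<or> nxt D ?f = e" using vertex_on_edge[OF assms f(1)] by simp
 then show False using nxt_nxt[OF assms] f(2) by metis
 qed
qed

text \<open>Approaching the vertex along \<open>e\<close>, the angle of the edge \<open>f\<close>
  tends to the exterior angle of the polygon. Leaving the vertex along \<open>f\<close>, the angle
  of \<open>e\<close> has the same limit. The other angles are continuous at the vertex, so the
  turning does not jump there.\<close>

lemma turning_at_vertex:
 assumes e: "e \<in> edges D"
 defines "f \<equiv> nxt D e"
 defines "T \<equiv> Arg (direction D f / direction D e) + (\<Sum>g\<in>edges D - {e, f}. angle D g (tgt D e))"
 shows "(turning D e \<longlongrightarrow> T) (at_left 1)" "(turning D f \<longlongrightarrow> T) (at_right 0)"
proof -
 have f: "f \<in> edges D" "f ~= e" using nxt_in nxt_ne e by (auto simp: f_def)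
 have off: "tgt D e \<notin> seg D g" if "g \<in> edges D - {e, f}" for g
 using tgt_on_edge[OF e, of g] that by (auto simp: f_def)
 have src_f: "src D f = tgt D e" by (simp add: f_def tgt_src)
 have de: "direction D e ~= 0" by (rule direction_nz[OF e])
 have nf: "direction D f / direction D e \<notin> \<real>\<^sub>\<le>\<^sub>0" unfolding f_def by (rule not_folded[OF e])
 have sum: "((%s. \<Sum>g\<in>edges D - {e, f}. angle D g (pt D h s)) \<longlongrightarrow> (\<Sum>g\<in>edges D - {e, f}. angle D g (tgt D e))) (at a within X)"
 if "pt D h a = tgt D e" for h a X
 using tendsto_pt[of D h a X] that by (intro tendsto_sum tendsto_angle off) auto
 have "((%s. angle D f (pt D e s)) \<longlongrightarrow> Arg (direction D f / direction D e)) (at_left 1)"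
 proof (rule Lim_transform_eventually)
 have "((%s. direction D f / direction D e + complex_of_real (1 - s)) \<longlongrightarrow> direction D f / direction D e + complex_of_real (1 - 1)) (at_left 1)"
 by (intro tendsto_intros)
 then show "((%s. Arg (direction D f / direction D e + complex_of_real (1 - s))) \<longlongrightarrow> Arg (direction D f / direction D e)) (at_left 1)"
 by (intro tendsto_Arg nf) simp
 show "\<forall>\<^sub>F s in at_left 1. Arg (direction D f / direction D e + complex_of_real (1 - s)) = angle D f (pt D e s)"
 proof (rule eventually_at_leftI[of 0])
 fix s :: real assume s: "s \<in> {0<..<1}"
 have "src D f - pt D e s = of_real (1 - s) * direction D e" "tgt D f - pt D e s = direction D f + of_real (1 - s) * direction D e"
 using src_f by (simp_all add: pt_def direction_def algebra_simps)
 then have "(tgt D f - pt D e s) / (src D f - pt D e s) = of_real (1 / (1 - s)) * (direction D f / direction D e + complex_of_real (1 - s))"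
 using de s by (simp add: divide_simps)
 then show "Arg (direction D f / direction D e + complex_of_real (1 - s)) = angle D f (pt D e s)"
 unfolding angle_def using s by (simp only: Arg_times_of_real zero_less_divide_1_iff diff_gt_0_iff_gt greaterThanLessThan_iff)
 qed simp
 qed
 then show "(turning D e \<longlongrightarrow> T) (at_left 1)"
 unfolding T_def turning_split[OF e f(1) f(2)[symmetric], abs_def] by (intro tendsto_add sum) simp_all
 have "((%s. angle D e (pt D f s)) \<longlongrightarrow> Arg (direction D f / direction D e)) (at_right 0)"
 proof (rule Lim_transform_eventually)
 have "((%s. direction D f / (direction D e + of_real s * direction D f)) \<longlongrightarrow> direction D f / (direction D e + of_real 0 * direction D f)) (at_right 0)"
 using de by (intro tendsto_intros) auto
 then show "((%s. Arg (direction D f / (direction D e + of_real s * direction D f))) \<longlongrightarrow> Arg (direction D f / direction D e)) (at_right 0)"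
 by (intro tendsto_Arg nf) simp
 show "\<forall>\<^sub>F s in at_right 0. Arg (direction D f / (direction D e + of_real s * direction D f)) = angle D e (pt D f s)"
 proof (rule eventually_at_rightI[of _ 1])
 fix s :: real assume s: "s \<in> {0<..<1}"
 have "tgt D e - pt D f s = - (of_real s * direction D f)" "src D e - pt D f s = - (direction D e + of_real s * direction D f)"
 using src_f by (simp_all add: pt_def direction_def algebra_simps)
 then have "(tgt D e - pt D f s) / (src D e - pt D f s) = of_real s * (direction D f / (direction D e + of_real s * direction D f))"
 by (simp only: minus_divide_divide times_divide_eq_right)
 then show "Arg (direction D f / (direction D e + of_real s * direction D f)) = angle D e (pt D f s)"
 unfolding angle_def using s by (simp only: Arg_times_of_real greaterThanLessThan_iff)
 qed simp
 qed
 moreover have "edges D - {f, e} = edges D - {e, f}" by auto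
 ultimately show "(turning D f \<longlongrightarrow> T) (at_right 0)"
 unfolding T_def turning_split[OF f(1) e f(2), abs_def] by (simp only:) (intro tendsto_add sum, simp_all add: src_f)
qed

text \<open>When \<open>f\<close> is crossed, only the angle of \<open>f\<close> is discontinuous,
  jumping from \<open>\<sigma> * pi\<close> to \<open>- \<sigma> * pi\<close>. The sum
  \<open>T\<close> over the remaining edges depends only on the crossing point and is thus common to
  both strands.\<close>

lemma turning_at_crossing:
 assumes c: "crosses D e f"
 defines "c0 \<equiv> pt D e (param D (e, f))" and "\<sigma> \<equiv> sgn (det2 (direction D e) (direction D f))"
 defines "T \<equiv> \<Sum>g\<in>edges D - {e, f}. angle D g c0"
 shows "(turning D e \<longlongrightarrow> \<sigma> * pi + T) (at_left (param D (e, f)))"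
 and "(turning D e \<longlongrightarrow> - \<sigma> * pi + T) (at_right (param D (e, f)))"
proof -
 have ef: "e \<in> edges D" "f \<in> edges D" "e ~= f" using c by (auto simp: crosses_def)
 let ?a = "param D (e, f)" and ?b = "param D (f, e)"
 have b: "0 < ?b" "?b < 1" using param(1,2)[of f e] c crosses_sym[of e f] by auto
 have a: "0 < ?a" "?a < 1" using param(1,2)[OF c] by auto
 have c0f: "c0 = pt D f ?b" unfolding c0_def by (rule param(3)[OF c])
 have off: "c0 \<notin> seg D g" if g: "g \<in> edges D - {e, f}" for g
 proof
 assume "c0 \<in> seg D g"
 moreover have "c0 \<in> seg D e" "c0 \<in> seg D f" unfolding c0_def using a by (intro pt_in_seg; simp) (use c0f b in \<open>simp add: c0_def pt_in_seg\<close>)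
 ultimately show False using no_triple[of e f g c0] ef g by auto
 qed
 have sum: "((%s. \<Sum>g\<in>edges D - {e, f}. angle D g (pt D e s)) \<longlongrightarrow> T) (at ?a within X)" for X
 unfolding T_def using tendsto_pt[of D e ?a X] by (intro tendsto_sum tendsto_angle off) (auto simp: c0_def)
 let ?z = "%s. (tgt D f - pt D e s) / (src D f - pt D e s)"
 have df: "direction D f ~= 0" by (rule direction_nz[OF ef(2)])
 have at: "src D f - c0 = - (of_real ?b * direction D f)" "tgt D f - c0 = of_real (1 - ?b) * direction D f"
 unfolding c0f by (simp_all add: pt_def direction_def algebra_simps)
 have "?z ?a = of_real (- (1 - ?b) / ?b)" unfolding c0_def[symmetric] at using df b by (simp add: field_simps)
 moreover have "(?z \<longlongrightarrow> ?z ?a) (at ?a within X)" for X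
 using at(1) df b by (intro tendsto_intros tendsto_pt) (auto simp: c0_def[symmetric])
 ultimately have zl: "(?z \<longlongrightarrow> of_real (- (1 - ?b) / ?b)) (at ?a within X)" for X by simp
 \<comment> \<open>The ratio tends to a negative real number, where \<open>Arg\<close> is
   discontinuous. Its negative has a continuous argument, and \<open>ang\<close> restores the half
   turn with the sign of the side.\<close>
 have neg: "((%s. Arg (- ?z s)) \<longlongrightarrow> 0) (at ?a within X)" for X
 proof -
 have "((%s. Arg (- ?z s)) \<longlongrightarrow> Arg (- of_real (- (1 - ?b) / ?b))) (at ?a within X)"
 using b by (intro tendsto_Arg tendsto_minus zl) (simp add: field_simps flip: of_real_minus of_real_divide of_real_diff)
 moreover have "Arg (- of_real (- (1 - ?b) / ?b)) = 0"
 using b unfolding of_real_minus[symmetric] Arg_of_real by (simp add: field_simps)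
 ultimately show ?thesis by simp
 qed
 have Im: "Im (?z s) = (?a - s) * det2 (direction D e) (direction D f) / (cmod (src D f - pt D e s))\<^sup>2"
 if "src D f - pt D e s ~= 0" for s
 proof -
 have "tgt D f - pt D e s = (src D f - pt D e s) + direction D f" by (simp add: direction_def)
 moreover have "src D f - pt D e s = of_real (?a - s) * direction D e + (src D f - c0)"
 by (simp add: c0_def pt_def algebra_simps)
 ultimately have "det2 (src D f - pt D e s) (tgt D f - pt D e s) = (?a - s) * det2 (direction D e) (direction D f) + det2 (src D f - c0) (direction D f)"
 by (simp only: det2_add det2_simps)
 moreover have "det2 (src D f - c0) (direction D f) = 0" unfolding at(1) det2_add det2_simps by simp
 ultimately show ?thesis unfolding Im_ratio[OF that] by simp
 qed
 have nz: "src D f - pt D e s ~= 0" if "0 < s" "s < 1" for s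
 proof
 assume z: "src D f - pt D e s = 0"
 then have "crosses D e f & s = ?a" using c param_eqI[OF c that] pt_in_seg[of 0 D f] by simp
 then show False using z at(1) df b by (simp add: c0_def)
 qed
 have det: "det2 (direction D e) (direction D f) ~= 0" by (rule crosses_det[OF c])
 have ang: "angle D f (pt D e s) = Arg (- ?z s) + sgn (?a - s) * \<sigma> * pi" if s: "0 < s" "s < 1" "s ~= ?a" for s
 proof -
 note I = Im[OF nz[OF s(1,2)]]
 have pos: "(cmod (src D f - pt D e s))\<^sup>2 > 0" using nz[OF s(1,2)] by simp
 have sg: "sgn (Im (?z s)) = sgn (?a - s) * \<sigma>" unfolding I \<sigma>_def using pos by (simp add: sgn_divide sgn_mult)
 have "sgn (?a - s) * \<sigma> ~= 0" using det s(3) by (auto simp: \<sigma>_def sgn_zero_iff)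
 then have i0: "Im (?z s) ~= 0" using sg by auto
 then have "?z s ~= 0" by auto
 note m = Arg_minus[OF this]
 have "Arg (?z s) <= 0 \<longleftrightarrow> Im (?z s) < 0" using Arg_less_0[of "?z s"] i0 Arg_eq_0[of "?z s"] complex_is_Real_iff[of "?z s"] by force
 then show ?thesis unfolding angle_def m sg[symmetric] using i0 by (simp add: sgn_if)
 qed
 have lim: "(turning D e \<longlongrightarrow> \<tau> * \<sigma> * pi + T) (at ?a within X)"
 if X: "\<forall>\<^sub>F s in at ?a within X. 0 < s & s < 1 & s ~= ?a & sgn (?a - s) = \<tau>" for X \<tau>
 proof -
 have "((%s. angle D f (pt D e s)) \<longlongrightarrow> \<tau> * \<sigma> * pi) (at ?a within X)"
 proof (rule Lim_transform_eventually)
 show "((%s. Arg (- ?z s) + \<tau> * \<sigma> * pi) \<longlongrightarrow> \<tau> * \<sigma> * pi) (at ?a within X)"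
 using tendsto_add[OF neg tendsto_const] by simp
 show "\<forall>\<^sub>F s in at ?a within X. Arg (- ?z s) + \<tau> * \<sigma> * pi = angle D f (pt D e s)"
 using X by eventually_elim (simp add: ang)
 qed
 then show ?thesis unfolding turning_split[OF ef, abs_def] by (intro tendsto_add sum)
 qed
 have "\<forall>\<^sub>F s in at_left ?a. 0 < s & s < 1 & s ~= ?a & sgn (?a - s) = 1"
 by (rule eventually_at_leftI[of 0]) (use a in auto)
 then show "(turning D e \<longlongrightarrow> \<sigma> * pi + T) (at_left ?a)" using lim[where X="{..<?a}" and \<tau>=1] by simp
 have "\<forall>\<^sub>F s in at_right ?a. 0 < s & s < 1 & s ~= ?a & sgn (?a - s) = - 1"
 by (rule eventually_at_rightI[of _ 1]) (use a in auto)
 then show "(turning D e \<longlongrightarrow> - \<sigma> * pi + T) (at_right ?a)" using lim[where X="{?a<..}" and \<tau>="- 1"] by simp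
qed

text \<open>The level of the gap after a node is read off the constant value of the turning number there.\<close>

lemma gap_free:
 assumes cl: "classical D" and e: "e \<in> edges D" "g \<in> edges D" "g ~= e" and s: "0 < s" "s < 1" "(e, s) \<notin> nodes D"
 shows "pt D e s \<notin> seg D g"
proof
 assume "pt D e s \<in> seg D g"
 then have c: "crosses D e g" "param D (e, g) = s"
 using crosses_interior[OF e(1,2)] param_eqI[of e g s] e s by auto
 then have "(e, g) \<in> passages D" using cl unfolding classical_def passages_def by blast
 then have "(e, s) \<in> nodes D" using c(2) unfolding nodes_def pos_def by force
 then show False using s by simp
qed

text \<open>Both limits belong to the gap between \<open>v\<close> and the next node, which ends at
  parameter 1 if that node is on another edge. In a classical diagram no edge crosses within the
  gap, so the turning is constant there.\<close>

lemma level_exists: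
 assumes cl: "classical D" and v: "v \<in> nodes D"
 shows "\<exists>k::int. (turning D (fst v) \<longlongrightarrow> pi + 2 * pi * k) (at_right (snd v)) &
 (turning D (fst v) \<longlongrightarrow> pi + 2 * pi * k)
 (at_left (if fst (nsucc (nxt D) (nodes D) v) = fst v then snd (nsucc (nxt D) (nodes D) v) else 1))"
proof -
 let ?w = "nsucc (nxt D) (nodes D) v"
 obtain e a where ea: "v = (e, a)" by (cases v)
 define b where "b = (if fst ?w = e then snd ?w else 1)"
 have E: "e \<in> edges D" "0 <= a" "a < 1" using positionsD(1)[OF positions_nodes, of e a] v ea by auto
 have con: "consecutive (nxt D) (nodes D) v ?w" by (rule consecutive_nsucc[OF positions_finite[OF positions_nodes]])
 have w: "?w \<in> nodes D" by (rule nsucc_in[OF positions_nodes v])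
 have ne: "nxt D e ~= e" by (rule nxt_ne[OF E(1)])
 have w1: "snd ?w < 1" using positionsD(1)[OF positions_nodes, of "fst ?w" "snd ?w"] w by simp
 have b: "a < b & b <= 1 & (\<forall>s. (e, s) \<in> nodes D --> s <= a \<or> b <= s)"
 using con w1 E ne
 unfolding consecutive_def ea b_def fst_conv snd_conv by (elim disjE conjE) auto
 obtain k :: int where k: "\<forall>s\<in>{a<..<b}. turning D e s = pi + 2 * pi * k"
 using turning_constant[OF E(1,2) conjunct1[OF b]] gap_free[OF cl E(1)] b E by (smt (verit))
 have "\<forall>\<^sub>F s in at_right a. turning D e s = pi + 2 * pi * k" "\<forall>\<^sub>F s in at_left b. turning D e s = pi + 2 * pi * k"
 using eventually_at_rightI[of a b "%s. turning D e s = pi + 2 * pi * k"]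
 eventually_at_leftI[of a b "%s. turning D e s = pi + 2 * pi * k"] k b by blast+
 then have "(turning D e \<longlongrightarrow> pi + 2 * pi * k) (at_right a)" "(turning D e \<longlongrightarrow> pi + 2 * pi * k) (at_left b)"
 by (simp_all add: tendsto_eventually)
 then show ?thesis unfolding ea fst_conv snd_conv b_def[unfolded ea] by blast
qed

text \<open>\<open>lam w\<close> is the level of the gap that ends at \<open>w\<close>, that is, of
  the strand arriving there. Vertices keep the level. At a crossing the arriving \<open>e\<close>
  and the leaving \<open>f\<close> share the limit \<open>\<sigma> * pi + T\<close>, while the
  leaving \<open>e\<close> and the arriving \<open>f\<close> share
  \<open>- \<sigma> * pi + T\<close>, which is exactly the required relation.\<close>

lemma alexander_numbering:
 assumes cl: "classical D"
 defines "sc \<equiv> nsucc (nxt D) (nodes D)"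
 shows "\<exists>lam :: nat \<times> real => int.
 (\<forall>v\<in>nodes D - ends (xings D). lam (sc v) = lam v) &
 (\<forall>(x, y, p)\<in>xings D. lam (sc y) = lam x & lam (sc x) = lam y & lam y = lam x - (if p then 1 else - 1))"
proof -
 define G where "G = (%v. SOME k::int. (turning D (fst v) \<longlongrightarrow> pi + 2 * pi * k) (at_right (snd v)) &
 (turning D (fst v) \<longlongrightarrow> pi + 2 * pi * k) (at_left (if fst (sc v) = fst v then snd (sc v) else 1)))"
 have G: "(turning D (fst v) \<longlongrightarrow> pi + 2 * pi * G v) (at_right (snd v))"
 "(turning D (fst v) \<longlongrightarrow> pi + 2 * pi * G v) (at_left (if fst (sc v) = fst v then snd (sc v) else 1))"
 if "v \<in> nodes D" for v
 using someI_ex[OF level_exists[OF cl that]] unfolding G_def sc_def by blast+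
 note fin = positions_finite[OF positions_nodes]
 have inj: "inj_on sc (nodes D)" unfolding sc_def by (rule inj_nsucc[OF positions_nodes])
 have surj: "sc ` nodes D = nodes D"
 unfolding sc_def using endo_inj_surj[OF fin nsucc_image[OF positions_nodes] inj_nsucc[OF positions_nodes]] .
 define lam where "lam = (%w. G (inv_into (nodes D) sc w))"
 have lam_sc: "lam (sc v) = G v" if "v \<in> nodes D" for v using inv_into_f_f[OF inj that] by (simp add: lam_def)
 have uniq: "k = k'" if "(f \<longlongrightarrow> pi + 2 * pi * real_of_int k) F" "(f \<longlongrightarrow> pi + 2 * pi * real_of_int k') F" "F ~= bot"
 for f :: "real => real" and F and k k' :: int
 using tendsto_unique[OF that(3,1,2)] by simp
 have con: "consecutive (nxt D) (nodes D) v (sc v)" for v unfolding sc_def by (rule consecutive_nsucc[OF fin])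
 have before: "(turning D e \<longlongrightarrow> pi + 2 * pi * lam (e, b)) (at_left b)" if eb: "(e, b) \<in> nodes D" "0 < b" for e b
 proof -
 obtain v where v: "v \<in> nodes D" "sc v = (e, b)" using surj eb(1) by (metis (no_types, lifting) imageE)
 have "fst v = e" using con[of v] eb(2) unfolding consecutive_def v(2) by auto
 then show ?thesis using G(2)[OF v(1)] lam_sc[OF v(1)] v(2) by simp
 qed
 have after: "(turning D e \<longlongrightarrow> pi + 2 * pi * lam (sc (e, b))) (at_right b)" if "(e, b) \<in> nodes D" for e b
 using G(1)[OF that] lam_sc[OF that] by simp
 have vertex: "lam (sc (f, 0)) = lam (f, 0)" if f: "f \<in> edges D" for f
 proof -
 have f0: "(f, 0) \<in> nodes D" using f by (simp add: nodes_def)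
 obtain v where v: "v \<in> nodes D" "sc v = (f, 0)" using surj f0 by (metis (no_types, lifting) imageE)
 have ve: "fst v \<in> edges D" "0 <= snd v" using positionsD(1)[OF positions_nodes, of "fst v" "snd v"] v by auto
 have nf: "nxt D (fst v) = f" using con[of v] ve(2) unfolding consecutive_def v(2) by auto
 then have "fst (sc v) ~= fst v" using nxt_ne[OF ve(1)] v(2) by simp
 then have "(turning D (fst v) \<longlongrightarrow> pi + 2 * pi * lam (f, 0)) (at_left 1)"
 using G(2)[OF v(1)] lam_sc[OF v(1)] v(2) by simp
 moreover note turning_at_vertex[OF ve(1), unfolded nf]
 ultimately have "pi + 2 * pi * lam (f, 0) = pi + 2 * pi * lam (sc (f, 0))"
 using tendsto_unique[OF trivial_limit_at_left_real] tendsto_unique[OF trivial_limit_at_right_real] after[OF f0] by metis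
 then show ?thesis by simp
 qed
 have crossing: "lam (sc (pos D (f, e))) = lam (pos D (e, f)) & lam (sc (pos D (e, f))) = lam (pos D (f, e)) &
 lam (pos D (f, e)) = lam (pos D (e, f)) - (if positive D (e, f) then 1 else - 1)" if ov: "(e, f) \<in> over D" for e f
 proof -
 have c: "crosses D e f" "crosses D f e" using over_crosses[OF ov] crosses_sym[of e f] by auto
 have n: "(e, param D (e, f)) \<in> nodes D" "(f, param D (f, e)) \<in> nodes D"
 using ov unfolding nodes_def passages_def pos_def by force+
 note P = param(1)[OF c(1)] param(1)[OF c(2)]
 let ?s = "sgn (det2 (direction D e) (direction D f))"
 let ?T = "\<Sum>g\<in>edges D - {e, f}. angle D g (pt D e (param D (e, f)))"
 have sw: "sgn (det2 (direction D f) (direction D e)) = - ?s" using det2_swap[of "direction D f" "direction D e"] by (simp add: sgn_minus)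
 have "edges D - {f, e} = edges D - {e, f}" by auto
 note tf = turning_at_crossing[OF c(2), unfolded sw this param(3)[OF c(1), symmetric]]
 note te = turning_at_crossing[OF c(1)]
 note L = trivial_limit_at_left_real and R = trivial_limit_at_right_real
 have 1: "pi + 2 * pi * lam (e, param D (e, f)) = ?s * pi + ?T" by (rule tendsto_unique[OF L before[OF n(1) P(1)] te(1)])
 have 2: "pi + 2 * pi * lam (sc (e, param D (e, f))) = - ?s * pi + ?T" by (rule tendsto_unique[OF R after[OF n(1)] te(2)])
 have 3: "pi + 2 * pi * lam (f, param D (f, e)) = - ?s * pi + ?T" by (rule tendsto_unique[OF L before[OF n(2) P(2)] tf(1)])
 have 4: "pi + 2 * pi * lam (sc (f, param D (f, e))) = - (- ?s) * pi + ?T" by (rule tendsto_unique[OF R after[OF n(2)] tf(2)])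
 have s: "?s = (if positive D (e, f) then 1 else - 1)" using crosses_det[OF c(1)] by (auto simp: positive_def sgn_if)
 have cancel: "j = k" if "2 * pi * real_of_int j = 2 * pi * real_of_int k" for j k using that by simp
 have "2 * pi * lam (sc (f, param D (f, e))) = 2 * pi * lam (e, param D (e, f))" using 1 4 by linarith
 moreover have "2 * pi * lam (sc (e, param D (e, f))) = 2 * pi * lam (f, param D (f, e))" using 2 3 by linarith
 moreover have "2 * pi * real_of_int (lam (f, param D (f, e))) = 2 * pi * lam (e, param D (e, f)) - 2 * (?s * pi)"
 using 1 3 by linarith
 then have "2 * pi * real_of_int (lam (f, param D (f, e))) =
 2 * pi * real_of_int (lam (e, param D (e, f)) - (if positive D (e, f) then 1 else - 1))"
 unfolding s by (cases "positive D (e, f)") (simp_all add: algebra_simps)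
 ultimately show ?thesis unfolding pos_def fst_conv using cancel by blast
 qed
 show ?thesis
 proof (intro exI[of _ lam] conjI ballI)
 fix v assume "v \<in> nodes D - ends (xings D)"
 then show "lam (sc v) = lam v" using vertex unfolding ends_xings nodes_def by auto
 next
 fix c assume "c \<in> xings D"
 then obtain e f where "(e, f) \<in> over D" "c = (pos D (e, f), pos D (f, e), positive D (e, f))" unfolding xings_def by auto
 then show "case c of (x, y, p) => lam (sc y) = lam x & lam (sc x) = lam y & lam y = lam x - (if p then 1 else - 1)"
 using crossing[of e f] by simp
 qed
qed

end

section \<open>Virtual isotopy and the criterion for non-classical diagrams\<close>

lemma (in bracket_model) Z_classical:
 assumes "vdiagram D" "classical D"
 shows "Z t D = Z 0 D"
proof -
 interpret diagram D by (rule diagramI[OF assms(1)])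
 obtain lam :: "nat \<times> real => int" where
 1: "\<forall>v\<in>nodes D - ends (xings D). lam (nsucc (nxt D) (nodes D) v) = lam v" and
 2: "\<forall>(x, y, p)\<in>xings D. lam (nsucc (nxt D) (nodes D) y) = lam x & lam (nsucc (nxt D) (nodes D) x) = lam y &
 lam y = lam x - (if p then 1 else - 1)" using alexander_numbering[OF assms(2)] by blast
 show ?thesis unfolding Z_def psum_def
 by (rule state_sum_gauge[where lam=lam, OF positions_finite[OF positions_nodes] nsucc_image[OF positions_nodes] ends_xings_nodes])
 (use 1 2 in auto)
qed

context bracket_model
begin

text \<open>The factor, which stems from the first Reidemeister move, is the same for all
  \<open>t\<close>. Hence equality of \<open>Z 1 D\<close> and \<open>Z 0 D\<close> is
  preserved.\<close>

lemma Z_move: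
 assumes "move D D'"
 shows "\<exists>c. c ~= 0 & (\<forall>t. Z t D' = c * Z t D)"
proof -
 have D: "vdiagram D" "vdiagram D'" using assms by (auto simp: move_def)
 have one: "\<exists>c. c ~= 0 & (\<forall>t. Z t D' = c * Z t D)" if "\<And>t. Z t D' = Z t D"
 using that by (intro exI[of _ 1]) simp
 from assms consider "relabel D D'" | "motion D D'" | "subdivision D D'" | "reidemeister1 D D'" | "reidemeister2 D D'"
 | "reidemeister3 D D'" | "detour D D'" unfolding move_def by blast
 then show ?thesis
 proof cases
 case 1 show ?thesis by (rule one) (use Z_relabel D 1 in blast)
 next
 case 2 show ?thesis by (rule one) (use Z_motion D 2 in blast)
 next
 case 3 show ?thesis by (rule one) (use Z_subdivision D 3 in blast)
 next
 case 4 show ?thesis using Z_R1 D 4 by blast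
 next
 case 5 show ?thesis by (rule one) (use Z_R2 D 5 in blast)
 next
 case 6 show ?thesis by (rule one) (use Z_R3 D 6 in blast)
 next
 case 7 show ?thesis by (rule one) (use Z_detour D 7 in blast)
 qed
qed

lemma Z_isotopic:
 assumes "virtually_isotopic D D'"
 shows "\<exists>c. c ~= 0 & (\<forall>t. Z t D' = c * Z t D)"
 using assms unfolding virtually_isotopic_def
proof (induction rule: equivclp_induct)
 case base
 show ?case by (intro exI[of _ 1]) simp
next
 case (step y z)
 obtain c where c: "c ~= 0" "\<forall>t. Z t y = c * Z t D" using step.IH by blast
 have "\<exists>k. k ~= 0 & (\<forall>t. Z t z = k * Z t y)"
 proof (cases "move y z")
 case False
 then obtain k where k: "k ~= 0" "\<forall>t. Z t y = k * Z t z" using step.hyps(2) Z_move by blast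
 then show ?thesis by (intro exI[of _ "inverse k"]) (simp add: field_simps)
 qed (rule Z_move)
 then obtain k where "k ~= 0" "\<forall>t. Z t z = k * Z t y" by blast
 then show ?case using c by (intro exI[of _ "k * c"]) simp
qed

text \<open>An embedded diagram is classical, so both conclusions follow from the vanishing of the
  difference on classical diagrams.\<close>

lemma nonclassicalI:
 assumes "Z 1 D ~= Z 0 D"
 shows "nontrivial D & nonclassical D"
proof -
 have "False" if D': "vdiagram D'" "classical D'" "virtually_isotopic D D'" for D'
 proof -
 obtain c where c: "c ~= 0" "\<And>t. Z t D' = c * Z t D" using Z_isotopic[OF D'(3)] by blast
 have "Z 1 D' = Z 0 D'" by (rule Z_classical[OF D'(1,2)])
 then show False using c assms by simp
 qed
 then show ?thesis unfolding nontrivial_def nonclassical_def classical_def embedded_def by blast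
qed

end

section \<open>Strands between passages as orbits of the successor map\<close>

definition ahead :: "vdiag => nat \<times> real => nat \<times> nat => real set" where
 "ahead D v Q = {real k + param D Q - snd v | k. fst Q = (nxt D ^^ k) (fst v)}"

text \<open>The relation \<open>R\<close> is strict or weak positivity: the next passage after
  \<open>v\<close> excludes \<open>v\<close> itself, but once a step to \<open>sc v\<close> has been
  made, the node reached there counts.\<close>

definition first_from :: "vdiag => (real => bool) => nat \<times> real => nat \<times> nat => bool" where
 "first_from D R v Q \<longleftrightarrow> Q \<in> passages D &
 (\<exists>h\<in>ahead D v Q. R h & (\<forall>Q'\<in>passages D. \<forall>h'\<in>ahead D v Q'. R h' --> h <= h'))"

lemma next_passage_first: "next_passage D P Q \<longleftrightarrow> P \<in> passages D & first_from D (%h. 0 < h) (pos D P) Q"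
proof -
 have "travel D P Q = ahead D (pos D P) Q \<inter> {0<..}" for Q by (simp add: travel_def ahead_def pos_def)
 then show ?thesis unfolding next_passage_def first_from_def by (simp add: Bex_def Ball_def conj_assoc imp_conjL)
qed

context diagram
begin

definition sc :: "nat \<times> real => nat \<times> real" where
 "sc = nsucc (nxt D) (nodes D)"

definition stops :: "(nat \<times> real) set" where
 "stops = pos D ` passages D"

lemma finite_nodes: "finite (nodes D)" and inj_sc: "inj_on sc (nodes D)" and sc_in: "v \<in> nodes D ==> sc v \<in> nodes D"
 and stops_nodes: "stops \<subseteq> nodes D"
 unfolding sc_def stops_def
 using positions_finite[OF positions_nodes] inj_nsucc[OF positions_nodes] nsucc_in[OF positions_nodes, of v]
 by (simp_all add: nodes_def)

lemma passage_param:
 assumes "Q \<in> passages D"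
 shows "0 < param D Q" "param D Q < 1" "(fst Q, param D Q) \<in> nodes D" "fst Q \<in> edges D"
proof -
 obtain e f where Q: "Q = (e, f)" by (cases Q)
 have c: "crosses D e f" using passage_crosses assms Q by auto
 show "0 < param D Q" "param D Q < 1" using param(1,2)[OF c] Q by auto
 show "(fst Q, param D Q) \<in> nodes D" using assms unfolding nodes_def pos_def by blast
 show "fst Q \<in> edges D" using c Q by (simp add: crosses_def)
qed

lemma node_range: "v \<in> nodes D ==> fst v \<in> edges D & 0 <= snd v & snd v < 1"
 using positionsD(1)[OF positions_nodes, of "fst v" "snd v"] by simp

lemma sc_cases:
 obtains "fst (sc v) = fst v" "snd v < snd (sc v)" "\<And>s. (fst v, s) \<in> nodes D ==> s <= snd v \<or> snd (sc v) <= s"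
 | "sc v = (nxt D (fst v), 0)" "\<And>s. (fst v, s) \<in> nodes D ==> s <= snd v"
 using consecutive_nsucc[OF finite_nodes, of "nxt D" v] unfolding sc_def[symmetric] consecutive_def by blast

text \<open>Going from \<open>v\<close> to \<open>sc v\<close> shortens all distances by the same
  \<open>\<delta>\<close>, and no passage lies strictly between the two nodes.\<close>

lemma first_from_step:
 assumes v: "v \<in> nodes D"
 shows "first_from D (%h. 0 < h) v Q \<longleftrightarrow> first_from D (%h. 0 <= h) (sc v) Q"
proof -
 have "\<exists>\<delta>. \<forall>Q\<in>passages D. \<forall>h. h \<in> ahead D v Q & 0 < h \<longleftrightarrow> h - \<delta> \<in> ahead D (sc v) Q & 0 <= h - \<delta>"
 proof (cases rule: sc_cases[of v])
 case 1
 show ?thesis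
 proof (intro exI[of _ "snd (sc v) - snd v"] ballI allI)
 fix Q h assume Q: "Q \<in> passages D"
 note q = passage_param[OF Q]
 have s1: "snd (sc v) < 1" using node_range[OF sc_in[OF v]] by simp
 have "0 < real k + param D Q - snd v \<longleftrightarrow> 0 <= real k + param D Q - snd (sc v)" if k: "fst Q = (nxt D ^^ k) (fst v)" for k
 proof (cases k)
 case 0
 then have "param D Q <= snd v \<or> snd (sc v) <= param D Q" using k 1(3) q(3) by simp
 then show ?thesis using 0 1(2) by auto
 next
 case (Suc j)
 then show ?thesis using q(1) s1 1(2) by auto
 qed
 note kk = this
 have "0 < h \<longleftrightarrow> 0 <= h - (snd (sc v) - snd v)"
 if k: "fst Q = (nxt D ^^ k) (fst v)" "h = real k + param D Q - snd v" for k
 proof -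
 have "h - (snd (sc v) - snd v) = real k + param D Q - snd (sc v)" using k(2) by simp
 then show ?thesis using kk[OF k(1)] unfolding k(2) by argo
 qed
 moreover have "h = real k + param D Q - snd v \<longleftrightarrow> h - (snd (sc v) - snd v) = real k + param D Q - snd (sc v)" for k
 by auto
 ultimately show "h \<in> ahead D v Q & 0 < h \<longleftrightarrow> h - (snd (sc v) - snd v) \<in> ahead D (sc v) Q & 0 <= h - (snd (sc v) - snd v)"
 unfolding ahead_def 1(1) mem_Collect_eq by metis
 qed
 next
 case 2
 show ?thesis
 proof (intro exI[of _ "1 - snd v"] ballI allI)
 fix Q h assume Q: "Q \<in> passages D"
 note q = passage_param[OF Q] and vr = node_range[OF v]
 show "h \<in> ahead D v Q & 0 < h \<longleftrightarrow> h - (1 - snd v) \<in> ahead D (sc v) Q & 0 <= h - (1 - snd v)"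
 proof
 assume "h \<in> ahead D v Q & 0 < h"
 then obtain k where k: "h = real k + param D Q - snd v" "fst Q = (nxt D ^^ k) (fst v)" "0 < h" by (auto simp: ahead_def)
 have "k ~= 0"
 proof
 assume "k = 0"
 then show False using k 2(2)[of "param D Q"] q(3) by simp
 qed
 then obtain j where j: "k = Suc j" using not0_implies_Suc by blast
 have "h - (1 - snd v) = real j + param D Q - snd (sc v)" "fst Q = (nxt D ^^ j) (fst (sc v))"
 using k j 2(1) by (simp_all add: funpow_swap1)
 then show "h - (1 - snd v) \<in> ahead D (sc v) Q & 0 <= h - (1 - snd v)" unfolding ahead_def using q(1) 2(1) by auto
 next
 assume "h - (1 - snd v) \<in> ahead D (sc v) Q & 0 <= h - (1 - snd v)"
 then obtain j where "h - (1 - snd v) = real j + param D Q" "fst Q = (nxt D ^^ j) (nxt D (fst v))" by (auto simp: ahead_def 2(1))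
 then have "h = real (Suc j) + param D Q - snd v" "fst Q = (nxt D ^^ Suc j) (fst v)" by (simp_all add: funpow_swap1)
 moreover have "0 < real (Suc j) + param D Q - snd v" using q(1) vr by simp
 ultimately show "h \<in> ahead D v Q & 0 < h" unfolding ahead_def by blast
 qed
 qed
 qed
 then obtain \<delta> where \<delta>: "\<And>Q h. Q \<in> passages D ==> h \<in> ahead D v Q & 0 < h \<longleftrightarrow> h - \<delta> \<in> ahead D (sc v) Q & 0 <= h - \<delta>" by blast
 have \<delta>': "h \<in> ahead D (sc v) Q & 0 <= h \<longleftrightarrow> h + \<delta> \<in> ahead D v Q & 0 < h + \<delta>" if "Q \<in> passages D" for Q h
 using \<delta>[OF that, of "h + \<delta>"] by simp
 show ?thesis
 proof
 assume "first_from D (%h. 0 < h) v Q"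
 then obtain h where h: "Q \<in> passages D" "h \<in> ahead D v Q & 0 < h" "\<And>Q' h'. Q' \<in> passages D ==> h' \<in> ahead D v Q' & 0 < h' ==> h <= h'"
 unfolding first_from_def by blast
 have "h - \<delta> <= h'" if "Q' \<in> passages D" "h' \<in> ahead D (sc v) Q'" "0 <= h'" for Q' h'
 using h(3)[OF that(1), of "h' + \<delta>"] \<delta>'[OF that(1), of h'] that(2,3) by simp
 then show "first_from D (%h. 0 <= h) (sc v) Q" using \<delta>[OF h(1), of h] h(1,2) unfolding first_from_def by blast
 next
 assume "first_from D (%h. 0 <= h) (sc v) Q"
 then obtain h where h: "Q \<in> passages D" "h \<in> ahead D (sc v) Q & 0 <= h" "\<And>Q' h'. Q' \<in> passages D ==> h' \<in> ahead D (sc v) Q' & 0 <= h' ==> h <= h'"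
 unfolding first_from_def by blast
 have "h + \<delta> <= h'" if "Q' \<in> passages D" "h' \<in> ahead D v Q'" "0 < h'" for Q' h'
 using h(3)[OF that(1), of "h' - \<delta>"] \<delta>[OF that(1), of h'] that(2,3) by simp
 then show "first_from D (%h. 0 < h) v Q" using \<delta>'[OF h(1), of h] h(1,2) unfolding first_from_def by blast
 qed
qed

lemma ahead_0:
 assumes "v \<in> nodes D" "Q \<in> passages D"
 shows "0 \<in> ahead D v Q \<longleftrightarrow> v = pos D Q"
proof
 assume "0 \<in> ahead D v Q"
 then obtain k where k: "real k + param D Q = snd v" "fst Q = (nxt D ^^ k) (fst v)" by (auto simp: ahead_def)
 then have "real k < 1" using node_range[OF assms(1)] passage_param(1)[OF assms(2)] by linarith
 then have "k = 0" by simp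
 then show "v = pos D Q" using k by (simp add: pos_def prod_eq_iff)
next
 assume "v = pos D Q"
 then show "0 \<in> ahead D v Q" unfolding ahead_def pos_def by (intro CollectI exI[of _ 0]) simp
qed

lemma first_from_stop:
 assumes P: "P \<in> passages D"
 shows "first_from D (%h. 0 <= h) (pos D P) Q \<longleftrightarrow> Q = P"
proof -
 have n: "pos D P \<in> nodes D" using P by (simp add: nodes_def)
 have 0: "0 \<in> ahead D (pos D P) P" using ahead_0[OF n P] by simp
 show ?thesis
 proof
 assume "first_from D (%h. 0 <= h) (pos D P) Q"
 then obtain h where h: "Q \<in> passages D" "h \<in> ahead D (pos D P) Q" "0 <= h" "h <= 0"
 using P 0 unfolding first_from_def by blast
 then have "0 \<in> ahead D (pos D P) Q" by simp
 then have "pos D P = pos D Q" using ahead_0[OF n h(1)] by simp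
 then show "Q = P" using inj_onD[OF inj_pos _ h(1) P] by simp
 next
 assume "Q = P"
 then show "first_from D (%h. 0 <= h) (pos D P) Q" unfolding first_from_def using P 0 by auto
 qed
qed

definition reaches :: "nat => nat \<times> real => nat \<times> nat => bool" where
 "reaches n v Q \<longleftrightarrow> Q \<in> passages D & (sc ^^ n) v = pos D Q & (\<forall>j<n. (sc ^^ j) v \<notin> stops)"

lemma reaches_Suc: "reaches (Suc n) v Q \<longleftrightarrow> v \<notin> stops & reaches n (sc v) Q"
proof -
 have "(sc ^^ Suc j) v = (sc ^^ j) (sc v)" for j by (simp only: funpow_Suc_right comp_apply)
 then show ?thesis unfolding reaches_def by (auto simp: less_Suc_eq_0_disj simp del: funpow.simps(2))
qed

lemma first_from_trivial:
 assumes "v \<in> nodes D" "v \<notin> stops"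
 shows "first_from D (%h. 0 <= h) v Q \<longleftrightarrow> first_from D (%h. 0 < h) v Q"
proof -
 have "0 \<notin> ahead D v Q" if "Q \<in> passages D" for Q using ahead_0[OF assms(1) that] assms(2) that by (auto simp: stops_def)
 then have "h \<in> ahead D v Q ==> 0 <= h \<longleftrightarrow> 0 < h" if "Q \<in> passages D" for Q h using that by (metis less_le)
 then show ?thesis unfolding first_from_def by (metis (no_types, lifting))
qed

lemma first_from_reaches:
 "reaches n v Q ==> v \<in> nodes D ==> first_from D (%h. 0 <= h) v Q' \<longleftrightarrow> Q' = Q"
proof (induction n arbitrary: v)
 case 0
 then show ?case using first_from_stop[of Q Q'] by (simp add: reaches_def)
next
 case (Suc n)
 then have "v \<notin> stops" "reaches n (sc v) Q" by (simp_all add: reaches_Suc)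
 then show ?case using first_from_trivial[of v Q'] first_from_step[of v Q'] Suc.IH[of "sc v"] Suc.prems(2) sc_in[of v] by simp
qed

lemma reaches_const:
 "reaches n v Q ==> v \<in> nodes D ==> (\<And>w. w \<in> nodes D - stops ==> f (sc w) = f w) ==> f (pos D Q) = f v"
proof (induction n arbitrary: v)
 case 0
 then show ?case by (simp add: reaches_def)
next
 case (Suc n)
 then have *: "v \<notin> stops" "reaches n (sc v) Q" by (simp_all add: reaches_Suc)
 have "f (pos D Q) = f (sc v)" by (rule Suc.IH[OF *(2) sc_in[OF Suc.prems(2)] Suc.prems(3)])
 then show ?case using Suc.prems(2,3) *(1) by simp
qed

lemma reaches_unique: "reaches n v Q ==> reaches n' v Q' ==> v \<in> nodes D ==> Q = Q'"
 using first_from_reaches[of n v Q Q] first_from_reaches[of n' v Q' Q] by simp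

lemma funpow_sc_in: "v \<in> nodes D ==> (sc ^^ n) v \<in> nodes D"
 by (induction n) (simp_all add: sc_in)

lemma funpow_sc_cancel: "v \<in> nodes D ==> w \<in> nodes D ==> (sc ^^ n) v = (sc ^^ n) w ==> v = w"
proof (induction n)
 case (Suc n)
 have "(sc ^^ n) v = (sc ^^ n) w"
 by (rule inj_onD[OF inj_sc _ funpow_sc_in[OF Suc.prems(1)] funpow_sc_in[OF Suc.prems(2)]]) (use Suc.prems(3) in simp)
 then show ?case by (rule Suc.IH[OF Suc.prems(1,2)])
qed simp

lemma reaches_exists:
 assumes "(sc ^^ n) v \<in> stops"
 shows "\<exists>n Q. reaches n v Q"
proof -
 define m where "m = (LEAST n. (sc ^^ n) v \<in> stops)"
 have "(sc ^^ m) v \<in> stops" unfolding m_def by (rule LeastI[of "%n. (sc ^^ n) v \<in> stops", OF assms])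
 moreover have "(sc ^^ j) v \<notin> stops" if "j < m" for j using not_less_Least[OF that[unfolded m_def]] .
 ultimately show ?thesis unfolding reaches_def stops_def by blast
qed

lemma sc_periodic:
 assumes v: "v \<in> nodes D"
 shows "\<exists>n. (sc ^^ n) (sc v) = v"
proof -
 have "~ inj (%n. (sc ^^ n) v)"
 proof
 assume "inj (%n. (sc ^^ n) v)"
 then have "infinite (range (%n. (sc ^^ n) v))" by (rule range_inj_infinite)
 moreover have "range (%n. (sc ^^ n) v) \<subseteq> nodes D" using funpow_sc_in[OF v] by blast
 ultimately show False using finite_nodes finite_subset by blast
 qed
 then obtain i j where "(sc ^^ i) v = (sc ^^ j) v" "i < j" unfolding inj_def by (metis linorder_neqE_nat)
 then obtain d where d: "(sc ^^ i) v = (sc ^^ (i + Suc d)) v" by (metis less_iff_Suc_add add_Suc_right)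
 have e: "(sc ^^ (i + Suc d)) v = (sc ^^ i) ((sc ^^ d) (sc v))"
 by (simp only: funpow_add funpow_Suc_right comp_apply)
 have "v = (sc ^^ d) (sc v)"
 by (rule funpow_sc_cancel[OF v _ trans[OF d e]]) (rule funpow_sc_in[OF sc_in[OF v]])
 then show ?thesis by (intro exI[of _ d]) simp
qed

definition after :: "nat \<times> nat => nat \<times> nat" where
 "after P = (THE Q. \<exists>n. reaches n (sc (pos D P)) Q)"

lemma pos_node: "P \<in> passages D ==> pos D P \<in> nodes D"
 by (simp add: nodes_def)

lemma reaches_after:
 assumes P: "P \<in> passages D"
 shows "\<exists>n. reaches n (sc (pos D P)) (after P)"
proof -
 note n = pos_node[OF P]
 obtain m where "(sc ^^ m) (sc (pos D P)) = pos D P" using sc_periodic[OF n] by blast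
 then have "(sc ^^ m) (sc (pos D P)) \<in> stops" using P by (simp add: stops_def)
 then obtain k Q where Q: "reaches k (sc (pos D P)) Q" using reaches_exists by blast
 show ?thesis unfolding after_def
 by (rule theI[of "%Q. \<exists>n. reaches n (sc (pos D P)) Q" Q]) (use Q reaches_unique[OF _ _ sc_in[OF n]] in blast)+
qed

lemma after_in: "P \<in> passages D ==> after P \<in> passages D"
 using reaches_after[of P] by (auto simp: reaches_def)

lemma next_passage_iff: "next_passage D P Q \<longleftrightarrow> P \<in> passages D & Q = after P"
proof (cases "P \<in> passages D")
 case True
 obtain n where n: "reaches n (sc (pos D P)) (after P)" using reaches_after[OF True] by blast
 show ?thesis unfolding next_passage_first first_from_step[OF pos_node[OF True]]
 using first_from_reaches[OF n sc_in[OF pos_node[OF True]]] True by simp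
qed (simp add: next_passage_first)

text \<open>Two walks to the same passage are traced back by the injectivity of \<open>sc\<close>.
  If they had different lengths, the longer one would already have stopped at the start of the
  shorter one.\<close>

lemma inj_after: "inj_on after (passages D)"
proof -
 have key: "P = P'" if P: "P \<in> passages D" "P' \<in> passages D" and r: "reaches n (sc (pos D P)) Q" "reaches n' (sc (pos D P')) Q" and le: "n <= n'"
 for P P' n n' Q
 proof -
 obtain d where d: "n' = n + d" using le le_Suc_ex by blast
 have "(sc ^^ Suc n) (pos D P) = (sc ^^ Suc n) ((sc ^^ d) (pos D P'))"
 proof -
 have "(sc ^^ Suc n) (pos D P) = (sc ^^ Suc (n + d)) (pos D P')"
 using r unfolding d reaches_def by (simp only: funpow_Suc_right comp_apply)
 then show ?thesis unfolding add_Suc[symmetric] by (simp only: funpow_add comp_apply)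
 qed
 then have e: "pos D P = (sc ^^ d) (pos D P')"
 by (rule funpow_sc_cancel[OF pos_node[OF P(1)] funpow_sc_in[OF pos_node[OF P(2)]]])
 show "P = P'"
 proof (cases d)
 case 0
 then show ?thesis using e inj_onD[OF inj_pos _ P] by simp
 next
 case (Suc j)
 then have "pos D P = (sc ^^ j) (sc (pos D P'))" using e by (simp only: funpow_Suc_right comp_apply)
 then have "(sc ^^ j) (sc (pos D P')) \<in> stops" unfolding stops_def using P(1) by (metis image_eqI)
 then show ?thesis using r(2) Suc d by (simp add: reaches_def)
 qed
 qed
 show ?thesis
 proof (rule inj_onI)
 fix P P' assume P: "P \<in> passages D" "P' \<in> passages D" "after P = after P'"
 obtain n n' where "reaches n (sc (pos D P)) (after P)" "reaches n' (sc (pos D P')) (after P)"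
 using reaches_after[OF P(1)] reaches_after[OF P(2)] P(3) by auto
 then show "P = P'" using key[OF P(1,2)] key[OF P(2,1)] by (metis nat_le_linear)
 qed
qed

definition before :: "nat \<times> nat => nat \<times> nat" where
 "before = inv_into (passages D) after"

lemma before: "Q \<in> passages D ==> before Q \<in> passages D & after (before Q) = Q"
 and before_after: "P \<in> passages D ==> before (after P) = P"
proof -
 have s: "after ` passages D = passages D"
 using endo_inj_surj[OF finite_passages _ inj_after] after_in by blast
 show "Q \<in> passages D ==> before Q \<in> passages D & after (before Q) = Q"
 using inv_into_into[of Q after "passages D"] f_inv_into_f[of Q after "passages D"] unfolding before_def s by blast
 show "P \<in> passages D ==> before (after P) = P" unfolding before_def by (rule inv_into_f_f[OF inj_after])
qed

definition partner :: "strand_end => strand_end" where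
 "partner a = (case snd a of Outgoing => (after (fst a), Incoming) | Incoming => (before (fst a), Outgoing))"

lemma paired_partner: "paired partner (passages D \<times> UNIV)"
 unfolding paired_def partner_def using after_in before before_after by (auto split: side.split)

lemma strands_pairs: "strands D = pairs partner (passages D \<times> UNIV)"
proof (rule eq_pairsI[OF paired_partner])
 fix a b
 show "{a, b} \<in> strands D \<longleftrightarrow> a \<in> passages D \<times> UNIV & b = partner a"
 proof
 assume "{a, b} \<in> strands D"
 then obtain P where P: "P \<in> passages D" "{a, b} = {(P, Outgoing), (after P, Incoming)}"
 unfolding strands_def next_passage_iff by blast
 then show "a \<in> passages D \<times> UNIV & b = partner a"
 using after_in[OF P(1)] before_after[OF P(1)] by (auto simp: doubleton_eq_iff partner_def)
 next
 assume r: "a \<in> passages D \<times> UNIV & b = partner a"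
 obtain P d where a: "a = (P, d)" by (cases a)
 have P: "P \<in> passages D" using r a by simp
 show "{a, b} \<in> strands D"
 proof (cases d)
 case Outgoing
 then have "{a, b} = {(P, Outgoing), (after P, Incoming)}" using r a by (simp add: partner_def)
 then show ?thesis using P unfolding strands_def next_passage_iff by blast
 next
 case Incoming
 then have "{a, b} = {(before P, Outgoing), (after (before P), Incoming)}" using r a before[OF P] by (simp add: partner_def insert_commute)
 then show ?thesis using before[OF P] unfolding strands_def next_passage_iff by blast
 qed
 qed
qed (unfold strands_def, blast)

text \<open>The node whose label is carried by the given strand end, in accordance with the
  convention that the label of a node belongs to the arriving strand.\<close>

definition node_of :: "strand_end => nat \<times> real" where
 "node_of a = (case snd a of Incoming => pos D (fst a) | Outgoing => sc (pos D (fst a)))"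

lemma node_of_in: "a \<in> passages D \<times> UNIV ==> node_of a \<in> nodes D"
 using pos_node[of "fst a"] sc_in[OF pos_node[of "fst a"]] by (simp add: node_of_def mem_Times_iff split: side.split)

lemma node_of_partner:
 assumes "a \<in> passages D \<times> UNIV" "\<And>w. w \<in> nodes D - stops ==> f (sc w) = f w"
 shows "f (node_of (partner a)) = f (node_of a)"
proof -
 have *: "f (pos D (after P)) = f (sc (pos D P))" if "P \<in> passages D" for P
 using reaches_after[OF that] reaches_const[OF _ sc_in[OF pos_node[OF that]], of _ _ f] assms(2) by blast
 show ?thesis using *[of "fst a"] *[of "before (fst a)"] before[of "fst a"] assms(1)
 by (auto simp: node_of_def partner_def split: side.splits)
qed

end

section \<open>The states of the complement of a crossing and their expansion\<close>

definition left_passage :: "vdiag => nat \<times> nat => nat \<times> nat" where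
 "left_passage D c = (if positive D c then c else prod.swap c)"

definition crossing_ends :: "nat \<times> nat => strand_end set" where
 "crossing_ends c = {c, prod.swap c} \<times> UNIV"

lemma crossing_end_simps [simp]:
 "crossing_end D c In_L = (left_passage D c, Incoming)" "crossing_end D c In_R = (prod.swap (left_passage D c), Incoming)"
 "crossing_end D c Out_R = (left_passage D c, Outgoing)" "crossing_end D c Out_L = (prod.swap (left_passage D c), Outgoing)"
 by (simp_all add: crossing_end_def left_passage_def Let_def split: prod.split)

lemma UNIV_side: "UNIV = {Incoming, Outgoing}"
 using side.exhaust by blast

lemma range_crossing_end: "range (crossing_end D c) = crossing_ends c"
 unfolding range_tangle_end crossing_ends_def UNIV_side by (auto simp: left_passage_def)

lemma range_complement_boundary: "range (complement_boundary D c) = crossing_ends c"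
 unfolding range_crossing_end[of D c, symmetric] range_tangle_end by (auto simp: complement_boundary_def)

lemma Union_crossing_cusps: "\<Union>(cusp_pairs {in_cusp D c, out_cusp D c}) = crossing_ends c"
 unfolding range_crossing_end[of D c, symmetric] range_tangle_end Union_cusp_pairs by (auto simp: in_cusp_def out_cusp_def)

lemma Union_oriented_joins: "\<Union>(oriented_joins c) = crossing_ends c"
 unfolding crossing_ends_def UNIV_side by (auto simp: oriented_joins_def split: prod.split)

definition state_joins :: "vdiag => nat \<times> nat => (nat \<times> nat) set => strand_end set set" where
 "state_joins D i \<sigma> = \<Union>(oriented_joins ` (over D - {i} - \<sigma>))"

definition state_cusps :: "vdiag => (nat \<times> nat) set => (strand_end \<times> strand_end) set" where
 "state_cusps D \<sigma> = in_cusp D ` \<sigma> \<union> out_cusp D ` \<sigma>"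

lemma Union_state_cusps: "\<Union>(cusp_pairs (state_cusps D \<sigma>)) = \<Union>(crossing_ends ` \<sigma>)"
proof -
 have "state_cusps D \<sigma> = (\<Union>c\<in>\<sigma>. {in_cusp D c, out_cusp D c})" by (auto simp: state_cusps_def)
 then have "\<Union>(cusp_pairs (state_cusps D \<sigma>)) = (\<Union>c\<in>\<sigma>. \<Union>(cusp_pairs {in_cusp D c, out_cusp D c}))"
 by (auto simp: cusp_pairs_def)
 then show ?thesis unfolding Union_crossing_cusps .
qed

lemma Union_state_joins: "\<Union>(state_joins D i \<sigma>) = \<Union>(crossing_ends ` (over D - {i} - \<sigma>))"
 unfolding Union_oriented_joins[abs_def, symmetric] state_joins_def by blast

lemma state_config_eq: "state_config D i \<sigma> = \<lparr>cusps = state_cusps D \<sigma>, sites = (%c. {in_cusp D c, out_cusp D c}) ` \<sigma>,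
 arcs = splice (strands D) (state_joins D i \<sigma>), boundary = complement_boundary D i\<rparr>"
 by (simp add: state_config_def state_cusps_def state_joins_def)

lemma swap_eq_iff: "prod.swap a = prod.swap b \<longleftrightarrow> a = b" "prod.swap a = b \<longleftrightarrow> a = prod.swap b"
 by (cases a; cases b; auto)+

lemma state_cuspsE:
 assumes "u \<in> state_cusps D \<sigma>"
 obtains c s where "c \<in> \<sigma>" "u = ((left_passage D c, s), (prod.swap (left_passage D c), s))"
 using assms unfolding state_cusps_def in_cusp_def out_cusp_def by auto

context diagram
begin

lemma over_swap: "c \<in> over D ==> c' \<in> over D ==> c' ~= prod.swap c"
 using over_asym by (cases c) auto

lemma left_passage_eq:
 assumes "c \<in> over D" "c' \<in> over D"
 shows "left_passage D c = left_passage D c' \<longleftrightarrow> c = c'" "left_passage D c ~= prod.swap (left_passage D c')"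
 using over_swap[OF assms] over_swap[OF assms(2,1)] over_swap[OF assms(1,1)] unfolding left_passage_def
 by (auto simp: swap_eq_iff)

lemma crossing_ends_disjoint: "c \<in> over D ==> c' \<in> over D ==> c ~= c' ==> crossing_ends c \<inter> crossing_ends c' = {}"
 using over_swap[of c c'] over_swap[of c' c] unfolding crossing_ends_def by (auto simp: prod.swap_def prod_eq_iff)

lemma passages_crossing_ends: "passages D \<times> UNIV = \<Union>(crossing_ends ` over D)"
 unfolding passages_def crossing_ends_def by (auto simp: prod.swap_def)

lemma state_ends:
 assumes "i \<in> over D" "\<sigma> \<subseteq> over D - {i}"
 shows "passages D \<times> UNIV - \<Union>(state_joins D i \<sigma>) = \<Union>(cusp_pairs (state_cusps D \<sigma>)) \<union> range (complement_boundary D i)"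
 and "range (complement_boundary D i) \<inter> \<Union>(cusp_pairs (state_cusps D \<sigma>)) = {}"
proof -
 have d: "c = c'" if "c \<in> over D" "c' \<in> over D" "a \<in> crossing_ends c" "a \<in> crossing_ends c'" for a c c'
 using crossing_ends_disjoint[OF that(1,2)] that(3,4) by blast
 show "range (complement_boundary D i) \<inter> \<Union>(cusp_pairs (state_cusps D \<sigma>)) = {}"
 unfolding Union_state_cusps range_complement_boundary using d[OF assms(1)] assms(2) by blast
 show "passages D \<times> UNIV - \<Union>(state_joins D i \<sigma>) = \<Union>(cusp_pairs (state_cusps D \<sigma>)) \<union> range (complement_boundary D i)"
 unfolding Union_state_cusps Union_state_joins range_complement_boundary passages_crossing_ends
 proof (intro set_eqI iffI)
 fix a assume "a \<in> \<Union>(crossing_ends ` over D) - \<Union>(crossing_ends ` (over D - {i} - \<sigma>))"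
 then show "a \<in> \<Union>(crossing_ends ` \<sigma>) \<union> crossing_ends i" by blast
 next
 fix a assume "a \<in> \<Union>(crossing_ends ` \<sigma>) \<union> crossing_ends i"
 then obtain c where c: "c \<in> insert i \<sigma>" "a \<in> crossing_ends c" by blast
 then have "c \<in> over D" using assms by blast
 then show "a \<in> \<Union>(crossing_ends ` over D) - \<Union>(crossing_ends ` (over D - {i} - \<sigma>))" using c d[of c _ a] by blast
 qed
qed

lemma state_joins_cases:
 assumes "s \<in> state_joins D i \<sigma>"
 obtains c where "c \<in> over D - {i} - \<sigma>" "s = {(c, Incoming), (prod.swap c, Outgoing)} \<or> s = {(prod.swap c, Incoming), (c, Outgoing)}"
proof -
 have "\<exists>c. c \<in> over D - {i} - \<sigma> & (s = {(c, Incoming), (prod.swap c, Outgoing)} \<or> s = {(prod.swap c, Incoming), (c, Outgoing)})"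
 proof -
 obtain c where c: "c \<in> over D - {i} - \<sigma>" "s \<in> oriented_joins c" using assms unfolding state_joins_def by blast
 obtain x y where xy: "c = (x, y)" by (cases c)
 show ?thesis by (rule exI[of _ c]) (use c in \<open>simp add: oriented_joins_def xy\<close>)
 qed
 then show ?thesis using that by blast
qed

text \<open>The colouring is the Alexander numbering of the diagram, read at the strand ends.
  Oriented joins connect equal levels, and a cusp leads from a left end to a right end or back,
  where the levels differ by one.\<close>

lemma coherent_state_config:
 assumes cl: "classical D" and i: "i \<in> over D" and \<sigma>: "\<sigma> \<subseteq> over D - {i}"
 shows "\<exists>col m P. coherent col m P (state_config D i \<sigma>)"
proof -
 obtain lam :: "nat \<times> real => int" where
 lt: "\<And>v. v \<in> nodes D - stops ==> lam (sc v) = lam v" and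
 lx: "\<And>x y p. (x, y, p) \<in> xings D ==> lam (sc y) = lam x & lam (sc x) = lam y & lam y = lam x - (if p then 1 else - 1)"
 using alexander_numbering[OF cl] unfolding sc_def[symmetric] ends_xings stops_def[symmetric] by blast
 define col where "col = (\<lambda>a::strand_end. (snd a = Incoming, lam (node_of a)))"
 have lc: "lam (sc (pos D (prod.swap c))) = lam (pos D c)" "lam (sc (pos D c)) = lam (pos D (prod.swap c))"
 "lam (pos D (prod.swap c)) = lam (pos D c) - (if positive D c then 1 else - 1)" if "c \<in> over D" for c
 using lx[of "pos D c" "pos D (prod.swap c)" "positive D c"] that unfolding xings_def by (cases c; force)+
 have ll: "lam (sc (pos D (prod.swap (left_passage D c)))) = lam (pos D (left_passage D c))"
 "lam (sc (pos D (left_passage D c))) = lam (pos D (prod.swap (left_passage D c)))"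
 "lam (pos D (left_passage D c)) = lam (pos D (prod.swap (left_passage D c))) + 1" if "c \<in> over D" for c
 using lc[OF that] by (auto simp: left_passage_def)
 let ?PE = "passages D \<times> (UNIV :: side set)" and ?J = "state_joins D i \<sigma>"
 have colp: "col (partner a) = flip (col a)" if "a \<in> ?PE" for a
 using node_of_partner[OF that, of lam] lt by (simp add: col_def partner_def split: side.split)
 have swne: "c ~= prod.swap c" if "c \<in> over D" for c using over_swap[OF that that] .
 have J1: "\<exists>x y. s = {x, y} & x ~= y & col y = flip (col x)" if s: "s \<in> ?J" for s
 proof (rule state_joins_cases[OF s])
 fix c assume c: "c \<in> over D - {i} - \<sigma>" "s = {(c, Incoming), (prod.swap c, Outgoing)} \<or> s = {(prod.swap c, Incoming), (c, Outgoing)}"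
 have "col (prod.swap c, Outgoing) = flip (col (c, Incoming))" "col (c, Outgoing) = flip (col (prod.swap c, Incoming))"
 using lc(1,2)[of c] c(1) by (simp_all add: col_def node_of_def)
 then show ?thesis using c(2) by blast
 qed
 have J2: "pairwise disjnt ?J"
 proof (rule pairwiseI)
 fix s s' assume s: "s \<in> ?J" "s' \<in> ?J" "s ~= s'"
 obtain c where c: "c \<in> over D - {i} - \<sigma>" "s = {(c, Incoming), (prod.swap c, Outgoing)} \<or> s = {(prod.swap c, Incoming), (c, Outgoing)}"
 using state_joins_cases[OF s(1)] .
 obtain c' where c': "c' \<in> over D - {i} - \<sigma>" "s' = {(c', Incoming), (prod.swap c', Outgoing)} \<or> s' = {(prod.swap c', Incoming), (c', Outgoing)}"
 using state_joins_cases[OF s(2)] .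
 show "disjnt s s'"
 proof (cases "c = c'")
 case True
 then show ?thesis using c(2) c'(2) s(3) swne[of c] c(1) by (auto simp: disjnt_def)
 next
 case False
 have "s \<subseteq> crossing_ends c" "s' \<subseteq> crossing_ends c'" using c(2) c'(2) by (auto simp: crossing_ends_def)
 then show ?thesis using crossing_ends_disjoint[of c c'] c(1) c'(1) False unfolding disjnt_def by blast
 qed
 qed
 have fin: "finite ?J" unfolding state_joins_def oriented_joins_def using finite_over by (auto split: prod.splits)
 have JP: "\<Union>?J \<subseteq> ?PE" unfolding Union_state_joins passages_crossing_ends by blast
 obtain m' where m': "paired m' (?PE - \<Union>?J)" "splice (pairs partner ?PE) ?J = pairs m' (?PE - \<Union>?J)"
 "\<forall>x\<in>?PE - \<Union>?J. col (m' x) = flip (col x)"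
 using splice_pairs[OF fin paired_partner flip_flip colp J1 JP J2] by blast
 have so: "c \<in> over D" if "c \<in> \<sigma>" for c using \<sigma> that by blast
 note lpe = left_passage_eq[OF so so]
 have part: "partition_on (state_cusps D \<sigma>) ((%c. {in_cusp D c, out_cusp D c}) ` \<sigma>)"
 proof (rule partition_onI)
 show "\<Union>((%c. {in_cusp D c, out_cusp D c}) ` \<sigma>) = state_cusps D \<sigma>" by (auto simp: state_cusps_def)
 fix p q assume "p \<in> (%c. {in_cusp D c, out_cusp D c}) ` \<sigma>" "q \<in> (%c. {in_cusp D c, out_cusp D c}) ` \<sigma>" "p ~= q"
 then obtain c c' where "c \<in> \<sigma>" "c' \<in> \<sigma>" "p = {in_cusp D c, out_cusp D c}" "q = {in_cusp D c', out_cusp D c'}" "c ~= c'" by blast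
 then show "disjnt p q" using lpe(1)[of c c'] by (auto simp: disjnt_def in_cusp_def out_cusp_def)
 qed auto
 have "coherent col m' (?PE - \<Union>?J) (state_config D i \<sigma>)"
 unfolding coherent_def state_config_eq config.simps
 proof (intro conjI)
 show "finite (state_cusps D \<sigma>)" using finite_over \<sigma> finite_subset[of \<sigma> "over D"] by (auto simp: state_cusps_def)
 show "splice (strands D) ?J = pairs m' (?PE - \<Union>?J)" unfolding strands_pairs by (rule m'(2))
 show "inj_on fst (state_cusps D \<sigma>)"
 by (rule inj_onI) (elim state_cuspsE, simp)
 show "inj_on snd (state_cusps D \<sigma>)"
 by (rule inj_onI) (elim state_cuspsE, simp add: swap_eq_iff(1))
 show "fst ` state_cusps D \<sigma> \<inter> snd ` state_cusps D \<sigma> = {}"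
 proof (rule equals0I)
 fix a assume "a \<in> fst ` state_cusps D \<sigma> \<inter> snd ` state_cusps D \<sigma>"
 then obtain u v where uv: "u \<in> state_cusps D \<sigma>" "v \<in> state_cusps D \<sigma>" "fst u = snd v" by fastforce
 obtain c s where c: "c \<in> \<sigma>" "u = ((left_passage D c, s), (prod.swap (left_passage D c), s))" using uv(1) by (rule state_cuspsE)
 obtain c' s' where c': "c' \<in> \<sigma>" "v = ((left_passage D c', s'), (prod.swap (left_passage D c'), s'))" using uv(2) by (rule state_cuspsE)
 show False using uv(3) lpe(2)[OF c(1) c'(1)] unfolding c(2) c'(2) by simp
 qed
 show "inj (complement_boundary D i)"
 using left_passage_eq(2)[OF i i] by (auto simp: inj_def all_tangle_end complement_boundary_def)
 show "\<forall>(t, h)\<in>state_cusps D \<sigma>. fst (col t) = fst (col h) & snd (col t) = snd (col h) + (if fst (col t) then 1 else - 1)"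
 using ll[OF so] by (auto simp: state_cusps_def in_cusp_def out_cusp_def col_def node_of_def)
 show "\<exists>k. col (complement_boundary D i In_L) = (False, k + 1) & col (complement_boundary D i In_R) = (False, k) &
 col (complement_boundary D i Out_R) = (True, k) & col (complement_boundary D i Out_L) = (True, k + 1)"
 using ll[OF i] by (auto simp: complement_boundary_def col_def node_of_def)
 show "\<forall>s\<in>(%c. {in_cusp D c, out_cusp D c}) ` \<sigma>. even (card s)" by (auto simp: in_cusp_def out_cusp_def)
 qed (use m'(1,3) part state_ends[OF i \<sigma>] in auto)
 then show ?thesis by blast
qed

definition disoriented :: "nat \<times> nat => (nat \<times> nat) set => bool" where
 "disoriented i \<sigma> \<longleftrightarrow> (complement_boundary D i In_L, complement_boundary D i In_R) \<in>
 connected_by (strands D \<union> state_joins D i \<sigma> \<union> cusp_pairs (state_cusps D \<sigma>))"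

lemma reduce_state_config:
 assumes cl: "classical D" and i: "i \<in> over D" and \<sigma>: "\<sigma> \<subseteq> over D - {i}"
 shows "reduce (state_config D i \<sigma>) (X :: nat config) = (if config_iso (smoothing (disoriented i \<sigma>)) X then 1 else 0)"
 and "(complement_boundary D i a, complement_boundary D i b) \<in>
 connected_by (strands D \<union> state_joins D i \<sigma> \<union> cusp_pairs (state_cusps D \<sigma>)) \<longleftrightarrow>
 left_strand (disoriented i \<sigma>) a = left_strand (disoriented i \<sigma>) b"
proof -
 let ?S = "state_config D i \<sigma>" and ?b = "complement_boundary D i"
 obtain col m P where c: "coherent col m P ?S" using coherent_state_config[OF assms] by blast
 have U: "\<Union>(strands D) = passages D \<times> UNIV" unfolding strands_pairs by (rule Union_pairs[OF paired_partner])
 have bd: "boundary ?S = ?b" by (simp add: state_config_eq)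
 have j: "(?b a, ?b b) \<in> joined ?S \<longleftrightarrow>
 (?b a, ?b b) \<in> connected_by (strands D \<union> state_joins D i \<sigma> \<union> cusp_pairs (state_cusps D \<sigma>))" for a b
 unfolding joined_def state_config_eq config.simps
 by (rule connected_by_splice) (use state_ends(1)[OF i \<sigma>] U in auto)
 have "\<exists>d. (\<forall>a c. (?b a, ?b c) \<in> joined ?S \<longleftrightarrow> left_strand d a = left_strand d c) &
 (\<forall>X::nat config. reduce ?S X = (if config_iso (smoothing d) X then 1 else 0))"
 using reduce_steps_coherent[OF c order_refl] unfolding bd reduce_def .
 then obtain d where d0: "(\<forall>a c. (?b a, ?b c) \<in> joined ?S \<longleftrightarrow> left_strand d a = left_strand d c) &
 (\<forall>X::nat config. reduce ?S X = (if config_iso (smoothing d) X then 1 else 0))" by (rule exE)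
 note d = d0[THEN conjunct1, THEN spec, THEN spec] d0[THEN conjunct2, THEN spec]
 have "d = disoriented i \<sigma>" using d(1)[of In_L In_R] unfolding disoriented_def j[symmetric] by (auto simp: left_strand_def)
 then show "reduce ?S X = (if config_iso (smoothing (disoriented i \<sigma>)) X then 1 else 0)"
 "(?b a, ?b b) \<in> connected_by (strands D \<union> state_joins D i \<sigma> \<union> cusp_pairs (state_cusps D \<sigma>)) \<longleftrightarrow>
 left_strand (disoriented i \<sigma>) a = left_strand (disoriented i \<sigma>) b"
 using d unfolding j by simp_all
qed

text \<open>Each state reduces to exactly one of the two tangles, decided by
  \<open>disoriented\<close>. The coefficients of the expansion are therefore plain state
  sums.\<close>

definition coefficient :: "nat \<times> nat => bool => laurent" where
 "coefficient i d = (\<Sum>\<sigma>\<in>{\<sigma>\<in>Pow (over D - {i}). disoriented i \<sigma> = d}.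
 state_weight D i \<sigma> * loop_value ^ loop_count D i \<sigma>)"

lemma is_expansion_coefficient:
 assumes "classical D" "i \<in> over D"
 shows "is_expansion D i (coefficient i False) (coefficient i True)"
 unfolding is_expansion_def
proof
 fix X
 let ?P = "Pow (over D - {i})" and ?w = "\<lambda>\<sigma>. state_weight D i \<sigma> * loop_value ^ loop_count D i \<sigma>"
 have fin: "finite ?P" using finite_over by simp
 have s01: "scalar 0 = 0" "scalar 1 = 1" by (simp_all add: scalar_def)
 have "extended_bracket D i X = (\<Sum>\<sigma>\<in>?P. ?w \<sigma> * basis (smoothing (disoriented i \<sigma>)) X)"
 unfolding extended_bracket_def basis_def
 by (intro sum.cong refl) (simp add: reduce_state_config(1)[OF assms] s01)
 also have "\<dots> = (\<Sum>\<sigma>\<in>?P. (if disoriented i \<sigma> = False then ?w \<sigma> else 0) * basis oriented_smoothing X +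
 (if disoriented i \<sigma> = True then ?w \<sigma> else 0) * basis reverse_oriented_smoothing X)"
 by (intro sum.cong refl) (auto simp: smoothing_def)
 also have "\<dots> = coefficient i False * basis oriented_smoothing X + coefficient i True * basis reverse_oriented_smoothing X"
 unfolding coefficient_def sum.inter_filter[OF fin] sum_distrib_right sum.distrib ..
 finally show "extended_bracket D i X = coefficient i False * basis oriented_smoothing X + coefficient i True * basis reverse_oriented_smoothing X" .
qed

end

text \<open>The two tangles are not isomorphic, since only one of them has cusps. Evaluation at each
  of them reads off the coefficients.\<close>

lemma expansion_unique:
 assumes "is_expansion D i a b" "is_expansion D i a' b'"
 shows "a' = a & b' = b"
proof -
 let ?O = oriented_smoothing and ?R = reverse_oriented_smoothing
 have refl: "config_iso X X" for X :: "nat config"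
 unfolding config_iso_def by (intro exI[of _ id]) (simp add: map_prod.id)
 have "~ config_iso ?R ?O" "~ config_iso ?O ?R"
 unfolding config_iso_def by (simp_all add: oriented_smoothing_def reverse_oriented_smoothing_def)
 then have "basis ?O ?O = 1" "basis ?R ?O = 0" "basis ?O ?R = 0" "basis ?R ?R = 1"
 using refl by (simp_all add: basis_def)
 then show ?thesis
 using assms[unfolded is_expansion_def, THEN spec, of ?O] assms[unfolded is_expansion_def, THEN spec, of ?R] by simp
qed

section \<open>Counting the labellings of a state\<close>

lemma (in bracket_model) sum_colorings:
 assumes "finite V"
 shows "(\<Sum>\<phi>\<in>V \<rightarrow>\<^sub>E S. of_bool (\<forall>v\<in>V. \<forall>w\<in>V. cl v = cl w --> \<phi> v = \<phi> w) * f \<phi>) =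
 (\<Sum>\<psi>\<in>cl ` V \<rightarrow>\<^sub>E S. f (\<lambda>v\<in>V. \<psi> (cl v)) :: complex)"
proof -
 let ?P = "\<lambda>\<phi>. \<forall>v\<in>V. \<forall>w\<in>V. cl v = cl w --> \<phi> v = \<phi> w"
 have ob: "of_bool B * x = (if B then x else 0)" for B and x :: complex by simp
 have fin: "finite (V \<rightarrow>\<^sub>E S)" by (simp add: finite_PiE assms)
 have "(\<Sum>\<phi>\<in>V \<rightarrow>\<^sub>E S. of_bool (?P \<phi>) * f \<phi>) = (\<Sum>\<phi>\<in>{\<phi>\<in>V \<rightarrow>\<^sub>E S. ?P \<phi>}. f \<phi>)"
 by (simp only: sum.inter_filter[OF fin] ob)
 also have "\<dots> = (\<Sum>\<psi>\<in>cl ` V \<rightarrow>\<^sub>E S. f (\<lambda>v\<in>V. \<psi> (cl v)))"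
 proof (rule sum.reindex_bij_witness[where i="\<lambda>\<psi>. \<lambda>v\<in>V. \<psi> (cl v)" and j="\<lambda>\<phi>. \<lambda>c\<in>cl ` V. \<phi> (inv_into V cl c)"])
 fix \<phi> assume \<phi>: "\<phi> \<in> {\<phi>\<in>V \<rightarrow>\<^sub>E S. ?P \<phi>}"
 have inv: "inv_into V cl (cl v) \<in> V" "cl (inv_into V cl (cl v)) = cl v" if "v \<in> V" for v
 using inv_into_into[of "cl v" cl V] f_inv_into_f[of "cl v" cl V] that by simp_all
 show e: "(\<lambda>v\<in>V. (\<lambda>c\<in>cl ` V. \<phi> (inv_into V cl c)) (cl v)) = \<phi>"
 proof (rule extensionalityI[of _ V])
 show "\<phi> \<in> extensional V" using \<phi> by (auto simp: PiE_def)
 fix v assume v: "v \<in> V"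
 have "\<phi> (inv_into V cl (cl v)) = \<phi> v" using \<phi> inv[OF v] v by blast
 then show "(\<lambda>v\<in>V. (\<lambda>c\<in>cl ` V. \<phi> (inv_into V cl c)) (cl v)) v = \<phi> v" using v by simp
 qed simp
 show "(\<lambda>c\<in>cl ` V. \<phi> (inv_into V cl c)) \<in> cl ` V \<rightarrow>\<^sub>E S" using \<phi> inv(1) by (auto simp: PiE_def Pi_def)
 show "f (\<lambda>v\<in>V. (\<lambda>c\<in>cl ` V. \<phi> (inv_into V cl c)) (cl v)) = f \<phi>" unfolding e ..
 next
 fix \<psi> assume \<psi>: "\<psi> \<in> cl ` V \<rightarrow>\<^sub>E S"
 show "(\<lambda>v\<in>V. \<psi> (cl v)) \<in> {\<phi>\<in>V \<rightarrow>\<^sub>E S. ?P \<phi>}" using \<psi> by auto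
 show "(\<lambda>c\<in>cl ` V. (\<lambda>v\<in>V. \<psi> (cl v)) (inv_into V cl c)) = \<psi>"
 proof (rule extensionalityI[of _ "cl ` V"])
 show "\<psi> \<in> extensional (cl ` V)" using \<psi> by (auto simp: PiE_def)
 fix c assume c: "c \<in> cl ` V"
 then show "(\<lambda>c\<in>cl ` V. (\<lambda>v\<in>V. \<psi> (cl v)) (inv_into V cl c)) c = \<psi> c"
 using inv_into_into[OF c] f_inv_into_f[OF c] by simp
 qed simp
 qed
 finally show ?thesis .
qed

text \<open>The classes other than \<open>c0\<close> and \<open>c1\<close> are free and contribute a
  factor \<open>N\<close> each. The auxiliary \<open>F\<close> is a Kronecker delta at the two
  distinguished classes and 1 elsewhere, which makes the sum a sum of products over all
  classes.\<close>

lemma (in bracket_model) sum_two_values: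
 assumes I: "finite I" "c0 \<in> I" "c1 \<in> I" "c0 ~= c1"
 shows "(\<Sum>\<psi>\<in>I \<rightarrow>\<^sub>E S. q (\<psi> c0) (\<psi> c1)) = of_int N ^ card (I - {c0, c1}) * (\<Sum>x\<in>S. \<Sum>y\<in>S. q x y :: complex)"
proof -
 define F where "F x y c z = (if c = c0 then of_bool (z = x) else if c = c1 then of_bool (z = y) else (1::complex))" for x y c and z :: int
 define R where "R = I - {c0, c1}"
 have IR: "I = insert c0 (insert c1 R)" "c0 \<notin> insert c1 R" "c1 \<notin> R" "finite R" using I by (auto simp: R_def)
 have F1: "(\<Prod>c\<in>R. g (F x y c)) = (\<Prod>c\<in>R. g (%_. 1))" for g :: "(int => complex) => complex" and x y
 by (intro prod.cong refl arg_cong[of _ _ g]) (auto simp: F_def R_def)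
 have P: "(\<Prod>c\<in>I. F x y c (\<psi> c)) = of_bool (\<psi> c0 = x) * of_bool (\<psi> c1 = y)" for x y \<psi>
 proof -
 have "(\<Prod>c\<in>R. F x y c (\<psi> c)) = 1" by (intro prod.neutral) (auto simp: F_def R_def)
 then show ?thesis unfolding IR(1) using IR(2-4) I(4) by (simp add: F_def)
 qed
 have Q: "(\<Prod>c\<in>I. \<Sum>z\<in>S. F x y c z) = of_int N ^ card R" if "x \<in> S" "y \<in> S" for x y
 proof -
 have "(\<Sum>z\<in>S. F x y c0 z) = 1" by (subst sum_at[of x]) (use that in \<open>auto simp: F_def\<close>)
 moreover have "(\<Sum>z\<in>S. F x y c1 z) = 1" by (subst sum_at[of y]) (use that I(4) in \<open>auto simp: F_def\<close>)
 ultimately show ?thesis unfolding IR(1) using IR(2-4) F1[of "%h. \<Sum>z\<in>S. h z" x y] by (simp add: card_S)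
 qed
 have "q (\<psi> c0) (\<psi> c1) = (\<Sum>x\<in>S. \<Sum>y\<in>S. q x y * (\<Prod>c\<in>I. F x y c (\<psi> c)))" if "\<psi> \<in> I \<rightarrow>\<^sub>E S" for \<psi>
 proof -
 have s: "\<psi> c0 \<in> S" "\<psi> c1 \<in> S" using that I by auto
 have "(\<Sum>x\<in>S. \<Sum>y\<in>S. q x y * (\<Prod>c\<in>I. F x y c (\<psi> c))) = (\<Sum>y\<in>S. q (\<psi> c0) y * (\<Prod>c\<in>I. F (\<psi> c0) y c (\<psi> c)))"
 unfolding P by (rule sum_at[OF s(1)]) simp
 also have "\<dots> = q (\<psi> c0) (\<psi> c1)" unfolding P by (subst sum_at[OF s(2)]) simp_all
 finally show ?thesis by simp
 qed
 then have "(\<Sum>\<psi>\<in>I \<rightarrow>\<^sub>E S. q (\<psi> c0) (\<psi> c1)) = (\<Sum>\<psi>\<in>I \<rightarrow>\<^sub>E S. \<Sum>x\<in>S. \<Sum>y\<in>S. q x y * (\<Prod>c\<in>I. F x y c (\<psi> c)))"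
 by (rule sum.cong[OF refl])
 also have "\<dots> = (\<Sum>x\<in>S. \<Sum>y\<in>S. \<Sum>\<psi>\<in>I \<rightarrow>\<^sub>E S. q x y * (\<Prod>c\<in>I. F x y c (\<psi> c)))"
 by (subst sum.swap) (intro sum.cong refl sum.swap)
 also have "\<dots> = (\<Sum>x\<in>S. \<Sum>y\<in>S. q x y * of_int N ^ card R)"
 unfolding sum_distrib_left[symmetric] prod_sum_PiE[OF I(1) finite_S, symmetric]
 by (intro sum.cong refl) (simp add: Q)
 finally show ?thesis by (simp add: R_def sum_distrib_left sum_distrib_right mult_ac)
qed

lemma connected_by_class: "connected_by L `` {a} = connected_by L `` {b} \<longleftrightarrow> (a, b) \<in> connected_by L"
proof
 assume "connected_by L `` {a} = connected_by L `` {b}"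
 then have "b \<in> connected_by L `` {a}" by simp
 then show "(a, b) \<in> connected_by L" by simp
next
 assume "(a, b) \<in> connected_by L"
 from connected_by_trans[OF this] connected_by_trans[OF connected_by_sym[OF this]]
 show "connected_by L `` {a} = connected_by L `` {b}" by auto
qed

context diagram
begin

text \<open>From such a node no classical passage is ever met; these are the vertices of the
  components without classical crossings.\<close>

definition stuck :: "nat \<times> real => bool" where
 "stuck v \<longleftrightarrow> v \<in> nodes D & (\<forall>n Q. ~ reaches n v Q)"

lemma stuck_step:
 assumes "stuck v"
 shows "snd v = 0" "fst v \<notin> fst ` passages D" "sc v = (nxt D (fst v), 0)" "stuck (sc v)" "v \<notin> stops"
proof -
 have v: "v \<in> nodes D" and nr: "\<And>n Q. ~ reaches n v Q" using assms by (auto simp: stuck_def)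
 show ns: "v \<notin> stops" using reaches_exists[of 0 v] nr by auto
 show "stuck (sc v)" unfolding stuck_def using sc_in[OF v] nr[of "Suc _"] ns by (auto simp: reaches_Suc)
 have trivial: "snd w = 0" if "w \<in> nodes D" "w \<notin> stops" for w using that by (auto simp: nodes_def stops_def)
 show 0: "snd v = 0" by (rule trivial[OF v ns])
 have ns': "sc v \<notin> stops" using reaches_exists[of 1 v] nr by auto
 have "~ snd v < snd (sc v)" using trivial[OF sc_in[OF v] ns'] 0 by simp
 then have c: "sc v = (nxt D (fst v), 0)" "\<And>s. (fst v, s) \<in> nodes D ==> s <= snd v"
 using sc_cases[of v] by metis+
 show "sc v = (nxt D (fst v), 0)" by (rule c(1))
 show "fst v \<notin> fst ` passages D"
 proof
 assume "fst v \<in> fst ` passages D"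
 then obtain P where P: "P \<in> passages D" "fst v = fst P" by blast
 then show False using c(2)[of "param D P"] passage_param(1,3)[OF P(1)] 0 by simp
 qed
qed

lemma stuck_funpow:
 assumes "stuck v"
 shows "stuck ((sc ^^ n) v) & (sc ^^ n) v = ((nxt D ^^ n) (fst v), 0)"
proof (induction n)
 case 0
 then show ?case using assms stuck_step(1)[OF assms] by (simp add: prod_eq_iff)
next
 case (Suc n)
 have "stuck (sc ((sc ^^ n) v))" "sc ((sc ^^ n) v) = (nxt D ((nxt D ^^ n) (fst v)), 0)"
 using stuck_step(3,4)[of "(sc ^^ n) v"] Suc by (metis fst_conv)+
 then show ?case by simp
qed

definition orbit :: "nat => nat set" where
 "orbit e = range (%k. (nxt D ^^ k) e)"

lemma orbit_nxt:
 assumes "stuck v"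
 shows "orbit (nxt D (fst v)) = orbit (fst v)"
proof -
 have v: "v \<in> nodes D" using assms by (simp add: stuck_def)
 obtain d where d: "(sc ^^ d) (sc v) = v" using sc_periodic[OF v] by blast
 have e: "fst v = (nxt D ^^ d) (nxt D (fst v))"
 using stuck_funpow[OF stuck_step(4)[OF assms], of d] d stuck_step(3)[OF assms] by (metis fst_conv)
 have S: "(nxt D ^^ k) (nxt D (fst v)) = (nxt D ^^ Suc k) (fst v)" for k by (simp only: funpow_Suc_right comp_apply)
 have "(nxt D ^^ k) (fst v) = (nxt D ^^ (k + d)) (nxt D (fst v))" for k
 unfolding funpow_add comp_apply e[symmetric] ..
 then show ?thesis unfolding orbit_def using S by (intro equalityI image_subsetI) (metis rangeI)+
qed

definition curve_edges :: "nat \<times> nat => (nat \<times> nat) set => strand_end set set" where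
 "curve_edges i \<sigma> = strands D \<union> state_joins D i \<sigma> \<union> cusp_pairs (state_cusps D \<sigma>)"

text \<open>The curve of the state that determines the label at \<open>v\<close>: the class of the
  next passage under the connections of the state, or a free circle, given by its edges.\<close>

definition curve_of :: "nat \<times> nat => (nat \<times> nat) set => nat \<times> real => strand_end set + nat set" where
 "curve_of i \<sigma> v = (if stuck v then Inr (orbit (fst v))
 else Inl (connected_by (curve_edges i \<sigma>) `` {(SOME Q. \<exists>n. reaches n v Q, Incoming)}))"

lemma curve_of_reaches:
 assumes "v \<in> nodes D" "reaches n v Q"
 shows "curve_of i \<sigma> v = Inl (connected_by (curve_edges i \<sigma>) `` {(Q, Incoming)})"
proof -
 have "\<exists>n. reaches n v (SOME Q. \<exists>n. reaches n v Q)" by (rule someI[of "%Q. \<exists>n. reaches n v Q" Q]) (rule exI[of _ n], rule assms(2))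
 then have "(SOME Q. \<exists>n. reaches n v Q) = Q" using reaches_unique[OF _ assms(2,1)] by blast
 moreover have "~ stuck v" using assms unfolding stuck_def by blast
 ultimately show ?thesis by (simp add: curve_of_def)
qed

lemma curve_of_node:
 assumes "a \<in> passages D \<times> UNIV"
 shows "curve_of i \<sigma> (node_of a) = Inl (connected_by (curve_edges i \<sigma>) `` {a})"
proof (cases "snd a")
 case Incoming
 have P: "fst a \<in> passages D" using assms by auto
 have r: "reaches 0 (pos D (fst a)) (fst a)" using P by (simp add: reaches_def)
 have "node_of a = pos D (fst a)" "(fst a, Incoming) = a" using Incoming by (simp_all add: node_of_def prod_eq_iff)
 then show ?thesis using curve_of_reaches[OF pos_node[OF P] r, of i \<sigma>] by simp
next
 case Outgoing
 have P: "fst a \<in> passages D" using assms by auto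
 obtain n where "reaches n (sc (pos D (fst a))) (after (fst a))" using reaches_after[OF P] by blast
 from curve_of_reaches[OF sc_in[OF pos_node[OF P]] this]
 have 1: "curve_of i \<sigma> (node_of a) = Inl (connected_by (curve_edges i \<sigma>) `` {partner a})"
 using Outgoing by (simp add: node_of_def partner_def)
 have "{a, partner a} \<in> strands D" unfolding strands_pairs mem_pairs[OF paired_partner] using assms by simp
 then have "(a, partner a) \<in> connected_by (curve_edges i \<sigma>)" unfolding curve_edges_def by (intro connected_by_edge) simp
 then show ?thesis unfolding 1 using connected_by_class[of "curve_edges i \<sigma>" a "partner a"] by simp
qed

lemma curve_of_sc:
 assumes v: "v \<in> nodes D - stops"
 shows "curve_of i \<sigma> (sc v) = curve_of i \<sigma> v"
proof (cases "stuck v")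
 case True
 then show ?thesis using stuck_step(3,4)[OF True] orbit_nxt[OF True] by (simp add: curve_of_def)
next
 case False
 then obtain n Q where "reaches n v Q" using v by (auto simp: stuck_def)
 moreover from this obtain k where "n = Suc k" using v by (cases n) (auto simp: reaches_def stops_def)
 ultimately show ?thesis using curve_of_reaches[of v n Q] curve_of_reaches[of "sc v" k Q] v sc_in[of v]
 by (simp add: reaches_Suc)
qed

text \<open>The labellings that contribute to the state \<open>\<sigma>\<close> at
  \<open>t = 0\<close>: every transmitting node and every smoothing passes the label on without
  shift.\<close>

definition consistent :: "nat \<times> nat => (nat \<times> nat) set => (nat \<times> real => int) => bool" where
 "consistent i \<sigma> \<phi> \<longleftrightarrow> (\<forall>v\<in>nodes D - stops. \<phi> v = \<phi> (sc v)) &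
 (\<forall>a b. {a, b} \<in> state_joins D i \<sigma> \<union> cusp_pairs (state_cusps D \<sigma>) --> \<phi> (node_of a) = \<phi> (node_of b))"

text \<open>Consistent labellings are the same as functions on the curves of the state. This turns
  sums over labellings into powers of \<open>N\<close>.\<close>

lemma consistent_iff:
 assumes i: "i \<in> over D" and \<sigma>: "\<sigma> \<subseteq> over D - {i}"
 shows "consistent i \<sigma> \<phi> \<longleftrightarrow> (\<forall>v\<in>nodes D. \<forall>w\<in>nodes D. curve_of i \<sigma> v = curve_of i \<sigma> w --> \<phi> v = \<phi> w)"
proof
 assume c: "consistent i \<sigma> \<phi>"
 have t: "\<phi> (sc v) = \<phi> v" if "v \<in> nodes D - stops" for v using c that by (simp add: consistent_def)
 have conn: "\<phi> (node_of b) = \<phi> (node_of a)" if "(a, b) \<in> connected_by (curve_edges i \<sigma>)" for a b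
 using that
 proof (induction rule: connected_by_induct)
 case (step y z)
 from step(2) have "{y, z} \<in> strands D \<or> {y, z} \<in> state_joins D i \<sigma> \<union> cusp_pairs (state_cusps D \<sigma>)"
 unfolding curve_edges_def by blast
 then have "\<phi> (node_of z) = \<phi> (node_of y)"
 proof
 assume "{y, z} \<in> strands D"
 then have y: "y \<in> passages D \<times> UNIV" "z = partner y" unfolding strands_pairs mem_pairs[OF paired_partner] by blast+
 show ?thesis unfolding y(2) by (rule node_of_partner[where f=\<phi>, OF y(1)]) (rule t)
 qed (use c[unfolded consistent_def] in metis)
 then show ?case using step(3) by simp
 qed simp
 show "\<forall>v\<in>nodes D. \<forall>w\<in>nodes D. curve_of i \<sigma> v = curve_of i \<sigma> w --> \<phi> v = \<phi> w"
 proof (intro ballI impI)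
 fix v w assume vw: "v \<in> nodes D" "w \<in> nodes D" "curve_of i \<sigma> v = curve_of i \<sigma> w"
 show "\<phi> v = \<phi> w"
 proof (cases "stuck v")
 case True
 then have w: "stuck w" "orbit (fst v) = orbit (fst w)" using vw(3) by (auto simp: curve_of_def split: if_splits)
 have "fst w \<in> orbit (fst w)" unfolding orbit_def by (rule range_eqI[of _ _ 0]) simp
 then have "fst w \<in> orbit (fst v)" using w(2) by simp
 then obtain k where "fst w = (nxt D ^^ k) (fst v)" unfolding orbit_def by blast
 then have wk: "w = (sc ^^ k) v" using stuck_funpow[OF True, of k] stuck_step(1)[OF w(1)] by (simp add: prod_eq_iff)
 have "\<phi> ((sc ^^ j) v) = \<phi> v" for j
 proof (induction j)
 case (Suc j)
 have "stuck ((sc ^^ j) v)" by (rule conjunct1[OF stuck_funpow[OF True]])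
 then have "(sc ^^ j) v \<in> nodes D - stops" using stuck_step(5) by (auto simp: stuck_def)
 then show ?case using t[of "(sc ^^ j) v"] Suc by simp
 qed simp
 then show ?thesis unfolding wk by simp
 next
 case False
 then have nw: "~ stuck w" using vw(3) by (auto simp: curve_of_def split: if_splits)
 obtain n Q where Q: "reaches n v Q" using False vw(1) by (auto simp: stuck_def)
 obtain n' Q' where Q': "reaches n' w Q'" using nw vw(2) by (auto simp: stuck_def)
 have "((Q, Incoming), (Q', Incoming)) \<in> connected_by (curve_edges i \<sigma>)"
 using vw(3) unfolding curve_of_reaches[OF vw(1) Q] curve_of_reaches[OF vw(2) Q'] by (simp add: connected_by_class)
 from conn[OF this] have "\<phi> (pos D Q') = \<phi> (pos D Q)" by (simp add: node_of_def)
 then show ?thesis using reaches_const[OF Q vw(1), of \<phi>] reaches_const[OF Q' vw(2), of \<phi>] t by simp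
 qed
 qed
next
 assume c: "\<forall>v\<in>nodes D. \<forall>w\<in>nodes D. curve_of i \<sigma> v = curve_of i \<sigma> w --> \<phi> v = \<phi> w"
 show "consistent i \<sigma> \<phi>"
 unfolding consistent_def
 proof (intro conjI ballI allI impI)
 show "\<phi> v = \<phi> (sc v)" if v: "v \<in> nodes D - stops" for v
 proof -
 have n: "v \<in> nodes D" using v by simp
 show ?thesis
 by (rule c[THEN bspec, OF n, THEN bspec, OF sc_in[OF n], THEN mp, OF curve_of_sc[OF v, symmetric]])
 qed
 fix a b assume e: "{a, b} \<in> state_joins D i \<sigma> \<union> cusp_pairs (state_cusps D \<sigma>)"
 have "\<Union>(state_joins D i \<sigma>) \<union> \<Union>(cusp_pairs (state_cusps D \<sigma>)) \<subseteq> passages D \<times> UNIV"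
 unfolding Union_state_joins Union_state_cusps passages_crossing_ends
 by (intro Un_least Union_mono image_mono) (use \<sigma> in auto)
 then have sub: "\<Union>(state_joins D i \<sigma> \<union> cusp_pairs (state_cusps D \<sigma>)) \<subseteq> passages D \<times> UNIV"
 unfolding Union_Un_distrib .
 have ab: "a \<in> passages D \<times> UNIV" "b \<in> passages D \<times> UNIV"
 by (rule subsetD[OF sub UnionI[OF e]], simp)+
 have "{a, b} \<in> strands D \<union> (state_joins D i \<sigma> \<union> cusp_pairs (state_cusps D \<sigma>))" by (rule UnI2[OF e])
 then have "(a, b) \<in> connected_by (curve_edges i \<sigma>)" unfolding curve_edges_def Un_assoc by (rule connected_by_edge)
 then have "curve_of i \<sigma> (node_of a) = curve_of i \<sigma> (node_of b)"
 unfolding curve_of_node[OF ab(1)] curve_of_node[OF ab(2)] by (simp add: connected_by_class)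
 then show "\<phi> (node_of a) = \<phi> (node_of b)"
 by (rule c[THEN bspec, OF node_of_in[OF ab(1)], THEN bspec, OF node_of_in[OF ab(2)], THEN mp])
 qed
qed

lemma state_curves_eq: "state_curves D i \<sigma> = (passages D \<times> UNIV) // connected_by (curve_edges i \<sigma>)"
 by (simp add: state_curves_def curve_edges_def state_joins_def cusp_pairs_def state_cusps_def)

lemma curve_of_image: "curve_of i \<sigma> ` nodes D = Inl ` state_curves D i \<sigma> \<union> Inr ` free_circles D"
proof (intro equalityI subsetI)
 fix c assume "c \<in> curve_of i \<sigma> ` nodes D"
 then obtain v where v: "v \<in> nodes D" "c = curve_of i \<sigma> v" by blast
 show "c \<in> Inl ` state_curves D i \<sigma> \<union> Inr ` free_circles D"
 proof (cases "stuck v")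
 case True
 have "(nxt D ^^ k) (fst v) \<notin> fst ` passages D" for k
 using stuck_step(2)[OF conjunct1[OF stuck_funpow[OF True, of k]]] stuck_funpow[OF True, of k] by simp
 then have "orbit (fst v) \<inter> fst ` passages D = {}" unfolding orbit_def by blast
 then have "orbit (fst v) \<in> free_circles D" unfolding free_circles_def orbit_def using node_range[OF v(1)] by blast
 then show ?thesis using v True by (simp add: curve_of_def)
 next
 case False
 then obtain n Q where Q: "reaches n v Q" using v by (auto simp: stuck_def)
 then have "(Q, Incoming) \<in> passages D \<times> UNIV" by (simp add: reaches_def)
 then show ?thesis unfolding v(2) curve_of_reaches[OF v(1) Q] state_curves_eq by (blast intro: quotientI)
 qed
next
 fix c assume "c \<in> Inl ` state_curves D i \<sigma> \<union> Inr ` free_circles D"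
 then show "c \<in> curve_of i \<sigma> ` nodes D"
 proof
 assume "c \<in> Inl ` state_curves D i \<sigma>"
 then obtain a where a: "a \<in> passages D \<times> UNIV" "c = Inl (connected_by (curve_edges i \<sigma>) `` {a})"
 unfolding state_curves_eq by (auto elim!: quotientE)
 then show ?thesis using curve_of_node[OF a(1), of i \<sigma>] node_of_in[OF a(1)] by (metis image_eqI)
 next
 assume "c \<in> Inr ` free_circles D"
 then obtain e where e: "e \<in> edges D" "c = Inr (orbit e)" "orbit e \<inter> fst ` passages D = {}"
 unfolding free_circles_def orbit_def by blast
 have no: "(nxt D ^^ k) e \<notin> fst ` passages D" for k using e(3) unfolding orbit_def by blast
 have n: "(e, 0) \<in> nodes D" using e(1) by (simp add: nodes_def)
 have ns: "(f, 0) \<notin> stops" for f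
 proof
 assume "(f, 0) \<in> stops"
 then obtain P where "P \<in> passages D" "(f, 0) = pos D P" unfolding stops_def by blast
 then show False using passage_param(1)[of P] by (simp add: pos_def)
 qed
 have step: "sc (f, 0) = (nxt D f, 0)" if f: "(f, 0) \<in> nodes D" "f \<notin> fst ` passages D" for f
 proof (cases rule: sc_cases[of "(f, 0)"])
 case 1
 have "sc (f, 0) \<in> nodes D" by (rule sc_in[OF f(1)])
 then obtain P where "P \<in> passages D" "sc (f, 0) = pos D P" using 1(2) unfolding nodes_def by auto
 then have "fst P = f" using 1(1) by (simp add: pos_def)
 then show ?thesis using f(2) \<open>P \<in> passages D\<close> by blast
 qed simp
 have k: "(sc ^^ k) (e, 0) = ((nxt D ^^ k) e, 0)" for k
 proof (induction k)
 case (Suc k)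
 have "((nxt D ^^ k) e, 0) \<in> nodes D" using funpow_sc_in[OF n, of k] unfolding Suc .
 from step[OF this no] show ?case using Suc by simp
 qed simp
 have "stuck (e, 0)" unfolding stuck_def
 proof (intro conjI allI n notI)
 fix m Q assume "reaches m (e, 0) Q"
 then have "(sc ^^ m) (e, 0) \<in> stops" unfolding reaches_def stops_def by blast
 then show False using ns unfolding k by blast
 qed
 then have "curve_of i \<sigma> (e, 0) = c" by (simp add: curve_of_def e(2))
 then show ?thesis using n by blast
 qed
qed

end

text \<open>Every closed curve has a free label and counts \<open>N\<close>. The two strands of the
  tangle carry labels \<open>x\<close> and \<open>y\<close>, distributed over the four ends
  according to \<open>disoriented\<close>.\<close>

lemma (in bracket_model) sum_consistent:
 assumes D: "vdiagram D" and cl: "classical D" and i: "i \<in> over D" and \<sigma>: "\<sigma> \<subseteq> over D - {i}"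
 and b: "\<And>t. nd t = diagram.node_of D (complement_boundary D i t)"
 shows "(\<Sum>\<phi>\<in>nodes D \<rightarrow>\<^sub>E S. of_bool (diagram.consistent D i \<sigma> \<phi>) * f (\<phi> (nd In_L)) (\<phi> (nd In_R)) (\<phi> (nd Out_R)) (\<phi> (nd Out_L))) =
 of_int N ^ loop_count D i \<sigma> * (\<Sum>x\<in>S. \<Sum>y\<in>S. if diagram.disoriented D i \<sigma> then f x x y y else f x y y x :: complex)"
proof -
 interpret diagram D by (rule diagramI[OF D])
 let ?cl = "curve_of i \<sigma>" and ?b = "complement_boundary D i" and ?d = "disoriented i \<sigma>"
 let ?C = "connected_by (curve_edges i \<sigma>)"
 have bP: "?b t \<in> passages D \<times> UNIV" for t
 using range_complement_boundary[of D i] i unfolding passages_crossing_ends by blast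
 define c where "c t = ?cl (nd t)" for t
 have c: "c t = Inl (?C `` {?b t})" for t unfolding c_def b by (rule curve_of_node[OF bP])
 have ceq: "c s = c t \<longleftrightarrow> left_strand ?d s = left_strand ?d t" for s t
 using reduce_state_config(2)[OF cl i \<sigma>, of s t] unfolding c curve_edges_def[symmetric] by (simp add: connected_by_class)
 have nd: "nd t \<in> nodes D" for t unfolding b by (rule node_of_in[OF bP])
 let ?I = "?cl ` nodes D"
 have cI: "c t \<in> ?I" for t unfolding c_def using nd by blast
 let ?c1 = "c Out_R"
 have ne: "c In_L ~= ?c1" unfolding ceq by (simp add: left_strand_def)
 \<comment> \<open>The curves through the boundary are exactly the two classes \<open>c In_L\<close>
   and \<open>c Out_R\<close>; all others are the loops and free circles counted by
   \<open>loop_count\<close>.\<close>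
 have loop: "card (?I - {c In_L, ?c1}) = loop_count D i \<sigma>"
 proof -
 have two: "c t = c In_L \<or> c t = ?c1" for t unfolding ceq by (auto simp: left_strand_def)
 have meets: "Inl K \<in> {c In_L, ?c1} \<longleftrightarrow> K \<inter> range ?b ~= {}" if K: "K \<in> state_curves D i \<sigma>" for K
 proof -
 obtain a where a: "K = ?C `` {a}" using K unfolding state_curves_eq by (auto elim!: quotientE)
 have "?b t \<in> K \<longleftrightarrow> Inl K = c t" for t unfolding c a by (simp add: connected_by_class)
 then have "K \<inter> range ?b ~= {} \<longleftrightarrow> (\<exists>t. Inl K = c t)" by blast
 moreover have "(\<exists>t. Inl K = c t) \<longleftrightarrow> Inl K \<in> {c In_L, ?c1}"
 proof
 assume "\<exists>t. Inl K = c t"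
 then obtain t where t: "Inl K = c t" by (rule exE)
 show "Inl K \<in> {c In_L, ?c1}" using two[of t] unfolding t by simp
 next
 assume "Inl K \<in> {c In_L, ?c1}"
 then show "\<exists>t. Inl K = c t" by blast
 qed
 ultimately show ?thesis by simp
 qed
 have nInr: "Inr C \<notin> {c In_L, ?c1}" for C by (simp add: c)
 have eqI: "?I - {c In_L, ?c1} = Inl ` {K \<in> state_curves D i \<sigma>. K \<inter> range ?b = {}} \<union> Inr ` free_circles D"
 unfolding curve_of_image
 proof (intro set_eqI iffI)
 fix z assume z: "z \<in> Inl ` state_curves D i \<sigma> \<union> Inr ` free_circles D - {c In_L, ?c1}"
 then consider K where "K \<in> state_curves D i \<sigma>" "z = Inl K" | C where "C \<in> free_circles D" "z = Inr C" by blast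
 then show "z \<in> Inl ` {K \<in> state_curves D i \<sigma>. K \<inter> range ?b = {}} \<union> Inr ` free_circles D"
 proof cases
 case (1 K)
 then have "Inl K \<notin> {c In_L, ?c1}" using z by blast
 then have "K \<inter> range ?b = {}" using meets[OF 1(1)] by blast
 then show ?thesis using 1 by blast
 qed blast
 next
 fix z assume "z \<in> Inl ` {K \<in> state_curves D i \<sigma>. K \<inter> range ?b = {}} \<union> Inr ` free_circles D"
 then consider K where "K \<in> state_curves D i \<sigma>" "K \<inter> range ?b = {}" "z = Inl K" | C where "C \<in> free_circles D" "z = Inr C" by blast
 then show "z \<in> Inl ` state_curves D i \<sigma> \<union> Inr ` free_circles D - {c In_L, ?c1}"
 proof cases
 case (1 K)
 then have n: "Inl K \<notin> {c In_L, ?c1}" using meets[OF 1(1)] by blast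
 show ?thesis unfolding 1(3) by (rule DiffI[OF UnI1[OF imageI[where f=Inl, OF 1(1)]] n])
 next
 case (2 C)
 show ?thesis unfolding 2(2) by (rule DiffI[OF UnI2[OF imageI[where f=Inr, OF 2(1)]] nInr])
 qed
 qed
 let ?X = "{K \<in> state_curves D i \<sigma>. K \<inter> range ?b = {}}" and ?F = "free_circles D"
 have fU: "finite (Inl ` state_curves D i \<sigma> \<union> Inr ` ?F)"
 using finite_imageI[OF finite_nodes, of ?cl] unfolding curve_of_image .
 have f1: "finite (state_curves D i \<sigma>)"
 by (rule finite_imageD[OF finite_subset[OF Un_upper1 fU]]) (simp add: inj_on_def)
 have f2: "finite ?F" by (rule finite_imageD[OF finite_subset[OF Un_upper2 fU]]) (simp add: inj_on_def)
 have f3: "finite ?X" by (rule finite_subset[OF _ f1]) blast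
 show ?thesis using card_Plus[OF f3 f2] unfolding eqI loop_count_def Plus_def .
 qed
 define g where "g x y = (if ?d then f x x y y else f x y y x)" for x y
 have "(\<Sum>\<phi>\<in>nodes D \<rightarrow>\<^sub>E S. of_bool (consistent i \<sigma> \<phi>) * f (\<phi> (nd In_L)) (\<phi> (nd In_R)) (\<phi> (nd Out_R)) (\<phi> (nd Out_L))) =
 (\<Sum>\<psi>\<in>?I \<rightarrow>\<^sub>E S. f (\<psi> (c In_L)) (\<psi> (c In_R)) (\<psi> (c Out_R)) (\<psi> (c Out_L)))"
 unfolding consistent_iff[OF i \<sigma>] sum_colorings[OF finite_nodes] using nd by (simp add: c_def)
 also have "\<dots> = (\<Sum>\<psi>\<in>?I \<rightarrow>\<^sub>E S. g (\<psi> (c In_L)) (\<psi> ?c1))"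
 proof (intro sum.cong refl)
 fix \<psi>
 have "?d ==> c In_R = c In_L & c Out_L = ?c1" "~ ?d ==> c In_R = ?c1 & c Out_L = c In_L"
 unfolding ceq by (simp_all add: left_strand_def)
 then show "f (\<psi> (c In_L)) (\<psi> (c In_R)) (\<psi> (c Out_R)) (\<psi> (c Out_L)) = g (\<psi> (c In_L)) (\<psi> ?c1)"
 by (cases ?d) (simp_all add: g_def)
 qed
 also have "\<dots> = of_int N ^ loop_count D i \<sigma> * (\<Sum>x\<in>S. \<Sum>y\<in>S. g x y)"
 unfolding loop[symmetric] by (rule sum_two_values[OF _ cI cI ne]) (simp add: finite_nodes)
 finally show ?thesis unfolding g_def .
qed

section \<open>Evaluation of Laurent polynomials, and the state sum with one crossing left
  out\<close>

lemma prod_of_bool: "finite X ==> (\<Prod>a\<in>X. of_bool (P a)) = (of_bool (\<forall>a\<in>X. P a) :: complex)"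
 by (induction X rule: finite_induct) auto

context bracket_model
begin

text \<open>Substitution of the number \<open>A\<close> for the variable: a ring homomorphism that
  sends \<open>loop_value\<close> to \<open>N\<close>.\<close>

definition ev :: "laurent => complex" where
 "ev p = (\<Sum>k\<in>Poly_Mapping.keys p. of_rat (Poly_Mapping.lookup p k) * A powi k)"

lemma ev_superset:
 assumes "finite F" "Poly_Mapping.keys p \<subseteq> F"
 shows "ev p = (\<Sum>k\<in>F. of_rat (Poly_Mapping.lookup p k) * A powi k)"
 unfolding ev_def by (rule sum.mono_neutral_left) (use assms in \<open>auto simp: in_keys_iff\<close>)

lemma ev_0 [simp]: "ev 0 = 0"
 by (simp add: ev_def)

lemma ev_add: "ev (p + q) = ev p + ev q"
proof -
 let ?F = "Poly_Mapping.keys p \<union> Poly_Mapping.keys q"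
 have "ev (p + q) = (\<Sum>k\<in>?F. of_rat (Poly_Mapping.lookup (p + q) k) * A powi k)"
 by (rule ev_superset) (use Poly_Mapping.keys_add[of p q] in auto)
 also have "\<dots> = (\<Sum>k\<in>?F. of_rat (Poly_Mapping.lookup p k) * A powi k) + (\<Sum>k\<in>?F. of_rat (Poly_Mapping.lookup q k) * A powi k)"
 unfolding sum.distrib[symmetric] by (intro sum.cong refl) (simp add: lookup_add of_rat_add ring_distribs)
 also have "\<dots> = ev p + ev q" by (subst (1 2) ev_superset[of ?F]) auto
 finally show ?thesis .
qed

lemma ev_single: "ev (Poly_Mapping.single k r) = of_rat r * A powi k"
 by (cases "r = 0") (simp_all add: ev_def)

lemma ev_sum: "ev (\<Sum>x\<in>F. g x) = (\<Sum>x\<in>F. ev (g x))"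
 by (induction F rule: infinite_finite_induct) (simp_all add: ev_add)

lemma ev_mult: "ev (p * q) = ev p * ev q"
proof -
 have e: "ev p = (\<Sum>k\<in>Poly_Mapping.keys p. ev (Poly_Mapping.single k (Poly_Mapping.lookup p k)))" for p
 by (simp add: ev_single) (simp add: ev_def)
 have s: "(\<Sum>k\<in>Poly_Mapping.keys p. Poly_Mapping.single k (Poly_Mapping.lookup p k)) = p" for p :: laurent
 by (rule poly_mapping_eqI) (simp add: lookup_sum lookup_single when_def in_keys_iff)
 have "p * q = (\<Sum>k\<in>Poly_Mapping.keys p. \<Sum>l\<in>Poly_Mapping.keys q.
 Poly_Mapping.single (k + l) (Poly_Mapping.lookup p k * Poly_Mapping.lookup q l))"
 by (subst (1) s[of p, symmetric], subst (1) s[of q, symmetric])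
 (simp only: sum_product mult_single)
 then have "ev (p * q) = (\<Sum>k\<in>Poly_Mapping.keys p. \<Sum>l\<in>Poly_Mapping.keys q.
 ev (Poly_Mapping.single (k + l) (Poly_Mapping.lookup p k * Poly_Mapping.lookup q l)))"
 by (simp only: ev_sum)
 also have "\<dots> = ev p * ev q"
 unfolding e[of p] e[of q] sum_product
 by (intro sum.cong refl) (simp add: ev_single of_rat_mult power_int_add A_nz)
 finally show ?thesis .
qed

lemma ev_1 [simp]: "ev 1 = 1"
 using ev_single[of 0 1] by simp

lemma ev_prod: "ev (\<Prod>x\<in>F. g x) = (\<Prod>x\<in>F. ev (g x))"
 by (induction F rule: infinite_finite_induct) (simp_all add: ev_mult)

lemma ev_power: "ev (p ^ n) = ev p ^ n"
 by (induction n) (simp_all add: ev_mult)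

lemma ev_A_pow: "ev (A_pow 1) = A" "ev (A_pow (- 1)) = inverse A"
 by (simp_all add: A_pow_def ev_single)

lemma ev_loop_value: "ev loop_value = of_int N"
proof -
 have "loop_value + (A_pow 2 + A_pow (- 2)) = 0" by (simp add: loop_value_def)
 from arg_cong[OF this, of ev] have "ev loop_value + (A powi 2 + A powi (- 2)) = 0"
 by (simp add: ev_add A_pow_def ev_single)
 then have "ev loop_value = - (A\<^sup>2 + inverse A ^ 2)"
 by (simp add: power_int_minus power_inverse add_eq_0_iff2)
 then show ?thesis unfolding loop by simp
qed

lemma prod_crossings_expand:
 assumes "finite X"
 shows "(\<Prod>c\<in>X. a c * of_bool (P c) + b c * of_bool (Q c)) =
 (\<Sum>\<sigma>\<in>Pow X. (\<Prod>c\<in>X. if c \<in> \<sigma> then b c else a c) * of_bool ((\<forall>c\<in>X - \<sigma>. P c) & (\<forall>c\<in>\<sigma>. Q c)) :: complex)"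
proof -
 have "(\<Prod>c\<in>X. b c * of_bool (Q c) + a c * of_bool (P c)) =
 (\<Sum>\<sigma>\<in>Pow X. (\<Prod>c\<in>\<sigma>. b c * of_bool (Q c)) * (\<Prod>c\<in>X - \<sigma>. a c * of_bool (P c)))"
 by (rule prod_add[OF assms])
 also have "\<dots> = (\<Sum>\<sigma>\<in>Pow X. (\<Prod>c\<in>X. if c \<in> \<sigma> then b c else a c) * of_bool ((\<forall>c\<in>X - \<sigma>. P c) & (\<forall>c\<in>\<sigma>. Q c)))"
 proof (intro sum.cong refl)
 fix \<sigma> assume "\<sigma> \<in> Pow X"
 then have s: "\<sigma> \<subseteq> X" "finite \<sigma>" "finite (X - \<sigma>)" using assms finite_subset by auto
 have "(\<Prod>c\<in>X. if c \<in> \<sigma> then b c else a c) = (\<Prod>c\<in>X - \<sigma>. if c \<in> \<sigma> then b c else a c) * (\<Prod>c\<in>\<sigma>. if c \<in> \<sigma> then b c else a c)"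
 by (rule prod.subset_diff[OF s(1) assms])
 also have "\<dots> = (\<Prod>c\<in>X - \<sigma>. a c) * (\<Prod>c\<in>\<sigma>. b c)" by simp
 finally show "(\<Prod>c\<in>\<sigma>. b c * of_bool (Q c)) * (\<Prod>c\<in>X - \<sigma>. a c * of_bool (P c)) =
 (\<Prod>c\<in>X. if c \<in> \<sigma> then b c else a c) * of_bool ((\<forall>c\<in>X - \<sigma>. P c) & (\<forall>c\<in>\<sigma>. Q c))"
 using prod_of_bool[OF s(2), of Q] prod_of_bool[OF s(3), of P] by (simp add: prod.distrib of_bool_conj)
 qed
 finally show ?thesis by (simp only: add.commute)
qed

text \<open>Multiplying out the crossing weights at \<open>t = 0\<close> gives one term per state,
  and \<open>sum_consistent\<close> evaluates it. As \<open>f\<close> is arbitrary, this says that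
  the complement of \<open>i\<close> acts on the boundary labels as the expansion predicts.\<close>

lemma gsum_expansion:
 assumes D: "vdiagram D" and cl: "classical D" and i: "i \<in> over D"
 and nd: "\<And>t. nd t = diagram.node_of D (complement_boundary D i t)"
 shows "gsum 0 (nodes D) (nodes D - ends (xings D)) (nsucc (nxt D) (nodes D))
 ((%c. (pos D c, pos D (prod.swap c), positive D c)) ` (over D - {i}))
 (\<lambda>\<phi>. f (\<phi> (nd In_L)) (\<phi> (nd In_R)) (\<phi> (nd Out_R)) (\<phi> (nd Out_L))) =
 ev (diagram.coefficient D i False) * (\<Sum>x\<in>S. \<Sum>y\<in>S. f x y y x) +
 ev (diagram.coefficient D i True) * (\<Sum>x\<in>S. \<Sum>y\<in>S. f x x y y)"
proof -
 interpret diagram D by (rule diagramI[OF D])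
 let ?X = "over D - {i}" and ?T = "nodes D - stops"
 have fX: "finite ?X" using finite_over by simp
 have TE: "nodes D - ends (xings D) = ?T" by (simp add: ends_xings stops_def)
 define wa wb where "wa c = (if positive D c then A else inverse A)" and "wb c = (if positive D c then inverse A else A)" for c
 define P Q where "P \<phi> c \<longleftrightarrow> \<phi> (pos D c) = \<phi> (sc (pos D (prod.swap c))) & \<phi> (pos D (prod.swap c)) = \<phi> (sc (pos D c))"
 and "Q \<phi> c \<longleftrightarrow> \<phi> (pos D c) = \<phi> (pos D (prod.swap c)) & \<phi> (sc (pos D (prod.swap c))) = \<phi> (sc (pos D c))" for \<phi> :: "nat \<times> real => int" and c
 have pas: "c \<in> passages D" "prod.swap c \<in> passages D" if "c \<in> over D" for c using that by (cases c; simp add: passages_def)+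
 have injX: "inj_on (%c. (pos D c, pos D (prod.swap c), positive D c)) ?X"
 proof (rule inj_onI)
 fix c c' assume "c \<in> ?X" "c' \<in> ?X" "(pos D c, pos D (prod.swap c), positive D c) = (pos D c', pos D (prod.swap c'), positive D c')"
 then show "c = c'" using inj_onD[OF inj_pos, of c c'] pas by simp
 qed
 let ?F = "\<lambda>\<phi>. f (\<phi> (nd In_L)) (\<phi> (nd In_R)) (\<phi> (nd Out_R)) (\<phi> (nd Out_L))"
 have weight: "(\<Prod>c\<in>?X. if c \<in> \<sigma> then wb c else wa c) = ev (state_weight D i \<sigma>)" for \<sigma>
 unfolding state_weight_def ev_prod by (intro prod.cong refl) (simp add: wa_def wb_def ev_A_pow)
 have cons: "consistent i \<sigma> \<phi> \<longleftrightarrow> (\<forall>v\<in>?T. \<phi> v = \<phi> (sc v)) & (\<forall>c\<in>?X - \<sigma>. P \<phi> c) & (\<forall>c\<in>\<sigma>. Q \<phi> c)" for \<sigma> \<phi>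
 proof -
 have "(\<forall>a b. {a, b} \<in> state_joins D i \<sigma> --> \<phi> (node_of a) = \<phi> (node_of b)) \<longleftrightarrow> (\<forall>c\<in>?X - \<sigma>. P \<phi> c)"
 proof (intro iffI ballI allI impI)
 fix c assume h: "\<forall>a b. {a, b} \<in> state_joins D i \<sigma> --> \<phi> (node_of a) = \<phi> (node_of b)" and c: "c \<in> ?X - \<sigma>"
 have "{(c, Incoming), (prod.swap c, Outgoing)} \<in> oriented_joins c" "{(prod.swap c, Incoming), (c, Outgoing)} \<in> oriented_joins c"
 by (cases c; simp add: oriented_joins_def)+
 then have "{(c, Incoming), (prod.swap c, Outgoing)} \<in> state_joins D i \<sigma>" "{(prod.swap c, Incoming), (c, Outgoing)} \<in> state_joins D i \<sigma>"
 using c unfolding state_joins_def by blast+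
 then have "\<phi> (node_of (c, Incoming)) = \<phi> (node_of (prod.swap c, Outgoing))" "\<phi> (node_of (prod.swap c, Incoming)) = \<phi> (node_of (c, Outgoing))"
 using h by blast+
 then show "P \<phi> c" by (simp add: P_def node_of_def)
 next
 fix a b assume h: "\<forall>c\<in>?X - \<sigma>. P \<phi> c" and ab: "{a, b} \<in> state_joins D i \<sigma>"
 obtain c where c: "c \<in> ?X - \<sigma>" "{a, b} = {(c, Incoming), (prod.swap c, Outgoing)} \<or> {a, b} = {(prod.swap c, Incoming), (c, Outgoing)}"
 using ab by (rule state_joins_cases)
 have "P \<phi> c" using h c(1) by blast
 then show "\<phi> (node_of a) = \<phi> (node_of b)" using c(2) by (auto simp: doubleton_eq_iff P_def node_of_def)
 qed
 moreover have "(\<forall>a b. {a, b} \<in> cusp_pairs (state_cusps D \<sigma>) --> \<phi> (node_of a) = \<phi> (node_of b)) \<longleftrightarrow> (\<forall>c\<in>\<sigma>. Q \<phi> c)"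
 proof (intro iffI ballI allI impI)
 fix c assume h: "\<forall>a b. {a, b} \<in> cusp_pairs (state_cusps D \<sigma>) --> \<phi> (node_of a) = \<phi> (node_of b)" and c: "c \<in> \<sigma>"
 have "{fst (in_cusp D c), snd (in_cusp D c)} \<in> cusp_pairs (state_cusps D \<sigma>)"
 "{fst (out_cusp D c), snd (out_cusp D c)} \<in> cusp_pairs (state_cusps D \<sigma>)"
 using c unfolding cusp_pairs_def state_cusps_def by (auto simp: split_beta)
 then have "\<phi> (node_of (fst (in_cusp D c))) = \<phi> (node_of (snd (in_cusp D c)))"
 "\<phi> (node_of (fst (out_cusp D c))) = \<phi> (node_of (snd (out_cusp D c)))" using h by blast+
 then show "Q \<phi> c" by (auto simp: Q_def node_of_def in_cusp_def out_cusp_def left_passage_def split: if_splits)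
 next
 fix a b assume h: "\<forall>c\<in>\<sigma>. Q \<phi> c" and ab: "{a, b} \<in> cusp_pairs (state_cusps D \<sigma>)"
 obtain u where u: "u \<in> state_cusps D \<sigma>" "{a, b} = {fst u, snd u}" using ab unfolding cusp_pairs_def by (auto simp: split_beta)
 obtain c s where c: "c \<in> \<sigma>" "u = ((left_passage D c, s), (prod.swap (left_passage D c), s))" using u(1) by (rule state_cuspsE)
 have "Q \<phi> c" using h c(1) by blast
 then have "\<phi> (node_of (fst u)) = \<phi> (node_of (snd u))"
 unfolding c(2) by (cases s) (auto simp: Q_def node_of_def left_passage_def)
 then show "\<phi> (node_of a) = \<phi> (node_of b)" using u(2) by (auto simp: doubleton_eq_iff)
 qed
 ultimately show ?thesis unfolding consistent_def Un_iff by blast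
 qed
 have summand: "(\<Prod>v\<in>?T. of_bool (\<phi> v = \<phi> (sc v))) *
 (\<Prod>(x, y, p)\<in>(%c. (pos D c, pos D (prod.swap c), positive D c)) ` ?X. W 0 p (\<phi> x) (\<phi> (sc x)) (\<phi> y) (\<phi> (sc y))) * ?F \<phi> =
 (\<Sum>\<sigma>\<in>Pow ?X. ev (state_weight D i \<sigma>) * (of_bool (consistent i \<sigma> \<phi>) * ?F \<phi>))"
 if \<phi>: "\<phi> \<in> nodes D \<rightarrow>\<^sub>E S" for \<phi>
 proof -
 have S: "\<phi> v \<in> S" if "v \<in> nodes D" for v using \<phi> that by auto
 have "(\<Prod>(x, y, p)\<in>(%c. (pos D c, pos D (prod.swap c), positive D c)) ` ?X. W 0 p (\<phi> x) (\<phi> (sc x)) (\<phi> y) (\<phi> (sc y))) =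
 (\<Prod>c\<in>?X. wa c * of_bool (P \<phi> c) + wb c * of_bool (Q \<phi> c))"
 unfolding prod.reindex[OF injX] comp_def
 proof (intro prod.cong refl)
 fix c assume c: "c \<in> ?X"
 have "pos D c \<in> nodes D" "pos D (prod.swap c) \<in> nodes D" using pos_node pas c by blast+
 then show "(case (pos D c, pos D (prod.swap c), positive D c) of (x, y, p) => W 0 p (\<phi> x) (\<phi> (sc x)) (\<phi> y) (\<phi> (sc y))) =
 wa c * of_bool (P \<phi> c) + wb c * of_bool (Q \<phi> c)"
 using S sc_in by (simp add: W0_skein skein_def wa_def wb_def P_def Q_def)
 qed
 also have "\<dots> = (\<Sum>\<sigma>\<in>Pow ?X. ev (state_weight D i \<sigma>) * of_bool ((\<forall>c\<in>?X - \<sigma>. P \<phi> c) & (\<forall>c\<in>\<sigma>. Q \<phi> c)))"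
 unfolding prod_crossings_expand[OF fX] weight ..
 finally have "(\<Prod>(x, y, p)\<in>(%c. (pos D c, pos D (prod.swap c), positive D c)) ` ?X. W 0 p (\<phi> x) (\<phi> (sc x)) (\<phi> y) (\<phi> (sc y))) =
 (\<Sum>\<sigma>\<in>Pow ?X. ev (state_weight D i \<sigma>) * of_bool ((\<forall>c\<in>?X - \<sigma>. P \<phi> c) & (\<forall>c\<in>\<sigma>. Q \<phi> c)))" .
 moreover have "finite ?T" using finite_nodes by simp
 note prod_of_bool[OF this, of "%v. \<phi> v = \<phi> (sc v)"]
 ultimately show ?thesis
 unfolding cons of_bool_conj by (simp only: sum_distrib_left sum_distrib_right) (intro sum.cong refl, simp only: mult_ac)
 qed
 let ?w = "\<lambda>\<sigma>. ev (state_weight D i \<sigma>) * of_int N ^ loop_count D i \<sigma>"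
 let ?s = "%d. \<Sum>x\<in>S. \<Sum>y\<in>S. if d then f x x y y else f x y y x"
 have co: "ev (coefficient i d) = (\<Sum>\<sigma>\<in>Pow ?X. if disoriented i \<sigma> = d then ?w \<sigma> else 0)" for d
 unfolding coefficient_def ev_sum ev_mult ev_power ev_loop_value using fX by (intro sum.inter_filter) simp
 have "gsum 0 (nodes D) (nodes D - ends (xings D)) (nsucc (nxt D) (nodes D))
 ((%c. (pos D c, pos D (prod.swap c), positive D c)) ` ?X) ?F =
 (\<Sum>\<phi>\<in>nodes D \<rightarrow>\<^sub>E S. \<Sum>\<sigma>\<in>Pow ?X. ev (state_weight D i \<sigma>) * (of_bool (consistent i \<sigma> \<phi>) * ?F \<phi>))"
 unfolding gsum_def TE sc_def[symmetric] by (rule sum.cong[OF refl summand])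
 also have "\<dots> = (\<Sum>\<sigma>\<in>Pow ?X. ev (state_weight D i \<sigma>) * (\<Sum>\<phi>\<in>nodes D \<rightarrow>\<^sub>E S. of_bool (consistent i \<sigma> \<phi>) * ?F \<phi>))"
 unfolding sum_distrib_left by (rule sum.swap)
 also have "\<dots> = (\<Sum>\<sigma>\<in>Pow ?X. ?w \<sigma> * ?s (disoriented i \<sigma>))"
 by (intro sum.cong refl) (simp only: sum_consistent[OF D cl i _ nd] Pow_iff mult.assoc)
 also have "\<dots> = (\<Sum>\<sigma>\<in>Pow ?X. (if disoriented i \<sigma> = False then ?w \<sigma> else 0) * ?s False +
 (if disoriented i \<sigma> = True then ?w \<sigma> else 0) * ?s True)"
 proof (intro sum.cong refl)
 fix \<sigma>
 show "?w \<sigma> * ?s (disoriented i \<sigma>) = (if disoriented i \<sigma> = False then ?w \<sigma> else 0) * ?s False +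
 (if disoriented i \<sigma> = True then ?w \<sigma> else 0) * ?s True"
 by (cases "disoriented i \<sigma>") simp_all
 qed
 also have "\<dots> = ev (coefficient i False) * ?s False + ev (coefficient i True) * ?s True"
 unfolding co sum_distrib_right sum.distrib ..
 finally show ?thesis by simp
qed

end

section \<open>Choice of \<open>N\<close> and \<open>A\<close>\<close>

text \<open>The number \<open>w\<close> is a root of \<open>w + inverse w = N\<close>, so a square
  root of \<open>- w\<close> is an admissible \<open>A\<close>.\<close>

lemma bracket_model_root:
 fixes N :: int
 assumes "N >= 3"
 defines "w \<equiv> (real_of_int N + sqrt ((real_of_int N)\<^sup>2 - 4)) / 2"
 shows "bracket_model N (csqrt (- complex_of_real w))"
proof -
 let ?n = "real_of_int N" and ?A = "csqrt (- complex_of_real w)"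
 define s where "s = sqrt (?n\<^sup>2 - 4)"
 have n: "?n >= 3" using assms(1) by linarith
 have "?n * ?n >= 3 * 3" using n by (intro mult_mono) auto
 then have s2: "s\<^sup>2 = ?n\<^sup>2 - 4" "s >= 0" unfolding s_def by (simp_all add: power2_eq_square)
 have w: "w = (?n + s) / 2" by (simp add: w_def s_def)
 have w0: "w > 0" using n s2(2) by (simp add: w)
 have "w * ((?n - s) / 2) = (?n\<^sup>2 - s\<^sup>2) / 4" by (simp add: w power2_eq_square field_simps)
 also have "\<dots> = 1" using s2(1) by simp
 finally have iw: "inverse w = (?n - s) / 2" by (rule inverse_unique)
 have "w + inverse w = ?n" unfolding iw by (simp add: w field_simps)
 then have "complex_of_real w + inverse (complex_of_real w) = of_int N" by (metis of_real_add of_real_inverse of_real_of_int_eq)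
 note e = this
 have A2: "?A\<^sup>2 = - complex_of_real w" by simp
 have "inverse ?A ^ 2 = - inverse (complex_of_real w)" unfolding power_inverse A2 by simp
 then have "?A\<^sup>2 + inverse ?A ^ 2 = - (complex_of_real w + inverse (complex_of_real w))" unfolding A2 by simp
 then have "?A\<^sup>2 + inverse ?A ^ 2 = - of_int N" unfolding e .
 moreover have "?A ~= 0" using w0 by simp
 ultimately show ?thesis using assms(1) by unfold_locales auto
qed

text \<open>Different \<open>N\<close> give different numbers \<open>A\<close>, because
  \<open>N\<close> can be recovered from \<open>A\<close>. A nonzero Laurent polynomial cannot
  vanish at infinitely many of them.\<close>

lemma laurent_nonroot:
 assumes b: "b ~= 0"
 shows "\<exists>N A. N >= 3 & bracket_model N A & bracket_model.ev A b ~= 0"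
proof (rule ccontr)
 assume c: "~ ?thesis"
 define root where "root N = csqrt (- complex_of_real ((real_of_int N + sqrt ((real_of_int N)\<^sup>2 - 4)) / 2))" for N
 have bm: "bracket_model N (root N)" if "N >= 3" for N unfolding root_def by (rule bracket_model_root[OF that])
 let ?K = "Poly_Mapping.keys b"
 define m where "m = Min ?K"
 have K: "finite ?K" "?K ~= {}" using b by simp_all
 have m: "m \<in> ?K" "\<And>k. k \<in> ?K ==> m <= k" using Min_in[OF K] Min_le[OF K(1)] by (auto simp: m_def)
 \<comment> \<open>Division by the lowest power of the variable leaves a polynomial with nonzero
   constant term.\<close>
 define P where "P = (\<Sum>k\<in>?K. monom (of_rat (Poly_Mapping.lookup b k) :: complex) (nat (k - m)))"
 have "coeff P 0 = (\<Sum>k\<in>?K. if k = m then of_rat (Poly_Mapping.lookup b m) else 0)"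
 unfolding P_def coeff_sum by (intro sum.cong refl) (use m(2) in \<open>force simp: coeff_monom\<close>)
 also have "\<dots> = of_rat (Poly_Mapping.lookup b m)" using m(1) K(1) by simp
 also have "\<dots> ~= 0" using m(1) by (simp add: in_keys_iff)
 finally have "P ~= 0" by auto
 then have fin: "finite {x. poly P x = 0}" by (rule poly_roots_finite)
 have "poly P (root N) = 0" if N: "N >= 3" for N
 proof -
 interpret bracket_model N "root N" by (rule bm[OF N])
 have "poly P (root N) = (\<Sum>k\<in>?K. of_rat (Poly_Mapping.lookup b k) * root N ^ nat (k - m))"
 unfolding P_def poly_sum poly_monom ..
 also have "\<dots> = (\<Sum>k\<in>?K. of_rat (Poly_Mapping.lookup b k) * root N powi k) * root N powi (- m)"
 unfolding sum_distrib_right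
 proof (intro sum.cong refl)
 fix k assume "k \<in> ?K"
 then have "root N ^ nat (k - m) = root N powi (k + - m)" using m(2) by (simp add: power_int_def)
 also have "\<dots> = root N powi k * root N powi (- m)" using A_nz by (intro power_int_add) simp
 finally show "of_rat (Poly_Mapping.lookup b k) * root N ^ nat (k - m) =
 of_rat (Poly_Mapping.lookup b k) * root N powi k * root N powi (- m)" by simp
 qed
 also have "\<dots> = ev b * root N powi (- m)" by (simp add: ev_def)
 also have "\<dots> = 0" using c N bm[OF N] by auto
 finally show ?thesis .
 qed
 then have sub: "root ` {3..} \<subseteq> {x. poly P x = 0}" by auto
 have fr: "finite (root ` {3..})" by (rule finite_subset[OF sub fin])
 have inj: "inj_on root {3..}"
 proof (rule inj_onI)
 fix N N' :: int assume NN: "N \<in> {3..}" "N' \<in> {3..}" "root N = root N'"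
 have "(root N)\<^sup>2 + inverse (root N) ^ 2 = - of_int N" "(root N')\<^sup>2 + inverse (root N') ^ 2 = - of_int N'"
 using bracket_model.loop[OF bm[of N]] bracket_model.loop[OF bm[of N']] NN(1,2) by simp_all
 then have "- of_int N = (- of_int N' :: complex)" unfolding NN(3) by (metis)
 then show "N = N'" by simp
 qed
 have "finite {3::int..}" by (rule finite_imageD[OF fr inj])
 then show False using infinite_Ici[of "3::int"] by simp
qed

section \<open>The state sum of the virtualized diagram depends on \<open>t\<close>\<close>

context bracket_model
begin

text \<open>The numbering of \<open>K\<close> removes \<open>t\<close> from all crossings other than
  \<open>i\<close>. At \<open>i\<close> it is adapted to the old sign, while the reversed sign
  exchanges left and right; the rotation then adds to the shift instead of cancelling it.\<close>

lemma Z_virtualization_ne: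
 assumes N3: "N >= 3" and D: "vdiagram K" and cl: "classical K" and i: "i \<in> over K" and v: "virtualization K i K'"
 and b: "ev (diagram.coefficient K i True) ~= 0"
 shows "Z 1 K' ~= Z 0 K'"
proof -
 interpret diagram K by (rule diagramI[OF D])
 let ?V = "nodes K" and ?T = "nodes K - ends (xings K)" and ?p = "positive K i"
 let ?c = "%c. (pos K c, pos K (prod.swap c), positive K c)"
 let ?X0 = "?c ` (over K - {i})" and ?xi = "(pos K i, pos K (prod.swap i), ~ ?p)"
 obtain lam :: "nat \<times> real => int" where
 lt: "\<And>v. v \<in> ?T ==> lam (sc v) = lam v" and
 lx: "\<And>x y p. (x, y, p) \<in> xings K ==> lam (sc y) = lam x & lam (sc x) = lam y & lam y = lam x - (if p then 1 else - 1)"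
 using alexander_numbering[OF cl] unfolding sc_def[symmetric] by blast
 have xi: "?c c \<in> xings K" if "c \<in> over K" for c unfolding xings_def using that by (cases c) force
 define X' where "X' = (%(u, v). (pos K (u, v), pos K (v, u), positive K (u, v) ~= ((u, v) = i))) ` over K"
 have X'c: "X' = (%c. (pos K c, pos K (prod.swap c), positive K c ~= (c = i))) ` over K"
 unfolding X'_def by (intro image_cong refl) auto
 have X': "X' = insert ?xi ?X0"
 proof -
 let ?g = "%c. (pos K c, pos K (prod.swap c), positive K c ~= (c = i))"
 have "?g ` insert i (over K - {i}) = insert (?g i) (?g ` (over K - {i}))" by (rule image_insert)
 then have "X' = insert (?g i) (?g ` (over K - {i}))" unfolding X'c insert_Diff[OF i] .
 moreover have "?g ` (over K - {i}) = ?X0" by (intro image_cong refl) auto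
 moreover have "?g i = ?xi" by simp
 ultimately show ?thesis by (simp only:)
 qed
 have pas: "c \<in> passages K" "prod.swap c \<in> passages K" if "c \<in> over K" for c using that by (cases c; simp add: passages_def)+
 have new: "?xi \<notin> ?X0"
 proof
 assume "?xi \<in> ?X0"
 then obtain c where c: "?xi = ?c c" "c \<in> over K - {i}" by (rule imageE)
 then have "pos K c = pos K i" "c \<in> over K - {i}" by simp_all
 then show False using inj_onD[OF inj_pos, of c i] pas i by blast
 qed
 have xg: "xings K = insert (?c i) ?X0"
 proof -
 have "xings K = ?c ` over K" unfolding xings_def by (intro image_cong refl) auto
 moreover have "?c ` insert i (over K - {i}) = insert (?c i) (?c ` (over K - {i}))" by (rule image_insert)
 ultimately show ?thesis unfolding insert_Diff[OF i] by (rule trans)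
 qed
 have e_ins: "ends (insert (x, y, p) X) = {x, y} \<union> ends X" for x y :: "nat \<times> real" and p X
 by (auto simp: ends_def)
 have eX: "ends X' = ends (xings K)" unfolding X' xg e_ins ..
 have fX0: "finite ?X0" using finite_over by simp
 have sX0: "?X0 \<subseteq> xings K" by (rule image_subsetI) (rule xi, simp)
 have "ends ?X0 \<subseteq> ends (xings K)" unfolding xg e_ins by (rule Un_upper2)
 then have eX0: "ends ?X0 \<subseteq> ?V" using ends_xings_nodes by (rule subset_trans)
 have sV: "sc ` ?V \<subseteq> ?V" using sc_in by blast
 define q where "q t \<phi> = W t (~ ?p) (\<phi> (pos K i)) (\<phi> (sc (pos K i))) (\<phi> (pos K (prod.swap i))) (\<phi> (sc (pos K (prod.swap i))))"
 for t and \<phi> :: "nat \<times> real => int"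
 have Z1: "Z t K' = gsum t ?V ?T sc ?X0 (q t)" for t
 proof -
 have "Z t K' = gsum t ?V ?T sc X' (%_. 1)"
 unfolding Z_virtualization[OF D v] X'_def[symmetric] psum_def state_sum_def eX sc_def ..
 also have "\<dots> = gsum t ?V ?T sc ?X0 (q t)"
 unfolding gsum_def X' prod.insert[OF fX0 new] q_def by (intro sum.cong refl) (simp add: mult_ac)
 finally show ?thesis .
 qed
 have Z2: "Z t K' = gsum 0 ?V ?T sc ?X0 (\<lambda>\<phi>. q t (\<lambda>v\<in>?V. rot (t * lam v) (\<phi> v)))" for t
 unfolding Z1
 proof (rule gsum_gauge[where lam=lam])
 show "finite ?V" by (rule finite_nodes)
 show "sc ` ?V \<subseteq> ?V" by (rule sV)
 show "?T \<subseteq> ?V" by blast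
 show "ends ?X0 \<subseteq> ?V" by (rule eX0)
 show "lam (sc v) = lam v" if "v \<in> ?T" for v by (rule lt[OF that])
 fix x y p assume "(x, y, p) \<in> ?X0"
 then have "(x, y, p) \<in> xings K" by (rule subsetD[OF sX0])
 then show "lam (sc y) = lam x & lam (sc x) = lam y & lam y = lam x - (if p then 1 else - 1)" by (rule lx)
 qed
 define l r where "l = left_passage K i" and "r = prod.swap l"
 define nd where "nd t = node_of (complement_boundary K i t)" for t
 have nd: "nd In_L = sc (pos K r)" "nd In_R = sc (pos K l)" "nd Out_R = pos K r" "nd Out_L = pos K l"
 by (simp_all add: nd_def complement_boundary_def node_of_def l_def r_def)
 define k where "k = lam (pos K r)"
 have lam: "lam (pos K l) = k + 1" "lam (sc (pos K l)) = k" "lam (sc (pos K r)) = k + 1" "lam (pos K r) = k"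
 using lx[OF xi[OF i]] unfolding k_def l_def r_def left_passage_def by auto
 define e1 e2 where "e1 = (if ?p then inverse A else A)" and "e2 = (if ?p then A else inverse A)"
 \<comment> \<open>The weight of the virtualized crossing after the gauge, as a function of the
   labels at \<open>In_L\<close>, \<open>In_R\<close>, \<open>Out_R\<close>, \<open>Out_L\<close> of
   the complement. The rotation by \<open>2 * t\<close> is the doubled shift.\<close>
 define f where "f t a b c d = e1 * of_bool (d = a & c = b) + e2 * of_bool (c = rot (2 * t) d & b = rot (2 * t) a)" for t a b c d
 have lrp: "l \<in> passages K" "r \<in> passages K" using pas[OF i] by (simp_all add: l_def r_def left_passage_def)
 have inV: "pos K l \<in> ?V" "pos K r \<in> ?V" "sc (pos K l) \<in> ?V" "sc (pos K r) \<in> ?V"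
 by (rule pos_node[OF lrp(1)] pos_node[OF lrp(2)] sc_in[OF pos_node[OF lrp(1)]] sc_in[OF pos_node[OF lrp(2)]])+
 have qf: "q t (\<lambda>v\<in>?V. rot (t * lam v) (\<phi> v)) = f t (\<phi> (nd In_L)) (\<phi> (nd In_R)) (\<phi> (nd Out_R)) (\<phi> (nd Out_L))"
 if \<phi>: "\<phi> \<in> ?V \<rightarrow>\<^sub>E S" for t \<phi>
 proof -
 have S: "\<phi> v \<in> S" if "v \<in> ?V" for v using \<phi> that by auto
 note S4 = S[OF inV(1)] S[OF inV(2)] S[OF inV(3)] S[OF inV(4)]
 have ad: "(u + t) mod N = rot t u" for u by (simp add: rot_def)
 have ar: "t + t * (k + 1) - t * k = 2 * t" by (simp add: algebra_simps)
 show ?thesis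
 proof (cases ?p)
 case True
 then have lr: "i = l" "prod.swap l = r" by (simp_all add: l_def r_def left_passage_def)
 show ?thesis unfolding q_def f_def e1_def e2_def lr nd W_def ad
 using True[unfolded lr] inV S4
 by ((simp add: lam rot_eq_iff ar; fail) | (auto simp: lam rot_eq_iff ar; fail) | (auto simp: lam rot_eq_iff algebra_simps))
 next
 case False
 then have lr: "i = r" "prod.swap r = l" by (simp_all add: l_def r_def left_passage_def)
 show ?thesis unfolding q_def f_def e1_def e2_def lr nd W_def ad
 using False[unfolded lr] inV S4
 by ((simp add: lam rot_eq_iff ar; fail) | (auto simp: lam rot_eq_iff ar; fail) | (auto simp: lam rot_eq_iff algebra_simps))
 qed
 qed
 have ZF: "Z t K' = gsum 0 ?V ?T sc ?X0 (\<lambda>\<phi>. f t (\<phi> (nd In_L)) (\<phi> (nd In_R)) (\<phi> (nd Out_R)) (\<phi> (nd Out_L)))" for t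
 unfolding Z2 gsum_def by (rule sum.cong[OF refl]) (simp only: qf)
 have Z3: "Z t K' = ev (coefficient i False) * (\<Sum>x\<in>S. \<Sum>y\<in>S. f t x y y x) + ev (coefficient i True) * (\<Sum>x\<in>S. \<Sum>y\<in>S. f t x x y y)" for t
 by (rule trans[OF ZF[of t] gsum_expansion[OF D cl i nd_def, of "f t", folded sc_def]])
 \<comment> \<open>When the complement joins \<open>In_L\<close> to \<open>Out_L\<close>, the second
   smoothing determines \<open>y\<close> as a rotation of \<open>x\<close>; this has one solution
   for every \<open>t\<close>.\<close>
 have or: "(\<Sum>x\<in>S. \<Sum>y\<in>S. f t x y y x) = (\<Sum>x\<in>S. \<Sum>y\<in>S. e1) + (\<Sum>x\<in>S. e2)" for t
 unfolding sum.distrib[symmetric]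
 proof (intro sum.cong refl)
 fix x assume "x \<in> S"
 have "(\<Sum>y\<in>S. f t x y y x) = (\<Sum>y\<in>S. e1) + (\<Sum>y\<in>S. e2 * of_bool (y = rot (2 * t) x))"
 unfolding f_def sum.distrib[symmetric] by (intro sum.cong refl) simp
 also have "(\<Sum>y\<in>S. e2 * of_bool (y = rot (2 * t) x)) = e2" by (subst sum_at[of "rot (2 * t) x"]) simp_all
 finally show "(\<Sum>y\<in>S. f t x y y x) = (\<Sum>y\<in>S. e1) + e2" .
 qed
 \<comment> \<open>This is where \<open>N >= 3\<close> enters: rotation by 2 has no fixed
   label.\<close>
 have r2: "rot 2 x ~= x" if x: "x \<in> S" for x
 proof
 assume "rot 2 x = x"
 then have "(x + 2) mod N = x mod N" using x by (simp add: rot_def)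
 then have "N dvd 2" by (simp add: mod_eq_dvd_iff)
 then show False using zdvd_imp_le[of N 2] N3 by simp
 qed
 \<comment> \<open>When the complement joins \<open>In_L\<close> to \<open>In_R\<close>, the second
   smoothing requires labels fixed by the rotation. At \<open>t = 0\<close> all pairs of labels
   qualify, at \<open>t = 1\<close> none.\<close>
 have d0: "(\<Sum>x\<in>S. \<Sum>y\<in>S. f 0 x x y y) = (\<Sum>x\<in>S. \<Sum>y\<in>S. e1 * of_bool (y = x)) + (\<Sum>x\<in>S. \<Sum>y\<in>S. e2)"
 unfolding sum.distrib[symmetric] f_def by (intro sum.cong refl) simp
 have d1: "(\<Sum>x\<in>S. \<Sum>y\<in>S. f 1 x x y y) = (\<Sum>x\<in>S. \<Sum>y\<in>S. e1 * of_bool (y = x))"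
 unfolding f_def by (intro sum.cong refl) (simp add: r2[symmetric])
 have "Z 0 K' - Z 1 K' = ev (coefficient i True) * (\<Sum>x\<in>S. \<Sum>y\<in>S. e2)"
 unfolding Z3 or d0 d1 by (simp add: ring_distribs)
 also have "\<dots> ~= 0" using b N_pos A_nz by (simp add: card_S e2_def)
 finally show ?thesis by simp
qed

end

theorem mainTheorem7:
  fixes K :: vdiag and i :: "nat \<times> nat"
  assumes "vdiagram K" and "classical K" and "i \<in> over K"
  shows "\<exists>a b. is_expansion K i a b \<and>
           (\<forall>a' b'. is_expansion K i a' b' \<longrightarrow> a' = a \<and> b' = b) \<and>
           (b \<noteq> 0 \<longrightarrow> (\<forall>K'. virtualization K i K' \<longrightarrow> nontrivial K' \<and> nonclassical K'))"
proof -
 interpret diagram K by (rule diagramI[OF assms(1)])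
 let ?a = "coefficient i False" and ?b = "coefficient i True"
 have e: "is_expansion K i ?a ?b" by (rule is_expansion_coefficient[OF assms(2,3)])
 have "nontrivial K' & nonclassical K'" if b: "?b ~= 0" and v: "virtualization K i K'" for K'
 proof -
 obtain N A where NA: "N >= 3" "bracket_model N A" "bracket_model.ev A ?b ~= 0" using laurent_nonroot[OF b] by blast
 interpret bracket_model N A by (rule NA(2))
 show ?thesis by (rule nonclassicalI[OF Z_virtualization_ne[OF NA(1) assms v NA(3)]])
 qed
 then show ?thesis using e expansion_unique[OF e] by blast
qed

end
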